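(* Let $m,n\ge2$, $N+1=m+n$, and let $\Sigma\subset\mathbb{R}^{N+1}$ be one of the following minimal hypersurfaces: if $N+1\ge8$, one of the two smooth minimal hypersurfaces $\Sigma^\pm_{m,n}\subset E^\pm_{m,n}$ asymptotic to the Lawson cone $C_{m,n}$ at infinity with $\mathrm{dist}(\Sigma^\pm_{m,n},0)=1$; if $N+1\le7$, the unique complete, embedded, $O(m)\times O(n)$-invariant minimal hypersurface $\Sigma_{m,n}$ that is asymptotic to $C_{m,n}$ at infinity, intersects $C_{m,n}$ infinitely many times, meets $\mathbb{R}^m\times\{0\}$ orthogonally and satisfies $\mathrm{dist}(\Sigma_{m,n},0)=1$. Let $g:=\mathrm{tr}(A_\Sigma^3)$ and $\beta\in(0,1)$. Then there exist a solution $\phi$ of $$J_\Sigma\phi=\mathrm{tr}(A_\Sigma^3)\qquad\text{in }\Sigma$$ and a constant $c>0$ such that for every $y\in\Sigma$: $$|\phi(y)|\,(|y|+1)\le c\|g\|_{C^{0,\beta}_{-3}(\Sigma)}\quad\text{if }N\ge5,$$ $$|\phi(y)|\,\frac{|y|+1}{\log(|y|+2)}\le c\|g\|_{C^{0,\beta}_{-3}(\Sigma)}\quad\text{if }N=4,$$ $$|\phi(y)|\,\frac{(|y|+1)^{1/2}}{\log(|y|+2)}\le c\|g\|_{C^{0,\beta}_{-3}(\Sigma)}\quad\text{if }N=3.$$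
   Context: The existence and uniqueness of the hypersurfaces $\Sigma^\pm_{m,n}$ and $\Sigma_{m,n}$ are known results (Mazet; Alencar et al.), taken as given; $\Sigma^\pm_{m,n}$ are also known to be $O(m)\times O(n)$-invariant with $y\cdot\nu_{\Sigma^\pm_{m,n}}(y)$ never vanishing. Writing points of $\mathbb{R}^{m+n}$ as $(x,y)\in\mathbb{R}^m\times\mathbb{R}^n$, $C_{m,n}:=\{(n-1)|x|^2=(m-1)|y|^2\}$ and $E^\pm_{m,n}:=\{\pm((n-1)|x|^2-(m-1)|y|^2)<0\}$. With $\Gamma:=C_{m,n}\cap\mathbb{S}^N$ and $\nu_C$ a unit normal of $C_{m,n}\setminus\{0\}$, $\Sigma$ is asymptotic to $C_{m,n}$ at infinity if there are $R>0$ and a smooth $w:(R,\infty)\times\Gamma\to\mathbb{R}$ with $\lim_{r\to\infty}\|w(r,\cdot)\|_{C^2(\Gamma)}=0$ such that $\Sigma_R:=\{r\theta+w(r,\theta)\nu_C(\theta):\theta\in\Gamma,\ r>R\}\subset\Sigma$ and $\Sigma\setminus\Sigma_R$ is compact. $A_\Sigma$ is the second fundamental form (shape operator) of $\Sigma$, so $\mathrm{tr}(A_\Sigma^3)$ is the sum of the cubes of the principal curvatures; $J_\Sigma:=\Delta_\Sigma+|A_\Sigma|^2$ with $\Delta_\Sigma$ the Laplace-Beltrami operator. $\|g\|_{C^{0,\beta}_\nu(\Sigma)}:=\sup_{y\in\Sigma}(|y|+1)^{-\nu}\|g\|_{C^{0,\beta}(B_1(y))}$, with $B_1(y)\subset\Sigma$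 the geodesic ball of radius one centered at $y$. *)

theory Defs
  imports "HOL-Analysis.Analysis"
begin

section \<open>Differentiability classes\<close>

text \<open>Class \<open>C\<^sup>k\<close> on an open set: in finite dimension it suffices to differentiate in each fixed
  direction \<open>v\<close>.\<close>

primrec Ck_on_open ::
  "nat \<Rightarrow> ('a::euclidean_space \<Rightarrow> 'b::real_normed_vector) \<Rightarrow> 'a set \<Rightarrow> bool" where
  "Ck_on_open 0 f U \<longleftrightarrow> continuous_on U f"
| "Ck_on_open (Suc k) f U \<longleftrightarrow>
     (\<forall>x\<in>U. f differentiable (at x)) \<and>
     (\<forall>v. Ck_on_open k (\<lambda>x. frechet_derivative f (at x) v) U)"

text \<open>Class \<open>C\<^sup>k\<close>, \<open>k \<le> \<infinity>\<close>, on an arbitrary subset: locally the restriction of an ambient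
  \<open>C\<^sup>k\<close> function. On an embedded submanifold this is the intrinsic notion.\<close>

definition Ck_on :: "enat \<Rightarrow> 'a::euclidean_space set \<Rightarrow> ('a \<Rightarrow> 'b::real_normed_vector) \<Rightarrow> bool" where
  "Ck_on k S f \<longleftrightarrow>
     (\<forall>p\<in>S. \<exists>U F. open U \<and> p \<in> U \<and> (\<forall>j::nat. enat j \<le> k \<longrightarrow> Ck_on_open j F U) \<and>
        (\<forall>q\<in>S \<inter> U. f q = F q))"

abbreviation smooth_on :: "'a::euclidean_space set \<Rightarrow> ('a \<Rightarrow> 'b::real_normed_vector) \<Rightarrow> bool" where
  "smooth_on \<equiv> Ck_on \<infinity>"

section \<open>Calculus on embedded submanifolds\<close>

definition tangent_space :: "'a::euclidean_space set \<Rightarrow> 'a \<Rightarrow> 'a set" where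
  "tangent_space S p =
     {v. \<exists>\<gamma>. \<gamma> 0 = p \<and> (\<forall>\<^sub>F t in at 0. \<gamma> t \<in> S) \<and>
          (\<gamma> has_vector_derivative v) (at (0::real))}"

text \<open>The derivative of \<open>f\<close> within \<open>S\<close> is determined on the tangent space only; it is extended by
  \<open>0\<close> to the normal space. Hence ambient traces of it are traces over the tangent space.\<close>

definition tangential_derivative ::
  "'a::euclidean_space set \<Rightarrow> ('a \<Rightarrow> 'b::real_normed_vector) \<Rightarrow> 'a \<Rightarrow> 'a \<Rightarrow> 'b" where
  "tangential_derivative S f p =
     (SOME L. (f has_derivative L) (at p within S) \<and> (\<forall>u\<in>(tangent_space S p)\<^sup>\<bottom>. L u = 0))"

definition linear_trace :: "('a::euclidean_space \<Rightarrow> 'a) \<Rightarrow> real" where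
  "linear_trace L = (\<Sum>b\<in>Basis. L b \<bullet> b)"

definition surface_gradient :: "'a::euclidean_space set \<Rightarrow> ('a \<Rightarrow> real) \<Rightarrow> 'a \<Rightarrow> 'a" where
  "surface_gradient S f p = (\<Sum>b\<in>Basis. tangential_derivative S f p b *\<^sub>R b)"

definition surface_divergence :: "'a::euclidean_space set \<Rightarrow> ('a \<Rightarrow> 'a) \<Rightarrow> 'a \<Rightarrow> real" where
  "surface_divergence S X p = linear_trace (tangential_derivative S X p)"

definition laplace_beltrami :: "'a::euclidean_space set \<Rightarrow> ('a \<Rightarrow> real) \<Rightarrow> 'a \<Rightarrow> real" where
  "laplace_beltrami S f = surface_divergence S (surface_gradient S f)"

text \<open>\<open>sup |f| + sup |\<nabla>f| + sup |\<nabla>\<^sup>2f|\<close>; the Hessian is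
  \<open>\<nabla>\<^sup>2f(v,w) = D\<^sub>v(\<nabla>f) \<bullet> w\<close> on tangent vectors, measured in the operator norm.\<close>

definition C2_norm :: "'a::euclidean_space set \<Rightarrow> ('a \<Rightarrow> real) \<Rightarrow> ennreal" where
  "C2_norm S f =
     (SUP p\<in>S. ennreal \<bar>f p\<bar>) +
     (SUP p\<in>S. ennreal (norm (surface_gradient S f p))) +
     (SUP p\<in>S. SUP v\<in>tangent_space S p \<inter> sphere 0 1. SUP w\<in>tangent_space S p \<inter> sphere 0 1.
        ennreal \<bar>tangential_derivative S (surface_gradient S f) p v \<bullet> w\<bar>)"

section \<open>Hypersurfaces\<close>

definition smooth_hypersurface :: "'a::euclidean_space set \<Rightarrow> bool" where
  "smooth_hypersurface S \<longleftrightarrow>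
     (\<forall>p\<in>S. \<exists>U (f::'a \<Rightarrow> real). open U \<and> p \<in> U \<and> smooth_on U f \<and>
        (\<forall>q\<in>U. frechet_derivative f (at q) \<noteq> (\<lambda>_. 0)) \<and> S \<inter> U = {q\<in>U. f q = 0})"

definition unit_normal :: "'a::euclidean_space set \<Rightarrow> ('a \<Rightarrow> 'a) \<Rightarrow> bool" where
  "unit_normal S \<nu> \<longleftrightarrow>
     smooth_on S \<nu> \<and> (\<forall>p\<in>S. norm (\<nu> p) = 1 \<and> \<nu> p \<in> (tangent_space S p)\<^sup>\<bottom>)"

text \<open>The shape operator \<open>-d\<nu>\<close>, extended by \<open>0\<close> to the normal line.\<close>

definition shape_operator :: "'a::euclidean_space set \<Rightarrow> ('a \<Rightarrow> 'a) \<Rightarrow> 'a \<Rightarrow> 'a \<Rightarrow> 'a" where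
  "shape_operator S \<nu> p v = - tangential_derivative S \<nu> p v"

definition mean_curvature :: "'a::euclidean_space set \<Rightarrow> ('a \<Rightarrow> 'a) \<Rightarrow> 'a \<Rightarrow> real" where
  "mean_curvature S \<nu> p = linear_trace (shape_operator S \<nu> p)"

definition norm_A_squared :: "'a::euclidean_space set \<Rightarrow> ('a \<Rightarrow> 'a) \<Rightarrow> 'a \<Rightarrow> real" where
  "norm_A_squared S \<nu> p = (\<Sum>b\<in>Basis. (norm (shape_operator S \<nu> p b))\<^sup>2)"

definition trace_A_cubed :: "'a::euclidean_space set \<Rightarrow> ('a \<Rightarrow> 'a) \<Rightarrow> 'a \<Rightarrow> real" where
  "trace_A_cubed S \<nu> p = linear_trace ((shape_operator S \<nu> p) ^^ 3)"

definition jacobi_operator ::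
  "'a::euclidean_space set \<Rightarrow> ('a \<Rightarrow> 'a) \<Rightarrow> ('a \<Rightarrow> real) \<Rightarrow> 'a \<Rightarrow> real" where
  "jacobi_operator S \<nu> \<phi> p = laplace_beltrami S \<phi> p + norm_A_squared S \<nu> p * \<phi> p"

definition minimal_hypersurface :: "'a::euclidean_space set \<Rightarrow> bool" where
  "minimal_hypersurface S \<longleftrightarrow> smooth_hypersurface S \<and>
     (\<forall>p\<in>S. \<exists>U \<nu>. open U \<and> p \<in> U \<and> unit_normal (S \<inter> U) \<nu> \<and>
        (\<forall>q\<in>S \<inter> U. mean_curvature (S \<inter> U) \<nu> q = 0))"

section \<open>Intrinsic distance and weighted Hoelder norms\<close>

text \<open>A \<^const>\<open>valid_path\<close> may have unbounded speed near its break points, hence the Lebesgue integral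
  with values in \<open>[0,\<infinity>]\<close>.\<close>

definition curve_length :: "(real \<Rightarrow> 'a::euclidean_space) \<Rightarrow> ennreal" where
  "curve_length \<gamma> = (\<integral>\<^sup>+t\<in>{0..1}. ennreal (norm (vector_derivative \<gamma> (at t))) \<partial>lborel)"

definition geodesic_dist :: "'a::euclidean_space set \<Rightarrow> 'a \<Rightarrow> 'a \<Rightarrow> ennreal" where
  "geodesic_dist S x y =
     (INF \<gamma>\<in>{\<gamma>. valid_path \<gamma> \<and> path_image \<gamma> \<subseteq> S \<and> pathstart \<gamma> = x \<and> pathfinish \<gamma> = y}.
        curve_length \<gamma>)"

definition geodesic_ball :: "'a::euclidean_space set \<Rightarrow> 'a \<Rightarrow> real \<Rightarrow> 'a set" where
  "geodesic_ball S y r = {z\<in>S. geodesic_dist S y z < ennreal r}"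

definition complete_hypersurface :: "'a::euclidean_space set \<Rightarrow> bool" where
  "complete_hypersurface S \<longleftrightarrow>
     (\<forall>X::nat \<Rightarrow> 'a. range X \<subseteq> S \<and>
        (\<forall>e>0. \<exists>M. \<forall>i\<ge>M. \<forall>j\<ge>M. geodesic_dist S (X i) (X j) < ennreal e) \<longrightarrow>
        (\<exists>l\<in>S. (\<lambda>i. geodesic_dist S (X i) l) \<longlonglongrightarrow> 0))"

text \<open>\<open>C\<^sup>0\<^sup>,\<^sup>\<beta>\<close> norm on a subset \<open>B\<close> of \<open>S\<close>, with respect to the intrinsic distance of \<open>S\<close>.
  Points at infinite distance contribute \<open>x / 0 = 0\<close>.\<close>

definition holder_norm :: "'a::euclidean_space set \<Rightarrow> real \<Rightarrow> 'a set \<Rightarrow> ('a \<Rightarrow> real) \<Rightarrow> ennreal" where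
  "holder_norm S \<beta> B g =
     (SUP p\<in>B. ennreal \<bar>g p\<bar>) +
     (SUP (p, q)\<in>{(p, q). p \<in> B \<and> q \<in> B \<and> p \<noteq> q}.
        ennreal (\<bar>g p - g q\<bar> / enn2real (geodesic_dist S p q) powr \<beta>))"

definition weighted_holder_norm ::
  "'a::euclidean_space set \<Rightarrow> real \<Rightarrow> real \<Rightarrow> ('a \<Rightarrow> real) \<Rightarrow> ennreal" where
  "weighted_holder_norm S \<beta> a g =
     (SUP y\<in>S. ennreal ((norm y + 1) powr (- a)) * holder_norm S \<beta> (geodesic_ball S y 1) g)"

section \<open>Lawson cones and the hypersurfaces asymptotic to them\<close>

definition lawson_form :: "(real^'m) \<times> (real^'n) \<Rightarrow> real" where
  "lawson_form = (\<lambda>(x, y). (real CARD('n) - 1) * (norm x)\<^sup>2 - (real CARD('m) - 1) * (norm y)\<^sup>2)"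

definition lawson_cone :: "((real^'m) \<times> (real^'n)) set" where
  "lawson_cone = {z. lawson_form z = 0}"

text \<open>The side \<open>E\<^sup>+\<close> (for \<open>s = 1\<close>) and \<open>E\<^sup>-\<close> (for \<open>s = -1\<close>) of the cone.\<close>

definition lawson_side :: "real \<Rightarrow> ((real^'m) \<times> (real^'n)) set" where
  "lawson_side s = {z. s * lawson_form z < 0}"

definition lawson_link :: "((real^'m) \<times> (real^'n)) set" where
  "lawson_link = lawson_cone \<inter> sphere 0 1"

definition asymptotic_to_lawson_cone :: "((real^'m) \<times> (real^'n)) set \<Rightarrow> bool" where
  "asymptotic_to_lawson_cone S \<longleftrightarrow>
     (\<exists>\<nu>C R w. unit_normal (lawson_cone - {0}) \<nu>C \<and> R > 0 \<and>
        smooth_on ({R<..} \<times> lawson_link) (\<lambda>(r, \<theta>). w r \<theta> :: real) \<and>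
        ((\<lambda>r. C2_norm lawson_link (w r)) \<longlongrightarrow> 0) at_top \<and>
        (let S\<^sub>R = {r *\<^sub>R \<theta> + w r \<theta> *\<^sub>R \<nu>C \<theta> | r \<theta>. \<theta> \<in> lawson_link \<and> r > R}
         in S\<^sub>R \<subseteq> S \<and> compact (S - S\<^sub>R)))"

definition OmOn_invariant :: "((real^'m) \<times> (real^'n)) set \<Rightarrow> bool" where
  "OmOn_invariant S \<longleftrightarrow>
     (\<forall>f g. orthogonal_transformation f \<and> orthogonal_transformation g \<longrightarrow> map_prod f g ` S = S)"

text \<open>Invariant sets meet the cone in whole \<open>O(m) \<times> O(n)\<close>-orbits, so intersections are counted
  on the profile curve, that is, per orbit.\<close>

definition meets_cone_infinitely_often :: "((real^'m) \<times> (real^'n)) set \<Rightarrow> bool" where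
  "meets_cone_infinitely_often S \<longleftrightarrow> infinite (map_prod norm norm ` (S \<inter> lawson_cone))"

definition meets_first_factor_orthogonally :: "((real^'m) \<times> (real^'n)) set \<Rightarrow> bool" where
  "meets_first_factor_orthogonally S \<longleftrightarrow>
     S \<inter> UNIV \<times> {0} \<noteq> {} \<and>
     (\<forall>z\<in>S \<inter> UNIV \<times> {0}. (tangent_space S z)\<^sup>\<bottom> \<subseteq> UNIV \<times> {0})"

text \<open>\<open>\<Sigma>\<^sup>+\<close> for \<open>s = 1\<close> and \<open>\<Sigma>\<^sup>-\<close> for \<open>s = -1\<close>.\<close>

definition is_Sigma_pm :: "real \<Rightarrow> ((real^'m) \<times> (real^'n)) set \<Rightarrow> bool" where
  "is_Sigma_pm s S \<longleftrightarrow>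
     minimal_hypersurface S \<and> complete_hypersurface S \<and> S \<subseteq> lawson_side s \<and>
     asymptotic_to_lawson_cone S \<and> infdist 0 S = 1"

definition is_Sigma :: "((real^'m) \<times> (real^'n)) set \<Rightarrow> bool" where
  "is_Sigma S \<longleftrightarrow>
     minimal_hypersurface S \<and> complete_hypersurface S \<and> OmOn_invariant S \<and>
     asymptotic_to_lawson_cone S \<and> meets_cone_infinitely_often S \<and>
     meets_first_factor_orthogonally S \<and> infdist 0 S = 1"

end

theory Submission
  imports Defs
begin

text \<open>
  By invariance everything happens on the profile curve in the quarter plane, with coordinates
  \<open>X = |x|\<close>, \<open>Y = |y|\<close>. Minimality and the flux of \<open>\<nabla>|z|\<^sup>2/2\<close> show that \<open>t = |z|\<^sup>2/2\<close> is a global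
  parameter of this curve: a piece on which it is one extends to infinity, two pieces agree near
  infinity because both lie in the same graph over the cone, and a critical point of \<open>t\<close> would start
  two such pieces on which \<open>k = - X \<nu>\<^sub>2 + Y \<nu>\<^sub>1\<close> has opposite signs. Completeness makes the curve end
  on an axis. For \<open>\<phi> = u(|z|\<^sup>2/2)\<close> the position vector field turns the Jacobi equation into
  \<open>k\<^sup>2 u'' + N u' + |A|\<^sup>2 u = tr A\<^sup>3\<close>, which is singular only at the axis and has a solution that is
  \<open>C\<^sup>2\<close> up to there. With \<open>r = log |z|\<close>, the angle of the profile satisfies a damped pendulum equation, so the
  surface approaches the cone exponentially fast in \<open>r\<close>; hence \<open>|z|\<^sup>\<sigma> u\<close> solves a perturbed
  oscillator, with \<open>\<sigma> = 1\<close>, damping \<open>N - 4\<close> and stiffness \<open>2\<close> if \<open>N \<ge> 4\<close>, and \<open>\<sigma> = 1/2\<close>, no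
  damping and stiffness \<open>7/4\<close> if \<open>N = 3\<close>. Every solution of it is bounded in the damped case and grows
  at most linearly in \<open>r\<close> otherwise.
\<close>


text \<open>The exponents come from the cone, where |A|^2 = (N - 1) / |z|^2. A function v of r = log
  |z| satisfies there v'' + (N - 2) v' + (N - 1) v = |z|^2 g, with a right side of order at most 1 /
  |z|. Passing to |z|^\<sigma> v changes the damping to N - 2 - 2 \<sigma>. For \<sigma> = 1 this is
  positive exactly if N > 4, and homogeneous solutions are then smaller than 1 / |z|; for N = 4 they
  have just that size and resonance costs a logarithm; for N = 3 they have size |z|^(-1/2). Since
  even the homogeneous solutions respect the claimed bounds, no solution has to be selected at
  infinity, and the one remaining condition, regularity on the axis, can be met.

  The coefficients on the surface differ from those of the cone. With damping it is enough that the
  error tends to zero; without damping it has to be integrable in r, and this is what exponential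
  convergence to the cone provides. The constant c may depend on the surface, so a bound by any
  constant suffices as soon as the weighted norm is not zero.\<close>

section \<open>Linear oscillators with decaying perturbations and bounded forcing\<close>

lemma young_real: "2 * x * y \<le> a * x\<^sup>2 + y\<^sup>2 / a" if "a > 0" for a x y :: real
proof -
 have "0 \<le> (a * x - y)\<^sup>2 / a" using that by simp
 also have "\<dots> = a * x\<^sup>2 + y\<^sup>2 / a - 2 * x * y"
  using that by (simp add: power2_eq_square field_simps)
 finally show ?thesis by simp
qed

lemma gronwall_exponential:
 fixes F F' :: "real => real"
 assumes der: "\<And>l. l \<ge> L ==> (F has_real_derivative F' l) (at l)"
  and le: "\<And>l. l \<ge> L ==> F' l \<le> - c * F l + B"
  and c: "c > 0" and l: "l \<ge> L"
 shows "F l \<le> F L * exp (- c * (l - L)) + \<bar>B\<bar> / c"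
proof -
 define G where "G l = exp (c * (l - L)) * (F l - B / c)" for l
 have "G l \<le> G L"
 proof (rule DERIV_nonpos_imp_nonincreasing[OF l])
  fix x assume x: "L \<le> x" "x \<le> l"
  have "(G has_real_derivative exp (c * (x - L)) * (F' x + c * F x - B)) (at x)"
   unfolding G_def
   by (rule derivative_eq_intros der x refl | use c in \<open>simp add: field_simps\<close>)+
  moreover have "exp (c * (x - L)) * (F' x + c * F x - B) \<le> 0"
   using le[OF x(1)] by (simp add: mult_nonneg_nonpos)
  ultimately show "\<exists>y. DERIV G x :> y & y \<le> 0" by blast
 qed
 hence "exp (c * (l - L)) * (F l - B / c) \<le> F L - B / c" by (simp add: G_def)
 hence "exp (c * (l - L)) * (F l - B / c) * exp (- c * (l - L)) \<le> (F L - B / c) * exp (- c * (l - L))"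
  by (rule mult_right_mono) simp
 moreover have "exp (c * (l - L)) * exp (- c * (l - L)) = 1"
  by (simp add: exp_add[symmetric])
 ultimately have "F l - B / c \<le> (F L - B / c) * exp (- c * (l - L))"
  by (metis (no_types, lifting) mult.assoc mult.commute mult.right_neutral)
 hence "F l \<le> F L * exp (- c * (l - L)) + B / c * (1 - exp (- c * (l - L)))"
  by (simp add: algebra_simps)
 also have "B / c * (1 - exp (- c * (l - L))) \<le> \<bar>B\<bar> / c * 1"
  by (rule mult_mono) (use c l in \<open>auto simp: divide_right_mono\<close>)
 finally show ?thesis by simp
qed

text \<open>The energy \<open>w^2 + k v^2\<close> dissipates in \<open>w\<close> only; the cross
  term \<open>2 dlt v w\<close> adds the missing \<open>- 2 dlt k v^2\<close>. The bounds on
  \<open>dlt\<close> and \<open>eta\<close> are those under which Young's inequality absorbs the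
  mixed terms: \<open>dlt \<le> d / 4\<close> and \<open>eta \<le> d / 4\<close> keep half of the
  friction, \<open>k / (25 * d)\<close> comes from \<open>d + e1 \<le> 5 / 4 * d\<close>, and the
  bound on \<open>eta^2\<close> pays for the product of \<open>e2\<close>, \<open>v\<close> and
  \<open>w\<close>.\<close>

lemma damped_energy_derivative_le:
 fixes d k dlt eta :: real
 assumes pos: "d > 0" "k > 0" "dlt > 0"
  and dlt: "dlt \<le> d / 4" "dlt \<le> k / (25 * d)"
  and eta: "eta \<le> d / 4" "eta \<le> k / 2" "eta\<^sup>2 \<le> dlt * k * d / 16"
  and e: "\<bar>e1\<bar> \<le> eta" "\<bar>e2\<bar> \<le> eta"
  and w': "w' = b - (d + e1) * w - (k + e2) * v"
 shows "2 * w * w' + 2 * k * v * w + 2 * dlt * (w * w + v * w')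
  \<le> - (d / 4) * w\<^sup>2 - (dlt * k / 4) * v\<^sup>2 + (4 / d + 4 * dlt / k) * b\<^sup>2"
proof -
 have "2 * w * w' + 2 * k * v * w + 2 * dlt * (w * w + v * w')
  = - 2 * (d - dlt + e1) * w\<^sup>2 + 2 * v * (- e2 * w) + 2 * w * b - 2 * dlt * (k + e2) * v\<^sup>2
   + 2 * v * (- dlt * (d + e1) * w) + 2 * v * (dlt * b)"
  unfolding w' by (simp add: algebra_simps power2_eq_square)
 moreover have "- 2 * (d - dlt + e1) * w\<^sup>2 \<le> - d * w\<^sup>2"
  by (rule mult_right_mono) (use dlt eta e in auto)
 moreover have "- 2 * dlt * (k + e2) * v\<^sup>2 \<le> - dlt * k * v\<^sup>2"
 proof -
  have "dlt * k \<le> dlt * (2 * (k + e2))" by (rule mult_left_mono) (use pos eta e in auto)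
  hence "dlt * k * v\<^sup>2 \<le> dlt * (2 * (k + e2)) * v\<^sup>2" by (rule mult_right_mono) simp
  thus ?thesis by (simp add: algebra_simps)
 qed
 moreover have "2 * v * (- e2 * w) \<le> dlt * k / 4 * v\<^sup>2 + d / 4 * w\<^sup>2"
 proof -
  have "2 * v * (- e2 * w) \<le> dlt * k / 4 * v\<^sup>2 + (- e2 * w)\<^sup>2 / (dlt * k / 4)"
   by (rule young_real) (use pos in simp)
  also have "(- e2 * w)\<^sup>2 / (dlt * k / 4) = e2\<^sup>2 / (dlt * k / 4) * w\<^sup>2"
   by (simp add: power_mult_distrib)
  also have "\<dots> \<le> d / 4 * w\<^sup>2"
  proof (rule mult_right_mono)
   have "e2\<^sup>2 \<le> eta\<^sup>2" by (metis e(2) abs_le_square_iff abs_of_nonneg abs_ge_zero order_trans)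
   thus "e2\<^sup>2 / (dlt * k / 4) \<le> d / 4" using eta(3) pos by (simp add: field_simps)
  qed simp
  finally show ?thesis by simp
 qed
 moreover have "2 * v * (- dlt * (d + e1) * w) \<le> dlt * k / 4 * v\<^sup>2 + d / 4 * w\<^sup>2"
 proof -
  have "2 * v * (- dlt * (d + e1) * w)
    \<le> dlt * k / 4 * v\<^sup>2 + (- dlt * (d + e1) * w)\<^sup>2 / (dlt * k / 4)"
   by (rule young_real) (use pos in simp)
  also have "(- dlt * (d + e1) * w)\<^sup>2 / (dlt * k / 4) = 4 * dlt * (d + e1)\<^sup>2 / k * w\<^sup>2"
   using pos by (simp add: power_mult_distrib power2_eq_square field_simps)
  also have "\<dots> \<le> d / 4 * w\<^sup>2"
  proof (rule mult_right_mono)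
   have "(d + e1)\<^sup>2 \<le> (5 / 4 * d)\<^sup>2" by (rule power_mono) (use e eta pos in auto)
   hence "4 * dlt * (d + e1)\<^sup>2 \<le> 4 * dlt * (5 / 4 * d)\<^sup>2" using pos by simp
   also have "\<dots> = dlt * (25 * d) * (d / 4)" by (simp add: power2_eq_square)
   also have "\<dots> \<le> k * (d / 4)"
    by (rule mult_right_mono) (use dlt(2) pos in \<open>auto simp: field_simps\<close>)
   finally show "4 * dlt * (d + e1)\<^sup>2 / k \<le> d / 4" using pos by (simp add: field_simps)
  qed simp
  finally show ?thesis by simp
 qed
 moreover have "2 * w * b \<le> d / 4 * w\<^sup>2 + b\<^sup>2 / (d / 4)"
  by (rule young_real) (use pos in simp)
 moreover have "2 * v * (dlt * b) \<le> dlt * k / 4 * v\<^sup>2 + (dlt * b)\<^sup>2 / (dlt * k / 4)"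
  by (rule young_real) (use pos in simp)
 moreover have "(dlt * b)\<^sup>2 / (dlt * k / 4) = 4 * dlt / k * b\<^sup>2"
  using pos by (simp add: power_mult_distrib power2_eq_square field_simps)
 moreover have "b\<^sup>2 / (d / 4) = 4 / d * b\<^sup>2" by simp
 ultimately show ?thesis by (simp add: algebra_simps)
qed

text \<open>The estimate separates the initial data, which decay, from the forcing. It is used
  twice: with \<open>B = 0\<close> it yields convergence to zero, with general \<open>B\<close>
  boundedness.\<close>

lemma damped_oscillator_estimate:
 fixes v w e1 e2 b :: "real => real"
 assumes pos: "d > 0" "k > 0"
  and lim: "(e1 \<longlongrightarrow> 0) at_top" "(e2 \<longlongrightarrow> 0) at_top"
  and der: "\<forall>\<^sub>F l in at_top. (v has_real_derivative w l) (at l)"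
   "\<forall>\<^sub>F l in at_top.
    (w has_real_derivative b l - (d + e1 l) * w l - (k + e2 l) * v l) (at l)"
  and b: "\<forall>\<^sub>F l in at_top. \<bar>b l\<bar> \<le> B"
 obtains K c C where "c > 0" "\<forall>\<^sub>F l in at_top. (v l)\<^sup>2 \<le> K * exp (- c * l) + C * B\<^sup>2"
proof -
 \<comment> \<open>The bounds \<open>1 / 2\<close> and \<open>k / 2\<close> keep \<open>F\<close>
   positive definite despite its cross term; the other two are those of the derivative
   estimate.\<close>
 define dlt where "dlt = min (min (d / 4) (k / (25 * d))) (min (1 / 2) (k / 2))"
 have dlt: "dlt > 0" "dlt \<le> d / 4" "dlt \<le> k / (25 * d)" "dlt \<le> 1 / 2" "dlt \<le> k / 2"
  using pos by (auto simp: dlt_def)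
 define eta where "eta = min (min (d / 4) (k / 2)) (sqrt (dlt * k * d / 16))"
 have eta: "eta > 0" "eta \<le> d / 4" "eta \<le> k / 2" "eta \<le> sqrt (dlt * k * d / 16)"
  using pos dlt(1) by (auto simp: eta_def)
 have eta2: "eta\<^sup>2 \<le> dlt * k * d / 16"
  using power_mono[OF eta(4), of 2] eta(1) pos dlt(1) by simp
 have "\<forall>\<^sub>F l in at_top. \<bar>e1 l\<bar> < eta" "\<forall>\<^sub>F l in at_top. \<bar>e2 l\<bar> < eta"
  using tendstoD[OF lim(1) eta(1)] tendstoD[OF lim(2) eta(1)] by (simp_all add: dist_real_def)
 with der b have "\<forall>\<^sub>F l in at_top. \<bar>e1 l\<bar> < eta & \<bar>e2 l\<bar> < eta & \<bar>b l\<bar> \<le> B &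
  (v has_real_derivative w l) (at l) &
  (w has_real_derivative b l - (d + e1 l) * w l - (k + e2 l) * v l) (at l)"
  by eventually_elim simp
 then obtain L where L: "\<And>l. l \<ge> L ==> \<bar>e1 l\<bar> < eta & \<bar>e2 l\<bar> < eta & \<bar>b l\<bar> \<le> B &
  (v has_real_derivative w l) (at l) &
  (w has_real_derivative b l - (d + e1 l) * w l - (k + e2 l) * v l) (at l)"
  unfolding eventually_at_top_linorder by blast
 define w' where "w' l = b l - (d + e1 l) * w l - (k + e2 l) * v l" for l
 define F where "F l = (w l)\<^sup>2 + k * (v l)\<^sup>2 + 2 * dlt * (v l * w l)" for l
 define F' where "F' l = 2 * w l * w' l + 2 * k * v l * w l + 2 * dlt * (w l * w l + v l * w' l)" for l
 \<comment> \<open>The largest rate for which \<open>c\<close> times the upper bound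
   \<open>Fle\<close> of the energy stays below the dissipation.\<close>
 define c where "c = min (d / (4 * (1 + dlt))) (dlt * k / (4 * (k + dlt)))"
 define C where "C = 4 / d + 4 * dlt / k"
 have c: "c > 0" using pos dlt by (simp add: c_def)
 have C: "C > 0" using pos dlt by (simp add: C_def add_pos_pos)
 have cross: "\<bar>2 * dlt * (v l * w l)\<bar> \<le> dlt * ((v l)\<^sup>2 + (w l)\<^sup>2)" for l
 proof -
  have "2 * \<bar>v l * w l\<bar> \<le> (v l)\<^sup>2 + (w l)\<^sup>2"
   using sum_squares_bound[of "\<bar>v l\<bar>" "\<bar>w l\<bar>"] by (simp add: abs_mult)
  from mult_left_mono[OF this, of dlt] show ?thesis using dlt(1) by (simp add: abs_mult)
 qed
 have Fle: "F l \<le> (1 + dlt) * (w l)\<^sup>2 + (k + dlt) * (v l)\<^sup>2" for l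
  using cross[of l] by (simp add: F_def algebra_simps)
 have Fge: "k / 2 * (v l)\<^sup>2 \<le> F l" for l
 proof -
  have "dlt * (w l)\<^sup>2 \<le> 1 * (w l)\<^sup>2" "dlt * (v l)\<^sup>2 \<le> k / 2 * (v l)\<^sup>2"
   using dlt by (intro mult_right_mono; simp)+
  with cross[of l] show ?thesis by (simp add: F_def algebra_simps)
 qed
 have le: "F' l \<le> - c * F l + C * B\<^sup>2" if "l \<ge> L" for l
 proof -
  have "F' l \<le> - (d / 4) * (w l)\<^sup>2 - (dlt * k / 4) * (v l)\<^sup>2 + C * (b l)\<^sup>2"
   unfolding F'_def C_def using L[OF that] pos dlt eta eta2
   by (intro damped_energy_derivative_le[where eta = eta and ?e1.0 = "e1 l" and ?e2.0 = "e2 l"])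
    (auto simp: w'_def)
  moreover have "C * (b l)\<^sup>2 \<le> C * B\<^sup>2"
   using L[OF that] C by (intro mult_left_mono) (auto simp: abs_le_square_iff[symmetric])
  moreover have "c * F l \<le> (d / 4) * (w l)\<^sup>2 + (dlt * k / 4) * (v l)\<^sup>2"
  proof -
   have "c * F l \<le> c * (1 + dlt) * (w l)\<^sup>2 + c * (k + dlt) * (v l)\<^sup>2"
    using mult_left_mono[OF Fle[of l], of c] c by (simp add: algebra_simps)
   moreover have "c * (1 + dlt) \<le> d / 4"
   proof -
    have "c \<le> d / (4 * (1 + dlt))" by (simp add: c_def)
    thus ?thesis using dlt(1) by (simp add: field_simps)
   qed
   moreover have "c * (k + dlt) \<le> dlt * k / 4"
   proof -
    have "c \<le> dlt * k / (4 * (k + dlt))" by (simp add: c_def)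
    thus ?thesis using dlt(1) pos by (simp add: field_simps)
   qed
   ultimately show ?thesis
    using mult_right_mono[of "c * (1 + dlt)" "d / 4" "(w l)\<^sup>2"]
     mult_right_mono[of "c * (k + dlt)" "dlt * k / 4" "(v l)\<^sup>2"] by simp
  qed
  ultimately show ?thesis by simp
 qed
 have F: "F l \<le> F L * exp (- c * (l - L)) + \<bar>C * B\<^sup>2\<bar> / c" if "l \<ge> L" for l
 proof (rule gronwall_exponential[where F' = F'])
  show "(F has_real_derivative F' l) (at l)" if "l \<ge> L" for l
   unfolding F_def F'_def w'_def
   by (rule derivative_eq_intros L[OF that, THEN conjunct2, THEN conjunct2, THEN conjunct2, THEN conjunct1]
     L[OF that, THEN conjunct2, THEN conjunct2, THEN conjunct2, THEN conjunct2] refl)+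
    (simp add: algebra_simps power2_eq_square)
 qed (use le c that in auto)
 show ?thesis
 proof (rule that[OF c])
  show "\<forall>\<^sub>F l in at_top. (v l)\<^sup>2 \<le> (2 / k * (F L * exp (c * L))) * exp (- c * l) + (2 * C / (k * c)) * B\<^sup>2"
   unfolding eventually_at_top_linorder
  proof (intro exI allI impI)
   fix l assume "l \<ge> L"
   have "\<bar>C * B\<^sup>2\<bar> = C * B\<^sup>2" using C by simp
   with F[OF \<open>l \<ge> L\<close>] Fge[of l]
   have "k / 2 * (v l)\<^sup>2 \<le> F L * exp (- c * (l - L)) + C * B\<^sup>2 / c" by linarith
   also have "exp (- c * (l - L)) = exp (c * L) * exp (- c * l)"
    by (simp add: exp_add[symmetric] algebra_simps)
   finally have "2 / k * (k / 2 * (v l)\<^sup>2)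
     \<le> 2 / k * (F L * (exp (c * L) * exp (- c * l)) + C * B\<^sup>2 / c)"
    by (rule mult_left_mono) (use pos in auto)
   thus "(v l)\<^sup>2 \<le> (2 / k * (F L * exp (c * L))) * exp (- c * l) + (2 * C / (k * c)) * B\<^sup>2"
    using pos by (simp add: algebra_simps)
  qed
 qed
qed

lemma damped_oscillator_bounded:
 fixes v w e1 e2 b :: "real => real"
 assumes pos: "d > 0" "k > 0"
  and lim: "(e1 \<longlongrightarrow> 0) at_top" "(e2 \<longlongrightarrow> 0) at_top"
  and der: "\<forall>\<^sub>F l in at_top. (v has_real_derivative w l) (at l)"
   "\<forall>\<^sub>F l in at_top.
    (w has_real_derivative b l - (d + e1 l) * w l - (k + e2 l) * v l) (at l)"
  and b: "\<forall>\<^sub>F l in at_top. \<bar>b l\<bar> \<le> B"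
 obtains A where "\<forall>\<^sub>F l in at_top. \<bar>v l\<bar> \<le> A"
proof -
 obtain K c C where c: "c > 0" and *: "\<forall>\<^sub>F l in at_top. (v l)\<^sup>2 \<le> K * exp (- c * l) + C * B\<^sup>2"
  by (rule damped_oscillator_estimate[OF assms])
 from * eventually_ge_at_top[of 0]
 have "\<forall>\<^sub>F l in at_top. \<bar>v l\<bar> \<le> sqrt (\<bar>K\<bar> + C * B\<^sup>2)"
 proof eventually_elim
  case (elim l)
  have "K * exp (- c * l) \<le> \<bar>K\<bar> * 1"
   by (rule mult_mono) (use c elim in auto)
  with elim have "(v l)\<^sup>2 \<le> \<bar>K\<bar> + C * B\<^sup>2" by simp
  thus ?case by (rule real_le_rsqrt[of "\<bar>v l\<bar>", simplified])
 qed
 thus ?thesis by (rule that)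
qed

lemma damped_oscillator_tendsto_0:
 fixes v w e1 e2 :: "real => real"
 assumes pos: "d > 0" "k > 0"
  and lim: "(e1 \<longlongrightarrow> 0) at_top" "(e2 \<longlongrightarrow> 0) at_top"
  and der: "\<forall>\<^sub>F l in at_top. (v has_real_derivative w l) (at l)"
   "\<forall>\<^sub>F l in at_top. (w has_real_derivative - (d + e1 l) * w l - (k + e2 l) * v l) (at l)"
 shows "(v \<longlongrightarrow> 0) at_top"
proof -
 obtain K c C :: real
  where c: "c > 0" and *: "\<forall>\<^sub>F l in at_top. (v l)\<^sup>2 \<le> K * exp (- c * l) + C * 0\<^sup>2"
  by (rule damped_oscillator_estimate[OF pos lim der(1), of "%_. 0" 0]) (use der(2) in \<open>simp_all only: minus_mult_left diff_0 abs_zero order_refl eventually_True\<close>)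
 have "((%l. K * exp (- c * l)) \<longlongrightarrow> 0) at_top"
  by (intro tendsto_mult_right_zero filterlim_compose[OF exp_at_bot])
   (use c in \<open>simp add: filterlim_uminus_at_bot filterlim_tendsto_pos_mult_at_top[OF tendsto_const _ filterlim_ident]\<close>)
 hence "((%l. (v l)\<^sup>2) \<longlongrightarrow> 0) at_top"
  by (rule tendsto_sandwich[rotated 3, of _ _ _ "%_. 0"]) (use * in auto)
 thus ?thesis using tendsto_rabs_zero_iff tendsto_real_sqrt[of "%l. (v l)\<^sup>2" 0] by auto
qed

text \<open>Without damping the root of the energy satisfies
  \<open>(sqrt F)' \<le> M' * exp (- c * l) * sqrt F + B\<close>. The first coefficient is
  integrable, so the factor \<open>exp (M' / c * exp (- c * l))\<close>, which lies between 1 and a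
  constant, absorbs it; only the forcing is left, and it can add at most a multiple of
  \<open>B\<close> per unit of \<open>l\<close>.\<close>

lemma oscillator_linear_growth:
 fixes v w e1 e2 b :: "real => real"
 assumes k: "k > 0" and c: "c > 0"
  and e: "\<forall>\<^sub>F l in at_top. \<bar>e1 l\<bar> \<le> M * exp (- c * l)" "\<forall>\<^sub>F l in at_top. \<bar>e2 l\<bar> \<le> M * exp (- c * l)"
  and der: "\<forall>\<^sub>F l in at_top. (v has_real_derivative w l) (at l)"
   "\<forall>\<^sub>F l in at_top. (w has_real_derivative b l - e1 l * w l - (k + e2 l) * v l) (at l)"
  and b: "\<forall>\<^sub>F l in at_top. \<bar>b l\<bar> \<le> B"
 obtains A where "\<forall>\<^sub>F l in at_top. \<bar>v l\<bar> \<le> A * (1 + l)"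
proof -
 from e der b eventually_ge_at_top[of 0] have "\<forall>\<^sub>F l in at_top. \<bar>e1 l\<bar> \<le> M * exp (- c * l) &
  \<bar>e2 l\<bar> \<le> M * exp (- c * l) & \<bar>b l\<bar> \<le> B & l \<ge> 0 &
  (v has_real_derivative w l) (at l) &
  (w has_real_derivative b l - e1 l * w l - (k + e2 l) * v l) (at l)"
  by eventually_elim simp
 then obtain L where L: "\<And>l. l \<ge> L ==> \<bar>e1 l\<bar> \<le> M * exp (- c * l) &
  \<bar>e2 l\<bar> \<le> M * exp (- c * l) & \<bar>b l\<bar> \<le> B & l \<ge> 0 &
  (v has_real_derivative w l) (at l) &
  (w has_real_derivative b l - e1 l * w l - (k + e2 l) * v l) (at l)"
  unfolding eventually_at_top_linorder by blast
 have B: "B \<ge> 0" using L[of L] by auto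
 have M: "M \<ge> 0"
 proof -
  have "0 \<le> M * exp (- c * L)" using L[of L] by auto
  thus ?thesis by (simp add: zero_le_mult_iff)
 qed
 \<comment> \<open>The summand 1 keeps \<open>sqrt F\<close> differentiable where \<open>v\<close>
   and \<open>w\<close> vanish together.\<close>
 define F where "F l = 1 + (w l)\<^sup>2 + k * (v l)\<^sup>2" for l
 define M' where "M' = M + M / sqrt k"
 have M': "M' \<ge> 0" using M k by (simp add: M'_def)
 define F' where "F' l = 2 * w l * (b l - e1 l * w l - (k + e2 l) * v l) + 2 * k * v l * w l" for l
 define G where "G l = sqrt (F l) * exp (M' / c * exp (- c * l)) - B * exp (M' / c) * l" for l
 have F1: "F l \<ge> 1" for l using k by (simp add: F_def)
 have wF: "\<bar>w l\<bar> \<le> sqrt (F l)" for l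
  using k by (intro real_le_rsqrt) (simp add: F_def)
 have vF: "\<bar>v l\<bar> \<le> sqrt (F l) / sqrt k" for l
 proof -
  have "\<bar>v l\<bar> * sqrt k \<le> sqrt (F l)"
   using k by (intro real_le_rsqrt) (simp add: F_def power_mult_distrib algebra_simps)
  thus ?thesis using k by (simp add: field_simps)
 qed
 have F': "F' l \<le> 2 * sqrt (F l) * (M' * exp (- c * l) * sqrt (F l) + B)" if "l \<ge> L" for l
 proof -
  let ?E = "exp (- c * l)"
  have "F' l = 2 * (w l * (b l - e1 l * w l - e2 l * v l))"
   by (simp add: F'_def algebra_simps)
  also have "w l * (b l - e1 l * w l - e2 l * v l) \<le> \<bar>w l\<bar> * \<bar>b l - e1 l * w l - e2 l * v l\<bar>"
   by (metis abs_ge_self abs_mult)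
  also have "\<dots> \<le> sqrt (F l) * (M' * ?E * sqrt (F l) + B)"
  proof (rule mult_mono[OF wF])
   have "\<bar>e1 l * w l\<bar> \<le> M * ?E * sqrt (F l)"
    unfolding abs_mult by (rule mult_mono) (use L[OF that] wF M in auto)
   moreover have "\<bar>e2 l * v l\<bar> \<le> M * ?E * (sqrt (F l) / sqrt k)"
    unfolding abs_mult by (rule mult_mono) (use L[OF that] vF M in auto)
   moreover have "\<bar>b l\<bar> \<le> B" using L[OF that] by simp
   ultimately have "\<bar>b l - e1 l * w l - e2 l * v l\<bar>
     \<le> M * ?E * sqrt (F l) + M * ?E * (sqrt (F l) / sqrt k) + B" by linarith
   thus "\<bar>b l - e1 l * w l - e2 l * v l\<bar> \<le> M' * ?E * sqrt (F l) + B"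
    by (simp add: M'_def algebra_simps)
  qed (use F1[of l] in auto)
  finally show ?thesis by simp
 qed
 have G: "G l \<le> G L" if "l \<ge> L" for l
 proof (rule DERIV_nonpos_imp_nonincreasing[OF that])
  fix x assume x: "L \<le> x" "x \<le> l"
  let ?E = "exp (- c * x)"
  let ?H = "exp (M' / c * ?E)"
  have dF: "(F has_real_derivative F' x) (at x)"
   unfolding F_def F'_def
   by (rule derivative_eq_intros L[OF x(1), THEN conjunct2, THEN conjunct2, THEN conjunct2, THEN conjunct2, THEN conjunct1]
     L[OF x(1), THEN conjunct2, THEN conjunct2, THEN conjunct2, THEN conjunct2, THEN conjunct2] refl)+
    (simp add: algebra_simps power2_eq_square)
  have "F x > 0" using F1[of x] by simp
  note dS = DERIV_chain2[OF DERIV_real_sqrt[OF this] dF]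
  have "(G has_real_derivative (inverse (sqrt (F x)) / 2 * F' x) * ?H
    + sqrt (F x) * (?H * (M' / c * (?E * (- c)))) - B * exp (M' / c)) (at x)"
   unfolding G_def by (rule derivative_eq_intros dS refl | simp)+
  moreover have "(inverse (sqrt (F x)) / 2 * F' x) * ?H
    + sqrt (F x) * (?H * (M' / c * (?E * (- c)))) - B * exp (M' / c) \<le> 0"
  proof -
   have "inverse (sqrt (F x)) / 2 * F' x \<le> M' * ?E * sqrt (F x) + B"
    using F'[OF x(1)] F1[of x] by (simp add: field_simps)
   hence "(inverse (sqrt (F x)) / 2 * F' x) * ?H \<le> (M' * ?E * sqrt (F x) + B) * ?H"
    by (rule mult_right_mono) simp
   moreover have "B * ?H \<le> B * exp (M' / c)"
    using L[OF x(1)] M' c B by (intro mult_left_mono) (auto simp: divide_le_cancel mult_left_le field_simps)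
   ultimately show ?thesis using c by (simp add: algebra_simps)
  qed
  ultimately show "\<exists>y. DERIV G x :> y & y \<le> 0" by blast
 qed
 show ?thesis
 proof (rule that)
  show "\<forall>\<^sub>F l in at_top. \<bar>v l\<bar> \<le> ((\<bar>G L\<bar> + B * exp (M' / c)) / sqrt k) * (1 + l)"
   unfolding eventually_at_top_linorder
  proof (intro exI allI impI)
   fix l assume l: "l \<ge> L"
   have l0: "l \<ge> 0" using L[OF l] by simp
   have "sqrt (F l) * 1 \<le> sqrt (F l) * exp (M' / c * exp (- c * l))"
    using M' c F1[of l] by (intro mult_left_mono) auto
   also have "\<dots> \<le> G L + B * exp (M' / c) * l" using G[OF l] by (simp add: G_def)
   also have "\<dots> \<le> (\<bar>G L\<bar> + B * exp (M' / c)) * (1 + l)"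
    using mult_nonneg_nonneg[OF abs_ge_zero[of "G L"] l0] abs_ge_self[of "G L"]
     mult_nonneg_nonneg[OF B exp_ge_zero[of "M' / c"]]
    unfolding distrib_left distrib_right mult_1_right by linarith
   finally have "sqrt (F l) \<le> (\<bar>G L\<bar> + B * exp (M' / c)) * (1 + l)" by simp
   with vF[of l] k show "\<bar>v l\<bar> \<le> ((\<bar>G L\<bar> + B * exp (M' / c)) / sqrt k) * (1 + l)"
    by (simp add: field_simps)
  qed
 qed
qed

section \<open>The damped pendulum equation for the angle of the profile\<close>

text \<open>This is the logarithmic derivative of \<open>sin^(n-1) cos^(m-1)\<close>, which is, up
  to a constant, the volume of the orbit at angle \<open>tht\<close> in the unit sphere. Its zero in
  the open quarter circle is the cone angle, and it pushes the profile towards the cone;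
  \<open>slope_potential\<close> is the corresponding potential energy.\<close>

definition slope_force :: "real => real => real => real" where
 "slope_force m n tht = (n - 1) * cos tht / sin tht - (m - 1) * sin tht / cos tht"

definition slope_potential :: "real => real => real => real" where
 "slope_potential m n tht = - (n - 1) * ln (sin tht) - (m - 1) * ln (cos tht)"

context
 fixes m n :: real and tha :: real
 assumes mn: "m > 1" "n > 1"
  and tha: "0 < tha" "tha < pi / 2" "(n - 1) * (cos tha)\<^sup>2 = (m - 1) * (sin tha)\<^sup>2"
begin

lemma slope_force_zero: "slope_force m n tha = 0"
proof -
 have "sin tha > 0" "cos tha > 0" using tha by (auto intro: sin_gt_zero cos_gt_zero)
 with tha(3) show ?thesis by (simp add: slope_force_def field_simps power2_eq_square)
qed

lemma slope_potential_deriv: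
 assumes "0 < tht" "tht < pi / 2"
 shows "(slope_potential m n has_real_derivative - slope_force m n tht) (at tht)"
proof -
 have "sin tht > 0" "cos tht > 0" using assms by (auto intro: sin_gt_zero cos_gt_zero)
 thus ?thesis unfolding slope_potential_def slope_force_def
  by (auto intro!: derivative_eq_intros simp: field_simps)
qed

lemma slope_force_deriv:
 assumes "0 < tht" "tht < pi / 2"
 shows "(slope_force m n has_real_derivative - ((n - 1) / (sin tht)\<^sup>2 + (m - 1) / (cos tht)\<^sup>2)) (at tht)"
proof -
 have sc: "sin tht > 0" "cos tht > 0" using assms by (auto intro: sin_gt_zero cos_gt_zero)
 have 1: "(sin tht * sin tht + cos tht * cos tht) = 1"
  by (metis power2_eq_square sin_cos_squared_add)
 have "((%tht. cos tht / sin tht) has_real_derivative - 1 / (sin tht)\<^sup>2) (at tht)"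
 proof -
  have "- sin tht * sin tht - cos tht * cos tht = - 1" using 1 by linarith
  thus ?thesis using DERIV_divide[OF DERIV_cos[of tht] DERIV_sin[of tht]] sc by (simp add: power2_eq_square)
 qed
 moreover have "((%tht. sin tht / cos tht) has_real_derivative 1 / (cos tht)\<^sup>2) (at tht)"
 proof -
  have "cos tht * cos tht - sin tht * - sin tht = 1" using 1 by linarith
  thus ?thesis using DERIV_divide[OF DERIV_sin[of tht] DERIV_cos[of tht]] sc by (simp add: power2_eq_square)
 qed
 ultimately have "((%tht. (n - 1) * (cos tht / sin tht) - (m - 1) * (sin tht / cos tht)) has_real_derivative
   (n - 1) * (- 1 / (sin tht)\<^sup>2) - (m - 1) * (1 / (cos tht)\<^sup>2)) (at tht)"
  by (intro DERIV_diff DERIV_cmult)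
 thus ?thesis by (simp add: slope_force_def[of m n, abs_def])
qed

text \<open>At the cone angle \<open>sin^2 = (n - 1) / (m + n - 2)\<close> and
  \<open>cos^2 = (m - 1) / (m + n - 2)\<close>, so each quotient equals \<open>m + n - 2\<close>.
  The sum is the linear stiffness of the pendulum at its equilibrium.\<close>

lemma slope_force_deriv_zero:
 "(n - 1) / (sin tha)\<^sup>2 + (m - 1) / (cos tha)\<^sup>2 = 2 * (m + n - 2)"
proof -
 have sc: "sin tha > 0" "cos tha > 0" using tha by (auto intro: sin_gt_zero cos_gt_zero)
 define s where "s = (sin tha)\<^sup>2"
 define c where "c = (cos tha)\<^sup>2"
 have sc1: "s > 0" "c > 0" "s + c = 1" using sc by (auto simp: s_def c_def)
 have e: "(n - 1) * c = (m - 1) * s" using tha(3) by (simp add: s_def c_def)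
 have c: "c = 1 - s" using sc1 by simp
 have "s * (m + n - 2) = n - 1" using e unfolding c by (simp add: algebra_simps)
 moreover have "c * (m + n - 2) = m - 1" using e sc1 unfolding c by (simp add: algebra_simps)
 ultimately show ?thesis using sc1 unfolding s_def[symmetric] c_def[symmetric]
  by (metis (no_types, lifting) less_irrefl mult_2 nonzero_mult_div_cancel_left)
qed

text \<open>Since \<open>sin^2\<close> and \<open>cos^2\<close> are at most 1, the derivative of the
  force is at most \<open>- (m + n - 2)\<close> on the whole quarter circle. The force therefore
  restores at least linearly also far away from the cone, which makes the convergence
  global.\<close>

lemma slope_force_mono_bound:
 assumes "0 < tht" "tht < pi / 2"
 shows "(m + n - 2) * (tht - tha)\<^sup>2 \<le> - (tht - tha) * slope_force m n tht"
proof -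
 have mono: "slope_force m n b + (m + n - 2) * b \<le> slope_force m n a + (m + n - 2) * a"
  if "0 < a" "a \<le> b" "b < pi / 2" for a b
 proof (rule DERIV_nonpos_imp_nonincreasing[OF that(2)])
  fix x assume x: "a \<le> x" "x \<le> b"
  hence x': "0 < x" "x < pi / 2" using that by auto
  hence sc: "sin x > 0" "cos x > 0" by (auto intro: sin_gt_zero cos_gt_zero)
  have "(n - 1) * 1 \<le> (n - 1) / (sin x)\<^sup>2" "(m - 1) * 1 \<le> (m - 1) / (cos x)\<^sup>2"
   using mult_left_mono[of "(sin x)\<^sup>2" 1 "n - 1"] mult_left_mono[of "(cos x)\<^sup>2" 1 "m - 1"] mn sc
   by (simp_all add: le_divide_eq abs_square_le_1)
  moreover have "((%x. slope_force m n x + (m + n - 2) * x) has_real_derivative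
    - ((n - 1) / (sin x)\<^sup>2 + (m - 1) / (cos x)\<^sup>2) + (m + n - 2) * 1) (at x)"
   by (intro DERIV_add DERIV_cmult slope_force_deriv[OF x'] DERIV_ident)
  ultimately show "\<exists>y. ((%x. slope_force m n x + (m + n - 2) * x) has_real_derivative y) (at x) & y \<le> 0"
   by (intro exI conjI) auto
 qed
 show ?thesis
 proof (cases "tht \<le> tha")
  case True
  from mono[OF assms(1) True tha(2)] slope_force_zero
  have "(tha - tht) * ((m + n - 2) * (tha - tht)) \<le> (tha - tht) * slope_force m n tht"
   by (intro mult_left_mono) (use True in \<open>auto simp: algebra_simps\<close>)
  thus ?thesis by (simp add: power2_eq_square algebra_simps)
 next
  case False
  from mono[OF tha(1) _ assms(2)] slope_force_zero False
  have "(tht - tha) * ((m + n - 2) * (tht - tha)) \<le> (tht - tha) * (- slope_force m n tht)"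
   by (intro mult_left_mono) (auto simp: algebra_simps)
  thus ?thesis by (simp add: power2_eq_square algebra_simps)
 qed
qed

text \<open>Both inequalities express convexity of the potential: the first is strong convexity
  around its minimum, the second says that the tangent at \<open>tht\<close> lies below the
  potential at \<open>tha\<close>.\<close>

lemma slope_potential_bounds:
 assumes "0 < tht" "tht < pi / 2"
 shows "(m + n - 2) / 2 * (tht - tha)\<^sup>2 \<le> slope_potential m n tht - slope_potential m n tha"
  and "slope_potential m n tht - slope_potential m n tha \<le> - (tht - tha) * slope_force m n tht"
proof -
 define f where "f x = slope_potential m n x - (m + n - 2) / 2 * (x - tha)\<^sup>2" for x
 define g where "g x = slope_potential m n x + (x - tha) * slope_force m n x" for x
 have df: "(f has_real_derivative - slope_force m n x - (m + n - 2) * (x - tha)) (at x)"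
  if "0 < x" "x < pi / 2" for x
  unfolding f_def
  by (rule derivative_eq_intros slope_potential_deriv[OF that] refl)+ (simp add: field_simps)
 have alg: "- F + ((1 - 0) * F + - z * y) = - y * z" for F y z :: real
  by (simp add: algebra_simps)
 have dg: "(g has_real_derivative - (x - tha) * ((n - 1) / (sin x)\<^sup>2 + (m - 1) / (cos x)\<^sup>2)) (at x)"
  if "0 < x" "x < pi / 2" for x
  unfolding g_def
  by (rule derivative_eq_intros slope_potential_deriv[OF that] slope_force_deriv[OF that] refl)+
   (rule alg)
 have f_ge: "0 \<le> (x - tha) * (- slope_force m n x - (m + n - 2) * (x - tha))"
  if "0 < x" "x < pi / 2" for x
  using slope_force_mono_bound[OF that] by (simp add: power2_eq_square algebra_simps)
 have "f tha \<le> f tht & g tht \<le> g tha"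
 proof (cases "tht \<le> tha")
  case True
  have "f tha \<le> f tht"
  proof (rule DERIV_nonpos_imp_nonincreasing[OF True])
   fix x assume x: "tht \<le> x" "x \<le> tha"
   hence x': "0 < x" "x < pi / 2" using assms tha by auto
   have "- slope_force m n x - (m + n - 2) * (x - tha) \<le> 0"
   proof (cases "x = tha")
    case False
    thus ?thesis using f_ge[OF x'] x by (simp add: zero_le_mult_iff)
   qed (use slope_force_zero in simp)
   with df[OF x'] show "\<exists>y. (f has_real_derivative y) (at x) & y \<le> 0" by blast
  qed
  moreover have "g tht \<le> g tha"
  proof (rule DERIV_nonneg_imp_nondecreasing[OF True])
   fix x assume x: "tht \<le> x" "x \<le> tha"
   hence x': "0 < x" "x < pi / 2" using assms tha by auto
   have "0 \<le> - (x - tha) * ((n - 1) / (sin x)\<^sup>2 + (m - 1) / (cos x)\<^sup>2)"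
    by (rule mult_nonneg_nonneg) (use x mn in auto)
   with dg[OF x'] show "\<exists>y. (g has_real_derivative y) (at x) & 0 \<le> y" by blast
  qed
  ultimately show ?thesis ..
 next
  case False
  hence F: "tha \<le> tht" by simp
  have "f tha \<le> f tht"
  proof (rule DERIV_nonneg_imp_nondecreasing[OF F])
   fix x assume x: "tha \<le> x" "x \<le> tht"
   hence x': "0 < x" "x < pi / 2" using assms tha by auto
   have "- slope_force m n x - (m + n - 2) * (x - tha) \<ge> 0"
   proof (cases "x = tha")
    case False
    thus ?thesis using f_ge[OF x'] x by (simp add: zero_le_mult_iff)
   qed (use slope_force_zero in simp)
   with df[OF x'] show "\<exists>y. (f has_real_derivative y) (at x) & 0 \<le> y" by blast
  qed
  moreover have "g tht \<le> g tha"
  proof (rule DERIV_nonpos_imp_nonincreasing[OF F])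
   fix x assume x: "tha \<le> x" "x \<le> tht"
   hence x': "0 < x" "x < pi / 2" using assms tha by auto
   have "0 \<le> (x - tha) * ((n - 1) / (sin x)\<^sup>2 + (m - 1) / (cos x)\<^sup>2)"
    by (rule mult_nonneg_nonneg) (use x mn in auto)
   with dg[OF x'] show "\<exists>y. (g has_real_derivative y) (at x) & y \<le> 0"
    by (metis minus_mult_left neg_le_0_iff_le)
  qed
  ultimately show ?thesis ..
 qed
 thus "(m + n - 2) / 2 * (tht - tha)\<^sup>2 \<le> slope_potential m n tht - slope_potential m n tha"
  "slope_potential m n tht - slope_potential m n tha \<le> - (tht - tha) * slope_force m n tht"
  by (auto simp: f_def g_def algebra_simps)
qed

text \<open>The factor \<open>1 + p^2\<close> in the equation makes \<open>ln (1 + p^2) / 2\<close>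
  the right kinetic energy: together with the potential it has derivative exactly
  \<open>- N * p^2\<close>. Its monotonicity bounds \<open>p\<close> for all later times, whatever
  the initial data. After that \<open>1 + p^2\<close> lies between 1 and \<open>B\<close>, and a
  cross term \<open>dlt * x * p\<close> gives exponential decay as for a linear oscillator.\<close>

lemma slope_exponential_decay:
 fixes tht p :: "real => real"
 assumes der: "\<And>l. l > l\<^sub>0 ==> (tht has_real_derivative p l) (at l)"
   "\<And>l. l > l\<^sub>0 ==> (p has_real_derivative
    (1 + (p l)\<^sup>2) * (slope_force m n (tht l) - (m + n - 1) * p l)) (at l)"
  and tht: "\<And>l. l > l\<^sub>0 ==> 0 < tht l & tht l < pi / 2"
 obtains K c where "c > 0"
  "\<forall>\<^sub>F l in at_top. \<bar>tht l - tha\<bar> \<le> K * exp (- c * l)"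
  "\<forall>\<^sub>F l in at_top. \<bar>p l\<bar> \<le> K * exp (- c * l)"
proof -
 define N where "N = m + n - 1"
 have N: "N > 1" using mn by (simp add: N_def)
 define L where "L = l\<^sub>0 + 1"
 define V where "V l = slope_potential m n (tht l) - slope_potential m n tha" for l
 define x where "x l = tht l - tha" for l
 define D where "D l = - x l * slope_force m n (tht l)" for l
 have V0: "0 \<le> V l" "(N - 1) / 2 * (x l)\<^sup>2 \<le> V l" "V l \<le> D l" "(N - 1) * (x l)\<^sup>2 \<le> D l" if "l \<ge> L" for l
 proof -
  have l: "0 < tht l" "tht l < pi / 2" using tht[of l] that by (auto simp: L_def)
  show "(N - 1) / 2 * (x l)\<^sup>2 \<le> V l" "V l \<le> D l" "(N - 1) * (x l)\<^sup>2 \<le> D l"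
   using slope_potential_bounds[OF l] slope_force_mono_bound[OF l]
   by (auto simp: V_def x_def D_def N_def algebra_simps)
  moreover have "0 \<le> (N - 1) / 2 * (x l)\<^sup>2" using N by simp
  ultimately show "0 \<le> V l" by linarith
 qed
 define E where "E l = ln (1 + (p l)\<^sup>2) / 2 + V l" for l
 have dV: "(V has_real_derivative - slope_force m n (tht l) * p l) (at l)" if "l \<ge> L" for l
 proof -
  have l: "0 < tht l" "tht l < pi / 2" "l > l\<^sub>0" using tht[of l] that by (auto simp: L_def)
  show ?thesis unfolding V_def
   using DERIV_chain2[OF slope_potential_deriv[OF l(1,2)] der(1)[OF l(3)]]
   by (auto intro!: derivative_eq_intros)
 qed
 have pos: "1 + (p l)\<^sup>2 > 0" for l by (simp add: add_pos_nonneg)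
 have dln: "((%l. ln (1 + (p l)\<^sup>2) / 2) has_real_derivative p l * (slope_force m n (tht l) - N * p l)) (at l)"
  if "l \<ge> L" for l
 proof -
  have l: "l > l\<^sub>0" using that by (simp add: L_def)
  have "((%l. ln (1 + (p l)\<^sup>2) / 2) has_real_derivative
   ((2 * p l * ((1 + (p l)\<^sup>2) * (slope_force m n (tht l) - N * p l))) / (1 + (p l)\<^sup>2)) / 2) (at l)"
   using pos[of l] unfolding N_def
   by (auto intro!: derivative_eq_intros der(2)[OF l] simp: divide_simps)
  moreover have "(2 * p l * ((1 + (p l)\<^sup>2) * (slope_force m n (tht l) - N * p l))) / (1 + (p l)\<^sup>2) / 2
    = p l * (slope_force m n (tht l) - N * p l)" using pos[of l] by simp
  ultimately show ?thesis by simp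
 qed
 have dE: "(E has_real_derivative - N * (p l)\<^sup>2) (at l)" if "l \<ge> L" for l
  unfolding E_def
  by (rule derivative_eq_intros dln[OF that] dV[OF that] refl)+
   (simp add: algebra_simps power2_eq_square)
 have E_le: "E l \<le> E L" if "l \<ge> L" for l
 proof (rule DERIV_nonpos_imp_nonincreasing[OF that])
  fix y assume "L \<le> y" "y \<le> l"
  with dE[of y] N show "\<exists>z. (E has_real_derivative z) (at y) & z \<le> 0"
   by (intro exI[of _ "- N * (p y)\<^sup>2"]) (auto simp: mult_nonneg_nonneg)
 qed
 define B where "B = exp (2 * E L)"
 have B: "1 + (p l)\<^sup>2 \<le> B" if "l \<ge> L" for l
 proof -
  have "ln (1 + (p l)\<^sup>2) \<le> 2 * E L" using E_le[OF that] V0(1)[OF that] by (simp add: E_def)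
  hence "exp (ln (1 + (p l)\<^sup>2)) \<le> B" by (simp add: B_def)
  thus ?thesis using pos[of l] by simp
 qed
 have B1: "B \<ge> 1" using B[of L] by (smt (verit) zero_le_power2)
 \<comment> \<open>Young's inequality, applied to \<open>N * (1 + p^2) * x * p\<close> so that half
   of \<open>D\<close> is spent, leaves the coefficient \<open>Q - 1\<close> in front of
   \<open>p^2\<close>; the further 1 comes from differentiating \<open>x\<close> in
   \<open>x * p\<close>.\<close>
 define Q where "Q = 1 + N\<^sup>2 * B\<^sup>2 / (2 * (N - 1))"
 have Q: "Q \<ge> 1" using N by (simp add: Q_def)
 define dlt where "dlt = min (min (N / (2 * Q)) (1 / (2 * B))) (min 1 ((N - 1) / 2))"
 have dlt: "dlt > 0" "dlt * Q \<le> N / 2" "dlt \<le> 1 / (2 * B)" "dlt \<le> 1" "dlt \<le> (N - 1) / 2"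
 proof -
  show "dlt > 0" "dlt \<le> 1 / (2 * B)" "dlt \<le> 1" "dlt \<le> (N - 1) / 2"
   using N B1 Q unfolding dlt_def by (simp_all only: min_less_iff_conj) (simp_all add: min_le_iff_disj)
  have "dlt \<le> N / (2 * Q)" by (simp add: dlt_def)
  thus "dlt * Q \<le> N / 2" using Q by (simp add: field_simps)
 qed
 define F where "F l = E l + dlt * (x l * p l)" for l
 define F' where "F' l = - N * (p l)\<^sup>2 + dlt * ((p l)\<^sup>2 - (1 + (p l)\<^sup>2) * D l - N * (1 + (p l)\<^sup>2) * (x l * p l))" for l
 have dF: "(F has_real_derivative F' l) (at l)" if "l \<ge> L" for l
 proof -
  have l: "l > l\<^sub>0" using that by (simp add: L_def)
  show ?thesis unfolding F_def F'_def x_def D_def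
   by (rule derivative_eq_intros dE[OF that] der(1)[OF l] der(2)[OF l] refl)+
    (simp add: algebra_simps power2_eq_square N_def)
 qed
 have xp: "\<bar>dlt * (x l * p l)\<bar> \<le> dlt / 2 * ((x l)\<^sup>2 + (p l)\<^sup>2)" for l
 proof -
  have "2 * \<bar>x l * p l\<bar> \<le> (x l)\<^sup>2 + (p l)\<^sup>2"
   using sum_squares_bound[of "\<bar>x l\<bar>" "\<bar>p l\<bar>"] by (simp add: abs_mult)
  from mult_left_mono[OF this, of "dlt / 2"] show ?thesis using dlt(1) by (simp add: abs_mult)
 qed
 define c where "c = min (N / 4) (dlt * (N - 1) / (4 * N))"
 have c: "c > 0" using N dlt by (simp add: c_def)
 have F'_le: "F' l \<le> - c * F l + 0" if "l \<ge> L" for l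
 proof -
  have "- N * (1 + (p l)\<^sup>2) * (x l * p l) \<le> 2 * \<bar>x l\<bar> * (N * B * \<bar>p l\<bar> / 2)"
  proof -
   have "- N * (1 + (p l)\<^sup>2) * (x l * p l) \<le> \<bar>- N * (1 + (p l)\<^sup>2) * (x l * p l)\<bar>"
    by (rule abs_ge_self)
   also have "\<dots> = (1 + (p l)\<^sup>2) * (N * (\<bar>x l\<bar> * \<bar>p l\<bar>))"
    using N pos[of l] by (simp add: abs_mult)
   also have "\<dots> \<le> B * (N * (\<bar>x l\<bar> * \<bar>p l\<bar>))"
    by (rule mult_right_mono[OF B[OF that]]) (use N in auto)
   finally show ?thesis by (simp add: algebra_simps)
  qed
  also have "\<dots> \<le> (N - 1) / 2 * \<bar>x l\<bar>\<^sup>2 + (N * B * \<bar>p l\<bar> / 2)\<^sup>2 / ((N - 1) / 2)"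
   using N by (intro young_real) auto
  also have "\<dots> = (N - 1) / 2 * (x l)\<^sup>2 + (Q - 1) * (p l)\<^sup>2"
   using N by (simp add: Q_def power2_eq_square field_simps)
  also have "\<dots> \<le> D l / 2 + (Q - 1) * (p l)\<^sup>2" using V0(4)[OF that] by simp
  finally have 1: "- N * (1 + (p l)\<^sup>2) * (x l * p l) \<le> D l / 2 + (Q - 1) * (p l)\<^sup>2" .
  have D0: "0 \<le> D l" using V0(1,3)[OF that] by linarith
  have 2: "D l \<le> (1 + (p l)\<^sup>2) * D l" using D0 by (simp add: algebra_simps)
  have "dlt * ((p l)\<^sup>2 - (1 + (p l)\<^sup>2) * D l - N * (1 + (p l)\<^sup>2) * (x l * p l)) \<le> dlt * (Q * (p l)\<^sup>2 - D l / 2)"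
   by (rule mult_left_mono) (use 1 2 dlt(1) in \<open>auto simp: algebra_simps\<close>)
  moreover have "dlt * Q * (p l)\<^sup>2 \<le> N / 2 * (p l)\<^sup>2" by (rule mult_right_mono[OF dlt(2)]) simp
  ultimately have 3: "F' l \<le> - N / 2 * (p l)\<^sup>2 - dlt / 2 * D l"
   by (simp add: F'_def algebra_simps)
  have 4: "F l \<le> (p l)\<^sup>2 + (1 + 1 / (N - 1)) * D l"
  proof -
   have "ln (1 + (p l)\<^sup>2) \<le> (p l)\<^sup>2" by (rule ln_add_one_self_le_self) simp
   moreover have "dlt / 2 * ((x l)\<^sup>2 + (p l)\<^sup>2) \<le> 1 / 2 * ((x l)\<^sup>2 + (p l)\<^sup>2)"
    by (rule mult_right_mono) (use dlt in auto)
   moreover have "(x l)\<^sup>2 \<le> D l / (N - 1)" using V0(4)[OF that] N by (simp add: field_simps)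
   moreover have "D l / (N - 1) \<ge> 0" using D0 N by simp
   ultimately show ?thesis using xp[of l] V0(3)[OF that] unfolding F_def E_def
    by (simp add: algebra_simps)
  qed
  have "c * F l \<le> c * ((p l)\<^sup>2 + (1 + 1 / (N - 1)) * D l)"
   using 4 c by simp
  also have "\<dots> = c * (p l)\<^sup>2 + c * (1 + 1 / (N - 1)) * D l" by (simp add: algebra_simps)
  also have "\<dots> \<le> N / 2 * (p l)\<^sup>2 + dlt / 2 * D l"
  proof (intro add_mono mult_right_mono D0)
   show "c \<le> N / 2" using N by (simp add: c_def)
   have "c \<le> dlt * (N - 1) / (4 * N)" by (simp add: c_def)
   hence "c * (1 + 1 / (N - 1)) \<le> dlt * (N - 1) / (4 * N) * (1 + 1 / (N - 1))"
    by (rule mult_right_mono) (use N in auto)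
   also have "\<dots> \<le> dlt / 2" using N dlt(1) by (simp add: field_simps)
   finally show "c * (1 + 1 / (N - 1)) \<le> dlt / 2" .
  qed simp
  finally show ?thesis using 3 by simp
 qed
 have F: "F l \<le> F L * exp (- c * (l - L)) + \<bar>0\<bar> / c" if "l \<ge> L" for l
  by (rule gronwall_exponential[of L F F' c 0]) (use dF F'_le c that in auto)
 have FB: "(p l)\<^sup>2 / (4 * B) \<le> F l" "(N - 1) / 4 * (x l)\<^sup>2 \<le> F l" if "l \<ge> L" for l
 proof -
  have "(p l)\<^sup>2 / B \<le> (p l)\<^sup>2 / (1 + (p l)\<^sup>2)"
   by (rule divide_left_mono) (use B[OF that] B1 pos[of l] in auto)
  also have "\<dots> \<le> ln (1 + (p l)\<^sup>2)"
  proof -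
   have "ln (1 / (1 + (p l)\<^sup>2)) \<le> 1 / (1 + (p l)\<^sup>2) - 1"
    by (rule ln_le_minus_one) (use pos[of l] in simp)
   thus ?thesis using pos[of l] by (simp add: ln_div field_simps)
  qed
  finally have 1: "(p l)\<^sup>2 / B \<le> ln (1 + (p l)\<^sup>2)" .
  have 2: "dlt * (p l)\<^sup>2 \<le> (p l)\<^sup>2 / B / 2"
   using mult_right_mono[OF dlt(3), of "(p l)\<^sup>2"] by (simp add: field_simps)
  have 3: "dlt * (x l)\<^sup>2 \<le> (N - 1) / 2 * (x l)\<^sup>2" by (rule mult_right_mono[OF dlt(5)]) simp
  have "- (dlt * (x l * p l)) \<le> dlt / 2 * ((x l)\<^sup>2 + (p l)\<^sup>2)" by (rule abs_le_D2[OF xp])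
  also have "\<dots> = (dlt * (x l)\<^sup>2) / 2 + (dlt * (p l)\<^sup>2) / 2"
   by (simp add: algebra_simps)
  also have "\<dots> \<le> (N - 1) / 2 * (x l)\<^sup>2 / 2 + (p l)\<^sup>2 / B / 2 / 2"
   using 2 3 by (intro add_mono divide_right_mono) auto
  also have "(p l)\<^sup>2 / B / 2 / 2 = (p l)\<^sup>2 / B / 4" by simp
  finally have "- (dlt * (x l * p l)) \<le> (N - 1) / 2 * (x l)\<^sup>2 / 2 + (p l)\<^sup>2 / B / 4" .
  with 1 V0(2)[OF that] have 4: "(p l)\<^sup>2 / B / 4 + (N - 1) / 4 * (x l)\<^sup>2 \<le> F l"
   unfolding F_def E_def by linarith
  have "(p l)\<^sup>2 / B / 4 \<ge> 0" "(N - 1) / 4 * (x l)\<^sup>2 \<ge> 0" using B1 N by auto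
  with 4 show "(p l)\<^sup>2 / (4 * B) \<le> F l" "(N - 1) / 4 * (x l)\<^sup>2 \<le> F l" by (auto simp: mult.commute)
 qed
 \<comment> \<open>The lower bounds \<open>FB\<close> of the energy are quadratic, so taking roots
   halves the rate.\<close>
 define K where "K = sqrt ((4 * B + 4 / (N - 1)) * (\<bar>F L\<bar> * exp (c * L)))"
 have main: "\<bar>p l\<bar> \<le> K * exp (- (c / 2) * l) & \<bar>x l\<bar> \<le> K * exp (- (c / 2) * l)" if "l \<ge> L" for l
 proof -
  have e: "exp (- c * (l - L)) = exp (c * L) * exp (- c * l)"
   by (simp add: exp_add[symmetric] algebra_simps)
  have "F l \<le> F L * exp (- c * (l - L))" using F[OF that] by simp
  also have "\<dots> \<le> \<bar>F L\<bar> * exp (- c * (l - L))" by (intro mult_right_mono) auto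
  finally have Fl: "F l \<le> \<bar>F L\<bar> * exp (c * L) * exp (- c * l)" (is "_ \<le> ?R")
   unfolding e by (simp only: mult.assoc)
  have R: "?R \<ge> 0" by simp
  have "(p l)\<^sup>2 \<le> 4 * B * F l" using FB(1)[OF that] B1 by (simp add: field_simps)
  also have "\<dots> \<le> 4 * B * ?R" by (rule mult_left_mono[OF Fl]) (use B1 in simp)
  also have "\<dots> \<le> (4 * B + 4 / (N - 1)) * ?R" by (rule mult_right_mono) (use N R in auto)
  finally have p: "(p l)\<^sup>2 \<le> (4 * B + 4 / (N - 1)) * ?R" .
  have "(x l)\<^sup>2 \<le> 4 / (N - 1) * F l" using FB(2)[OF that] N by (simp add: field_simps)
  also have "\<dots> \<le> 4 / (N - 1) * ?R" by (rule mult_left_mono[OF Fl]) (use N in simp)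
  also have "\<dots> \<le> (4 * B + 4 / (N - 1)) * ?R" by (rule mult_right_mono) (use B1 R in auto)
  finally have x: "(x l)\<^sup>2 \<le> (4 * B + 4 / (N - 1)) * ?R" .
  have "sqrt ((4 * B + 4 / (N - 1)) * ?R) = K * sqrt (exp (- c * l))"
   by (simp add: K_def real_sqrt_mult mult.assoc)
  also have "sqrt (exp (- c * l)) = exp (- (c / 2) * l)"
   by (rule real_sqrt_unique) (auto simp: exp_double[symmetric])
  finally show ?thesis
   using real_sqrt_le_mono[OF p] real_sqrt_le_mono[OF x] by simp
 qed
 show ?thesis
  by (rule that[of "c / 2" K])
   (use c main in \<open>auto simp: eventually_at_top_linorder x_def intro!: exI[of _ L]\<close>)
qed

end

section \<open>A linear second order equation with a singular end, solved up to that end\<close>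

text \<open>The equation in view is \<open>q u'' + N u' + al u = g\<close>, with \<open>q\<close>
  vanishing at \<open>t\<^sub>0\<close>. The function \<open>P\<close> is its integrating factor:
  \<open>P' = N P / q\<close> turns \<open>q u'' + N u' = k\<close> into
  \<open>N (P u')' = k P'\<close>, and \<open>P t\<^sub>0 = 0\<close> singles out the solution whose
  derivative stays finite, namely \<open>u'\<close> equal to \<open>1 / N\<close> times the mean of
  \<open>k\<close> with respect to \<open>P\<close>.\<close>

locale singular_ode =
 fixes t\<^sub>0 N A :: real and P q al g :: "real => real"
 assumes N: "N > 0" and A: "A > 0"
  and P: "continuous_on {t\<^sub>0..} P" "P t\<^sub>0 = 0"
  and q: "\<And>t. t > t\<^sub>0 ==> q t > 0"
  and P': "\<And>t. t > t\<^sub>0 ==> P t > 0 & (P has_real_derivative N * P t / q t) (at t)"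
  and cont: "continuous_on {t\<^sub>0..} al" "continuous_on {t\<^sub>0..} g"
  and bound: "\<And>t. t \<ge> t\<^sub>0 ==> \<bar>al t\<bar> \<le> A & \<bar>g t\<bar> \<le> A"
begin

lemma P_strict_mono: "P s < P t" if "t\<^sub>0 \<le> s" "s < t"
proof (rule DERIV_pos_imp_increasing_open[OF that(2)])
 fix x assume "s < x" "x < t"
 with P'[of x] q[of x] N that show "\<exists>y. (P has_real_derivative y) (at x) & y > 0" by auto
next
 show "continuous_on {s..t} P" by (rule continuous_on_subset[OF P(1)]) (use that in auto)
qed

definition Q :: "real => real" where "Q = inv_into {t\<^sub>0..} P"

lemma inj_P: "inj_on P {t\<^sub>0..}"
 by (rule linorder_inj_onI) (use P_strict_mono in force)+

lemma Q_P: "t \<ge> t\<^sub>0 ==> Q (P t) = t"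
 unfolding Q_def by (rule inv_into_f_f[OF inj_P]) simp

lemma P_image: "t \<ge> t\<^sub>0 ==> P ` {t\<^sub>0..t} = {0..P t}"
proof (intro equalityI subsetI)
 fix s assume t: "t \<ge> t\<^sub>0" and s: "s \<in> {0..P t}"
 have "\<exists>x\<ge>t\<^sub>0. x \<le> t & P x = s"
  by (rule IVT') (use t s P in \<open>auto intro: continuous_on_subset\<close>)
 thus "s \<in> P ` {t\<^sub>0..t}" by auto
next
 fix s assume t: "t \<ge> t\<^sub>0" and "s \<in> P ` {t\<^sub>0..t}"
 then obtain x where x: "s = P x" "t\<^sub>0 \<le> x" "x \<le> t" by auto
 thus "s \<in> {0..P t}" using P_strict_mono[of t\<^sub>0 x] P_strict_mono[of x t] P(2)
  by (cases "x = t\<^sub>0"; cases "x = t") (auto simp: less_imp_le)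
qed

lemma Q_range: "s \<in> {0..P t} ==> t \<ge> t\<^sub>0 ==> Q s \<in> {t\<^sub>0..t}"
 using P_image[of t] Q_P by (metis (no_types, lifting) atLeastAtMost_iff imageE)

lemma continuous_Q: "t \<ge> t\<^sub>0 ==> continuous_on {0..P t} Q"
 using continuous_on_inv[of "{t\<^sub>0..t}" P Q] P_image[of t] Q_P continuous_on_subset[OF P(1), of "{t\<^sub>0..t}"]
 by simp

text \<open>The integral of \<open>k\<close> against \<open>dP\<close>, written in the variable
  \<open>s = P t\<close>. There the integrand is continuous up to the singular end, whereas the
  density \<open>N * P t / q t\<close> in the variable \<open>t\<close> is controlled only for
  \<open>t > t\<^sub>0\<close>.\<close>

definition Y :: "(real => real) => real => real" where
 "Y k t = integral {0..P t} (%s. k (Q s))"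

lemma continuous_kQ:
 assumes "continuous_on {t\<^sub>0..} k" "t \<ge> t\<^sub>0"
 shows "continuous_on {0..P t} (%s. k (Q s))"
 by (rule continuous_on_compose2[OF assms(1) continuous_Q[OF assms(2)]])
  (use Q_range assms in fastforce)

lemma Y_deriv:
 assumes k: "continuous_on {t\<^sub>0..} k" and t: "t > t\<^sub>0"
 shows "(Y k has_real_derivative k t * (N * P t / q t)) (at t)"
proof -
 have P1: "0 < P t" "P t < P (t + 1)" using P'[OF t] P_strict_mono[of t "t + 1"] t by auto
 have "((%x. integral {0..x} (%s. k (Q s))) has_real_derivative k (Q (P t))) (at (P t) within {0..P (t + 1)})"
  by (rule integral_has_real_derivative[OF continuous_kQ[OF k]]) (use t P1 in auto)
 hence "((%x. integral {0..x} (%s. k (Q s))) has_real_derivative k t) (at (P t))"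
  using t P1 Q_P[of t] at_within_Icc_at[of 0 "P t" "P (t + 1)"] by simp
 from DERIV_chain2[of "%x. integral {0..x} (%s. k (Q s))" "k t" P t, OF this P'[OF t, THEN conjunct2]]
 show ?thesis by (simp add: Y_def[abs_def])
qed

lemma Y_bound:
 assumes k: "continuous_on {t\<^sub>0..} k" and t: "t \<ge> t\<^sub>0"
  and C: "\<And>s. t\<^sub>0 \<le> s ==> s \<le> t ==> \<bar>k s - c\<bar> \<le> C"
 shows "\<bar>Y k t - c * P t\<bar> \<le> C * P t"
proof -
 have P0: "P t \<ge> 0" using P'[of t] P(2) t by (cases "t = t\<^sub>0") auto
 have int: "(%s. k (Q s)) integrable_on {0..P t}"
  by (rule integrable_continuous_interval[OF continuous_kQ[OF k t]])
 have "Y k t - c * P t = integral {0..P t} (%s. k (Q s) - c)"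
  using integral_diff[OF int, of "%_. c"] P0 integrable_const_ivl[of c 0 "P t"]
  by (simp add: Y_def mult.commute)
 moreover have "norm (integral {0..P t} (%s. k (Q s) - c)) \<le> integral {0..P t} (%s. C)"
  by (rule integral_norm_bound_integral)
   (use C Q_range t int integrable_diff[OF int, of "%_. c"] in auto)
 ultimately show ?thesis using P0 by (simp add: mult.commute)
qed

lemma Y_diff:
 assumes "continuous_on {t\<^sub>0..} k" "continuous_on {t\<^sub>0..} k'" "t \<ge> t\<^sub>0"
 shows "Y (%s. k s - k' s) t = Y k t - Y k' t"
 unfolding Y_def using assms
 by (intro integral_diff integrable_continuous_interval continuous_kQ)

text \<open>The candidate for \<open>u'\<close> when the right side of \<open>q u'' + N u'\<close>
  is \<open>k\<close>: the mean of \<open>k\<close> over the \<open>P\<close>-mass of the interval,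
  divided by \<open>N\<close>. The value at \<open>t\<^sub>0\<close> is the limit of these
  means.\<close>

definition avg :: "(real => real) => real => real" where
 "avg k t = (if t \<le> t\<^sub>0 then k t\<^sub>0 else Y k t / P t) / N"

lemma avg_deriv:
 assumes k: "continuous_on {t\<^sub>0..} k" and t: "t > t\<^sub>0"
 shows "(avg k has_real_derivative (k t - N * avg k t) / q t) (at t)"
proof -
 have "((%t. Y k t / P t / N) has_real_derivative
  (k t * (N * P t / q t) * P t - Y k t * (N * P t / q t)) / (P t * P t) / N) (at t)"
  using P'[OF t] by (intro DERIV_cdivide DERIV_divide Y_deriv k t) auto
 moreover have "(k t * (N * P t / q t) * P t - Y k t * (N * P t / q t)) / (P t * P t) / N
   = (k t - N * avg k t) / q t"
  using P'[OF t] q[OF t] N t by (simp add: avg_def field_simps)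
 ultimately have "((%t. Y k t / P t / N) has_real_derivative (k t - N * avg k t) / q t) (at t)"
  by simp
 thus ?thesis
  by (rule has_field_derivative_transform_within_open[of _ _ _ "{t\<^sub>0<..}"]) (use t in \<open>auto simp: avg_def\<close>)
qed

lemma avg_bound:
 assumes k: "continuous_on {t\<^sub>0..} k" and t: "t \<ge> t\<^sub>0"
  and C: "\<And>s. t\<^sub>0 \<le> s ==> s \<le> t ==> \<bar>k s - c\<bar> \<le> C"
 shows "\<bar>avg k t - c / N\<bar> \<le> C / N"
proof (cases "t = t\<^sub>0")
 case True
 have "avg k t - c / N = (k t\<^sub>0 - c) / N" using True by (simp add: avg_def diff_divide_distrib)
 thus ?thesis using C[of t] True N by (simp add: divide_right_mono)
next
 case False
 hence t': "t > t\<^sub>0" using t by simp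
 have P0: "P t > 0" using P'[OF t'] by simp
 have "avg k t - c / N = (Y k t - c * P t) / P t / N"
  using P0 t' N by (simp add: avg_def divide_simps)
 moreover have "\<bar>(Y k t - c * P t) / P t\<bar> \<le> C"
  using Y_bound[OF k t, of c C] C P0 by (simp add: field_simps)
 ultimately show ?thesis using divide_right_mono[of "\<bar>(Y k t - c * P t) / P t\<bar>" C N] N
  by (simp add: abs_divide abs_mult)
qed

lemma continuous_avg:
 assumes k: "continuous_on {t\<^sub>0..} k"
 shows "continuous_on {t\<^sub>0..} (avg k)"
 unfolding continuous_on_eq_continuous_within
proof
 fix t assume t: "t \<in> {t\<^sub>0..}"
 show "continuous (at t within {t\<^sub>0..}) (avg k)"
 proof (cases "t = t\<^sub>0")
  case False
  thus ?thesis using avg_deriv[OF k, of t] t DERIV_isCont continuous_at_imp_continuous_at_within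
   by fastforce
 next
  case True
  show ?thesis unfolding continuous_within_eps_delta True
  proof (intro allI impI)
   fix e :: real assume e: "e > 0"
   hence "e * N / 2 > 0" using N by simp
   with k obtain d where d: "d > 0" "\<And>x. x \<ge> t\<^sub>0 ==> dist x t\<^sub>0 < d ==> dist (k x) (k t\<^sub>0) < e * N / 2"
    unfolding continuous_on_iff by (metis atLeast_iff order_refl)
   show "\<exists>d>0. \<forall>x'\<in>{t\<^sub>0..}. dist x' t\<^sub>0 < d --> dist (avg k x') (avg k t\<^sub>0) < e"
   proof (intro exI[of _ d] conjI ballI impI d(1))
    fix x assume x: "x \<in> {t\<^sub>0..}" "dist x t\<^sub>0 < d"
    have "\<bar>avg k x - k t\<^sub>0 / N\<bar> \<le> (e * N / 2) / N"
     by (rule avg_bound[OF k]) (use x d(2) in \<open>force simp: dist_real_def less_imp_le\<close>)+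
    thus "dist (avg k x) (avg k t\<^sub>0) < e" using e N by (simp add: dist_real_def avg_def)
   qed
  qed
 qed
qed

lemma avg_diff:
 assumes "continuous_on {t\<^sub>0..} k" "continuous_on {t\<^sub>0..} k'" "t \<ge> t\<^sub>0"
 shows "avg (%s. k s - k' s) t = avg k t - avg k' t"
 using Y_diff[OF assms] by (simp add: avg_def diff_divide_distrib)

definition J :: "(real => real) => real => real" where
 "J k t = integral {t\<^sub>0..t} (avg k)"

lemma J_deriv:
 assumes "continuous_on {t\<^sub>0..} k" "t > t\<^sub>0"
 shows "(J k has_real_derivative avg k t) (at t)"
proof -
 have "((%x. integral {t\<^sub>0..x} (avg k)) has_real_derivative avg k t) (at t within {t\<^sub>0..t + 1})"
  by (rule integral_has_real_derivative)
   (use assms continuous_on_subset[OF continuous_avg[OF assms(1)]] in auto)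
 thus ?thesis using assms at_within_Icc_at[of t\<^sub>0 t "t + 1"] by (simp add: J_def[abs_def])
qed

lemma continuous_J:
 assumes "continuous_on {t\<^sub>0..} k"
 shows "continuous_on {t\<^sub>0..} (J k)"
proof (rule continuous_on_subset[of "\<Union>T. {t\<^sub>0..<T}"])
 have "continuous_on {t\<^sub>0..<T} (J k)" for T
  unfolding J_def[abs_def]
  by (rule continuous_on_subset[OF indefinite_integral_continuous_1[OF integrable_continuous_interval], of t\<^sub>0 T])
   (auto intro: continuous_on_subset[OF continuous_avg[OF assms]])
 show "continuous_on (\<Union>T. {t\<^sub>0..<T}) (J k)"
  unfolding continuous_on_eq_continuous_within
 proof
  fix x assume "x \<in> (\<Union>T. {t\<^sub>0..<T})"
  hence x: "x \<ge> t\<^sub>0" by auto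
  have "continuous (at x within {t\<^sub>0..<x + 1}) (J k)"
   using \<open>continuous_on {t\<^sub>0..<x + 1} (J k)\<close> x by (simp add: continuous_on_eq_continuous_within)
  moreover have "at x within {t\<^sub>0..<x + 1} = at x within (\<Union>T. {t\<^sub>0..<T})"
   by (rule at_within_nhd[of _ "{..<x + 1}"]) auto
  ultimately show "continuous (at x within (\<Union>T. {t\<^sub>0..<T})) (J k)" by simp
 qed
 show "{t\<^sub>0..} \<subseteq> (\<Union>T. {t\<^sub>0..<T})" using gt_ex by auto
qed

text \<open>Integrating the increasing weight \<open>exp (\<Lambda> * (t - t\<^sub>0))\<close> gains
  the factor \<open>1 / \<Lambda>\<close>, and averaging does not spoil a bound by an increasing
  weight. A large \<open>\<Lambda>\<close> thus makes the solution operator contracting on the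
  entire half line at once.\<close>

lemma J_bound:
 assumes k: "continuous_on {t\<^sub>0..} k" and t: "t \<ge> t\<^sub>0" and \<Lambda>: "\<Lambda> > 0" and C: "C \<ge> 0"
  and le: "\<And>s. s \<ge> t\<^sub>0 ==> \<bar>k s\<bar> \<le> C * exp (\<Lambda> * (s - t\<^sub>0))"
 shows "\<bar>J k t\<bar> \<le> C / (N * \<Lambda>) * exp (\<Lambda> * (t - t\<^sub>0))"
proof -
 have avg: "\<bar>avg k s\<bar> \<le> C / N * exp (\<Lambda> * (s - t\<^sub>0))" if "s \<ge> t\<^sub>0" for s
 proof -
  have "\<bar>avg k s - 0 / N\<bar> \<le> (C * exp (\<Lambda> * (s - t\<^sub>0))) / N"
  proof (rule avg_bound[OF k that])
   fix r assume r: "t\<^sub>0 \<le> r" "r \<le> s"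
   have "\<bar>k r\<bar> \<le> C * exp (\<Lambda> * (r - t\<^sub>0))" by (rule le[OF r(1)])
   also have "\<dots> \<le> C * exp (\<Lambda> * (s - t\<^sub>0))"
    using r \<Lambda> C by (intro mult_left_mono) auto
   finally show "\<bar>k r - 0\<bar> \<le> C * exp (\<Lambda> * (s - t\<^sub>0))" by simp
  qed
  thus ?thesis by simp
 qed
 have I: "((%s. C / N * exp (\<Lambda> * (s - t\<^sub>0))) has_integral
   C / (N * \<Lambda>) * exp (\<Lambda> * (t - t\<^sub>0)) - C / (N * \<Lambda>) * exp (\<Lambda> * (t\<^sub>0 - t\<^sub>0))) {t\<^sub>0..t}"
  by (rule fundamental_theorem_of_calculus[OF t])
   (use N \<Lambda> in \<open>auto intro!: derivative_eq_intros simp: has_real_derivative_iff_has_vector_derivative[symmetric]\<close>)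
 have "norm (J k t) \<le> integral {t\<^sub>0..t} (%s. C / N * exp (\<Lambda> * (s - t\<^sub>0)))"
  unfolding J_def
  by (rule integral_norm_bound_integral)
   (use avg I in \<open>auto intro: has_integral_integrable intro!: integrable_continuous_interval[OF continuous_on_subset[OF continuous_avg[OF k]]]\<close>)
 also have "\<dots> \<le> C / (N * \<Lambda>) * exp (\<Lambda> * (t - t\<^sub>0))"
  unfolding integral_unique[OF I] using C N \<Lambda> by simp
 finally show ?thesis by simp
qed

lemma J_diff:
 assumes "continuous_on {t\<^sub>0..} k" "continuous_on {t\<^sub>0..} k'" "t \<ge> t\<^sub>0"
 shows "J (%s. k s - k' s) t = J k t - J k' t"
proof -
 have "J (%s. k s - k' s) t = integral {t\<^sub>0..t} (%s. avg k s - avg k' s)"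
  unfolding J_def by (rule integral_cong) (use avg_diff assms in auto)
 also have "\<dots> = J k t - J k' t"
  unfolding J_def using assms
  by (intro integral_diff integrable_continuous_interval continuous_on_subset[OF continuous_avg]) auto
 finally show ?thesis .
qed

text \<open>Banach's theorem in a weighted sup norm: the unknown is \<open>u = E * v\<close> with
  \<open>v\<close> bounded and continuous. As \<open>J\<close> integrates from
  \<open>t\<^sub>0\<close>, the solution found has value 0 at the singular end; any other finite
  value would do as well.\<close>

lemma fixed_point:
 obtains u where "continuous_on {t\<^sub>0..} u" "\<And>t. t \<ge> t\<^sub>0 ==> u t = J (%s. g s - al s * u s) t"
proof -
 \<comment> \<open>With \<open>N * \<Lambda> = 2 * A\<close> the contraction factor is
   \<open>1 / 2\<close>.\<close>
 define \<Lambda> where "\<Lambda> = 2 * A / N"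
 have \<Lambda>: "\<Lambda> > 0" using A N by (simp add: \<Lambda>_def)
 have NL: "N * \<Lambda> = 2 * A" using N by (simp add: \<Lambda>_def)
 define E where "E t = exp (\<Lambda> * (t - t\<^sub>0))" for t
 have E: "E t > 0" for t by (simp add: E_def)
 have cE: "continuous_on S E" for S unfolding E_def[abs_def] by (intro continuous_intros)
 define k where "k v s = g s - al s * (E s * apply_bcontfun v s)" for v s
 have ck: "continuous_on {t\<^sub>0..} (k v)" for v
  unfolding k_def[abs_def]
  by (intro continuous_intros cont cE continuous_on_subset[OF continuous_on_apply_bcontfun]) auto
 \<comment> \<open>Bounded continuous functions live on the whole line here;
   \<open>max t t\<^sub>0\<close> continues the values to the left of the singular end by a
   constant.\<close>
 define T where "T v t = J (k v) (max t t\<^sub>0) / E (max t t\<^sub>0)" for v t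
 have kb: "\<bar>k v s\<bar> \<le> A * (1 + norm v) * exp (\<Lambda> * (s - t\<^sub>0))" if "s \<ge> t\<^sub>0" for v s
 proof -
  have "\<bar>k v s\<bar> \<le> \<bar>g s\<bar> + \<bar>al s\<bar> * (E s * \<bar>apply_bcontfun v s\<bar>)"
   using abs_triangle_ineq4[of "g s" "al s * (E s * apply_bcontfun v s)"] E[of s]
   by (simp add: k_def abs_mult)
  also have "\<bar>g s\<bar> \<le> A * E s"
  proof -
   have "1 \<le> E s" using \<Lambda> that by (simp add: E_def)
   hence "A * 1 \<le> A * E s" by (rule mult_left_mono) (use A in simp)
   thus ?thesis using bound[OF that] by simp
  qed
  also have "\<bar>al s\<bar> * (E s * \<bar>apply_bcontfun v s\<bar>) \<le> A * (E s * norm v)"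
   using bound[OF that] E[of s] norm_bounded[of v s] A
   by (intro mult_mono) auto
  finally show ?thesis by (simp add: E_def algebra_simps)
 qed
 have Tb: "\<bar>T v t\<bar> \<le> (1 + norm v) / 2" for v t
 proof -
  have "\<bar>J (k v) (max t t\<^sub>0)\<bar> \<le> A * (1 + norm v) / (N * \<Lambda>) * exp (\<Lambda> * (max t t\<^sub>0 - t\<^sub>0))"
   by (rule J_bound[OF ck _ \<Lambda> _ kb]) (use A in auto)
  also have "\<dots> = (1 + norm v) / 2 * E (max t t\<^sub>0)" using A by (simp add: NL E_def)
  finally show ?thesis using E[of "max t t\<^sub>0"] by (simp add: T_def field_simps)
 qed
 have Tc: "continuous_on UNIV (T v)" for v
  unfolding T_def[abs_def] using E
  by (intro continuous_on_divide continuous_on_compose2[OF continuous_J[OF ck]]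
    continuous_on_compose2[OF cE[of UNIV]] continuous_intros) (auto simp: less_imp_neq[symmetric])
 have Tbc: "T v \<in> bcontfun" for v
  by (rule bcontfun_normI[of _ "(1 + norm v) / 2"]) (use Tc Tb in auto)
 have "\<exists>!v\<in>UNIV. Bcontfun (T v) = v"
 proof (rule Banach_fix[of UNIV "1 / 2"])
  fix v w :: "real \<Rightarrow>\<^sub>C real"
  show "dist (Bcontfun (T v)) (Bcontfun (T w)) \<le> 1 / 2 * dist v w"
  proof (rule dist_bound)
   fix t
   let ?t = "max t t\<^sub>0"
   have "J (k v) ?t - J (k w) ?t = J (%s. k v s - k w s) ?t"
    by (rule J_diff[symmetric]) (use ck in auto)
   moreover have "\<bar>J (%s. k v s - k w s) ?t\<bar> \<le> A * dist v w / (N * \<Lambda>) * exp (\<Lambda> * (?t - t\<^sub>0))"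
   proof (rule J_bound[OF _ _ \<Lambda>])
    show "continuous_on {t\<^sub>0..} (%s. k v s - k w s)" by (intro continuous_on_diff ck)
    fix s assume s: "s \<ge> t\<^sub>0"
    have "\<bar>k v s - k w s\<bar> = \<bar>al s\<bar> * (E s * dist (apply_bcontfun v s) (apply_bcontfun w s))"
    proof -
     have "k v s - k w s = - (al s * (E s * (apply_bcontfun v s - apply_bcontfun w s)))"
      by (simp add: k_def algebra_simps)
     thus ?thesis using E[of s] by (simp add: abs_mult dist_real_def)
    qed
    also have "\<dots> \<le> A * (E s * dist v w)"
     using bound[OF s] E[of s] A by (intro mult_mono dist_bounded) auto
    finally show "\<bar>k v s - k w s\<bar> \<le> A * dist v w * exp (\<Lambda> * (s - t\<^sub>0))"
     by (simp add: E_def algebra_simps)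
   qed (use A in auto)
   ultimately have "\<bar>J (k v) ?t - J (k w) ?t\<bar> \<le> dist v w / 2 * E ?t" using A by (simp add: NL E_def)
   moreover have "T v t - T w t = (J (k v) ?t - J (k w) ?t) / E ?t"
    by (simp add: T_def diff_divide_distrib)
   ultimately show "dist (apply_bcontfun (Bcontfun (T v)) t) (apply_bcontfun (Bcontfun (T w)) t) \<le> 1 / 2 * dist v w"
    using E[of ?t] by (simp add: Bcontfun_inverse[OF Tbc] dist_real_def abs_divide divide_le_eq)
  qed
 qed (auto simp: complete_UNIV)
 then obtain v where v: "Bcontfun (T v) = v" by auto
 have vT: "apply_bcontfun v t = T v t" for t using v Bcontfun_inverse[OF Tbc, of v] by simp
 show ?thesis
 proof (rule that[of "%t. E t * apply_bcontfun v t"])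
  show "continuous_on {t\<^sub>0..} (%t. E t * apply_bcontfun v t)"
   by (intro continuous_intros cE continuous_on_subset[OF continuous_on_apply_bcontfun]) auto
  fix t assume t: "t \<ge> t\<^sub>0"
  have "k v = (%s. g s - al s * (E s * apply_bcontfun v s))" by (simp add: k_def fun_eq_iff)
  moreover have "E t * apply_bcontfun v t = J (k v) t"
   unfolding vT using t E[of t] by (simp add: T_def max_absorb1)
  ultimately show "E t * apply_bcontfun v t = J (%s. g s - al s * (E s * apply_bcontfun v s)) t"
   by simp
 qed
qed

end

lemma antiderivative_UNIV:
 fixes f :: "real => real"
 assumes "continuous_on UNIV f"
 obtains F where "\<And>t. (F has_real_derivative f t) (at t)" "F a = c"
proof -
 have "\<exists>F. \<forall>x::real. (-\<infinity>::ereal) < x --> x < (\<infinity>::ereal) --> (F has_vector_derivative f x) (at x)"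
  by (rule einterval_antiderivative) (use assms in \<open>auto simp: continuous_on_eq_continuous_at\<close>)
 then obtain F where F: "\<And>x. (F has_vector_derivative f x) (at x)" by auto
 show ?thesis
  by (rule that[of "%t. F t - F a + c"])
   (use F in \<open>auto intro!: derivative_eq_intros simp: has_real_derivative_iff_has_vector_derivative\<close>)
qed

lemma eq_if_same_derivative:
 fixes f h :: "real => real"
 assumes cont: "continuous_on {a..} f" "continuous_on {a..} h"
  and der: "\<And>t. t > a ==> (f has_real_derivative d t) (at t)"
   "\<And>t. t > a ==> (h has_real_derivative d t) (at t)"
  and eq: "f a = h a" and t: "t \<ge> a"
 shows "f t = h t"
proof (cases "t = a")
 case False
 hence "a < t" using t by simp
 moreover have "continuous_on {a..t} (%x. f x - h x)"
  by (intro continuous_on_diff continuous_on_subset[OF cont(1)] continuous_on_subset[OF cont(2)]) auto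
 moreover have "((%x. f x - h x) has_real_derivative 0) (at x)" if "a < x" "x < t" for x
  using DERIV_diff[OF der(1)[OF that(1)] der(2)[OF that(1)]] by simp
 ultimately have "f t - h t = f a - h a" by (rule DERIV_isconst2) (use t in auto)
 thus ?thesis using eq by simp
qed (use eq in simp)

context singular_ode
begin

text \<open>The second derivative \<open>(k - N * avg k) / q\<close> is of the form 0 / 0 at the
  singular end. Multiplying numerator and denominator by \<open>P\<close> before applying
  l'Hospital's rule makes the singular terms cancel: the derivatives become \<open>P * k'\<close>
  and \<open>P * (N + q')\<close>, and \<open>P\<close> drops out of the quotient. The condition
  \<open>q1 \<ge> 0\<close> keeps the limit of \<open>N + q'\<close> away from zero.\<close>

theorem C2_solution:
 assumes der: "\<And>t. t > t\<^sub>0 ==> (al has_real_derivative al' t) (at t)"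
   "\<And>t. t > t\<^sub>0 ==> (g has_real_derivative g' t) (at t)"
   "\<And>t. t > t\<^sub>0 ==> (q has_real_derivative q' t) (at t)"
  and lim: "(al' \<longlongrightarrow> a1) (at_right t\<^sub>0)" "(g' \<longlongrightarrow> g1) (at_right t\<^sub>0)"
   "(q \<longlongrightarrow> 0) (at_right t\<^sub>0)" "(q' \<longlongrightarrow> q1) (at_right t\<^sub>0)"
  and q1: "q1 \<ge> 0"
 obtains u u1 u2 where "continuous_on UNIV u2"
  "\<And>t. (u has_real_derivative u1 t) (at t)" "\<And>t. (u1 has_real_derivative u2 t) (at t)"
  "\<And>t. t > t\<^sub>0 ==> q t * u2 t + N * u1 t + al t * u t = g t"
  "N * u1 t\<^sub>0 + al t\<^sub>0 * u t\<^sub>0 = g t\<^sub>0"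
proof -
 obtain v where cv: "continuous_on {t\<^sub>0..} v"
  and v: "\<And>t. t \<ge> t\<^sub>0 ==> v t = J (%s. g s - al s * v s) t"
  using fixed_point by blast
 define k where "k s = g s - al s * v s" for s
 have ck: "continuous_on {t\<^sub>0..} k" unfolding k_def[abs_def] by (intro continuous_intros cont cv)
 have v: "v t = J k t" if "t \<ge> t\<^sub>0" for t using v[OF that] by (simp add: k_def[abs_def])
 have dv: "(v has_real_derivative avg k t) (at t)" if "t > t\<^sub>0" for t
  by (rule has_field_derivative_transform_within_open[OF J_deriv[OF ck that], of "{t\<^sub>0<..}"])
   (use v that in \<open>auto simp: k_def[abs_def]\<close>)
 define k' where "k' t = g' t - (al' t * v t + avg k t * al t)" for t
 have dk: "(k has_real_derivative k' t) (at t)" if "t > t\<^sub>0" for t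
 proof -
  have "((%s. g s - al s * v s) has_real_derivative k' t) (at t)"
   unfolding k'_def by (rule DERIV_diff DERIV_mult der dv that)+
  thus ?thesis by (simp add: k_def[abs_def])
 qed
 have right: "(f \<longlongrightarrow> f t\<^sub>0) (at_right t\<^sub>0)" if "continuous_on {t\<^sub>0..} f" for f :: "real => real"
 proof -
  have "(f \<longlongrightarrow> f t\<^sub>0) (at t\<^sub>0 within {t\<^sub>0..})" using that by (simp add: continuous_on_def)
  thus ?thesis by (rule tendsto_within_subset) auto
 qed
 \<comment> \<open>The limit of \<open>k' / (N + q')\<close>, hence the value of the second
   derivative at the singular end.\<close>
 define L where "L = (g1 - (a1 * v t\<^sub>0 + avg k t\<^sub>0 * al t\<^sub>0)) / (N + q1)"
 define w where "w t = (k t - N * avg k t) / q t" for t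
 have limw: "(w \<longlongrightarrow> L) (at_right t\<^sub>0)"
 proof -
  have "((%t. (P t * (k t - N * avg k t)) / (P t * q t)) \<longlongrightarrow> L) (at_right t\<^sub>0)"
  proof (rule lhopital_right)
   show "((%t. P t * (k t - N * avg k t)) \<longlongrightarrow> 0) (at_right t\<^sub>0)"
    using right[OF continuous_on_mult[OF P(1) continuous_on_diff[OF ck continuous_on_mult[OF continuous_on_const continuous_avg[OF ck]]]]]
    by (simp add: P(2))
   show "((%t. P t * q t) \<longlongrightarrow> 0) (at_right t\<^sub>0)"
    using tendsto_mult[OF right[OF P(1)] lim(3)] by simp
   have ev: "\<forall>\<^sub>F t in at_right t\<^sub>0. t > t\<^sub>0" by (simp add: eventually_at_right_less)
   show "\<forall>\<^sub>F t in at_right t\<^sub>0. P t * q t ~= 0"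
    using ev by eventually_elim (use P' q in fastforce)
   have Nq: "((%t. N + q' t) \<longlongrightarrow> N + q1) (at_right t\<^sub>0)" by (intro tendsto_intros lim)
   have "\<forall>\<^sub>F t in at_right t\<^sub>0. N + q' t > 0"
    by (rule order_tendstoD(1)[OF Nq]) (use N q1 in simp)
   thus ev2: "\<forall>\<^sub>F t in at_right t\<^sub>0. P t * (N + q' t) ~= 0"
    using ev by eventually_elim (use P' in fastforce)
   show "\<forall>\<^sub>F t in at_right t\<^sub>0. DERIV (%t. P t * (k t - N * avg k t)) t :> P t * k' t"
    using ev
   proof eventually_elim
    case (elim t)
    have "DERIV (%t. P t * (k t - N * avg k t)) t :>
     (N * P t / q t) * (k t - N * avg k t) + (k' t - N * ((k t - N * avg k t) / q t)) * P t"
     by (intro DERIV_mult DERIV_diff DERIV_cmult dk avg_deriv ck elim) (use P'[OF elim] in simp)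
    moreover have "(N * P t / q t) * (k t - N * avg k t) + (k' t - N * ((k t - N * avg k t) / q t)) * P t
     = P t * k' t" using q[OF elim] by (simp add: field_simps)
    ultimately show ?case by simp
   qed
   show "\<forall>\<^sub>F t in at_right t\<^sub>0. DERIV (%t. P t * q t) t :> P t * (N + q' t)"
    using ev
   proof eventually_elim
    case (elim t)
    have "DERIV (%t. P t * q t) t :> (N * P t / q t) * q t + q' t * P t"
     by (intro DERIV_mult der elim) (use P'[OF elim] in simp)
    thus ?case using q[OF elim] by (simp add: algebra_simps)
   qed
   have "((%t. k' t / (N + q' t)) \<longlongrightarrow> L) (at_right t\<^sub>0)"
    unfolding k'_def[abs_def] L_def
    by (intro tendsto_divide tendsto_diff tendsto_mult tendsto_add tendsto_const lim
      right[OF cv] right[OF cont(1)] right[OF continuous_avg[OF ck]]) (use N q1 in simp)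
   thus "((%t. P t * k' t / (P t * (N + q' t))) \<longlongrightarrow> L) (at_right t\<^sub>0)"
   proof (rule Lim_transform_eventually)
    show "\<forall>\<^sub>F t in at_right t\<^sub>0. k' t / (N + q' t) = P t * k' t / (P t * (N + q' t))"
     using ev by eventually_elim (use P' in force)
   qed
  qed
  thus ?thesis
  proof (rule Lim_transform_eventually)
   show "\<forall>\<^sub>F t in at_right t\<^sub>0. P t * (k t - N * avg k t) / (P t * q t) = w t"
    using eventually_at_right_less[of t\<^sub>0]
    by eventually_elim (use P' in \<open>force simp: w_def\<close>)
  qed
 qed
 \<comment> \<open>Constant continuation to the left gives a solution that is \<open>C^2\<close> on
   the whole line, so that composing it with a function of the ambient point needs no care near the
   end orbit.\<close>
 define u2 where "u2 t = (if t > t\<^sub>0 then w t else L)" for t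
 have cw: "isCont w t" if "t > t\<^sub>0" for t
  unfolding w_def using that DERIV_isCont[OF dk[OF that]] DERIV_isCont[OF avg_deriv[OF ck that]]
   DERIV_isCont[OF der(3)[OF that]] q[OF that]
  by (intro continuous_intros) auto
 have cu2: "continuous_on UNIV u2"
  unfolding continuous_on_eq_continuous_at[OF open_UNIV]
 proof
  fix t
  consider "t < t\<^sub>0" | "t = t\<^sub>0" | "t > t\<^sub>0" by linarith
  thus "isCont u2 t"
  proof cases
   case 1
   have "\<forall>\<^sub>F x in nhds t. u2 x = L"
    using eventually_nhds_in_open[of "{..<t\<^sub>0}" t] 1 by (auto simp: u2_def elim!: eventually_mono)
   from isCont_cong[OF this] show ?thesis by simp
  next
   case 2
   have "(u2 \<longlongrightarrow> L) (at_left t\<^sub>0)"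
    by (rule tendsto_eventually) (auto simp: eventually_at_filter u2_def)
   moreover have "(u2 \<longlongrightarrow> L) (at_right t\<^sub>0)"
    by (rule Lim_transform_eventually[OF limw]) (auto simp: eventually_at_filter u2_def)
   ultimately show ?thesis unfolding 2 isCont_def by (simp add: filterlim_split_at u2_def)
  next
   case 3
   have "\<forall>\<^sub>F x in nhds t. u2 x = w x"
    using eventually_nhds_in_open[of "{t\<^sub>0<..}" t] 3 by (auto simp: u2_def elim!: eventually_mono)
   from isCont_cong[OF this] show ?thesis using cw[OF 3] by simp
  qed
 qed
 obtain u1 where u1: "\<And>t. (u1 has_real_derivative u2 t) (at t)" "u1 t\<^sub>0 = avg k t\<^sub>0"
  using antiderivative_UNIV[OF cu2] by blast
 have cu1: "continuous_on S u1" for S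
  using u1(1) DERIV_isCont continuous_at_imp_continuous_on by blast
 obtain u where u: "\<And>t. (u has_real_derivative u1 t) (at t)" "u t\<^sub>0 = v t\<^sub>0"
  using antiderivative_UNIV[OF cu1] by blast
 have cu: "continuous_on S u" for S
  using u(1) DERIV_isCont continuous_at_imp_continuous_on by blast
 have eq1: "u1 t = avg k t" if "t \<ge> t\<^sub>0" for t
 proof (rule eq_if_same_derivative[OF cu1 continuous_avg[OF ck] _ _ u1(2) that])
  fix t assume "t > t\<^sub>0"
  thus "(u1 has_real_derivative w t) (at t)" "(avg k has_real_derivative w t) (at t)"
   using u1(1)[of t] avg_deriv[OF ck] by (auto simp: u2_def w_def)
 qed
 have eq: "u t = v t" if "t \<ge> t\<^sub>0" for t
  by (rule eq_if_same_derivative[OF cu cv _ dv u(2) that]) (use u(1) eq1 in \<open>metis less_imp_le\<close>)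
 show ?thesis
 proof (rule that[OF cu2 u(1) u1(1)])
  fix t assume t: "t > t\<^sub>0"
  show "q t * u2 t + N * u1 t + al t * u t = g t"
   using t q[OF t] eq1[of t] eq[of t] by (simp add: u2_def w_def k_def)
 next
  show "N * u1 t\<^sub>0 + al t\<^sub>0 * u t\<^sub>0 = g t\<^sub>0"
   using eq1[of t\<^sub>0] eq[of t\<^sub>0] N by (simp add: avg_def k_def)
 qed
qed

end

section \<open>Tangent spaces, normals and tangential derivatives on hypersurfaces\<close>

lemma smooth_on_local_C1:
 fixes f :: "'a::euclidean_space => 'b::real_normed_vector"
 assumes "smooth_on S f" "p \<in> S"
 obtains W F D where "open W" "p \<in> W" "\<And>q. q \<in> W ==> (F has_derivative D q) (at q)"
  "\<And>v. continuous_on W (%q. D q v)" "\<And>q. q \<in> S ==> q \<in> W ==> f q = F q"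
proof -
 obtain W F where W: "open W" "p \<in> W" "\<And>j::nat. Ck_on_open j F W" "\<forall>q\<in>S \<inter> W. f q = F q"
  using assms unfolding Ck_on_def by (metis enat_ord_code(3))
 from W(3)[of 1] have C1: "\<forall>x\<in>W. F differentiable (at x)"
  "\<forall>v. continuous_on W (%x. frechet_derivative F (at x) v)" by simp_all
 show ?thesis
  by (rule that[OF W(1,2), of F "%q. frechet_derivative F (at q)"])
   (use C1 W(4) in \<open>auto simp: frechet_derivative_works\<close>)
qed

text \<open>Everything that is used of a unit normal at one point. The last clause, flatness of
  \<open>S\<close> to first order, is what allows the normal part of a derivative within
  \<open>S\<close> to be projected away without changing the derivative.\<close>

definition normal_at :: "'a::euclidean_space set => 'a => 'a => bool" where
 "normal_at S p n \<longleftrightarrow> norm n = 1 & tangent_space S p = {v. v \<bullet> n = 0} &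
  (\<forall>e>0. \<exists>d>0. \<forall>q\<in>S. norm (q - p) < d --> \<bar>(q - p) \<bullet> n\<bar> \<le> e * norm (q - p))"

lemma smooth_hypersurface_local:
 assumes "smooth_hypersurface S" "p \<in> S"
 obtains W f D where "open W" "p \<in> W" "\<And>q. q \<in> W ==> (f has_derivative D q) (at q)"
  "\<And>v. continuous_on W (%q. D q v)" "\<And>q. q \<in> W ==> \<exists>v. D q v ~= 0"
  "\<And>q. q \<in> W ==> q \<in> S \<longleftrightarrow> f q = (0::real)"
proof -
 obtain U f where U: "open U" "p \<in> U" "smooth_on U (f :: 'a => real)"
  "\<forall>q\<in>U. frechet_derivative f (at q) ~= (%_. 0)" "S \<inter> U = {q\<in>U. f q = 0}"
  using assms unfolding smooth_hypersurface_def by meson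
 obtain W F D where W: "open W" "p \<in> W" "\<And>q. q \<in> W ==> (F has_derivative D q) (at q)"
  "\<And>v. continuous_on W (%q. D q v)" "\<And>q. q \<in> U ==> q \<in> W ==> f q = F q"
  using U(3,2) by (rule smooth_on_local_C1) blast
 show ?thesis
 proof (rule that[of "U \<inter> W" F D])
  show "open (U \<inter> W)" "p \<in> U \<inter> W" using U W by auto
  show "(F has_derivative D q) (at q)" if "q \<in> U \<inter> W" for q using W(3) that by auto
  show "continuous_on (U \<inter> W) (%q. D q v)" for v
   by (rule continuous_on_subset[OF W(4)]) auto
  show "q \<in> S \<longleftrightarrow> F q = 0" if "q \<in> U \<inter> W" for q
  proof -
   have "q \<in> S \<inter> U \<longleftrightarrow> q \<in> {q\<in>U. f q = 0}" using U(5) by simp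
   thus ?thesis using W(5)[of q] that by simp
  qed
  show "\<exists>v. D q v ~= 0" if "q \<in> U \<inter> W" for q
  proof -
   have "(f has_derivative D q) (at q)"
    by (rule has_derivative_transform_within_open[OF W(3), of _ "U \<inter> W"]) (use that U W in auto)
   hence "frechet_derivative f (at q) = D q" by (rule frechet_derivative_at[symmetric])
   thus ?thesis using U(4) that by (metis IntD1 ext)
  qed
 qed
qed

lemma derivative_as_inner:
 fixes D :: "'a::euclidean_space => real"
 assumes "linear D"
 obtains g where "\<And>v. D v = g \<bullet> v"
proof -
 have "D v = (\<Sum>b\<in>Basis. D b *\<^sub>R b) \<bullet> v" for v
 proof -
  have "D v = D (\<Sum>b\<in>Basis. (v \<bullet> b) *\<^sub>R b)" by (simp add: euclidean_representation)
  also have "\<dots> = (\<Sum>b\<in>Basis. (v \<bullet> b) *\<^sub>R D b)"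
   by (simp add: linear_sum[OF assms] linear_cmul[OF assms])
  finally show ?thesis 
   by (simp add: inner_sum_left) (simp add: inner_commute mult.commute)
 qed
 thus ?thesis by (rule that)
qed

text \<open>A tangent vector is the velocity of a curve that need only be differentiable at a single
  parameter, so the intermediate value theorem can replace the implicit function theorem. On the
  line through \<open>p + t v\<close> in the direction of the gradient the function changes sign
  within distance \<open>e * \<bar>t\<bar>\<close>, for every \<open>e\<close> and all small
  \<open>t\<close>; it remains to choose corrections \<open>s t\<close> that are small compared with
  \<open>t\<close>.\<close>

lemma level_set_tangent:
 fixes f :: "'a::euclidean_space => real"
 assumes W: "open W" "p \<in> W" and der: "\<And>q. q \<in> W ==> (f has_derivative D q) (at q)"
  and g: "\<And>v. D p v = g \<bullet> v" "g ~= 0"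
  and S: "\<And>q. q \<in> W ==> q \<in> S \<longleftrightarrow> f q = 0" and p: "p \<in> S"
 shows "tangent_space S p = {v. v \<bullet> g = 0}"
proof (intro equalityI subsetI)
 fix v assume "v \<in> tangent_space S p"
 then obtain gm where gm: "gm 0 = p" "\<forall>\<^sub>F t in at 0. gm t \<in> S" "(gm has_vector_derivative v) (at (0::real))"
  unfolding tangent_space_def by auto
 have "((%t. f (gm t)) has_vector_derivative D p v) (at 0)"
  using vector_derivative_diff_chain_within[of gm v 0 UNIV f "D p"] gm has_derivative_at_withinI[OF der[OF W(2)]]
  by (auto simp: o_def)
 moreover have "((%t. f (gm t)) has_vector_derivative 0) (at 0)"
 proof -
  have "isCont gm 0" using gm(3) by (rule has_vector_derivative_continuous)
  hence "\<forall>\<^sub>F t in at 0. gm t \<in> W"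
   unfolding isCont_def by (rule topological_tendstoD) (use W gm in auto)
  with gm(2) have "\<forall>\<^sub>F t in at 0. f (gm t) = 0" by eventually_elim (use S in auto)
  then obtain d where d: "d > 0" "\<And>t. t ~= 0 ==> dist t 0 < d ==> f (gm t) = 0"
   unfolding eventually_at by auto
  have "f (gm t) = 0" if "dist t 0 < d" for t
   using d(2)[OF _ that] gm(1) S[OF W(2)] p by (cases "t = 0") auto
  thus ?thesis
   by (intro has_vector_derivative_transform_within[OF has_vector_derivative_const d(1)]) auto
 qed
 ultimately show "v \<in> {v. v \<bullet> g = 0}"
  using vector_derivative_unique_at g(1)[of v] by (fastforce simp: inner_commute)
next
 fix v assume "v \<in> {v. v \<bullet> g = 0}"
 hence v: "g \<bullet> v = 0" by (simp add: inner_commute)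
 have gg: "g \<bullet> g > 0" using g(2) by simp
 \<comment> \<open>The corrections along the gradient that bring \<open>p + t v\<close> back to
   \<open>S\<close>.\<close>
 define R where "R t = {s. p + t *\<^sub>R v + s *\<^sub>R g \<in> S}" for t :: real
 have key: "\<exists>d>0. \<forall>t. \<bar>t\<bar> < d --> (\<exists>s\<in>R t. \<bar>s\<bar> \<le> e * \<bar>t\<bar>)" if e: "e > 0" for e :: real
 proof -
  define M where "M = norm v + e * norm g"
  have M: "M > 0" using e g(2) by (simp add: M_def add_nonneg_pos)
  define eta where "eta = e * (g \<bullet> g) / (2 * M)"
  have eta: "eta > 0" using e gg M by (simp add: eta_def)
  obtain d1 where d1: "d1 > 0" "\<And>y. norm (y - p) < d1 ==> norm (f y - f p - D p (y - p)) \<le> eta * norm (y - p)"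
   using der[OF W(2)] eta unfolding has_derivative_at_alt by blast
  obtain d2 where d2: "d2 > 0" "ball p d2 \<subseteq> W" using W openE by blast
  define d where "d = min d1 d2 / M"
  have d: "d > 0" using d1 d2 M by (simp add: d_def)
  show ?thesis
  proof (intro exI[of _ d] conjI allI impI d)
   fix t :: real assume t: "\<bar>t\<bar> < d"
   define h where "h s = t *\<^sub>R v + s *\<^sub>R g" for s
   have hn: "norm (h s) \<le> \<bar>t\<bar> * M" if "\<bar>s\<bar> \<le> e * \<bar>t\<bar>" for s
   proof -
    have "norm (h s) \<le> \<bar>t\<bar> * norm v + \<bar>s\<bar> * norm g"
     unfolding h_def by (rule order_trans[OF norm_triangle_ineq]) simp
    also have "\<bar>s\<bar> * norm g \<le> e * \<bar>t\<bar> * norm g" by (rule mult_right_mono[OF that]) simp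
    finally show ?thesis by (simp add: M_def algebra_simps)
   qed
   have hs: "norm (h s) < d1" "norm (h s) < d2" if "\<bar>s\<bar> \<le> e * \<bar>t\<bar>" for s
   proof -
    have "\<bar>t\<bar> * M < min d1 d2" using t M by (simp add: d_def field_simps)
    with hn[OF that] show "norm (h s) < d1" "norm (h s) < d2" by auto
   qed
   have inW: "p + h s \<in> W" if "\<bar>s\<bar> \<le> e * \<bar>t\<bar>" for s
    using hs[OF that] d2 by (auto simp: dist_norm subset_iff)
   have fp: "f p = 0" using S[OF W(2)] p by simp
   have est: "\<bar>f (p + h s) - s * (g \<bullet> g)\<bar> \<le> e * (g \<bullet> g) / 2 * \<bar>t\<bar>" if "\<bar>s\<bar> \<le> e * \<bar>t\<bar>" for s
   proof -
    have "D p (h s) = s * (g \<bullet> g)" using v by (simp add: g(1) h_def inner_add_right)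
    hence "\<bar>f (p + h s) - s * (g \<bullet> g)\<bar> \<le> eta * norm (h s)"
     using d1(2)[of "p + h s"] hs(1)[OF that] fp by simp
    also have "\<dots> \<le> eta * (\<bar>t\<bar> * M)" using hn[OF that] eta by simp
    also have "\<dots> = e * (g \<bullet> g) / 2 * \<bar>t\<bar>" using M by (simp add: eta_def)
    finally show ?thesis .
   qed
   have "\<exists>s\<ge>- (e * \<bar>t\<bar>). s \<le> e * \<bar>t\<bar> & f (p + h s) = 0"
   proof (rule IVT')
    have et: "e * (g \<bullet> g) * \<bar>t\<bar> \<ge> 0" using e by simp
    have "\<bar>- (e * \<bar>t\<bar>)\<bar> \<le> e * \<bar>t\<bar>" "\<bar>e * \<bar>t\<bar>\<bar> \<le> e * \<bar>t\<bar>" using e by auto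
    from est[OF this(1)] est[OF this(2)]
    have "\<bar>f (p + h (- (e * \<bar>t\<bar>))) + e * (g \<bullet> g) * \<bar>t\<bar>\<bar> \<le> (e * (g \<bullet> g) * \<bar>t\<bar>) / 2"
     "\<bar>f (p + h (e * \<bar>t\<bar>)) - e * (g \<bullet> g) * \<bar>t\<bar>\<bar> \<le> (e * (g \<bullet> g) * \<bar>t\<bar>) / 2"
     by (simp_all add: mult_ac)
    with et show "f (p + h (- (e * \<bar>t\<bar>))) \<le> 0" "0 \<le> f (p + h (e * \<bar>t\<bar>))"
     by linarith+
    show "- (e * \<bar>t\<bar>) \<le> e * \<bar>t\<bar>" using e by simp
    have "continuous_on W f" using der has_derivative_continuous_on has_derivative_at_withinI by blast
    thus "continuous_on {- (e * \<bar>t\<bar>)..e * \<bar>t\<bar>} (%s. f (p + h s))"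
     by (rule continuous_on_compose2) (use inW in \<open>auto simp: h_def intro!: continuous_intros\<close>)
   qed
   then obtain s where "- (e * \<bar>t\<bar>) \<le> s" "s \<le> e * \<bar>t\<bar>" and s0: "f (p + h s) = 0" by blast
   hence s: "\<bar>s\<bar> \<le> e * \<bar>t\<bar>" "f (p + h s) = 0" using s0 by linarith+
   hence "s \<in> R t" using S[OF inW[OF s(1)]] by (simp add: R_def h_def add.assoc)
   with s show "\<exists>s\<in>R t. \<bar>s\<bar> \<le> e * \<bar>t\<bar>" by blast
  qed
 qed
 \<comment> \<open>Choosing a correction for one fixed \<open>e\<close> would only give a bound
   linear in \<open>t\<close>. A correction that is minimal up to \<open>t^2\<close> inherits the
   bound for every \<open>e\<close> simultaneously; the error \<open>t^2\<close> is
   negligible.\<close>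
 define s where "s t = (if t = 0 then 0 else SOME s. s \<in> R t & \<bar>s\<bar> \<le> (INF x\<in>R t. \<bar>x\<bar>) + t\<^sup>2)" for t
 have sel: "s t \<in> R t & \<bar>s t\<bar> \<le> (INF x\<in>R t. \<bar>x\<bar>) + t\<^sup>2" if R: "R t ~= {}" and t: "t ~= 0" for t
 proof -
  have "Inf ((%x. \<bar>x\<bar>) ` R t) < (INF x\<in>R t. \<bar>x\<bar>) + t\<^sup>2" using t by simp
  from cInf_lessD[OF _ this] R
  obtain x where "x \<in> R t" "\<bar>x\<bar> < (INF x\<in>R t. \<bar>x\<bar>) + t\<^sup>2" by blast
  hence "\<exists>s. s \<in> R t & \<bar>s\<bar> \<le> (INF x\<in>R t. \<bar>x\<bar>) + t\<^sup>2" by (intro exI[of _ x]) auto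
  from someI_ex[OF this] show ?thesis using t by (simp add: s_def)
 qed
 have s_small: "\<exists>d>0. \<forall>t. \<bar>t\<bar> < d --> s t \<in> R t & \<bar>s t\<bar> \<le> e * \<bar>t\<bar>" if e: "e > 0" for e
 proof -
  from key[of "e / 2"] e obtain d where d: "d > 0" "\<And>t. \<bar>t\<bar> < d ==> \<exists>s\<in>R t. \<bar>s\<bar> \<le> e / 2 * \<bar>t\<bar>" by auto
  show ?thesis
  proof (intro exI[of _ "min d (e / 2)"] conjI allI impI)
   show "min d (e / 2) > 0" using d e by simp
   fix t assume t: "\<bar>t\<bar> < min d (e / 2)"
   then obtain x where x: "x \<in> R t" "\<bar>x\<bar> \<le> e / 2 * \<bar>t\<bar>" using d(2) by auto
   have "s t \<in> R t & \<bar>s t\<bar> \<le> e * \<bar>t\<bar>"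
   proof (cases "t = 0")
    case True thus ?thesis using p by (simp add: s_def R_def)
   next
    case False
    have "(INF x\<in>R t. \<bar>x\<bar>) \<le> \<bar>x\<bar>" by (rule cINF_lower[OF _ x(1)]) (auto intro!: bdd_belowI2[of _ 0])
    moreover have "t\<^sup>2 \<le> e / 2 * \<bar>t\<bar>"
     using t mult_right_mono[of "\<bar>t\<bar>" "e / 2" "\<bar>t\<bar>"] by (simp add: power2_eq_square)
    ultimately show ?thesis using sel[OF _ False] x by fastforce
   qed
   thus "s t \<in> R t" "\<bar>s t\<bar> \<le> e * \<bar>t\<bar>" by auto
  qed
 qed
 define gm where "gm t = p + t *\<^sub>R v + s t *\<^sub>R g" for t
 have "gm 0 = p" by (simp add: gm_def s_def)
 moreover have "\<forall>\<^sub>F t in at 0. gm t \<in> S"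
  using s_small[of 1] unfolding eventually_at R_def gm_def by (auto simp: dist_real_def)
 moreover have "(s has_vector_derivative 0) (at 0)"
  unfolding has_vector_derivative_def has_derivative_at_alt
 proof (intro conjI allI impI)
  fix e :: real assume "e > 0"
  from s_small[OF this] show "\<exists>d>0. \<forall>y. norm (y - 0) < d -->
    norm (s y - s 0 - (y - 0) *\<^sub>R 0) \<le> e * norm (y - 0)"
   by (simp add: s_def[of 0]) blast
 qed (simp add: bounded_linear_zero)
 hence "(gm has_vector_derivative v) (at 0)"
  unfolding gm_def by (auto intro!: derivative_eq_intros simp: has_vector_derivative_def)
 ultimately show "v \<in> tangent_space S p" unfolding tangent_space_def by blast
qed

lemma normal_at_unit_normal:
 assumes S: "smooth_hypersurface S" and p: "p \<in> S" and \<nu>: "unit_normal S \<nu>"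
 shows "normal_at S p (\<nu> p)"
proof -
 obtain W f D where W: "open W" "p \<in> W" "\<And>q. q \<in> W ==> (f has_derivative D q) (at q)"
  "\<And>q. q \<in> W ==> \<exists>v. D q v ~= 0" "\<And>q. q \<in> W ==> q \<in> S \<longleftrightarrow> f q = (0::real)"
  using S p by (rule smooth_hypersurface_local) blast
 obtain g where g: "\<And>v. D p v = g \<bullet> v"
  using derivative_as_inner[OF has_derivative_linear[OF W(3)[OF W(2)]]] by metis
 have g0: "g ~= 0" using W(4)[OF W(2)] g by auto
 have T: "tangent_space S p = {v. v \<bullet> g = 0}"
  by (rule level_set_tangent[OF W(1,2) W(3) g g0 W(5) p])
 have n: "norm (\<nu> p) = 1" and perp: "\<And>v. v \<bullet> g = 0 ==> \<nu> p \<bullet> v = 0"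
  using \<nu> p T unfolding unit_normal_def orthogonal_comp_def orthogonal_def by (auto simp: inner_commute)
 define c where "c = (\<nu> p \<bullet> g) / (g \<bullet> g)"
 define w where "w = \<nu> p - c *\<^sub>R g"
 have wg: "w \<bullet> g = 0" using g0 by (simp add: w_def c_def inner_diff_left)
 hence "w \<bullet> w = 0" using perp[OF wg] by (simp add: w_def inner_diff_left inner_diff_right inner_commute)
 hence \<nu>g: "\<nu> p = c *\<^sub>R g" by (simp add: w_def)
 hence c0: "c ~= 0" using n by auto
 have "\<exists>d>0. \<forall>q\<in>S. norm (q - p) < d --> \<bar>(q - p) \<bullet> \<nu> p\<bar> \<le> e * norm (q - p)" if e: "e > 0" for e
 proof -
  have ec: "e / \<bar>c\<bar> > 0" using e c0 by simp
  obtain d1 where d1: "d1 > 0" "\<And>y. norm (y - p) < d1 ==> norm (f y - f p - D p (y - p)) \<le> e / \<bar>c\<bar> * norm (y - p)"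
   using W(3)[OF W(2)] ec unfolding has_derivative_at_alt by blast
  obtain d2 where d2: "d2 > 0" "ball p d2 \<subseteq> W" using W openE by blast
  show ?thesis
  proof (intro exI[of _ "min d1 d2"] conjI ballI impI)
   show "min d1 d2 > 0" using d1 d2 by simp
   fix q assume q: "q \<in> S" "norm (q - p) < min d1 d2"
   hence "q \<in> W" using d2 by (auto simp: subset_iff dist_norm norm_minus_commute)
   hence "f q = 0" "f p = 0" using W(5) q W(2) p by auto
   hence "\<bar>g \<bullet> (q - p)\<bar> \<le> e / \<bar>c\<bar> * norm (q - p)" using d1(2)[of q] q g by simp
   thus "\<bar>(q - p) \<bullet> \<nu> p\<bar> \<le> e * norm (q - p)"
    using c0 by (simp add: \<nu>g abs_mult inner_commute field_simps)
  qed
 qed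
 moreover have "{v. v \<bullet> g = 0} = {v. v \<bullet> \<nu> p = 0}" using c0 by (simp add: \<nu>g)
 ultimately show ?thesis unfolding normal_at_def using n T by simp
qed

lemma normal_at_unique:
 assumes "normal_at S p a" "normal_at S p b"
 shows "b = a \<or> b = - a"
proof -
 have n: "norm a = 1" "norm b = 1" and e: "\<And>v. v \<bullet> a = 0 \<longleftrightarrow> v \<bullet> b = 0"
  using assms unfolding normal_at_def by auto
 have aa: "a \<bullet> a = 1" "b \<bullet> b = 1" using n by (simp_all add: dot_square_norm)
 define w where "w = b - (b \<bullet> a) *\<^sub>R a"
 have "w \<bullet> a = 0" using aa by (simp add: w_def inner_diff_left)
 hence "w \<bullet> b = 0" using e by simp
 hence "w \<bullet> w = 0" using \<open>w \<bullet> a = 0\<close> by (metis (no_types, lifting) inner_diff_right inner_scaleR_right mult_zero_right diff_zero w_def)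
 hence b: "b = (b \<bullet> a) *\<^sub>R a" by (simp add: w_def)
 hence "\<bar>b \<bullet> a\<bar> = 1" using n by (metis mult.right_neutral norm_scaleR)
 thus ?thesis using b by (metis abs_eq_iff abs_one scaleR_minus1_left scaleR_one)
qed

lemma has_vector_derivative_along_curve:
 assumes D: "(f has_derivative D) (at p within S)" and p: "p \<in> S"
  and gm: "gm 0 = p" "\<forall>\<^sub>F t in at 0. gm t \<in> S" "(gm has_vector_derivative w) (at (0::real))"
 shows "((%t. f (gm t)) has_vector_derivative D w) (at 0)"
proof -
 from gm(2) obtain d where d: "d > 0" "\<And>t. t ~= 0 ==> dist t 0 < d ==> gm t \<in> S"
  unfolding eventually_at by auto
 have sub: "gm ` ball 0 d \<subseteq> S"
 proof safe
  fix t :: real assume "t \<in> ball 0 d"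
  thus "gm t \<in> S" using d(2)[of t] gm(1) p by (cases "t = 0") auto
 qed
 have "(f \<circ> gm has_vector_derivative D w) (at 0 within ball 0 d)"
  by (rule vector_derivative_diff_chain_within)
   (use D gm sub in \<open>auto intro: has_vector_derivative_at_within has_derivative_subset\<close>)
 thus ?thesis using d(1) at_within_open[of "0::real" "ball 0 d"] by (simp add: o_def)
qed

text \<open>This evaluates the choice in \<open>tangential_derivative\<close>. Composition with the
  tangential projection keeps a derivative within \<open>S\<close>, because \<open>S\<close> is flat
  to first order; uniqueness holds because every tangent vector is the velocity of a curve in
  \<open>S\<close>, along which a derivative within \<open>S\<close> is determined.\<close>

lemma tangential_derivative_eq:
 assumes nrm: "normal_at S p n" and D: "(f has_derivative D) (at p within S)" and p: "p \<in> S"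
 shows "tangential_derivative S f p = (%v. D (v - (v \<bullet> n) *\<^sub>R n))"
proof -
 have n: "norm n = 1" "n \<bullet> n = 1" and T: "tangent_space S p = {v. v \<bullet> n = 0}"
  and flat: "\<And>e. e > 0 ==> \<exists>d>0. \<forall>q\<in>S. norm (q - p) < d --> \<bar>(q - p) \<bullet> n\<bar> \<le> e * norm (q - p)"
  using nrm unfolding normal_at_def by (auto simp: dot_square_norm)
 have perp: "u = (u \<bullet> n) *\<^sub>R n" if "u \<in> (tangent_space S p)\<^sup>\<bottom>" for u
 proof -
  define w where "w = u - (u \<bullet> n) *\<^sub>R n"
  have wn: "w \<bullet> n = 0" using n by (simp add: w_def inner_diff_left)
  hence "u \<bullet> w = 0" using that T by (auto simp: orthogonal_comp_def orthogonal_def inner_commute)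
  with wn have "w \<bullet> w = 0" by (simp add: w_def inner_diff_left inner_commute)
  thus ?thesis by (simp add: w_def)
 qed
 have n_perp: "n \<in> (tangent_space S p)\<^sup>\<bottom>"
  using T by (auto simp: orthogonal_comp_def orthogonal_def)
 let ?L = "%v. D (v - (v \<bullet> n) *\<^sub>R n)"
 have bl: "bounded_linear D" using D by (rule has_derivative_bounded_linear)
 then interpret D: bounded_linear D .
 have blL: "bounded_linear ?L"
  by (rule bounded_linear_compose[OF bl]) (intro bounded_linear_intros)
 have hasL: "(f has_derivative ?L) (at p within S)"
  unfolding has_derivative_within_alt
 proof (intro conjI allI impI blL)
  fix e :: real assume e: "e > 0"
  define e' where "e' = e / (2 * (norm (D n) + 1))"
  have "norm (D n) + 1 > 0" by (simp add: add_nonneg_pos)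
  hence e': "e' > 0" "e' * norm (D n) \<le> e / 2" using e by (auto simp: e'_def field_simps)
  from D e obtain d1 where d1: "d1 > 0"
   "\<And>y. y \<in> S ==> norm (y - p) < d1 ==> norm (f y - f p - D (y - p)) \<le> e / 2 * norm (y - p)"
   unfolding has_derivative_within_alt by (metis half_gt_zero)
  from flat[OF e'(1)] obtain d2 where d2: "d2 > 0"
   "\<And>y. y \<in> S ==> norm (y - p) < d2 ==> \<bar>(y - p) \<bullet> n\<bar> \<le> e' * norm (y - p)" by auto
  show "\<exists>d>0. \<forall>y\<in>S. norm (y - p) < d --> norm (f y - f p - ?L (y - p)) \<le> e * norm (y - p)"
  proof (intro exI[of _ "min d1 d2"] conjI ballI impI)
   show "min d1 d2 > 0" using d1 d2 by simp
   fix y assume y: "y \<in> S" "norm (y - p) < min d1 d2"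
   have "?L (y - p) = D (y - p) - ((y - p) \<bullet> n) *\<^sub>R D n" by (simp only: D.diff D.scaleR)
   hence "f y - f p - ?L (y - p) = (f y - f p - D (y - p)) + ((y - p) \<bullet> n) *\<^sub>R D n"
    by (simp only: diff_diff_eq2 diff_add_eq)
   hence "norm (f y - f p - ?L (y - p)) = norm ((f y - f p - D (y - p)) + ((y - p) \<bullet> n) *\<^sub>R D n)"
    by (rule arg_cong)
   also have "\<dots> \<le> norm (f y - f p - D (y - p)) + \<bar>(y - p) \<bullet> n\<bar> * norm (D n)"
    by (rule order_trans[OF norm_triangle_ineq]) simp
   also have "\<dots> \<le> e / 2 * norm (y - p) + e' * norm (y - p) * norm (D n)"
    using d1(2)[of y] d2(2)[of y] y by (intro add_mono mult_right_mono) auto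
   also have "e' * norm (y - p) * norm (D n) \<le> e / 2 * norm (y - p)"
    using mult_right_mono[OF e'(2), of "norm (y - p)"] by (simp add: algebra_simps)
   finally show "norm (f y - f p - ?L (y - p)) \<le> e * norm (y - p)" by simp
  qed
 qed
 have L0: "\<forall>u\<in>(tangent_space S p)\<^sup>\<bottom>. ?L u = 0"
  using perp by (metis D.zero diff_self)
 have uniq: "L = ?L" if L: "(f has_derivative L) (at p within S)" "\<forall>u\<in>(tangent_space S p)\<^sup>\<bottom>. L u = 0" for L
 proof
  fix v
  interpret L: bounded_linear L using L(1) by (rule has_derivative_bounded_linear)
  define w where "w = v - (v \<bullet> n) *\<^sub>R n"
  have "w \<bullet> n = 0" using n by (simp add: w_def inner_diff_left)
  hence "w \<in> tangent_space S p" using T by simp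
  then obtain gm where "gm 0 = p" "\<forall>\<^sub>F t in at 0. gm t \<in> S" "(gm has_vector_derivative w) (at (0::real))"
   unfolding tangent_space_def by auto
  hence "L w = D w"
   using has_vector_derivative_along_curve[OF L(1) p] has_vector_derivative_along_curve[OF D p]
    vector_derivative_unique_at by blast
  moreover have "L v = L w" using L(2) n_perp by (simp add: w_def L.diff L.scaleR)
  ultimately show "L v = ?L v" by (simp add: w_def)
 qed
 show ?thesis unfolding tangential_derivative_def
 proof (rule some_equality)
  show "(f has_derivative ?L) (at p within S) & (\<forall>u\<in>(tangent_space S p)\<^sup>\<bottom>. ?L u = 0)"
   using hasL L0 by blast
  show "L = ?L" if "(f has_derivative L) (at p within S) & (\<forall>u\<in>(tangent_space S p)\<^sup>\<bottom>. L u = 0)" for L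
   using uniq that by blast
 qed
qed

lemma normal_at_open_Int:
 assumes "normal_at S p n" "open U" "p \<in> U"
 shows "normal_at (S \<inter> U) p n"
proof -
 have "tangent_space (S \<inter> U) p = tangent_space S p"
 proof (intro equalityI subsetI)
  fix v assume "v \<in> tangent_space S p"
  then obtain gm where gm: "gm 0 = p" "\<forall>\<^sub>F t in at 0. gm t \<in> S" "(gm has_vector_derivative v) (at (0::real))"
   unfolding tangent_space_def by auto
  have "isCont gm 0" using gm(3) by (rule has_vector_derivative_continuous)
  hence "\<forall>\<^sub>F t in at 0. gm t \<in> U"
   unfolding isCont_def by (rule topological_tendstoD) (use assms gm in auto)
  with gm(2) have "\<forall>\<^sub>F t in at 0. gm t \<in> S \<inter> U" by eventually_elim simp
  with gm show "v \<in> tangent_space (S \<inter> U) p" unfolding tangent_space_def by blast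
 next
  fix v assume "v \<in> tangent_space (S \<inter> U) p"
  then obtain gm where gm: "gm 0 = p" "\<forall>\<^sub>F t in at 0. gm t \<in> S \<inter> U" "(gm has_vector_derivative v) (at (0::real))"
   unfolding tangent_space_def by auto
  from gm(2) have "\<forall>\<^sub>F t in at 0. gm t \<in> S" by eventually_elim simp
  with gm show "v \<in> tangent_space S p" unfolding tangent_space_def by blast
 qed
 with assms(1) show ?thesis unfolding normal_at_def by (metis IntD1)
qed

lemma linear_trace_add: "linear_trace (%v. f v + g v) = linear_trace f + linear_trace g"
 by (simp add: linear_trace_def inner_add_left sum.distrib)

lemma linear_trace_cmul: "linear_trace (%v. c *\<^sub>R f v) = c * linear_trace f"
 by (simp add: linear_trace_def sum_distrib_left)

lemma linear_trace_minus: "linear_trace (%v. - f v) = - linear_trace f"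
 by (simp add: linear_trace_def sum_negf)

lemma linear_trace_diff: "linear_trace (%v. f v - g v) = linear_trace f - linear_trace g"
 by (simp add: linear_trace_def inner_diff_left sum_subtractf)

lemma linear_trace_rank_one:
 assumes "linear f"
 shows "linear_trace (%v. f v *\<^sub>R a) = f a"
proof -
 have "f a = f (\<Sum>b\<in>Basis. (a \<bullet> b) *\<^sub>R b)" by (simp add: euclidean_representation)
 also have "\<dots> = (\<Sum>b\<in>Basis. (a \<bullet> b) *\<^sub>R f b)"
  by (simp add: linear_sum[OF assms] linear_cmul[OF assms])
 finally show ?thesis by (simp add: linear_trace_def mult.commute)
qed

lemma linear_trace_id: "linear_trace (%v::'a::euclidean_space. v) = DIM('a)"
 by (simp add: linear_trace_def)

lemma unit_normal_derivative:
 assumes "unit_normal S \<nu>" "p \<in> S"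
 obtains D where "(\<nu> has_derivative D) (at p within S)"
proof -
 have "smooth_on S \<nu>" using assms(1) by (simp add: unit_normal_def)
 then obtain W F D where W: "open W" "p \<in> W" "\<And>q. q \<in> W ==> (F has_derivative D q) (at q)"
  "\<And>v. continuous_on W (%q. D q v)" "\<And>q. q \<in> S ==> q \<in> W ==> \<nu> q = F q"
  using assms(2) by (rule smooth_on_local_C1) blast
 obtain d where d: "d > 0" "ball p d \<subseteq> W" using W openE by blast
 have "(\<nu> has_derivative D p) (at p within S)"
  by (rule has_derivative_transform_within[OF has_derivative_at_withinI[OF W(3)[OF W(2)]] d(1) assms(2)])
   (use W(5) d(2) in \<open>auto simp: dist_commute subset_iff\<close>)
 thus ?thesis by (rule that)
qed

lemma unit_normal_continuous:
 assumes "unit_normal S \<nu>"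
 shows "continuous_on S \<nu>"
 unfolding continuous_on_eq_continuous_within
 using unit_normal_derivative[OF assms] has_derivative_continuous by metis

lemma Ck_on_subset:
 assumes "Ck_on k S f" "T \<subseteq> S"
 shows "Ck_on k T f"
 unfolding Ck_on_def
proof
 fix p assume "p \<in> T"
 with assms obtain U F where "open U" "p \<in> U" "\<forall>j::nat. enat j \<le> k --> Ck_on_open j F U" "\<forall>q\<in>S \<inter> U. f q = F q"
  unfolding Ck_on_def by (metis subsetD)
 with assms(2) show "\<exists>U F. open U & p \<in> U & (\<forall>j::nat. enat j \<le> k --> Ck_on_open j F U) & (\<forall>q\<in>T \<inter> U. f q = F q)"
  by (intro exI[of _ U] exI[of _ F]) auto
qed

lemma smooth_hypersurface_open_Int:
 assumes "smooth_hypersurface S" "open U"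
 shows "smooth_hypersurface (S \<inter> U)"
 unfolding smooth_hypersurface_def
proof
 fix p assume p: "p \<in> S \<inter> U"
 then obtain V f where V: "open V" "p \<in> V" "smooth_on V (f :: 'a => real)"
  "\<forall>q\<in>V. frechet_derivative f (at q) ~= (%_. 0)" "S \<inter> V = {q\<in>V. f q = 0}"
  using assms unfolding smooth_hypersurface_def by blast
 have "smooth_on (V \<inter> U) f"
  by (rule Ck_on_subset[OF V(3)]) simp
 moreover have "S \<inter> U \<inter> (V \<inter> U) = {q \<in> V \<inter> U. f q = 0}" using V(5) by blast
 ultimately show "\<exists>V f. open V & p \<in> V & smooth_on V (f :: 'a => real) &
   (\<forall>q\<in>V. frechet_derivative f (at q) ~= (%_. 0)) & S \<inter> U \<inter> V = {q\<in>V. f q = 0}"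
  using V(1,2,4) assms(2) p by (intro exI[of _ "V \<inter> U"] exI[of _ f] conjI) (simp_all add: open_Int)
qed

text \<open>Minimality is stated with local normals. Near \<open>p\<close> such a normal is
  \<open>\<nu>\<close> up to a sign, and by continuity the sign is constant there, so the vanishing
  trace passes to the given global normal.\<close>

lemma minimal_trace_zero:
 assumes S: "minimal_hypersurface S" and \<nu>: "unit_normal S \<nu>" and p: "p \<in> S"
 shows "linear_trace (tangential_derivative S \<nu> p) = 0"
proof -
 have sS: "smooth_hypersurface S" using S by (simp add: minimal_hypersurface_def)
 obtain U mu where U: "open U" "p \<in> U" "unit_normal (S \<inter> U) mu"
  "\<forall>q\<in>S \<inter> U. mean_curvature (S \<inter> U) mu q = 0"
  using S p unfolding minimal_hypersurface_def by blast
 note sU = smooth_hypersurface_open_Int[OF sS U(1)]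
 have nu: "normal_at (S \<inter> U) q (\<nu> q)" "normal_at (S \<inter> U) q (mu q)" if "q \<in> S \<inter> U" for q
  using normal_at_open_Int[OF normal_at_unit_normal[OF sS _ \<nu>] U(1)] normal_at_unit_normal[OF sU that U(3)] that
  by auto
 have alt: "mu q = (mu q \<bullet> \<nu> q) *\<^sub>R \<nu> q & (mu q \<bullet> \<nu> q = 1 \<or> mu q \<bullet> \<nu> q = -1)" if "q \<in> S \<inter> U" for q
  using normal_at_unique[OF nu(1)[OF that] nu(2)[OF that]] nu(1)[OF that]
  by (auto simp: normal_at_def dot_square_norm)
 define c where "c = mu p \<bullet> \<nu> p"
 have c: "c = 1 \<or> c = -1" using alt[of p] p U by (auto simp: c_def)
 have "continuous_on (S \<inter> U) (%q. mu q \<bullet> \<nu> q)"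
  by (intro continuous_intros unit_normal_continuous[OF U(3)]
    continuous_on_subset[OF unit_normal_continuous[OF \<nu>]]) auto
 then obtain d where d: "d > 0" "\<And>q. q \<in> S \<inter> U ==> dist q p < d ==> dist (mu q \<bullet> \<nu> q) c < 1"
  using p U unfolding continuous_on_iff c_def by (metis IntI zero_less_one)
 have near: "mu q = c *\<^sub>R \<nu> q" if "q \<in> S \<inter> U" "dist q p < d" for q
  using alt[OF that(1)] d(2)[OF that] c by (auto simp: dist_real_def)
 obtain D where D: "(\<nu> has_derivative D) (at p within S)" by (rule unit_normal_derivative[OF \<nu> p])
 have DU: "(\<nu> has_derivative D) (at p within S \<inter> U)" by (rule has_derivative_subset[OF D]) auto
 have "((%q. c *\<^sub>R \<nu> q) has_derivative (%v. c *\<^sub>R D v)) (at p within S \<inter> U)"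
  by (intro derivative_intros DU)
 hence Dmu: "(mu has_derivative (%v. c *\<^sub>R D v)) (at p within S \<inter> U)"
  by (rule has_derivative_transform_within[OF _ d(1)]) (use near p U in auto)
 have pU: "p \<in> S \<inter> U" using p U by simp
 have "tangential_derivative S \<nu> p = (%v. D (v - (v \<bullet> \<nu> p) *\<^sub>R \<nu> p))"
  by (rule tangential_derivative_eq[OF normal_at_unit_normal[OF sS p \<nu>] D p])
 moreover have "tangential_derivative (S \<inter> U) mu p = (%v. c *\<^sub>R D (v - (v \<bullet> \<nu> p) *\<^sub>R \<nu> p))"
  by (rule tangential_derivative_eq[OF nu(1)[OF pU] Dmu pU])
 moreover have "linear_trace (%v. - tangential_derivative (S \<inter> U) mu p v) = 0"
  using U(4) pU by (simp add: mean_curvature_def shape_operator_def[abs_def])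
 ultimately show ?thesis using c by (auto simp: linear_trace_minus linear_trace_cmul)
qed

lemma continuous_on_apply_linear:
 fixes L :: "'c::topological_space => 'a::euclidean_space => 'b::real_normed_vector"
 assumes lin: "\<And>q. q \<in> X ==> linear (L q)"
  and L: "\<And>v. continuous_on X (%q. L q v)" and v: "continuous_on X v"
 shows "continuous_on X (%q. L q (v q))"
proof -
 have "L q (v q) = (\<Sum>b\<in>Basis. (v q \<bullet> b) *\<^sub>R L q b)" if "q \<in> X" for q
 proof -
  have "L q (v q) = L q (\<Sum>b\<in>Basis. (v q \<bullet> b) *\<^sub>R b)" by (simp add: euclidean_representation)
  thus ?thesis by (simp add: linear_sum[OF lin[OF that]] linear_cmul[OF lin[OF that]])
 qed
 moreover have "continuous_on X (%q. \<Sum>b\<in>Basis. (v q \<bullet> b) *\<^sub>R L q b)"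
  by (intro continuous_intros L v)
 ultimately show ?thesis by (simp cong: continuous_on_cong)
qed

lemma shape_operator_local:
 assumes S: "smooth_hypersurface S" and \<nu>: "unit_normal S \<nu>" and p: "p \<in> S"
 obtains W where "open W" "p \<in> W" "\<And>v. continuous_on (S \<inter> W) (%q. shape_operator S \<nu> q v)"
  "\<And>q. q \<in> S ==> q \<in> W ==> linear (shape_operator S \<nu> q)"
proof -
 have "smooth_on S \<nu>" using \<nu> by (simp add: unit_normal_def)
 then obtain W F D where W: "open W" "p \<in> W" "\<And>q. q \<in> W ==> (F has_derivative D q) (at q)"
  "\<And>v. continuous_on W (%q. D q v)" "\<And>q. q \<in> S ==> q \<in> W ==> \<nu> q = F q"
  using p by (rule smooth_on_local_C1) blast
 have D: "(\<nu> has_derivative D q) (at q within S)" if q: "q \<in> S" "q \<in> W" for q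
 proof -
  obtain d where d: "d > 0" "ball q d \<subseteq> W" using W q openE by blast
  show ?thesis
   by (rule has_derivative_transform_within[OF has_derivative_at_withinI[OF W(3)[OF q(2)]] d(1) q(1)])
    (use W(5) d(2) in \<open>auto simp: dist_commute subset_iff\<close>)
 qed
 have eq: "shape_operator S \<nu> q v = - D q (v - (v \<bullet> \<nu> q) *\<^sub>R \<nu> q)" if "q \<in> S" "q \<in> W" for q v
  using tangential_derivative_eq[OF normal_at_unit_normal[OF S that(1) \<nu>] D[OF that] that(1)]
  by (simp add: shape_operator_def)
 have lin: "linear (D q)" if "q \<in> W" for q using W(3)[OF that] by (rule has_derivative_linear)
 show ?thesis
 proof (rule that[OF W(1,2)])
  fix v
  have c\<nu>: "continuous_on (S \<inter> W) \<nu>"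
   by (rule continuous_on_subset[OF unit_normal_continuous[OF \<nu>]]) auto
  have "continuous_on (S \<inter> W) (%q. D q (v - (v \<bullet> \<nu> q) *\<^sub>R \<nu> q))"
  proof (rule continuous_on_apply_linear[where L = D and v = "%q. v - (v \<bullet> \<nu> q) *\<^sub>R \<nu> q"])
   show "linear (D q)" if "q \<in> S \<inter> W" for q using lin that by simp
   show "continuous_on (S \<inter> W) (%q. D q v)" for v by (rule continuous_on_subset[OF W(4)]) auto
   show "continuous_on (S \<inter> W) (%q. v - (v \<bullet> \<nu> q) *\<^sub>R \<nu> q)" by (intro continuous_intros c\<nu>)
  qed
  hence "continuous_on (S \<inter> W) (%q. - D q (v - (v \<bullet> \<nu> q) *\<^sub>R \<nu> q))" by (rule continuous_on_minus)
  thus "continuous_on (S \<inter> W) (%q. shape_operator S \<nu> q v)"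
   by (rule continuous_on_eq) (simp add: eq)
 next
  fix q assume q: "q \<in> S" "q \<in> W"
  have "linear (%v. - D q (v - (v \<bullet> \<nu> q) *\<^sub>R \<nu> q))"
   by (rule linearI) (simp_all add: linear_diff[OF lin[OF q(2)]] linear_add[OF lin[OF q(2)]]
     linear_cmul[OF lin[OF q(2)]] inner_add_left algebra_simps)
  thus "linear (shape_operator S \<nu> q)" using eq[OF q] by presburger
 qed
qed

text \<open>The formulas for the curvatures in terms of the profile hold off the axes only.
  Continuity on all of \<open>S\<close> carries their limits to the orbit where the profile
  ends.\<close>

lemma curvature_continuous:
 assumes S: "smooth_hypersurface S" and \<nu>: "unit_normal S \<nu>"
 shows "continuous_on S (norm_A_squared S \<nu>)" "continuous_on S (trace_A_cubed S \<nu>)"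
proof -
 have "continuous (at p within S) (norm_A_squared S \<nu>) & continuous (at p within S) (trace_A_cubed S \<nu>)"
  if p: "p \<in> S" for p
 proof -
  obtain W where W: "open W" "p \<in> W" "\<And>v. continuous_on (S \<inter> W) (%q. shape_operator S \<nu> q v)"
   "\<And>q. q \<in> S ==> q \<in> W ==> linear (shape_operator S \<nu> q)"
   using S \<nu> p by (rule shape_operator_local) blast
  have step: "continuous_on (S \<inter> W) (%q. shape_operator S \<nu> q (v q))" if "continuous_on (S \<inter> W) v" for v
   by (rule continuous_on_apply_linear) (use W that in auto)
  have "continuous_on (S \<inter> W) (norm_A_squared S \<nu>)"
   unfolding norm_A_squared_def[abs_def] by (intro continuous_intros W)
  moreover have "continuous_on (S \<inter> W) (trace_A_cubed S \<nu>)"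
   unfolding trace_A_cubed_def[abs_def] linear_trace_def numeral_3_eq_3
   by (simp, intro continuous_intros step W)
  moreover have "at p within S \<inter> W = at p within S"
   by (rule at_within_nhd[of _ W]) (use W in auto)
  ultimately show ?thesis using p W(2) by (metis IntI continuous_on_eq_continuous_within)
 qed
 thus "continuous_on S (norm_A_squared S \<nu>)" "continuous_on S (trace_A_cubed S \<nu>)"
  by (auto simp: continuous_on_eq_continuous_within)
qed

text \<open>The position vector \<open>z\<close> satisfies \<open>\<Delta> |z|\<^sup>2 / 2 = N\<close> on a minimal hypersurface, which makes the Jacobi
 operator on functions of \<open>|z|\<^sup>2 / 2\<close> an ordinary differential operator.\<close>

lemma jacobi_operator_radial:
 fixes S :: "'a::euclidean_space set"
 assumes S: "minimal_hypersurface S" and \<nu>: "unit_normal S \<nu>" and p: "p \<in> S"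
  and u: "\<And>t. (u has_real_derivative u1 t) (at t)" "\<And>t. (u1 has_real_derivative u2 t) (at t)"
 shows "jacobi_operator S \<nu> (%z. u (z \<bullet> z / 2)) p =
  (p \<bullet> p - (p \<bullet> \<nu> p)\<^sup>2) * u2 (p \<bullet> p / 2) + (real DIM('a) - 1) * u1 (p \<bullet> p / 2)
   + norm_A_squared S \<nu> p * u (p \<bullet> p / 2)"
proof -
 have sS: "smooth_hypersurface S" using S by (simp add: minimal_hypersurface_def)
 note nrm = normal_at_unit_normal[OF sS _ \<nu>]
 have nn: "\<nu> q \<bullet> \<nu> q = 1" if "q \<in> S" for q using nrm[OF that] by (simp add: normal_at_def dot_square_norm)
 define P where "P q = q - (q \<bullet> \<nu> q) *\<^sub>R \<nu> q" for q
 have comp: "((%z. h (z \<bullet> z / 2)) has_derivative (%v. h' (q \<bullet> q / 2) * (q \<bullet> v))) (at q within X)"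
  if "\<And>t. (h has_real_derivative h' t) (at t)" for h h' and q :: 'a and X
 proof -
  have "((%z. z \<bullet> z / 2) has_derivative (%v. q \<bullet> v)) (at q within X)"
   by (auto intro!: derivative_eq_intros simp: inner_commute)
  from has_derivative_compose[OF this that[of "q \<bullet> q / 2", unfolded has_field_derivative_def]]
  show ?thesis by (simp add: o_def)
 qed
 have grad: "surface_gradient S (%z. u (z \<bullet> z / 2)) q = u1 (q \<bullet> q / 2) *\<^sub>R P q" if q: "q \<in> S" for q
 proof -
  have "tangential_derivative S (%z. u (z \<bullet> z / 2)) q = (%v. u1 (q \<bullet> q / 2) * (q \<bullet> (v - (v \<bullet> \<nu> q) *\<^sub>R \<nu> q)))"
   by (rule tangential_derivative_eq[OF nrm[OF q] comp[OF u(1)] q])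
  moreover have "q \<bullet> (v - (v \<bullet> \<nu> q) *\<^sub>R \<nu> q) = P q \<bullet> v" for v
   by (simp add: P_def inner_diff_left inner_diff_right inner_commute)
  ultimately have "surface_gradient S (%z. u (z \<bullet> z / 2)) q
    = (\<Sum>b\<in>Basis. u1 (q \<bullet> q / 2) *\<^sub>R (P q \<bullet> b) *\<^sub>R b)"
   by (simp add: surface_gradient_def)
  thus ?thesis by (simp only: scaleR_right.sum[symmetric] euclidean_representation)
 qed
 obtain D where D: "(\<nu> has_derivative D) (at p within S)" by (rule unit_normal_derivative[OF \<nu> p])
 let ?r = "p \<bullet> p / 2"
 define G where "G w = (u2 ?r * (p \<bullet> w)) *\<^sub>R P p + u1 ?r *\<^sub>R
   (w - ((w \<bullet> \<nu> p + p \<bullet> D w) *\<^sub>R \<nu> p + (p \<bullet> \<nu> p) *\<^sub>R D w))" for w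
 have "((%q. u1 (q \<bullet> q / 2) *\<^sub>R P q) has_derivative G) (at p within S)"
  unfolding P_def G_def
  by (rule derivative_eq_intros comp[OF u(2)] D refl)+ (simp add: fun_eq_iff algebra_simps)
 hence "(surface_gradient S (%z. u (z \<bullet> z / 2)) has_derivative G) (at p within S)"
  by (rule has_derivative_transform_within[OF _ zero_less_one p]) (simp add: grad)
 from tangential_derivative_eq[OF nrm[OF p] this p]
 have lap: "laplace_beltrami S (%z. u (z \<bullet> z / 2)) p = linear_trace (%v. G (v - (v \<bullet> \<nu> p) *\<^sub>R \<nu> p))"
  by (simp add: laplace_beltrami_def surface_divergence_def)
 interpret D: bounded_linear D using D by (rule has_derivative_bounded_linear)
 define Q where "Q v = v - (v \<bullet> \<nu> p) *\<^sub>R \<nu> p" for v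
 have Q\<nu>: "Q (\<nu> p) = 0" "Q v \<bullet> \<nu> p = 0" for v using nn[OF p] by (simp_all add: Q_def inner_diff_left)
 have linQ: "linear (%v. p \<bullet> D (Q v))"
  by (rule linearI) (simp_all add: Q_def D.diff D.add D.scaleR inner_add_left inner_diff_right inner_add_right algebra_simps)
 have G: "G (Q v) = u2 ?r *\<^sub>R ((p \<bullet> Q v) *\<^sub>R P p) + u1 ?r *\<^sub>R
   ((v - (v \<bullet> \<nu> p) *\<^sub>R \<nu> p) - ((p \<bullet> D (Q v)) *\<^sub>R \<nu> p + (p \<bullet> \<nu> p) *\<^sub>R D (Q v)))" for v
  unfolding G_def by (simp add: Q\<nu>) (simp add: Q_def)
 \<comment> \<open>The derivative of the normal enters the Laplacian through this trace, which
   vanishes by minimality, and through its value at \<open>Q (\<nu> p) = 0\<close>.\<close>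
 have tr0: "linear_trace (%v. D (Q v)) = 0"
  using minimal_trace_zero[OF S \<nu> p] tangential_derivative_eq[OF nrm[OF p] D p] by (simp add: Q_def)
 have PP: "p \<bullet> Q (P p) = p \<bullet> p - (p \<bullet> \<nu> p)\<^sup>2"
  using nn[OF p] by (simp add: P_def Q_def inner_diff_left inner_diff_right power2_eq_square inner_commute)
 have "linear_trace (%v. G (Q v)) = u2 ?r * (p \<bullet> Q (P p)) + u1 ?r *
  ((real DIM('a) - \<nu> p \<bullet> \<nu> p) - (p \<bullet> D (Q (\<nu> p)) + (p \<bullet> \<nu> p) * 0))"
 proof -
  have "linear (%v. p \<bullet> Q v)"
   by (rule linearI) (simp_all add: Q_def inner_add_left inner_diff_right inner_add_right algebra_simps)
  moreover have "linear (%v. v \<bullet> \<nu> p)" by (rule linearI) (simp_all add: inner_add_left)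
  ultimately show ?thesis
   unfolding G by (simp only: linear_trace_add linear_trace_diff linear_trace_cmul tr0
     linear_trace_rank_one[OF linQ] linear_trace_rank_one linear_trace_id)
 qed
 hence "linear_trace (%v. G (Q v)) = (p \<bullet> p - (p \<bullet> \<nu> p)\<^sup>2) * u2 ?r + (real DIM('a) - 1) * u1 ?r"
  by (simp add: PP Q\<nu> nn[OF p] D.zero)
 thus ?thesis unfolding jacobi_operator_def lap by (simp add: Q_def)
qed

section \<open>Rotationally symmetric hypersurfaces: the normal and the principal curvatures\<close>

lemma tangent_space_image:
 assumes inv: "h ` S \<subseteq> S" and h: "bounded_linear h" and v: "v \<in> tangent_space S p"
 shows "h v \<in> tangent_space S (h p)"
proof -
 obtain gm where gm: "gm 0 = p" "\<forall>\<^sub>F t in at 0. gm t \<in> S" "(gm has_vector_derivative v) (at (0::real))"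
  using v unfolding tangent_space_def by auto
 have "((%t. h (gm t)) has_vector_derivative h v) (at 0)"
  using bounded_linear.has_vector_derivative[OF h gm(3)] .
 moreover have "\<forall>\<^sub>F t in at 0. h (gm t) \<in> S" using gm(2) by eventually_elim (use inv in auto)
 ultimately show ?thesis using gm(1) unfolding tangent_space_def
  by (intro CollectI exI[of _ "%t. h (gm t)"]) auto
qed

lemma linear_trace_prod:
 fixes L :: "'a::euclidean_space \<times> 'b::euclidean_space => 'a \<times> 'b"
 shows "linear_trace L = (\<Sum>i\<in>Basis. fst (L (i, 0)) \<bullet> i) + (\<Sum>i\<in>Basis. snd (L (0, i)) \<bullet> i)"
proof -
 have "inj_on (%u. (u::'a, 0::'b)) Basis" "inj_on (%u. (0::'a, u::'b)) Basis"
  by (auto simp: inj_on_def)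
 moreover have "(%u. (u::'a, 0::'b)) ` Basis \<inter> (%u. (0::'a, u::'b)) ` Basis = {}" by auto
 ultimately show ?thesis
  by (simp add: linear_trace_def Basis_prod_def sum.union_disjoint sum.reindex inner_prod_def)
qed

text \<open>The shape of the derivative of a rotationally symmetric normal: eigenvalues \<open>a\<close>, \<open>b\<close> on the two
 spherical factors and \<open>c\<close> along the profile direction \<open>e\<close>.\<close>

definition rot_form :: "'a::euclidean_space => 'b::euclidean_space => 'a \<times> 'b => real => real => real => 'a \<times> 'b => 'a \<times> 'b" where
 "rot_form x y e a b c v = a *\<^sub>R (fst v - (fst v \<bullet> x) *\<^sub>R x, 0) + b *\<^sub>R (0, snd v - (snd v \<bullet> y) *\<^sub>R y) + (c * (v \<bullet> e)) *\<^sub>R e"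

context
 fixes x :: "'a::euclidean_space" and y :: "'b::euclidean_space" and e :: "'a \<times> 'b" and r s :: real
 assumes x: "x \<bullet> x = 1" and y: "y \<bullet> y = 1" and e: "e = (r *\<^sub>R x, s *\<^sub>R y)" "r\<^sup>2 + s\<^sup>2 = 1"
begin

lemma rot_form_inner_commute: "rot_form x y e a b c v \<bullet> w = v \<bullet> rot_form x y e a b c w"
 by (simp add: rot_form_def inner_prod_def inner_add_left inner_add_right inner_diff_left
   inner_diff_right inner_commute algebra_simps)

text \<open>The three blocks act on mutually orthogonal subspaces, since \<open>e\<close> lies in
  the plane of \<open>x\<close> and \<open>y\<close>. Powers of the shape operator therefore reduce
  to powers of its eigenvalues.\<close>

lemma rot_form_comp:
 "rot_form x y e a b c (rot_form x y e a' b' c' v) = rot_form x y e (a * a') (b * b') (c * c') v"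
proof -
 define V where "V = rot_form x y e a' b' c' v"
 define k where "k = c' * (v \<bullet> e)"
 have ee: "e \<bullet> e = 1" using e x y by (simp add: inner_prod_def power2_eq_square)
 have fe: "fst e = r *\<^sub>R x" "snd e = s *\<^sub>R y" by (simp_all add: e(1))
 have f: "fst V = a' *\<^sub>R (fst v - (fst v \<bullet> x) *\<^sub>R x) + k *\<^sub>R (r *\<^sub>R x)"
  and g: "snd V = b' *\<^sub>R (snd v - (snd v \<bullet> y) *\<^sub>R y) + k *\<^sub>R (s *\<^sub>R y)"
  by (simp_all add: V_def rot_form_def k_def e(1))
 have fx: "fst V \<bullet> x = k * r" using x by (simp add: f inner_add_left inner_diff_left)
 have gy: "snd V \<bullet> y = k * s" using y by (simp add: g inner_add_left inner_diff_left)
 have "V \<bullet> e = k * (r\<^sup>2 + s\<^sup>2)"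
  using fx gy by (simp add: e(1) inner_prod_def power2_eq_square algebra_simps)
 hence Ve: "V \<bullet> e = k" using e(2) by simp
 show ?thesis unfolding V_def[symmetric]
  by (rule prod_eqI) (simp_all add: rot_form_def fx gy Ve f g k_def fe x y algebra_simps)
qed

lemma linear_trace_rot_form:
 "linear_trace (rot_form x y e a b c) = a * (real DIM('a) - 1) + b * (real DIM('b) - 1) + c"
proof -
 have t1: "linear_trace (%v::'a \<times> 'b. (fst v - (fst v \<bullet> x) *\<^sub>R x, 0)) = real DIM('a) - 1"
 proof -
  have "linear_trace (%v::'a \<times> 'b. (fst v - (fst v \<bullet> x) *\<^sub>R x, 0))
    = (\<Sum>b\<in>Basis. (b - (b \<bullet> x) *\<^sub>R x) \<bullet> (b::'a))"
   by (simp add: linear_trace_prod)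
  also have "\<dots> = (\<Sum>b\<in>Basis. 1 - (x \<bullet> b) * (x \<bullet> b))"
   by (rule sum.cong) (simp_all add: inner_diff_left inner_commute[of x])
  also have "\<dots> = real DIM('a) - (\<Sum>b\<in>Basis. (x \<bullet> b) * (x \<bullet> b))"
   by (simp add: sum_subtractf)
  finally show ?thesis using euclidean_inner[of x x] x by simp
 qed
 have t2: "linear_trace (%v::'a \<times> 'b. (0, snd v - (snd v \<bullet> y) *\<^sub>R y)) = real DIM('b) - 1"
 proof -
  have "linear_trace (%v::'a \<times> 'b. (0, snd v - (snd v \<bullet> y) *\<^sub>R y))
    = (\<Sum>b\<in>Basis. (b - (b \<bullet> y) *\<^sub>R y) \<bullet> (b::'b))"
   by (simp add: linear_trace_prod)
  also have "\<dots> = (\<Sum>b\<in>Basis. 1 - (y \<bullet> b) * (y \<bullet> b))"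
   by (rule sum.cong) (simp_all add: inner_diff_left inner_commute[of y])
  also have "\<dots> = real DIM('b) - (\<Sum>b\<in>Basis. (y \<bullet> b) * (y \<bullet> b))"
   by (simp add: sum_subtractf)
  finally show ?thesis using euclidean_inner[of y y] y by simp
 qed
 have ee: "e \<bullet> e = 1" using e x y by (simp add: inner_prod_def power2_eq_square)
 have "linear (%v. c * (v \<bullet> e))" by (rule linearI) (simp_all add: inner_add_left algebra_simps)
 from linear_trace_rank_one[OF this, of e] have "linear_trace (%v. (c * (v \<bullet> e)) *\<^sub>R e) = c" using ee by simp
 thus ?thesis unfolding rot_form_def[abs_def] by (simp only: linear_trace_add linear_trace_cmul t1 t2)
qed

end

lemma curve_on_sphere:
 fixes x :: "'a::real_inner"
 assumes x: "x ~= 0" and xi: "xi \<bullet> x = 0"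
 obtains gm where "gm 0 = x" "\<And>t. norm (gm t) = norm x" "(gm has_vector_derivative xi) (at (0::real))"
proof (cases "xi = 0")
 case True
 show ?thesis by (rule that[of "%_. x"]) (use True in \<open>auto intro: has_vector_derivative_const\<close>)
next
 case False
 define c where "c = norm xi / norm x"
 have c: "c > 0" "c * norm x = norm xi" using False x by (simp_all add: c_def)
 define gm where "gm t = cos (c * t) *\<^sub>R x + (sin (c * t) / c) *\<^sub>R xi" for t
 show ?thesis
 proof (rule that[of gm])
  show "gm 0 = x" by (simp add: gm_def)
  show "norm (gm t) = norm x" for t
  proof -
   have "gm t \<bullet> gm t = (cos (c * t))\<^sup>2 * (x \<bullet> x) + (sin (c * t) / c)\<^sup>2 * (xi \<bullet> xi)"
    using xi by (simp add: gm_def inner_add_left inner_add_right inner_commute power2_eq_square)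
   also have "xi \<bullet> xi = c\<^sup>2 * (x \<bullet> x)"
    by (simp only: power2_norm_eq_inner[symmetric] c(2)[symmetric] power_mult_distrib)
   also have "(cos (c * t))\<^sup>2 * (x \<bullet> x) + (sin (c * t) / c)\<^sup>2 * (c\<^sup>2 * (x \<bullet> x))
     = ((cos (c * t))\<^sup>2 + (sin (c * t))\<^sup>2) * (x \<bullet> x)"
    using c by (simp only: distrib_right power_divide) simp
   finally show ?thesis by (simp add: norm_eq_sqrt_inner)
  qed
  show "(gm has_vector_derivative xi) (at 0)"
   unfolding gm_def using c
   by (auto intro!: derivative_eq_intros simp: has_vector_derivative_def)
 qed
qed

text \<open>By invariance the hypersurface is determined by its points in the plane of two arbitrary
  unit vectors \<open>e1\<close> and \<open>f1\<close>. The dimensions appear as reals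
  \<open>m\<close> and \<open>n\<close> because they serve as coefficients and exponents.\<close>

locale profile_surface =
 fixes S :: "((real^'m) \<times> (real^'n)) set"
  and \<nu> :: "(real^'m) \<times> (real^'n) => (real^'m) \<times> (real^'n)"
  and e1 :: "real^'m" and f1 :: "real^'n" and m n :: real
 assumes mn: "CARD('m) \<ge> 2" "CARD('n) \<ge> 2"
  and dims: "m = real CARD('m)" "n = real CARD('n)"
  and min: "minimal_hypersurface S" and \<nu>: "unit_normal S \<nu>" and inv: "OmOn_invariant S"
  and unit: "norm e1 = 1" "norm f1 = 1"
begin

lemma hyp: "smooth_hypersurface S" using min by (simp add: minimal_hypersurface_def)

lemma nrm: "p \<in> S ==> normal_at S p (\<nu> p)"
 by (rule normal_at_unit_normal[OF hyp _ \<nu>])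

lemma tangentI: "p \<in> S ==> v \<bullet> \<nu> p = 0 ==> v \<in> tangent_space S p"
 and tangentD: "p \<in> S ==> v \<in> tangent_space S p ==> v \<bullet> \<nu> p = 0"
 using nrm[of p] by (auto simp: normal_at_def)

lemma norm_\<nu>: "p \<in> S ==> \<nu> p \<bullet> \<nu> p = 1"
 using nrm[of p] by (simp add: normal_at_def dot_square_norm)

lemma unit_inner: "e1 \<bullet> e1 = 1" "f1 \<bullet> f1 = 1" using unit by (simp_all add: dot_square_norm)

lemma orbit_map:
 assumes "norm x' = norm (x :: real^'m)" "norm y' = norm (y :: real^'n)"
 obtains f g where "orthogonal_transformation f" "orthogonal_transformation g" "f x = x'" "g y = y'"
  "map_prod f g ` S = S" "bounded_linear (map_prod f g)"
proof -
 obtain f where f: "orthogonal_transformation f" "f x = x'"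
  using orthogonal_transformation_exists[of x x'] assms by metis
 obtain g where g: "orthogonal_transformation g" "g y = y'"
  using orthogonal_transformation_exists[of y y'] assms by metis
 have "linear f" "linear g" using f g by (auto simp: orthogonal_transformation_linear)
 hence "linear (map_prod f g)"
  by (intro linearI) (auto simp: linear_add linear_cmul map_prod_def split_beta)
 hence "bounded_linear (map_prod f g)" by (rule linear_conv_bounded_linear[THEN iffD1])
 moreover have "map_prod f g ` S = S" using inv f g unfolding OmOn_invariant_def by blast
 ultimately show ?thesis using that f g by blast
qed

lemma mem_S_norms:
 assumes "norm x' = norm (x :: real^'m)" "norm y' = norm (y :: real^'n)" "(x, y) \<in> S"
 shows "(x', y') \<in> S"
proof -
 obtain f g where "f x = x'" "g y = y'" "map_prod f g ` S = S"
  using assms(1,2) by (rule orbit_map) blast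
 with assms(3) show ?thesis by (metis map_prod_imageI)
qed

end

lemma inner_Pair_fst: "(v :: 'a::real_inner \<times> 'b::real_inner) \<bullet> (x, 0) = fst v \<bullet> x"
 by (simp add: inner_prod_def)

lemma inner_Pair_snd: "(v :: 'a::real_inner \<times> 'b::real_inner) \<bullet> (0, y) = snd v \<bullet> y"
 by (simp add: inner_prod_def)

lemma sgn_inner_self: "x ~= 0 ==> sgn x \<bullet> sgn x = 1" for x :: "'a::real_inner"
 by (simp add: dot_square_norm norm_sgn)

lemma norm_scaleR_sgn: "norm x *\<^sub>R sgn x = x" for x :: "'a::real_normed_vector"
 by (cases "x = 0") (simp_all add: sgn_div_norm)

lemma parallel_if_perp:
 fixes a u :: "'a::real_inner"
 assumes "u \<bullet> u = 1" "\<And>xi. xi \<bullet> u = 0 ==> a \<bullet> xi = 0"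
 shows "a = (a \<bullet> u) *\<^sub>R u"
proof -
 define xi where "xi = a - (a \<bullet> u) *\<^sub>R u"
 have "xi \<bullet> u = 0" using assms(1) by (simp add: xi_def inner_diff_left)
 hence "a \<bullet> xi = 0" by (rule assms(2))
 hence "xi \<bullet> xi = 0" using \<open>xi \<bullet> u = 0\<close> by (simp add: xi_def inner_diff_left inner_commute)
 thus ?thesis by (simp add: xi_def)
qed

context profile_surface
begin

lemma orbit_tangent_fst:
 assumes "(x, y) \<in> S" "x ~= 0" "xi \<bullet> x = 0"
 shows "(xi, 0) \<in> tangent_space S (x, y)"
proof -
 obtain gm where gm: "gm 0 = x" "\<And>t. norm (gm t) = norm x" "(gm has_vector_derivative xi) (at (0::real))"
  using assms(2,3) by (rule curve_on_sphere) blast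
 have "((%t. (gm t, y)) has_vector_derivative (xi, 0)) (at 0)"
  by (intro has_vector_derivative_Pair gm has_vector_derivative_const)
 moreover have "(gm t, y) \<in> S" for t using mem_S_norms[OF gm(2) refl assms(1)] .
 ultimately show ?thesis unfolding tangent_space_def using gm(1)
  by (intro CollectI exI[of _ "%t. (gm t, y)"]) auto
qed

lemma orbit_tangent_snd:
 assumes "(x, y) \<in> S" "y ~= 0" "xi \<bullet> y = 0"
 shows "(0, xi) \<in> tangent_space S (x, y)"
proof -
 obtain gm where gm: "gm 0 = y" "\<And>t. norm (gm t) = norm y" "(gm has_vector_derivative xi) (at (0::real))"
  using assms(2,3) by (rule curve_on_sphere) blast
 have "((%t. (x, gm t)) has_vector_derivative (0, xi)) (at 0)"
  by (intro has_vector_derivative_Pair gm has_vector_derivative_const)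
 moreover have "(x, gm t) \<in> S" for t using mem_S_norms[OF refl gm(2) assms(1)] .
 ultimately show ?thesis unfolding tangent_space_def using gm(1)
  by (intro CollectI exI[of _ "%t. (x, gm t)"]) auto
qed

lemma \<nu>_fst_parallel:
 assumes "(x, y) \<in> S" "x ~= 0"
 shows "fst (\<nu> (x, y)) = (fst (\<nu> (x, y)) \<bullet> sgn x) *\<^sub>R sgn x"
proof (rule parallel_if_perp[OF sgn_inner_self[OF assms(2)]])
 fix xi assume "xi \<bullet> sgn x = 0"
 hence "xi \<bullet> x = 0" using assms(2) by (simp add: sgn_div_norm)
 from tangentD[OF assms(1) orbit_tangent_fst[OF assms this]]
 show "fst (\<nu> (x, y)) \<bullet> xi = 0" by (simp add: inner_Pair_fst inner_commute[of "(xi, 0)"])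
qed

lemma \<nu>_snd_parallel:
 assumes "(x, y) \<in> S" "y ~= 0"
 shows "snd (\<nu> (x, y)) = (snd (\<nu> (x, y)) \<bullet> sgn y) *\<^sub>R sgn y"
proof (rule parallel_if_perp[OF sgn_inner_self[OF assms(2)]])
 fix xi assume "xi \<bullet> sgn y = 0"
 hence "xi \<bullet> y = 0" using assms(2) by (simp add: sgn_div_norm)
 from tangentD[OF assms(1) orbit_tangent_snd[OF assms this]]
 show "snd (\<nu> (x, y)) \<bullet> xi = 0" by (simp add: inner_Pair_snd inner_commute[of "(0, xi)"])
qed

definition nu1 :: "real => real => real" where
 "nu1 X Y = fst (\<nu> (X *\<^sub>R e1, Y *\<^sub>R f1)) \<bullet> e1"

definition nu2 :: "real => real => real" where
 "nu2 X Y = snd (\<nu> (X *\<^sub>R e1, Y *\<^sub>R f1)) \<bullet> f1"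

text \<open>Invariance of \<open>S\<close> makes the normal invariant only up to a sign. The product
  of the components at a point of the orbit with those at a base point is 1 or -1 and continuous,
  and the orbit is connected because both spheres have positive dimension; so the sign is
  constant.\<close>

lemma \<nu>_orbit:
 assumes S: "(x, y) \<in> S" and xy: "x ~= 0" "y ~= 0"
 shows "\<nu> (x, y) = (nu1 (norm x) (norm y) *\<^sub>R sgn x, nu2 (norm x) (norm y) *\<^sub>R sgn y)"
proof -
 define X where "X = norm x"
 define Y where "Y = norm y"
 have XY: "X > 0" "Y > 0" using xy by (simp_all add: X_def Y_def)
 define Or where "Or = sphere (0 :: real^'m) X \<times> sphere (0 :: real^'n) Y"
 define A where "A p = fst (\<nu> p) \<bullet> sgn (fst p)" for p
 define B where "B p = snd (\<nu> p) \<bullet> sgn (snd p)" for p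
 have OrS: "Or \<subseteq> S" using mem_S_norms[OF _ _ S] by (auto simp: Or_def X_def Y_def)
 have Or0: "fst p ~= 0" "snd p ~= 0" "norm (fst p) = X" "norm (snd p) = Y" if "p \<in> Or" for p
  using that XY by (auto simp: Or_def)
 have form: "\<nu> p = (A p *\<^sub>R sgn (fst p), B p *\<^sub>R sgn (snd p))" if p: "p \<in> Or" for p
  using \<nu>_fst_parallel[of "fst p" "snd p"] \<nu>_snd_parallel[of "fst p" "snd p"] Or0[OF p] OrS p
  by (intro prod_eqI) (auto simp: A_def B_def)
 have AB: "(A p)\<^sup>2 + (B p)\<^sup>2 = 1" if p: "p \<in> Or" for p
  using norm_\<nu>[of p] OrS p sgn_inner_self[OF Or0(1)[OF p]] sgn_inner_self[OF Or0(2)[OF p]]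
  unfolding form[OF p] by (auto simp: inner_prod_def power2_eq_square)
 define p0 where "p0 = (X *\<^sub>R e1, Y *\<^sub>R f1)"
 have p0: "p0 \<in> Or" using XY unit by (simp add: p0_def Or_def)
 have p0S: "p0 \<in> S" using p0 OrS by auto
 have sg: "sgn (fst p0) = e1" "sgn (snd p0) = f1" using XY unit by (simp_all add: p0_def sgn_div_norm)
 have nuAB: "A p0 = nu1 X Y" "B p0 = nu2 X Y" 
  by (simp_all add: A_def B_def sg nu1_def nu2_def) (simp_all add: p0_def)
 have alt: "A p * A p0 + B p * B p0 \<in> {1, -1}" if p: "p \<in> Or" for p
 proof -
  have "norm (fst p) = norm (fst p0)" "norm (snd p) = norm (snd p0)" using Or0[OF p] Or0[OF p0] by simp_all
  then obtain f g where fg: "orthogonal_transformation f" "orthogonal_transformation g"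
   "f (fst p0) = fst p" "g (snd p0) = snd p" "map_prod f g ` S = S" "bounded_linear (map_prod f g)"
   by (rule orbit_map) blast
  interpret f: linear f using fg(1) by (rule orthogonal_transformation_linear)
  interpret g: linear g using fg(2) by (rule orthogonal_transformation_linear)
  \<comment> \<open>The profile direction at the base point. Its image under the isometry is tangent
    at \<open>p\<close>, so the components of the normal at \<open>p\<close> are proportional to
    those at the base point.\<close>
  define v where "v = (- B p0 *\<^sub>R sgn (fst p0), A p0 *\<^sub>R sgn (snd p0))"
  have "v \<bullet> \<nu> p0 = 0"
   using sgn_inner_self[OF Or0(1)[OF p0]] sgn_inner_self[OF Or0(2)[OF p0]]
   unfolding form[OF p0] v_def by (simp add: inner_prod_def)
  hence "v \<in> tangent_space S p0" by (rule tangentI[OF p0S])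
  hence "map_prod f g v \<in> tangent_space S (map_prod f g p0)"
   by (rule tangent_space_image[OF equalityD1[OF fg(5)] fg(6)])
  moreover have "map_prod f g p0 = p" using fg by (simp add: prod_eq_iff)
  moreover have "map_prod f g v = (- B p0 *\<^sub>R sgn (fst p), A p0 *\<^sub>R sgn (snd p))"
   using fg Or0[OF p] Or0[OF p0] by (simp add: v_def f.scale f.neg g.scale sgn_div_norm)
  ultimately have "(- B p0 *\<^sub>R sgn (fst p), A p0 *\<^sub>R sgn (snd p)) \<bullet> \<nu> p = 0"
   using tangentD[of p] OrS p by auto
  hence 0: "A p0 * B p - B p0 * A p = 0"
   using sgn_inner_self[OF Or0(1)[OF p]] sgn_inner_self[OF Or0(2)[OF p]]
   unfolding form[OF p] by (simp add: inner_prod_def mult.commute)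
  have "(A p * A p0 + B p * B p0)\<^sup>2 + (A p0 * B p - B p0 * A p)\<^sup>2
    = ((A p)\<^sup>2 + (B p)\<^sup>2) * ((A p0)\<^sup>2 + (B p0)\<^sup>2)"
   by (simp add: power2_eq_square algebra_simps)
  hence "(A p * A p0 + B p * B p0)\<^sup>2 = 1" using 0 AB[OF p] AB[OF p0] by simp
  thus ?thesis by (simp add: power2_eq_1_iff)
 qed
 have contA: "continuous_on Or A" "continuous_on Or B"
  unfolding A_def[abs_def] B_def[abs_def] using Or0
  by (intro continuous_intros continuous_on_subset[OF unit_normal_continuous[OF \<nu>] OrS] continuous_on_sgn; simp)+
 have "connected Or" unfolding Or_def using mn by (intro connected_Times connected_sphere) auto
 moreover have "continuous_on Or (%p. A p * A p0 + B p * B p0)" by (intro continuous_intros contA)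
 moreover have "finite ((%p. A p * A p0 + B p * B p0) ` Or)"
  by (rule finite_subset[of _ "{1, -1}"]) (use alt in auto)
 ultimately have "(%p. A p * A p0 + B p * B p0) constant_on Or"
  by (rule continuous_finite_range_constant)
 then obtain c where c: "\<And>p. p \<in> Or ==> A p * A p0 + B p * B p0 = c" unfolding constant_on_def by auto
 have "c = 1" using c[OF p0] AB[OF p0] by (simp add: power2_eq_square)
 have eq: "A p = A p0 & B p = B p0" if p: "p \<in> Or" for p
 proof -
  have "(A p - A p0)\<^sup>2 + (B p - B p0)\<^sup>2 = 0"
   using c[OF p] AB[OF p] AB[OF p0] \<open>c = 1\<close> by (simp add: power2_eq_square algebra_simps)
  thus ?thesis by (simp add: sum_power2_eq_zero_iff)
 qed
 have "(x, y) \<in> Or" by (simp add: Or_def X_def Y_def)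
 from form[OF this] eq[OF this] nuAB show ?thesis by (simp add: X_def Y_def)
qed

text \<open>The stabiliser of the point contains all of \<open>O(n)\<close> and preserves the
  tangent space. The reflection in the second factor forces the normal to lie entirely in one of the
  two factors. If it lay in the second one, a vector orthogonal to it could be rotated onto it; such
  a vector exists because the second factor has dimension at least 2.\<close>

lemma axis_normal_fst:
 assumes S: "(x, 0) \<in> S" and x: "x ~= 0"
 shows "\<nu> (x, 0) = (sgn x \<bullet> fst (\<nu> (x, 0))) *\<^sub>R (sgn x, 0)" "\<bar>sgn x \<bullet> fst (\<nu> (x, 0))\<bar> = 1"
proof -
 define al where "al = fst (\<nu> (x, 0)) \<bullet> sgn x"
 define b where "b = snd (\<nu> (x, 0))"
 have nu: "\<nu> (x, 0) = (al *\<^sub>R sgn x, b)" using \<nu>_fst_parallel[OF S x] by (simp add: prod_eq_iff al_def b_def)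
 have ss: "sgn x \<bullet> sgn x = 1" by (rule sgn_inner_self[OF x])
 have move: "(fst v, g (snd v)) \<in> tangent_space S (x, 0)"
  if "v \<in> tangent_space S (x, 0)" "orthogonal_transformation g" for v g
 proof -
  have lg: "linear g" using that(2) by (rule orthogonal_transformation_linear)
  have img: "map_prod (id :: real^'m => real^'m) g ` S = S"
  proof -
   have "orthogonal_transformation (id :: real^'m => real^'m)"
    using orthogonal_transformation_id by (simp add: id_def)
   with inv that(2) show ?thesis unfolding OmOn_invariant_def by blast
  qed
  have bl: "bounded_linear (map_prod (id :: real^'m => real^'m) g)"
   by (intro linear_conv_bounded_linear[THEN iffD1] linearI)
    (auto simp: linear_add[OF lg] linear_cmul[OF lg] map_prod_def split_beta)
  have "map_prod (id :: real^'m => real^'m) g v \<in> tangent_space S (map_prod (id :: real^'m => real^'m) g (x, 0))"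
   by (rule tangent_space_image[OF equalityD1[OF img] bl that(1)])
  thus ?thesis by (simp add: map_prod_def split_beta linear_0[OF lg])
 qed
 have b0: "b = 0"
 proof (rule ccontr)
  assume b: "b ~= 0"
  have "(- (b \<bullet> b) *\<^sub>R sgn x, al *\<^sub>R b) \<in> tangent_space S (x, 0)"
   by (rule tangentI[OF S]) (simp add: nu inner_prod_def ss)
  from move[OF this, of uminus] have "(- (b \<bullet> b) *\<^sub>R sgn x, - al *\<^sub>R b) \<in> tangent_space S (x, 0)"
   by (simp add: orthogonal_transformation_neg orthogonal_transformation_id)
  from tangentD[OF S this] have "al = 0" using b by (simp add: nu inner_prod_def ss)
  obtain w where w: "w ~= 0" "orthogonal b w"
   using orthogonal_to_vector_exists[of b] mn by auto
  define w' where "w' = (norm b / norm w) *\<^sub>R w"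
  have w': "norm w' = norm b" "w' \<bullet> b = 0" using w by (auto simp: w'_def orthogonal_def inner_commute)
  obtain g where g: "orthogonal_transformation g" "g w' = b"
   using orthogonal_transformation_exists[OF w'(1)] by auto
  have "(0, w') \<in> tangent_space S (x, 0)"
   by (rule tangentI[OF S]) (simp add: nu inner_prod_def w')
  from move[OF this g(1)] have "(0, b) \<in> tangent_space S (x, 0)" using g by simp
  from tangentD[OF S this] show False using b by (simp add: nu inner_prod_def)
 qed
 show "\<nu> (x, 0) = (sgn x \<bullet> fst (\<nu> (x, 0))) *\<^sub>R (sgn x, 0)" using nu b0 ss by simp
 show "\<bar>sgn x \<bullet> fst (\<nu> (x, 0))\<bar> = 1"
  using norm_\<nu>[OF S] unfolding nu b0 by (simp add: inner_prod_def ss abs_square_eq_1 power2_eq_square[symmetric])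
qed

lemma axis_normal_snd:
 assumes S: "(0, y) \<in> S" and y: "y ~= 0"
 shows "\<nu> (0, y) = (sgn y \<bullet> snd (\<nu> (0, y))) *\<^sub>R (0, sgn y)" "\<bar>sgn y \<bullet> snd (\<nu> (0, y))\<bar> = 1"
proof -
 define al where "al = snd (\<nu> (0, y)) \<bullet> sgn y"
 define b where "b = fst (\<nu> (0, y))"
 have nu: "\<nu> (0, y) = (b, al *\<^sub>R sgn y)" using \<nu>_snd_parallel[OF S y] by (simp add: prod_eq_iff al_def b_def)
 have ss: "sgn y \<bullet> sgn y = 1" by (rule sgn_inner_self[OF y])
 have move: "(g (fst v), snd v) \<in> tangent_space S (0, y)"
  if "v \<in> tangent_space S (0, y)" "orthogonal_transformation g" for v g
 proof -
  have lg: "linear g" using that(2) by (rule orthogonal_transformation_linear)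
  have img: "map_prod g (id :: real^'n => real^'n) ` S = S"
  proof -
   have "orthogonal_transformation (id :: real^'n => real^'n)"
    using orthogonal_transformation_id by (simp add: id_def)
   with inv that(2) show ?thesis unfolding OmOn_invariant_def by blast
  qed
  have bl: "bounded_linear (map_prod g (id :: real^'n => real^'n))"
   by (intro linear_conv_bounded_linear[THEN iffD1] linearI)
    (auto simp: linear_add[OF lg] linear_cmul[OF lg] map_prod_def split_beta)
  have "map_prod g (id :: real^'n => real^'n) v \<in> tangent_space S (map_prod g (id :: real^'n => real^'n) (0, y))"
   by (rule tangent_space_image[OF equalityD1[OF img] bl that(1)])
  thus ?thesis by (simp add: map_prod_def split_beta linear_0[OF lg])
 qed
 have b0: "b = 0"
 proof (rule ccontr)
  assume b: "b ~= 0"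
  have "(al *\<^sub>R b, - (b \<bullet> b) *\<^sub>R sgn y) \<in> tangent_space S (0, y)"
   by (rule tangentI[OF S]) (simp add: nu inner_prod_def ss)
  from move[OF this, of uminus] have "(- al *\<^sub>R b, - (b \<bullet> b) *\<^sub>R sgn y) \<in> tangent_space S (0, y)"
   by (simp add: orthogonal_transformation_neg orthogonal_transformation_id)
  from tangentD[OF S this] have "al = 0" using b by (simp add: nu inner_prod_def ss)
  obtain w where w: "w ~= 0" "orthogonal b w"
   using orthogonal_to_vector_exists[of b] mn by auto
  define w' where "w' = (norm b / norm w) *\<^sub>R w"
  have w': "norm w' = norm b" "w' \<bullet> b = 0" using w by (auto simp: w'_def orthogonal_def inner_commute)
  obtain g where g: "orthogonal_transformation g" "g w' = b"
   using orthogonal_transformation_exists[OF w'(1)] by auto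
  have "(w', 0) \<in> tangent_space S (0, y)"
   by (rule tangentI[OF S]) (simp add: nu inner_prod_def w')
  from move[OF this g(1)] have "(b, 0) \<in> tangent_space S (0, y)" using g by simp
  from tangentD[OF S this] show False using b by (simp add: nu inner_prod_def)
 qed
 show "\<nu> (0, y) = (sgn y \<bullet> snd (\<nu> (0, y))) *\<^sub>R (0, sgn y)" using nu b0 ss by simp
 show "\<bar>sgn y \<bullet> snd (\<nu> (0, y))\<bar> = 1"
  using norm_\<nu>[OF S] unfolding nu b0 by (simp add: inner_prod_def ss abs_square_eq_1 power2_eq_square[symmetric])
qed

text \<open>The eigenvalue of \<open>d\<nu>\<close> along the profile. Minimality determines it from
  the two rotational eigenvalues, so no second derivative of the profile is ever needed.\<close>

definition lam :: "real => real => real" where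
 "lam X Y = - (m - 1) * (nu1 X Y / X) - (n - 1) * (nu2 X Y / Y)"

text \<open>Along great circles in the orbit the normal is known explicitly, which gives the two
  rotational eigenvalues. In the profile direction \<open>e\<close> a curve is chosen inside the
  plane of \<open>sgn x\<close> and \<open>sgn y\<close>; the normal stays in that plane and keeps
  length 1, so its derivative is a multiple of \<open>e\<close>, and the vanishing trace identifies
  the multiple.\<close>

lemma \<nu>_derivative:
 assumes S: "(x, y) \<in> S" and xy: "x ~= 0" "y ~= 0"
  and D: "(\<nu> has_derivative D) (at (x, y) within S)"
 defines "X \<equiv> norm x" and "Y \<equiv> norm y"
 defines "e \<equiv> (- nu2 X Y *\<^sub>R sgn x, nu1 X Y *\<^sub>R sgn y)"
 shows "tangential_derivative S \<nu> (x, y) = rot_form (sgn x) (sgn y) e (nu1 X Y / X) (nu2 X Y / Y) (lam X Y)"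
  and "D e = lam X Y *\<^sub>R e" and "(nu1 X Y)\<^sup>2 + (nu2 X Y)\<^sup>2 = 1"
proof -
 let ?p = "(x, y)"
 have XY: "X > 0" "Y > 0" using xy by (simp_all add: X_def Y_def)
 have ss: "sgn x \<bullet> sgn x = 1" "sgn y \<bullet> sgn y = 1" using xy by (simp_all add: sgn_inner_self)
 have nu: "\<nu> ?p = (nu1 X Y *\<^sub>R sgn x, nu2 X Y *\<^sub>R sgn y)" unfolding X_def Y_def by (rule \<nu>_orbit[OF S xy])
 show n1: "(nu1 X Y)\<^sup>2 + (nu2 X Y)\<^sup>2 = 1"
  using norm_\<nu>[OF S] unfolding nu by (simp add: inner_prod_def ss power2_eq_square)
 interpret D: bounded_linear D using D by (rule has_derivative_bounded_linear)
 have D1: "D (xi, 0) = (nu1 X Y / X) *\<^sub>R (xi, 0)" if xi: "xi \<bullet> x = 0" for xi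
 proof -
  obtain gm where gm: "gm 0 = x" "\<And>t. norm (gm t) = norm x" "(gm has_vector_derivative xi) (at (0::real))"
   using xy(1) xi by (rule curve_on_sphere) blast
  have mem: "(gm t, y) \<in> S" for t using mem_S_norms[OF gm(2) refl S] .
  have "((%t. \<nu> (gm t, y)) has_vector_derivative D (xi, 0)) (at 0)"
   by (rule has_vector_derivative_along_curve[OF D S])
    (use gm mem in \<open>auto intro: has_vector_derivative_Pair has_vector_derivative_const\<close>)
  moreover have "\<nu> (gm t, y) = ((nu1 X Y / X) *\<^sub>R gm t, nu2 X Y *\<^sub>R sgn y)" for t
  proof -
   have "gm t ~= 0" using gm(2)[of t] xy by auto
   from \<nu>_orbit[OF mem this xy(2)] show ?thesis using gm(2)[of t] by (simp add: X_def Y_def sgn_div_norm divide_inverse)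
  qed
  moreover have "((%t. ((nu1 X Y / X) *\<^sub>R gm t, nu2 X Y *\<^sub>R sgn y)) has_vector_derivative ((nu1 X Y / X) *\<^sub>R xi, 0)) (at 0)"
   by (intro has_vector_derivative_Pair has_vector_derivative_const bounded_linear.has_vector_derivative[OF bounded_linear_scaleR_right gm(3)])
  ultimately show ?thesis using vector_derivative_unique_at by fastforce
 qed
 have D2: "D (0, xi) = (nu2 X Y / Y) *\<^sub>R (0, xi)" if xi: "xi \<bullet> y = 0" for xi
 proof -
  obtain gm where gm: "gm 0 = y" "\<And>t. norm (gm t) = norm y" "(gm has_vector_derivative xi) (at (0::real))"
   using xy(2) xi by (rule curve_on_sphere) blast
  have mem: "(x, gm t) \<in> S" for t using mem_S_norms[OF refl gm(2) S] .
  have "((%t. \<nu> (x, gm t)) has_vector_derivative D (0, xi)) (at 0)"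
   by (rule has_vector_derivative_along_curve[OF D S])
    (use gm mem in \<open>auto intro: has_vector_derivative_Pair has_vector_derivative_const\<close>)
  moreover have "\<nu> (x, gm t) = (nu1 X Y *\<^sub>R sgn x, (nu2 X Y / Y) *\<^sub>R gm t)" for t
  proof -
   have "gm t ~= 0" using gm(2)[of t] xy by auto
   from \<nu>_orbit[OF mem xy(1) this] show ?thesis using gm(2)[of t] by (simp add: X_def Y_def sgn_div_norm divide_inverse)
  qed
  moreover have "((%t. (nu1 X Y *\<^sub>R sgn x, (nu2 X Y / Y) *\<^sub>R gm t)) has_vector_derivative (0, (nu2 X Y / Y) *\<^sub>R xi)) (at 0)"
   by (intro has_vector_derivative_Pair has_vector_derivative_const bounded_linear.has_vector_derivative[OF bounded_linear_scaleR_right gm(3)])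
  ultimately show ?thesis using vector_derivative_unique_at by fastforce
 qed
 have ee: "e \<bullet> e = 1" using n1 by (simp add: e_def inner_prod_def ss power2_eq_square)
 have e\<nu>: "e \<bullet> \<nu> ?p = 0" unfolding nu by (simp add: e_def inner_prod_def ss)
 obtain gm where gm: "gm 0 = ?p" "\<forall>\<^sub>F t in at 0. gm t \<in> S" "(gm has_vector_derivative e) (at (0::real))"
  using tangentI[OF S e\<nu>] unfolding tangent_space_def by auto
 \<comment> \<open>Replacing both components by their norms rotates the curve back into the plane of
   the profile. It stays in \<open>S\<close> by invariance and keeps its velocity, since that
   velocity already lies in the plane.\<close>
 define gm' where "gm' t = (norm (fst (gm t)) *\<^sub>R sgn x, norm (snd (gm t)) *\<^sub>R sgn y)" for t
 have gm'0: "gm' 0 = ?p" using gm(1) by (simp add: gm'_def norm_scaleR_sgn)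
 have gm'S: "\<forall>\<^sub>F t in at 0. gm' t \<in> S"
  using gm(2)
 proof eventually_elim
  case (elim t)
  have "(fst (gm t), snd (gm t)) \<in> S" using elim by simp
  thus ?case unfolding gm'_def by (rule mem_S_norms[rotated 2]) (use xy in \<open>auto simp: norm_sgn\<close>)
 qed
 have dfst: "((%t. fst (gm t)) has_vector_derivative fst e) (at 0)"
  by (rule bounded_linear.has_vector_derivative[OF bounded_linear_fst gm(3)])
 have dsnd: "((%t. snd (gm t)) has_vector_derivative snd e) (at 0)"
  by (rule bounded_linear.has_vector_derivative[OF bounded_linear_snd gm(3)])
 have "((%t. norm (fst (gm t))) has_derivative (%t. (t *\<^sub>R fst e) \<bullet> sgn (fst (gm 0)))) (at 0)"
  by (rule has_derivative_compose[OF dfst[unfolded has_vector_derivative_def] has_derivative_norm])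
   (use gm(1) xy in simp)
 hence d1: "((%t. norm (fst (gm t))) has_vector_derivative (- nu2 X Y)) (at 0)"
  using gm(1) by (simp add: has_vector_derivative_def e_def ss)
 have "((%t. norm (snd (gm t))) has_derivative (%t. (t *\<^sub>R snd e) \<bullet> sgn (snd (gm 0)))) (at 0)"
  by (rule has_derivative_compose[OF dsnd[unfolded has_vector_derivative_def] has_derivative_norm])
   (use gm(1) xy in simp)
 hence d2: "((%t. norm (snd (gm t))) has_vector_derivative nu1 X Y) (at 0)"
  using gm(1) by (simp add: has_vector_derivative_def e_def ss)
 have dgm': "(gm' has_vector_derivative e) (at 0)"
  unfolding gm'_def e_def
  by (intro has_vector_derivative_Pair bounded_linear.has_vector_derivative[OF bounded_linear_scaleR_left d1]
    bounded_linear.has_vector_derivative[OF bounded_linear_scaleR_left d2])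
 have De: "((%t. \<nu> (gm' t)) has_vector_derivative D e) (at 0)"
  by (rule has_vector_derivative_along_curve[OF D S gm'0 gm'S dgm'])
 have plane: "\<forall>\<^sub>F t in at 0. fst (\<nu> (gm' t)) \<bullet> xi = 0" if "xi \<bullet> sgn x = 0" for xi
 proof -
  have "isCont (%t. fst (gm t)) 0" "isCont (%t. snd (gm t)) 0"
   using dfst dsnd has_vector_derivative_continuous by blast+
  hence "\<forall>\<^sub>F t in at 0. fst (gm t) ~= 0" "\<forall>\<^sub>F t in at 0. snd (gm t) ~= 0"
   using gm(1) xy unfolding isCont_def by (auto intro: tendsto_imp_eventually_ne)
  with gm'S show ?thesis
  proof eventually_elim
   case (elim t)
   from \<nu>_fst_parallel[of "fst (gm' t)" "snd (gm' t)"] elim xy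
   have "fst (\<nu> (gm' t)) = (fst (\<nu> (gm' t)) \<bullet> sgn (fst (gm' t))) *\<^sub>R sgn (fst (gm' t))"
    by (simp add: gm'_def sgn_zero_iff)
   moreover have "sgn (fst (gm' t)) \<bullet> xi = 0"
    using that by (simp add: gm'_def sgn_div_norm inner_commute)
   ultimately show ?case by (metis inner_scaleR_left mult_zero_right)
  qed
 qed
 have plane': "\<forall>\<^sub>F t in at 0. snd (\<nu> (gm' t)) \<bullet> xi = 0" if "xi \<bullet> sgn y = 0" for xi
 proof -
  have "isCont (%t. fst (gm t)) 0" "isCont (%t. snd (gm t)) 0"
   using dfst dsnd has_vector_derivative_continuous by blast+
  hence "\<forall>\<^sub>F t in at 0. fst (gm t) ~= 0" "\<forall>\<^sub>F t in at 0. snd (gm t) ~= 0"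
   using gm(1) xy unfolding isCont_def by (auto intro: tendsto_imp_eventually_ne)
  with gm'S show ?thesis
  proof eventually_elim
   case (elim t)
   from \<nu>_snd_parallel[of "fst (gm' t)" "snd (gm' t)"] elim xy
   have "snd (\<nu> (gm' t)) = (snd (\<nu> (gm' t)) \<bullet> sgn (snd (gm' t))) *\<^sub>R sgn (snd (gm' t))"
    by (simp add: gm'_def sgn_zero_iff)
   moreover have "sgn (snd (gm' t)) \<bullet> xi = 0"
    using that by (simp add: gm'_def sgn_div_norm inner_commute)
   ultimately show ?case by (metis inner_scaleR_left mult_zero_right)
  qed
 qed
 have vanish: "c' = 0" if "(f has_vector_derivative c') (at (0::real))" "\<forall>\<^sub>F t in at 0. f t = c" "f 0 = c" for f :: "real => real" and c c'
 proof -
  from that(2) obtain d where d: "d > 0" "\<And>t. t ~= 0 ==> dist t 0 < d ==> f t = c"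
   unfolding eventually_at by auto
  have "f t = c" if "dist t 0 < d" for t using d(2)[OF _ that] \<open>f 0 = c\<close> by (cases "t = 0") auto
  hence "(f has_vector_derivative 0) (at 0)"
   by (intro has_vector_derivative_transform_within[OF has_vector_derivative_const[of c] d(1)]) auto
  thus ?thesis using that(1) vector_derivative_unique_at by blast
 qed
 have De1: "fst (D e) = (fst (D e) \<bullet> sgn x) *\<^sub>R sgn x"
 proof (rule parallel_if_perp[OF ss(1)])
  fix xi assume xi: "xi \<bullet> sgn x = 0"
  have "((%t. \<nu> (gm' t) \<bullet> (xi, 0)) has_vector_derivative D e \<bullet> (xi, 0)) (at 0)"
   by (rule bounded_linear.has_vector_derivative[OF bounded_linear_inner_left De])
  hence "((%t. fst (\<nu> (gm' t)) \<bullet> xi) has_vector_derivative fst (D e) \<bullet> xi) (at 0)" by (simp add: inner_Pair_fst)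
  from vanish[OF this plane[OF xi]] show "fst (D e) \<bullet> xi = 0"
   using xi unfolding gm'0 nu by (simp add: inner_commute)
 qed
 have De2: "snd (D e) = (snd (D e) \<bullet> sgn y) *\<^sub>R sgn y"
 proof (rule parallel_if_perp[OF ss(2)])
  fix xi assume xi: "xi \<bullet> sgn y = 0"
  have "((%t. \<nu> (gm' t) \<bullet> (0, xi)) has_vector_derivative D e \<bullet> (0, xi)) (at 0)"
   by (rule bounded_linear.has_vector_derivative[OF bounded_linear_inner_left De])
  hence "((%t. snd (\<nu> (gm' t)) \<bullet> xi) has_vector_derivative snd (D e) \<bullet> xi) (at 0)" by (simp add: inner_Pair_snd)
  from vanish[OF this plane'[OF xi]] show "snd (D e) \<bullet> xi = 0"
   using xi unfolding gm'0 nu by (simp add: inner_commute)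
 qed
 define al where "al = fst (D e) \<bullet> sgn x"
 define \<beta> where "\<beta> = snd (D e) \<bullet> sgn y"
 have Deab: "D e = (al *\<^sub>R sgn x, \<beta> *\<^sub>R sgn y)" using De1 De2 by (simp add: prod_eq_iff al_def \<beta>_def)
 have "((%t. \<nu> (gm' t) \<bullet> \<nu> (gm' t)) has_derivative (%t. \<nu> (gm' 0) \<bullet> (t *\<^sub>R D e) + (t *\<^sub>R D e) \<bullet> \<nu> (gm' 0))) (at 0)"
  by (rule has_derivative_inner) (use De in \<open>simp_all add: has_vector_derivative_def\<close>)
 hence "((%t. \<nu> (gm' t) \<bullet> \<nu> (gm' t)) has_vector_derivative 2 * (D e \<bullet> \<nu> ?p)) (at 0)"
  by (simp add: has_vector_derivative_def gm'0 inner_commute algebra_simps)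
 moreover have "\<forall>\<^sub>F t in at 0. \<nu> (gm' t) \<bullet> \<nu> (gm' t) = 1" using gm'S by eventually_elim (rule norm_\<nu>)
 ultimately have "2 * (D e \<bullet> \<nu> ?p) = 0" by (rule vanish) (simp add: gm'0 norm_\<nu>[OF S])
 hence "D e \<bullet> \<nu> ?p = 0" by simp
 hence perp: "al * nu1 X Y + \<beta> * nu2 X Y = 0"
  unfolding Deab nu by (simp add: inner_prod_def ss mult.commute)
 define kap where "kap = D e \<bullet> e"
 have kap: "kap = - al * nu2 X Y + \<beta> * nu1 X Y" 
  unfolding kap_def Deab by (simp add: e_def inner_prod_def ss mult.commute)
 have "al = - kap * nu2 X Y + (al * nu1 X Y + \<beta> * nu2 X Y) * nu1 X Y + al * (1 - ((nu1 X Y)\<^sup>2 + (nu2 X Y)\<^sup>2))"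
  unfolding kap by (simp add: power2_eq_square algebra_simps)
 hence al: "al = - kap * nu2 X Y" using perp n1 by simp
 have "\<beta> = kap * nu1 X Y + (al * nu1 X Y + \<beta> * nu2 X Y) * nu2 X Y + \<beta> * (1 - ((nu1 X Y)\<^sup>2 + (nu2 X Y)\<^sup>2))"
  unfolding kap by (simp add: power2_eq_square algebra_simps)
 hence \<beta>: "\<beta> = kap * nu1 X Y" using perp n1 by simp
 have Dekap: "D e = kap *\<^sub>R e" unfolding Deab al \<beta> by (simp add: e_def)
 have form: "tangential_derivative S \<nu> ?p = rot_form (sgn x) (sgn y) e (nu1 X Y / X) (nu2 X Y / Y) kap"
 proof
  fix v :: "(real^'m) \<times> (real^'n)"
  let ?xi = "fst v - (fst v \<bullet> sgn x) *\<^sub>R sgn x"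
  let ?eta = "snd v - (snd v \<bullet> sgn y) *\<^sub>R sgn y"
  have "?xi \<bullet> sgn x = 0" "?eta \<bullet> sgn y = 0" by (simp_all add: inner_diff_left ss)
  hence perp: "?xi \<bullet> x = 0" "?eta \<bullet> y = 0"
   by (metis norm_scaleR_sgn inner_scaleR_right mult_zero_right)+
  \<comment> \<open>The tangential projection splits into the two orbit directions and
    \<open>e\<close>, and on each of them \<open>D\<close> is already known.\<close>
  have split: "v - (v \<bullet> \<nu> ?p) *\<^sub>R \<nu> ?p = (?xi, 0) + (0, ?eta) + (v \<bullet> e) *\<^sub>R e"
  proof -
   define a where "a = fst v \<bullet> sgn x"
   define b where "b = snd v \<bullet> sgn y"
   have v\<nu>: "v \<bullet> \<nu> ?p = nu1 X Y * a + nu2 X Y * b" unfolding nu by (simp add: inner_prod_def a_def b_def)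
   have ve: "v \<bullet> e = - nu2 X Y * a + nu1 X Y * b" unfolding e_def by (simp add: inner_prod_def a_def b_def)
   have "- (nu1 X Y * a + nu2 X Y * b) * nu1 X Y = - a + (- nu2 X Y * a + nu1 X Y * b) * (- nu2 X Y)
     + a * (1 - ((nu1 X Y)\<^sup>2 + (nu2 X Y)\<^sup>2))"
    by (simp add: power2_eq_square algebra_simps)
   hence 1: "- (nu1 X Y * a + nu2 X Y * b) * nu1 X Y = - a + (- nu2 X Y * a + nu1 X Y * b) * (- nu2 X Y)"
    using n1 by simp
   have "- (nu1 X Y * a + nu2 X Y * b) * nu2 X Y = - b + (- nu2 X Y * a + nu1 X Y * b) * nu1 X Y
     + b * (1 - ((nu1 X Y)\<^sup>2 + (nu2 X Y)\<^sup>2))"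
    by (simp add: power2_eq_square algebra_simps)
   hence 2: "- (nu1 X Y * a + nu2 X Y * b) * nu2 X Y = - b + (- nu2 X Y * a + nu1 X Y * b) * nu1 X Y"
    using n1 by simp
   have s1: "fst v - ((v \<bullet> \<nu> ?p) * nu1 X Y) *\<^sub>R sgn x = fst v + (- (v \<bullet> \<nu> ?p) * nu1 X Y) *\<^sub>R sgn x" by simp
   have s2: "snd v - ((v \<bullet> \<nu> ?p) * nu2 X Y) *\<^sub>R sgn y = snd v + (- (v \<bullet> \<nu> ?p) * nu2 X Y) *\<^sub>R sgn y" by simp
   show ?thesis
   proof (rule prod_eqI)
    have "fst (v - (v \<bullet> \<nu> ?p) *\<^sub>R \<nu> ?p) = fst v - ((v \<bullet> \<nu> ?p) * nu1 X Y) *\<^sub>R sgn x" by (simp add: nu)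
    also have "\<dots> = fst v + (- a + (v \<bullet> e) * (- nu2 X Y)) *\<^sub>R sgn x"
     unfolding s1 unfolding v\<nu> ve 1 ..
    also have "\<dots> = fst ((?xi, 0) + (0, ?eta) + (v \<bullet> e) *\<^sub>R e)"
     by (simp add: a_def scaleR_add_left scaleR_diff_left) (simp add: e_def)
    finally show "fst (v - (v \<bullet> \<nu> ?p) *\<^sub>R \<nu> ?p) = fst ((?xi, 0) + (0, ?eta) + (v \<bullet> e) *\<^sub>R e)" .
    have "snd (v - (v \<bullet> \<nu> ?p) *\<^sub>R \<nu> ?p) = snd v - ((v \<bullet> \<nu> ?p) * nu2 X Y) *\<^sub>R sgn y" by (simp add: nu)
    also have "\<dots> = snd v + (- b + (v \<bullet> e) * nu1 X Y) *\<^sub>R sgn y"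
     unfolding s2 unfolding v\<nu> ve 2 ..
    also have "\<dots> = snd ((?xi, 0) + (0, ?eta) + (v \<bullet> e) *\<^sub>R e)"
     by (simp add: b_def scaleR_add_left scaleR_diff_left) (simp add: e_def)
    finally show "snd (v - (v \<bullet> \<nu> ?p) *\<^sub>R \<nu> ?p) = snd ((?xi, 0) + (0, ?eta) + (v \<bullet> e) *\<^sub>R e)" .
   qed
  qed
  have "tangential_derivative S \<nu> ?p v = D (v - (v \<bullet> \<nu> ?p) *\<^sub>R \<nu> ?p)"
   using tangential_derivative_eq[OF nrm[OF S] D S] by simp
  also have "\<dots> = (nu1 X Y / X) *\<^sub>R (?xi, 0) + (nu2 X Y / Y) *\<^sub>R (0, ?eta) + ((v \<bullet> e) * kap) *\<^sub>R e"
   unfolding split D.add D.scaleR D1[OF perp(1)] D2[OF perp(2)] Dekap by simp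
  finally show "tangential_derivative S \<nu> ?p v = rot_form (sgn x) (sgn y) e (nu1 X Y / X) (nu2 X Y / Y) kap v"
   by (simp add: rot_form_def mult.commute)
 qed
 have "kap = lam X Y"
 proof -
  have "linear_trace (rot_form (sgn x) (sgn y) e (nu1 X Y / X) (nu2 X Y / Y) kap) = 0"
   using minimal_trace_zero[OF min \<nu> S] unfolding form .
  hence "nu1 X Y / X * (m - 1) + nu2 X Y / Y * (n - 1) + kap = 0"
   using linear_trace_rot_form[OF ss, of e "- nu2 X Y" "nu1 X Y"] n1 by (simp add: e_def dims add.commute)
  moreover have "lam X Y = - (nu1 X Y / X * (m - 1)) - nu2 X Y / Y * (n - 1)"
   unfolding lam_def mult_minus_left by (simp only: mult.commute)
  ultimately show ?thesis by linarith
 qed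
 with form Dekap show "tangential_derivative S \<nu> ?p = rot_form (sgn x) (sgn y) e (nu1 X Y / X) (nu2 X Y / Y) (lam X Y)"
  and "D e = lam X Y *\<^sub>R e" by simp_all
qed

lemma curvatures:
 assumes S: "(x, y) \<in> S" and xy: "x ~= 0" "y ~= 0"
 defines "X \<equiv> norm x" and "Y \<equiv> norm y"
 shows "norm_A_squared S \<nu> (x, y) = (m - 1) * (nu1 X Y / X)\<^sup>2 + (n - 1) * (nu2 X Y / Y)\<^sup>2 + (lam X Y)\<^sup>2"
  and "trace_A_cubed S \<nu> (x, y) = - ((m - 1) * (nu1 X Y / X) ^ 3 + (n - 1) * (nu2 X Y / Y) ^ 3 + (lam X Y) ^ 3)"
proof -
 obtain D where D: "(\<nu> has_derivative D) (at (x, y) within S)" by (rule unit_normal_derivative[OF \<nu> S])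
 define e where "e = (- nu2 X Y *\<^sub>R sgn x, nu1 X Y *\<^sub>R sgn y)"
 have ss: "sgn x \<bullet> sgn x = 1" "sgn y \<bullet> sgn y = 1" using xy by (simp_all add: sgn_inner_self)
 have n1: "(- nu2 X Y)\<^sup>2 + (nu1 X Y)\<^sup>2 = 1"
  using \<nu>_derivative(3)[OF S xy D] by (simp add: X_def Y_def add.commute)
 let ?R = "rot_form (sgn x) (sgn y) e (nu1 X Y / X) (nu2 X Y / Y) (lam X Y)"
 have T: "tangential_derivative S \<nu> (x, y) = ?R"
  using \<nu>_derivative(1)[OF S xy D] by (simp add: X_def Y_def e_def)
 note comp = rot_form_comp[OF ss e_def n1]
 note comm = rot_form_inner_commute[OF ss e_def n1]
 note tr = linear_trace_rot_form[OF ss e_def n1]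
 have neg: "?R (- v) = - ?R v" for v
  by (rule prod_eqI) (simp_all add: rot_form_def algebra_simps)
 have "norm_A_squared S \<nu> (x, y) = (\<Sum>b\<in>Basis. ?R b \<bullet> ?R b)"
  by (simp add: norm_A_squared_def shape_operator_def T power2_norm_eq_inner)
 also have "\<dots> = linear_trace (%v. ?R (?R v))"
  unfolding linear_trace_def by (rule sum.cong) (simp_all add: comm)
 also have "\<dots> = (m - 1) * (nu1 X Y / X)\<^sup>2 + (n - 1) * (nu2 X Y / Y)\<^sup>2 + (lam X Y)\<^sup>2"
  unfolding comp tr by (simp add: power2_eq_square dims mult.commute)
 finally show "norm_A_squared S \<nu> (x, y) = \<dots>" .
 have sh: "shape_operator S \<nu> (x, y) v = - ?R v" for v
  by (simp add: shape_operator_def T)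
 have "((shape_operator S \<nu> (x, y)) ^^ 3) = (%v. - ?R (?R (?R v)))"
  by (rule ext) (simp only: numeral_3_eq_3 funpow.simps o_apply id_apply sh neg minus_minus)
 hence "trace_A_cubed S \<nu> (x, y) = linear_trace (%v. - ?R (?R (?R v)))"
  by (simp add: trace_A_cubed_def)
 also have "\<dots> = - ((m - 1) * (nu1 X Y / X) ^ 3 + (n - 1) * (nu2 X Y / Y) ^ 3 + (lam X Y) ^ 3)"
  unfolding comp linear_trace_minus tr by (simp add: power3_eq_cube dims mult_ac)
 finally show "trace_A_cubed S \<nu> (x, y) = \<dots>" .
qed

end

section \<open>The differential equations of the profile curve\<close>

text \<open>The profile has unit normal \<open>(a, b)\<close> and unit tangent
  \<open>(- b, a)\<close>. The number \<open>k\<close> is the derivative of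
  \<open>t = |z|^2 / 2\<close> along this tangent, hence \<open>1 / k\<close> is the speed in the
  parameter \<open>t\<close>, and \<open>k0\<close> says that \<open>t\<close> has no critical
  point. The function \<open>l\<close> is the eigenvalue of \<open>d\<nu>\<close> along the
  profile.\<close>

locale profile_ode =
 fixes I :: "real set" and X Y a b k l :: "real => real" and m n :: real
 assumes I: "open I" "connected I" and mn: "m \<ge> 2" "n \<ge> 2"
  and pos: "\<And>t. t \<in> I ==> X t > 0 & Y t > 0"
  and level: "\<And>t. t \<in> I ==> (X t)\<^sup>2 + (Y t)\<^sup>2 = 2 * t"
  and unit: "\<And>t. t \<in> I ==> (a t)\<^sup>2 + (b t)\<^sup>2 = 1"
  and k: "\<And>t. t \<in> I ==> k t = - X t * b t + Y t * a t" and k0: "\<And>t. t \<in> I ==> k t ~= 0"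
  and l: "\<And>t. t \<in> I ==> l t = - (m - 1) * (a t / X t) - (n - 1) * (b t / Y t)"
  and dX: "\<And>t. t \<in> I ==> (X has_real_derivative - b t / k t) (at t)"
  and dY: "\<And>t. t \<in> I ==> (Y has_real_derivative a t / k t) (at t)"
  and da: "\<And>t. t \<in> I ==> (a has_real_derivative - l t * b t / k t) (at t)"
  and db: "\<And>t. t \<in> I ==> (b has_real_derivative l t * a t / k t) (at t)"
begin

text \<open>The support function. With \<open>k\<close> it gives the components of the position
  vector along the normal and the tangent, whence \<open>hk\<close>.\<close>

definition h :: "real => real" where "h t = X t * a t + Y t * b t"

lemma hk: "t \<in> I ==> (h t)\<^sup>2 + (k t)\<^sup>2 = 2 * t"
proof -
 assume t: "t \<in> I"
 have "(h t)\<^sup>2 + (k t)\<^sup>2 = ((X t)\<^sup>2 + (Y t)\<^sup>2) * ((a t)\<^sup>2 + (b t)\<^sup>2)"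
  unfolding k[OF t] h_def by (simp add: power2_eq_square algebra_simps)
 thus ?thesis using level[OF t] unit[OF t] by simp
qed

lemma t_pos: "t \<in> I ==> t > 0"
 using hk[of t] k0[of t] by (smt (verit) zero_less_power2 zero_le_power2)

lemma ab: "2 * t * a t = X t * h t + Y t * k t" "2 * t * b t = Y t * h t - X t * k t" if t: "t \<in> I"
 unfolding level[OF t, symmetric] k[OF t] h_def by (simp_all add: power2_eq_square algebra_simps)

lemma transform_on_I:
 assumes "t \<in> I" "(f has_real_derivative d) (at t)" "\<And>s. s \<in> I ==> f s = g s"
 shows "(g has_real_derivative d) (at t)"
 by (rule has_field_derivative_transform_within_open[OF assms(2) I(1) assms(1)]) (use assms(3) in auto)

lemma dh: "t \<in> I ==> (h has_real_derivative l t) (at t)"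
proof -
 assume t: "t \<in> I"
 have "(h has_real_derivative (- b t / k t) * a t + (- l t * b t / k t) * X t
   + ((a t / k t) * b t + (l t * a t / k t) * Y t)) (at t)"
  unfolding h_def[abs_def] by (intro DERIV_add DERIV_mult dX dY da db t)
 moreover have "(- b t / k t) * a t + (- l t * b t / k t) * X t
   + ((a t / k t) * b t + (l t * a t / k t) * Y t) = l t * (- X t * b t + Y t * a t) / k t"
  using k0[OF t] by (simp add: field_simps)
 ultimately show ?thesis using k[OF t] k0[OF t] by simp
qed

lemma dk: "t \<in> I ==> (k has_real_derivative (1 - l t * h t) / k t) (at t)"
proof (rule transform_on_I)
 assume t: "t \<in> I"
 have "((%t. - (X t * b t) + Y t * a t) has_real_derivative
   - ((- b t / k t) * b t + (l t * a t / k t) * X t) + ((a t / k t) * a t + (- l t * b t / k t) * Y t)) (at t)"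
  by (intro DERIV_add DERIV_minus DERIV_mult dX dY da db t)
 moreover have "- ((- b t / k t) * b t + (l t * a t / k t) * X t) + ((a t / k t) * a t + (- l t * b t / k t) * Y t)
   = ((a t)\<^sup>2 + (b t)\<^sup>2 - l t * h t) / k t"
  using k0[OF t] by (simp add: h_def field_simps power2_eq_square)
 ultimately show "((%t. - (X t * b t) + Y t * a t) has_real_derivative (1 - l t * h t) / k t) (at t)"
  using unit[OF t] by simp
qed (use k in auto)

lemma lh: "t \<in> I ==> - l t * h t = (m - 1) * ((a t)\<^sup>2 + Y t * a t * b t / X t) + (n - 1) * ((b t)\<^sup>2 + X t * a t * b t / Y t)"
 using pos[of t] by (simp add: l h_def field_simps power2_eq_square)

text \<open>The volume of the orbit up to a constant, so that \<open>w / \<bar>k\<bar>\<close> is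
  the area density in the parameter \<open>t\<close>.\<close>

definition w :: "real => real" where "w t = X t powr (m - 1) * Y t powr (n - 1)"

lemma w_pos: "t \<in> I ==> w t > 0" using pos[of t] by (simp add: w_def)

lemma dw: "t \<in> I ==> (w has_real_derivative w t * ((m - 1) * (- b t / X t) + (n - 1) * (a t / Y t)) / k t) (at t)"
proof -
 assume t: "t \<in> I"
 have 1: "((%t. X t powr (m - 1)) has_real_derivative (m - 1) * X t powr (m - 1 - 1) * (- b t / k t)) (at t)"
  by (rule DERIV_chain2[OF has_real_derivative_powr dX[OF t]]) (use pos[OF t] in simp)
 have 2: "((%t. Y t powr (n - 1)) has_real_derivative (n - 1) * Y t powr (n - 1 - 1) * (a t / k t)) (at t)"
  by (rule DERIV_chain2[OF has_real_derivative_powr dY[OF t]]) (use pos[OF t] in simp)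
 have 3: "X t powr (m - 1 - 1) = X t powr (m - 1) / X t" "Y t powr (n - 1 - 1) = Y t powr (n - 1) / Y t"
  using pos[OF t] by (simp_all add: powr_diff power2_eq_square)
 have "(w has_real_derivative ((m - 1) * (X t powr (m - 1) / X t) * (- b t / k t)) * Y t powr (n - 1)
   + ((n - 1) * (Y t powr (n - 1) / Y t) * (a t / k t)) * X t powr (m - 1)) (at t)"
  unfolding w_def[abs_def] using DERIV_mult[OF 1 2] unfolding 3 .
 moreover have "((m - 1) * (X t powr (m - 1) / X t) * (- b t / k t)) * Y t powr (n - 1)
   + ((n - 1) * (Y t powr (n - 1) / Y t) * (a t / k t)) * X t powr (m - 1)
   = w t * ((m - 1) * (- b t / X t) + (n - 1) * (a t / Y t)) / k t"
  using k0[OF t] by (simp add: w_def algebra_simps add_divide_distrib diff_divide_distrib)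
 ultimately show ?thesis by simp
qed

text \<open>The flux \<open>w k\<close> of \<open>\<nabla>|z|\<^sup>2/2\<close> has derivative \<open>N\<close> times the area element \<open>w/k\<close>; likewise the
 coordinate functions are harmonic on the hypersurface, up to their spherical part.\<close>

lemma d_flux: "t \<in> I ==> ((%t. w t * k t) has_real_derivative (m + n - 1) * (w t * k t) / (k t)\<^sup>2) (at t)"
proof -
 assume t: "t \<in> I"
 note p = pos[OF t]
 define A where "A = (m - 1) * (- b t / X t) + (n - 1) * (a t / Y t)"
 have "((%t. w t * k t) has_real_derivative (w t * A / k t) * k t + ((1 - l t * h t) / k t) * w t) (at t)"
  unfolding A_def by (intro DERIV_mult dw dk t)
 moreover have "A * k t - l t * h t = (m - 1) * ((a t)\<^sup>2 + (b t)\<^sup>2) + (n - 1) * ((a t)\<^sup>2 + (b t)\<^sup>2)"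
 proof -
  have "A * k t = (m - 1) * ((b t)\<^sup>2 - Y t * a t * b t / X t) + (n - 1) * ((a t)\<^sup>2 - X t * a t * b t / Y t)"
   unfolding A_def k[OF t] using p by (simp add: field_simps power2_eq_square)
  moreover have "(m - 1) * (B - U) + (n - 1) * (C - V) + ((m - 1) * (C + U) + (n - 1) * (B + V))
    = (m - 1) * (C + B) + (n - 1) * (C + B)" for B C U V
   by (simp add: algebra_simps)
  moreover have "A * k t - l t * h t = A * k t + - l t * h t" by simp
  ultimately show ?thesis unfolding lh[OF t] by presburger
 qed
 hence e: "A * k t - l t * h t = m + n - 2" using unit[OF t] by simp
 have "(w t * A / k t) * k t + ((1 - l t * h t) / k t) * w t = w t * ((A * k t - l t * h t + 1) / k t)"
  using k0[OF t] by (simp add: field_simps)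
 hence "(w t * A / k t) * k t + ((1 - l t * h t) / k t) * w t = w t * ((m + n - 1) / k t)"
  unfolding e by simp
 moreover have "w t * ((m + n - 1) / k t) = (m + n - 1) * (w t * k t) / (k t)\<^sup>2"
  using k0[OF t] by (simp add: power2_eq_square)
 ultimately show ?thesis by simp
qed

lemma d_flux_X: "t \<in> I ==> ((%t. w t * b t) has_real_derivative - (m - 1) * w t / (k t * X t)) (at t)"
proof -
 assume t: "t \<in> I"
 note p = pos[OF t]
 define A where "A = (m - 1) * (- b t / X t) + (n - 1) * (a t / Y t)"
 have "((%t. w t * b t) has_real_derivative (w t * A / k t) * b t + (l t * a t / k t) * w t) (at t)"
  unfolding A_def by (intro DERIV_mult dw db t)
 moreover have "A * b t + l t * a t = - (m - 1) * ((a t)\<^sup>2 + (b t)\<^sup>2) / X t"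
  unfolding A_def l[OF t] using p by (simp add: field_simps power2_eq_square)
 hence e: "A * b t + l t * a t = - (m - 1) / X t" using unit[OF t] by simp
 have "(w t * A / k t) * b t + (l t * a t / k t) * w t = w t * (A * b t + l t * a t) / k t"
  by (simp add: algebra_simps add_divide_distrib)
 hence "(w t * A / k t) * b t + (l t * a t / k t) * w t = - (m - 1) * w t / (k t * X t)"
  unfolding e by (simp add: mult.commute)
 ultimately show ?thesis by simp
qed

lemma d_flux_Y: "t \<in> I ==> ((%t. w t * a t) has_real_derivative (n - 1) * w t / (k t * Y t)) (at t)"
proof -
 assume t: "t \<in> I"
 note p = pos[OF t]
 define A where "A = (m - 1) * (- b t / X t) + (n - 1) * (a t / Y t)"
 have "((%t. w t * a t) has_real_derivative (w t * A / k t) * a t + (- l t * b t / k t) * w t) (at t)"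
  unfolding A_def by (intro DERIV_mult dw da t)
 moreover have "A * a t - l t * b t = (n - 1) * ((a t)\<^sup>2 + (b t)\<^sup>2) / Y t"
  unfolding A_def l[OF t] using p by (simp add: field_simps power2_eq_square)
 hence e: "A * a t - l t * b t = (n - 1) / Y t" using unit[OF t] by simp
 have "(w t * A / k t) * a t + (- l t * b t / k t) * w t = w t * (A * a t - l t * b t) / k t"
  by (simp add: algebra_simps add_divide_distrib diff_divide_distrib)
 hence "(w t * A / k t) * a t + (- l t * b t / k t) * w t = (n - 1) * w t / (k t * Y t)"
  unfolding e by (simp add: mult.commute)
 ultimately show ?thesis by simp
qed

lemma interval: "s \<in> I ==> t \<in> I ==> s \<le> r ==> r \<le> t ==> r \<in> I"
 using I(2) by (meson connectedD_interval)

lemma k_sign: "(\<forall>t\<in>I. k t > 0) \<or> (\<forall>t\<in>I. k t < 0)"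
proof (rule ccontr)
 assume "\<not> ?thesis"
 then obtain s t where st: "s \<in> I" "t \<in> I" "k s < 0" "k t > 0" using k0 by (metis linorder_neqE_linordered_idom)
 have "continuous_on I k" using dk DERIV_isCont continuous_at_imp_continuous_on by blast
 hence "connected (k ` I)" using I(2) connected_continuous_image by blast
 hence "0 \<in> k ` I" using st connectedD_interval[of "k ` I" "k s" "k t" 0] by auto
 thus False using k0 by auto
qed

lemma flux_square_mono: "(w s * k s)\<^sup>2 \<le> (w t * k t)\<^sup>2" if "s \<in> I" "t \<in> I" "s \<le> t"
proof (rule DERIV_nonneg_imp_nondecreasing[OF that(3)])
 fix r assume "s \<le> r" "r \<le> t"
 hence r: "r \<in> I" using interval that by blast
 have "((%t. (w t * k t)\<^sup>2) has_real_derivative 2 * (w r * k r) * ((m + n - 1) * (w r * k r) / (k r)\<^sup>2)) (at r)"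
  using DERIV_power[OF d_flux[OF r], of 2] by (simp add: algebra_simps)
 moreover have "2 * (w r * k r) * ((m + n - 1) * (w r * k r) / (k r)\<^sup>2) = 2 * (m + n - 1) * (w r)\<^sup>2"
  using k0[OF r] by (simp add: power2_eq_square)
 ultimately show "\<exists>y. DERIV (%t. (w t * k t)\<^sup>2) r :> y & 0 \<le> y" using mn by (intro exI conjI) auto
qed

text \<open>Meant for \<open>w * b\<close> and \<open>w * a\<close>, with \<open>Z\<close> equal to
  \<open>X\<close> or \<open>Y\<close>. The derivative has the sign of \<open>c / k\<close>, and
  \<open>k\<close> does not change sign on an interval.\<close>

lemma flux_mono:
 fixes f :: "real => real"
 assumes der: "\<And>t. t \<in> I ==> (f has_real_derivative c * w t / (k t * Z t)) (at t)"
  and Z: "\<And>t. t \<in> I ==> Z t > 0" and c: "c ~= 0"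
 shows "(\<forall>s\<in>I. \<forall>t\<in>I. s < t --> f s < f t) \<or> (\<forall>s\<in>I. \<forall>t\<in>I. s < t --> f t < f s)"
proof -
 have up: "\<forall>s\<in>I. \<forall>t\<in>I. s < t --> g s < g t"
  if g: "\<And>t. t \<in> I ==> (g has_real_derivative d t) (at t)" "\<And>t. t \<in> I ==> d t > 0" for g d :: "real => real"
 proof (intro ballI impI)
  fix s t assume st: "s \<in> I" "t \<in> I" "s < t"
  show "g s < g t"
   by (rule DERIV_pos_imp_increasing[OF st(3)]) (use g interval[OF st(1,2)] in blast)
 qed
 define d where "d t = c * w t / (k t * Z t)" for t
 have d: "(\<forall>t\<in>I. d t > 0) \<or> (\<forall>t\<in>I. d t < 0)"
  using k_sign
 proof
  assume k: "\<forall>t\<in>I. k t > 0"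
  hence "d t > 0 \<longleftrightarrow> c > 0" "d t < 0 \<longleftrightarrow> c < 0" if "t \<in> I" for t
   using that w_pos[OF that] Z[OF that] by (auto simp: d_def zero_less_divide_iff divide_less_0_iff
     zero_less_mult_iff mult_less_0_iff dest: less_asym)
  thus ?thesis using c by (cases "c > 0") auto
 next
  assume k: "\<forall>t\<in>I. k t < 0"
  hence "d t > 0 \<longleftrightarrow> c < 0" "d t < 0 \<longleftrightarrow> c > 0" if "t \<in> I" for t
   using that w_pos[OF that] Z[OF that] by (auto simp: d_def zero_less_divide_iff divide_less_0_iff
     zero_less_mult_iff mult_less_0_iff dest: less_asym)
  thus ?thesis using c by (cases "c > 0") auto
 qed
 thus ?thesis
 proof
  assume "\<forall>t\<in>I. d t > 0"
  thus ?thesis using up[of f d] der by (simp add: d_def)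
 next
  assume "\<forall>t\<in>I. d t < 0"
  moreover have "((%t. - f t) has_real_derivative - d t) (at t)" if "t \<in> I" for t
   using DERIV_minus[OF der[OF that]] by (simp add: d_def)
  ultimately have "\<forall>s\<in>I. \<forall>t\<in>I. s < t --> - f s < - f t"
   using up[of "%t. - f t" "%t. - d t"] by simp
  thus ?thesis by simp
 qed
qed

text \<open>A strictly monotone function changes sign at most once, so it has a constant sign near
  either end of an interval. Applied to \<open>w * a\<close> and \<open>w * b\<close> this makes
  \<open>Y\<close> and \<open>X\<close> monotone near the ends, which is the substitute for a bound
  on the curvature there.\<close>

lemma eventual_sign:
 fixes f :: "real => real"
 assumes mono: "(\<forall>s\<in>I. \<forall>t\<in>I. s < t --> f s < f t) \<or> (\<forall>s\<in>I. \<forall>t\<in>I. s < t --> f t < f s)"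
  and ab: "{c<..<d} \<subseteq> I" "c < d"
 shows "\<exists>c'\<ge>c. c' < d & ((\<forall>t\<in>{c'<..<d}. f t \<ge> 0) \<or> (\<forall>t\<in>{c'<..<d}. f t \<le> 0))"
  and "\<exists>d'\<le>d. c < d' & ((\<forall>t\<in>{c<..<d'}. f t \<ge> 0) \<or> (\<forall>t\<in>{c<..<d'}. f t \<le> 0))"
proof -
 have "\<exists>r\<in>{c<..<d}. (\<forall>t\<in>{c<..<d}. r < t --> f t \<ge> 0) \<or> (\<forall>t\<in>{c<..<d}. r < t --> f t \<le> 0)"
 proof (rule ccontr)
  assume N: "\<not> ?thesis"
  have N': "\<exists>t\<in>{c<..<d}. r < t & f t < 0" "\<exists>t\<in>{c<..<d}. r < t & f t > 0" if "r \<in> {c<..<d}" for r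
   using N that by (metis not_le)+
  obtain r0 where r0: "r0 \<in> {c<..<d}" using dense[OF ab(2)] by auto
  obtain t1 where t1: "t1 \<in> {c<..<d}" "r0 < t1" "f t1 < 0" using N'(1)[OF r0] by blast
  obtain t2 where t2: "t2 \<in> {c<..<d}" "r0 < t2" "f t2 > 0" using N'(2)[OF r0] by blast
  note t = t1 t2
  obtain t3 where t3: "t3 \<in> {c<..<d}" "t1 < t3" "f t3 > 0" using N'(2)[OF t1(1)] by blast
  obtain t4 where t4: "t4 \<in> {c<..<d}" "t2 < t4" "f t4 < 0" using N'(1)[OF t2(1)] by blast
  have "t1 \<in> I" "t2 \<in> I" "t3 \<in> I" "t4 \<in> I" using t t3 t4 ab(1) by auto
  have "f t1 < f t3 & f t2 < f t4 \<or> f t3 < f t1 & f t4 < f t2"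
   using mono \<open>t1 \<in> I\<close> \<open>t2 \<in> I\<close> \<open>t3 \<in> I\<close> \<open>t4 \<in> I\<close> t3(2) t4(2) by blast
  thus False using t t3 t4 by linarith
 qed
 then obtain r where "r \<in> {c<..<d}" "(\<forall>t\<in>{c<..<d}. r < t --> f t \<ge> 0) \<or> (\<forall>t\<in>{c<..<d}. r < t --> f t \<le> 0)"
  by blast
 thus "\<exists>c'\<ge>c. c' < d & ((\<forall>t\<in>{c'<..<d}. f t \<ge> 0) \<or> (\<forall>t\<in>{c'<..<d}. f t \<le> 0))"
  by (intro exI[of _ r]) auto
next
 have "\<exists>r\<in>{c<..<d}. (\<forall>t\<in>{c<..<d}. t < r --> f t \<ge> 0) \<or> (\<forall>t\<in>{c<..<d}. t < r --> f t \<le> 0)"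
 proof (rule ccontr)
  assume N: "\<not> ?thesis"
  have N': "\<exists>t\<in>{c<..<d}. t < r & f t < 0" "\<exists>t\<in>{c<..<d}. t < r & f t > 0" if "r \<in> {c<..<d}" for r
   using N that by (metis not_le)+
  obtain r0 where r0: "r0 \<in> {c<..<d}" using dense[OF ab(2)] by auto
  obtain t1 where t1: "t1 \<in> {c<..<d}" "t1 < r0" "f t1 < 0" using N'(1)[OF r0] by blast
  obtain t2 where t2: "t2 \<in> {c<..<d}" "t2 < r0" "f t2 > 0" using N'(2)[OF r0] by blast
  note t = t1 t2
  obtain t3 where t3: "t3 \<in> {c<..<d}" "t3 < t1" "f t3 > 0" using N'(2)[OF t1(1)] by blast
  obtain t4 where t4: "t4 \<in> {c<..<d}" "t4 < t2" "f t4 < 0" using N'(1)[OF t2(1)] by blast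
  have "t1 \<in> I" "t2 \<in> I" "t3 \<in> I" "t4 \<in> I" using t t3 t4 ab(1) by auto
  have "f t3 < f t1 & f t4 < f t2 \<or> f t1 < f t3 & f t2 < f t4"
   using mono \<open>t1 \<in> I\<close> \<open>t2 \<in> I\<close> \<open>t3 \<in> I\<close> \<open>t4 \<in> I\<close> t3(2) t4(2) by blast
  thus False using t t3 t4 by linarith
 qed
 then obtain r where "r \<in> {c<..<d}" "(\<forall>t\<in>{c<..<d}. t < r --> f t \<ge> 0) \<or> (\<forall>t\<in>{c<..<d}. t < r --> f t \<le> 0)"
  by blast
 thus "\<exists>d'\<le>d. c < d' & ((\<forall>t\<in>{c<..<d'}. f t \<ge> 0) \<or> (\<forall>t\<in>{c<..<d'}. f t \<le> 0))"
  by (intro exI[of _ r]) auto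
qed

end

section \<open>Strands: pieces of the profile curve over intervals of t\<close>

text \<open>Plane geometry behind differentiability in \<open>t\<close>. Here \<open>(x, y)\<close>
  is an increment between two points of the profile; flatness makes it almost orthogonal to the
  normal, and the quadratic expression is exactly the increment of \<open>|z|^2 / 2\<close>. Split
  into a normal part \<open>A\<close> and a tangential part \<open>B\<close>, the increment has
  small \<open>A\<close>, while \<open>k * B\<close> is the increment of \<open>t\<close> up to a
  small relative error.\<close>

lemma profile_difference:
 fixes x0 y0 n1 n2 k e :: real
 assumes n: "n1\<^sup>2 + n2\<^sup>2 = 1" and k: "k = - x0 * n2 + y0 * n1" "k ~= 0" and e: "e > 0"
 obtains eta where "eta > 0" "\<And>x y. \<bar>x * n1 + y * n2\<bar> \<le> eta * (\<bar>x\<bar> + \<bar>y\<bar>) ==> \<bar>x\<bar> + \<bar>y\<bar> \<le> eta ==>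
  \<bar>x + n2 / k * (x0 * x + y0 * y + (x\<^sup>2 + y\<^sup>2) / 2)\<bar> \<le> e * \<bar>x0 * x + y0 * y + (x\<^sup>2 + y\<^sup>2) / 2\<bar> &
  \<bar>y - n1 / k * (x0 * x + y0 * y + (x\<^sup>2 + y\<^sup>2) / 2)\<bar> \<le> e * \<bar>x0 * x + y0 * y + (x\<^sup>2 + y\<^sup>2) / 2\<bar>"
proof -
 define h where "h = x0 * n1 + y0 * n2"
 define H where "H = \<bar>h\<bar> + 1"
 have H: "H \<ge> 1" by (simp add: H_def)
 \<comment> \<open>Collects the losses of the chain below:
   \<open>\<bar>A\<bar> + \<bar>B - d / k\<bar>\<close> is at most
   \<open>eta * (1 + H / \<bar>k\<bar>) * s\<close>, and \<open>s\<close> is at most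
   \<open>8 / \<bar>k\<bar> * \<bar>d\<bar>\<close>.\<close>
 define Q where "Q = (1 + H / \<bar>k\<bar>) * (8 / \<bar>k\<bar>)"
 have Q: "Q > 0" unfolding Q_def using H k by (intro mult_pos_pos add_pos_nonneg) auto
 define eta where "eta = min (1 / 4) (min (\<bar>k\<bar> / (8 * H)) (e / Q))"
 have eta: "eta > 0" "eta \<le> 1 / 4" "4 * eta * H \<le> \<bar>k\<bar> / 2" "eta * Q \<le> e"
 proof -
  show "eta > 0" using H k e Q by (simp add: eta_def)
  show "eta \<le> 1 / 4" unfolding eta_def by linarith
  have "eta \<le> \<bar>k\<bar> / (8 * H)" unfolding eta_def by linarith
  thus "4 * eta * H \<le> \<bar>k\<bar> / 2" using H by (simp add: field_simps)
  have "eta \<le> e / Q" unfolding eta_def by linarith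
  thus "eta * Q \<le> e" using Q by (simp add: field_simps)
 qed
 have n12: "\<bar>n1\<bar> \<le> 1" "\<bar>n2\<bar> \<le> 1"
 proof -
  have "n1\<^sup>2 \<le> 1" "n2\<^sup>2 \<le> 1" using n zero_le_power2[of n1] zero_le_power2[of n2] by linarith+
  thus "\<bar>n1\<bar> \<le> 1" "\<bar>n2\<bar> \<le> 1" by (simp_all add: abs_square_le_1)
 qed
 show ?thesis
 proof (rule that[OF eta(1)])
  fix x y :: real
  define s where "s = \<bar>x\<bar> + \<bar>y\<bar>"
  define A where "A = x * n1 + y * n2"
  define B where "B = - x * n2 + y * n1"
  define d where "d = x0 * x + y0 * y + (x\<^sup>2 + y\<^sup>2) / 2"
  assume "\<bar>x * n1 + y * n2\<bar> \<le> eta * (\<bar>x\<bar> + \<bar>y\<bar>)" "\<bar>x\<bar> + \<bar>y\<bar> \<le> eta"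
  hence A: "\<bar>A\<bar> \<le> eta * s" and s: "s \<le> eta" by (simp_all add: A_def s_def)
  have s0: "s \<ge> 0" by (simp add: s_def)
  have xy: "x = A * n1 - B * n2" "y = A * n2 + B * n1"
  proof -
   have "A * n1 - B * n2 = x * (n1\<^sup>2 + n2\<^sup>2)" "A * n2 + B * n1 = y * (n1\<^sup>2 + n2\<^sup>2)"
    by (simp_all add: A_def B_def power2_eq_square algebra_simps)
   thus "x = A * n1 - B * n2" "y = A * n2 + B * n1" using n by simp_all
  qed
  have prod: "\<bar>u * n1\<bar> \<le> \<bar>u\<bar>" "\<bar>u * n2\<bar> \<le> \<bar>u\<bar>" for u
   using n12 by (simp_all add: abs_mult mult_left_le)
  have "\<bar>x\<bar> \<le> \<bar>A\<bar> + \<bar>B\<bar>" "\<bar>y\<bar> \<le> \<bar>A\<bar> + \<bar>B\<bar>"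
   using prod[of A] prod[of B] unfolding xy by linarith+
  hence "s \<le> 2 * \<bar>A\<bar> + 2 * \<bar>B\<bar>" by (simp add: s_def)
  moreover have "eta * s \<le> 1 / 4 * s" by (rule mult_right_mono[OF eta(2) s0])
  ultimately have sB: "s \<le> 4 * \<bar>B\<bar>" using A by linarith
  have hk: "x0 * x + y0 * y = h * A + k * B"
  proof -
   have "h * A + k * B = (x0 * x + y0 * y) * (n1\<^sup>2 + n2\<^sup>2)"
    by (simp add: h_def k A_def B_def power2_eq_square algebra_simps)
   thus ?thesis using n by simp
  qed
  have "x\<^sup>2 + y\<^sup>2 \<le> s\<^sup>2" by (simp add: s_def power2_sum)
  also have "s\<^sup>2 \<le> eta * s" using mult_right_mono[OF s s0] by (simp add: power2_eq_square)
  finally have sq: "x\<^sup>2 + y\<^sup>2 \<le> eta * s" .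
  have dk: "\<bar>d - k * B\<bar> \<le> eta * H * s"
  proof -
   have "d - k * B = h * A + (x\<^sup>2 + y\<^sup>2) / 2" by (simp add: d_def hk)
   hence "\<bar>d - k * B\<bar> \<le> \<bar>h * A\<bar> + \<bar>(x\<^sup>2 + y\<^sup>2) / 2\<bar>" by (simp only: abs_triangle_ineq)
   also have "\<bar>h * A\<bar> \<le> \<bar>h\<bar> * (eta * s)" unfolding abs_mult by (rule mult_left_mono[OF A]) simp
   also have "\<bar>(x\<^sup>2 + y\<^sup>2) / 2\<bar> \<le> eta * s" 
    using sq mult_nonneg_nonneg[OF less_imp_le[OF eta(1)] s0] by (simp add: add_nonneg_nonneg)
   finally show ?thesis by (simp add: H_def algebra_simps)
  qed
  have "eta * H * s \<le> eta * H * (4 * \<bar>B\<bar>)" using sB eta(1) H by (intro mult_left_mono) auto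
  also have "\<dots> = (4 * eta * H) * \<bar>B\<bar>" by simp
  also have "\<dots> \<le> \<bar>k\<bar> / 2 * \<bar>B\<bar>" by (rule mult_right_mono[OF eta(3)]) simp
  finally have "\<bar>d - k * B\<bar> \<le> \<bar>k\<bar> * \<bar>B\<bar> / 2" using dk by simp
  hence "\<bar>k\<bar> * \<bar>B\<bar> / 2 \<le> \<bar>d\<bar>" using abs_mult[of k B] by linarith
  hence "\<bar>B\<bar> \<le> 2 * \<bar>d\<bar> / \<bar>k\<bar>" using k(2) by (simp add: field_simps)
  hence sd: "s \<le> 8 / \<bar>k\<bar> * \<bar>d\<bar>" using sB by simp
  have Bd: "\<bar>B - d / k\<bar> \<le> eta * H * s / \<bar>k\<bar>"
  proof -
   have "B - d / k = - ((d - k * B) / k)" using k(2) by (simp add: field_simps)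
   hence "\<bar>B - d / k\<bar> = \<bar>d - k * B\<bar> / \<bar>k\<bar>" by (simp add: abs_divide abs_minus_commute)
   thus ?thesis using dk by (simp add: divide_right_mono)
  qed
  have fin: "\<bar>A\<bar> + \<bar>B - d / k\<bar> \<le> e * \<bar>d\<bar>"
  proof -
   have "\<bar>A\<bar> + \<bar>B - d / k\<bar> \<le> eta * (1 + H / \<bar>k\<bar>) * s" using A Bd by (simp add: algebra_simps)
   also have "\<dots> \<le> eta * (1 + H / \<bar>k\<bar>) * (8 / \<bar>k\<bar> * \<bar>d\<bar>)"
    using eta(1) H by (intro mult_left_mono[OF sd]) auto
   also have "\<dots> = eta * Q * \<bar>d\<bar>" by (simp add: Q_def)
   also have "\<dots> \<le> e * \<bar>d\<bar>" by (rule mult_right_mono[OF eta(4)]) simp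
   finally show ?thesis .
  qed
  have "x + n2 / k * d = A * n1 - (B - d / k) * n2" "y - n1 / k * d = A * n2 + (B - d / k) * n1"
   using xy by (simp_all add: algebra_simps)
  moreover have "\<bar>A * n1 - (B - d / k) * n2\<bar> \<le> \<bar>A\<bar> + \<bar>B - d / k\<bar>"
   "\<bar>A * n2 + (B - d / k) * n1\<bar> \<le> \<bar>A\<bar> + \<bar>B - d / k\<bar>"
   using prod[of A] prod[of "B - d / k"] by linarith+
  ultimately show "\<bar>x + n2 / k * (x0 * x + y0 * y + (x\<^sup>2 + y\<^sup>2) / 2)\<bar> \<le> e * \<bar>x0 * x + y0 * y + (x\<^sup>2 + y\<^sup>2) / 2\<bar> &
  \<bar>y - n1 / k * (x0 * x + y0 * y + (x\<^sup>2 + y\<^sup>2) / 2)\<bar> \<le> e * \<bar>x0 * x + y0 * y + (x\<^sup>2 + y\<^sup>2) / 2\<bar>"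
   using fin unfolding d_def[symmetric] by linarith
 qed
qed

context profile_surface
begin

definition emb :: "real => real => (real^'m) \<times> (real^'n)" where
 "emb X Y = (X *\<^sub>R e1, Y *\<^sub>R f1)"

definition prof :: "(real \<times> real) set" where
 "prof = {(X, Y). X > 0 & Y > 0 & emb X Y \<in> S}"

definition kk :: "real => real => real" where "kk X Y = - X * nu2 X Y + Y * nu1 X Y"

text \<open>Only continuity is demanded; differentiability in \<open>t\<close> is a consequence of
  the flatness of \<open>S\<close>. This makes strands easy to construct, to glue and to
  compare.\<close>

definition strand :: "real set => (real => real) => (real => real) => bool" where
 "strand I X Y \<longleftrightarrow> open I & connected I & continuous_on I X & continuous_on I Y &
  (\<forall>t\<in>I. (X t, Y t) \<in> prof & (X t)\<^sup>2 + (Y t)\<^sup>2 = 2 * t & kk (X t) (Y t) ~= 0)"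

lemma profD: "(X, Y) \<in> prof ==> X > 0 & Y > 0 & emb X Y \<in> S" by (simp add: prof_def)

lemma mem_S_iff_prof:
 assumes "x ~= 0" "y ~= 0"
 shows "(x, y) \<in> S \<longleftrightarrow> (norm x, norm y) \<in> prof"
proof -
 have "norm (norm x *\<^sub>R e1) = norm x" "norm (norm y *\<^sub>R f1) = norm y" using unit by simp_all
 thus ?thesis using assms mem_S_norms[of x "norm x *\<^sub>R e1" y "norm y *\<^sub>R f1"]
   mem_S_norms[of "norm x *\<^sub>R e1" x "norm y *\<^sub>R f1" y]
  by (auto simp: prof_def emb_def)
qed

lemma emb_nz: "X > 0 ==> X *\<^sub>R e1 ~= 0" "Y > 0 ==> Y *\<^sub>R f1 ~= 0" using unit by auto

lemma emb_norm: "X > 0 ==> norm (X *\<^sub>R e1) = X" "Y > 0 ==> norm (Y *\<^sub>R f1) = Y" using unit by auto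

lemma emb_sgn: "X > 0 ==> sgn (X *\<^sub>R e1) = e1" "Y > 0 ==> sgn (Y *\<^sub>R f1) = f1"
 using unit by (auto simp: sgn_div_norm)

lemma prof_\<nu>: "\<nu> (emb X Y) = (nu1 X Y *\<^sub>R e1, nu2 X Y *\<^sub>R f1)" if "(X, Y) \<in> prof"
proof -
 have "X > 0" "Y > 0" "emb X Y \<in> S" using profD[OF that] by auto
 from \<nu>_orbit[OF this(3)[unfolded emb_def] emb_nz(1)[OF this(1)] emb_nz(2)[OF this(2)]]
  emb_norm(1)[OF this(1)] emb_norm(2)[OF this(2)] emb_sgn(1)[OF this(1)] emb_sgn(2)[OF this(2)]
 show ?thesis by (simp add: emb_def)
qed

lemma emb_diff: "emb X Y - emb X' Y' = ((X - X') *\<^sub>R e1, (Y - Y') *\<^sub>R f1)"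
 by (simp add: emb_def scaleR_left_diff_distrib)

lemma prof_unit: "(X, Y) \<in> prof ==> (nu1 X Y)\<^sup>2 + (nu2 X Y)\<^sup>2 = 1"
 using norm_\<nu>[of "emb X Y"] profD[of X Y] prof_\<nu>[of X Y] unit_inner
 by (simp add: inner_prod_def power2_eq_square)

lemma continuous_emb: "continuous_on A X ==> continuous_on A Y ==> continuous_on A (%t. emb (X t) (Y t))"
 unfolding emb_def by (intro continuous_intros)

lemma continuous_nu:
 assumes "continuous_on A X" "continuous_on A Y" "\<And>t. t \<in> A ==> emb (X t) (Y t) \<in> S"
 shows "continuous_on A (%t. nu1 (X t) (Y t))" "continuous_on A (%t. nu2 (X t) (Y t))"
proof -
 have "continuous_on A (%t. \<nu> (emb (X t) (Y t)))"
  by (rule continuous_on_compose2[OF unit_normal_continuous[OF \<nu>] continuous_emb[OF assms(1,2)]]) (use assms in auto)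
 thus "continuous_on A (%t. nu1 (X t) (Y t))" "continuous_on A (%t. nu2 (X t) (Y t))"
  unfolding nu1_def nu2_def emb_def by (auto intro!: continuous_intros)
qed

lemma continuous_kk:
 assumes "continuous_on A X" "continuous_on A Y" "\<And>t. t \<in> A ==> emb (X t) (Y t) \<in> S"
 shows "continuous_on A (%t. kk (X t) (Y t))"
 unfolding kk_def by (intro continuous_intros assms continuous_nu)

lemma prof_flat:
 assumes p: "(X0, Y0) \<in> prof" and e: "e > 0"
 obtains d where "d > 0" "\<And>X Y. emb X Y \<in> S ==> \<bar>X - X0\<bar> + \<bar>Y - Y0\<bar> < d ==>
  \<bar>(X - X0) * nu1 X0 Y0 + (Y - Y0) * nu2 X0 Y0\<bar> \<le> e * (\<bar>X - X0\<bar> + \<bar>Y - Y0\<bar>)"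
proof -
 have pS: "emb X0 Y0 \<in> S" using profD[OF p] by simp
 obtain d where d: "d > 0" "\<And>q. q \<in> S ==> norm (q - emb X0 Y0) < d ==>
   \<bar>(q - emb X0 Y0) \<bullet> \<nu> (emb X0 Y0)\<bar> \<le> e * norm (q - emb X0 Y0)"
  using nrm[OF pS] e unfolding normal_at_def by meson
 show ?thesis
 proof (rule that[OF d(1)])
  fix X Y assume XY: "emb X Y \<in> S" "\<bar>X - X0\<bar> + \<bar>Y - Y0\<bar> < d"
  have nle: "norm (emb X Y - emb X0 Y0) \<le> \<bar>X - X0\<bar> + \<bar>Y - Y0\<bar>"
   unfolding emb_diff by (rule order_trans[OF norm_Pair_le]) (simp add: unit)
  have "(emb X Y - emb X0 Y0) \<bullet> \<nu> (emb X0 Y0) = (X - X0) * nu1 X0 Y0 + (Y - Y0) * nu2 X0 Y0"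
   unfolding emb_diff prof_\<nu>[OF p] by (simp add: inner_prod_def unit_inner)
  with d(2)[OF XY(1)] nle XY(2)
  have "\<bar>(X - X0) * nu1 X0 Y0 + (Y - Y0) * nu2 X0 Y0\<bar> \<le> e * norm (emb X Y - emb X0 Y0)" by simp
  also have "\<dots> \<le> e * (\<bar>X - X0\<bar> + \<bar>Y - Y0\<bar>)" using nle e by simp
  finally show "\<bar>(X - X0) * nu1 X0 Y0 + (Y - Y0) * nu2 X0 Y0\<bar> \<le> e * (\<bar>X - X0\<bar> + \<bar>Y - Y0\<bar>)" .
 qed
qed

lemma strandD:
 assumes "strand I X Y" "t \<in> I"
 shows "(X t, Y t) \<in> prof" "(X t)\<^sup>2 + (Y t)\<^sup>2 = 2 * t" "kk (X t) (Y t) ~= 0" "X t > 0" "Y t > 0" "emb (X t) (Y t) \<in> S"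
 using assms profD[of "X t" "Y t"] by (auto simp: strand_def)

text \<open>By the level condition the quadratic expression of \<open>profile_difference\<close>
  equals \<open>s - t\<close> along a strand. Flatness of \<open>S\<close> at the point then is
  differentiability in the parameter, with derivative the tangent divided by
  \<open>k\<close>.\<close>

lemma strand_deriv:
 assumes st: "strand I X Y" and t: "t \<in> I"
 shows "(X has_real_derivative - nu2 (X t) (Y t) / kk (X t) (Y t)) (at t)"
  and "(Y has_real_derivative nu1 (X t) (Y t) / kk (X t) (Y t)) (at t)"
proof -
 note p = strandD[OF st t]
 have cont: "isCont X t" "isCont Y t"
  using st t by (auto simp: strand_def continuous_on_eq_continuous_at)
 have "\<exists>d>0. \<forall>s. \<bar>s - t\<bar> < d -->
   \<bar>X s - X t + nu2 (X t) (Y t) / kk (X t) (Y t) * (s - t)\<bar> \<le> e * \<bar>s - t\<bar> &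
   \<bar>Y s - Y t - nu1 (X t) (Y t) / kk (X t) (Y t) * (s - t)\<bar> \<le> e * \<bar>s - t\<bar>" if e: "e > 0" for e
 proof -
  obtain eta where eta: "eta > 0" and *: "\<And>x y. \<bar>x * nu1 (X t) (Y t) + y * nu2 (X t) (Y t)\<bar> \<le> eta * (\<bar>x\<bar> + \<bar>y\<bar>) ==> \<bar>x\<bar> + \<bar>y\<bar> \<le> eta ==>
  \<bar>x + nu2 (X t) (Y t) / kk (X t) (Y t) * (X t * x + Y t * y + (x\<^sup>2 + y\<^sup>2) / 2)\<bar> \<le> e * \<bar>X t * x + Y t * y + (x\<^sup>2 + y\<^sup>2) / 2\<bar> &
  \<bar>y - nu1 (X t) (Y t) / kk (X t) (Y t) * (X t * x + Y t * y + (x\<^sup>2 + y\<^sup>2) / 2)\<bar> \<le> e * \<bar>X t * x + Y t * y + (x\<^sup>2 + y\<^sup>2) / 2\<bar>"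
   using prof_unit[OF p(1)] kk_def p(3) e by (rule profile_difference) blast
  obtain d where d: "d > 0" "\<And>X' Y'. emb X' Y' \<in> S ==> \<bar>X' - X t\<bar> + \<bar>Y' - Y t\<bar> < d ==>
   \<bar>(X' - X t) * nu1 (X t) (Y t) + (Y' - Y t) * nu2 (X t) (Y t)\<bar> \<le> eta * (\<bar>X' - X t\<bar> + \<bar>Y' - Y t\<bar>)"
   using p(1) eta by (rule prof_flat) blast
  have "isCont (%s. \<bar>X s - X t\<bar> + \<bar>Y s - Y t\<bar>) t" by (intro continuous_intros cont)
  hence "((%s. \<bar>X s - X t\<bar> + \<bar>Y s - Y t\<bar>) \<longlongrightarrow> 0) (at t)" by (simp add: isCont_def)
  from tendstoD[OF this, of "min d eta"] obtain d1 where d1: "d1 > 0"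
   "\<And>s. s ~= t ==> dist s t < d1 ==> \<bar>X s - X t\<bar> + \<bar>Y s - Y t\<bar> < min d eta"
   using d(1) eta unfolding eventually_at by auto
  obtain d2 where d2: "d2 > 0" "ball t d2 \<subseteq> I" using st t openE by (metis strand_def)
  show ?thesis
  proof (intro exI[of _ "min d1 d2"] conjI[OF _ allI[OF impI]])
   show "min d1 d2 > 0" using d1 d2 by simp
   fix s assume s: "\<bar>s - t\<bar> < min d1 d2"
   hence sI: "s \<in> I" using d2 by (auto simp: dist_real_def subset_iff abs_minus_commute)
   have small: "\<bar>X s - X t\<bar> + \<bar>Y s - Y t\<bar> < min d eta"
    using d1(2)[of s] s d(1) eta by (cases "s = t") (auto simp: dist_real_def)
   have eq: "X t * (X s - X t) + Y t * (Y s - Y t) + ((X s - X t)\<^sup>2 + (Y s - Y t)\<^sup>2) / 2 = s - t"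
   proof -
    have "2 * (X t * (X s - X t) + Y t * (Y s - Y t)) + ((X s - X t)\<^sup>2 + (Y s - Y t)\<^sup>2)
     = ((X s)\<^sup>2 + (Y s)\<^sup>2) - ((X t)\<^sup>2 + (Y t)\<^sup>2)"
     by (simp add: power2_eq_square algebra_simps)
    thus ?thesis using p(2) strandD(2)[OF st sI] by (simp add: field_simps)
   qed
   have "\<bar>X s - X t\<bar> + \<bar>Y s - Y t\<bar> < d" "\<bar>X s - X t\<bar> + \<bar>Y s - Y t\<bar> \<le> eta" using small by auto
   from *[OF d(2)[OF strandD(6)[OF st sI] this(1)] this(2)]
   show "\<bar>X s - X t + nu2 (X t) (Y t) / kk (X t) (Y t) * (s - t)\<bar> \<le> e * \<bar>s - t\<bar> &
    \<bar>Y s - Y t - nu1 (X t) (Y t) / kk (X t) (Y t) * (s - t)\<bar> \<le> e * \<bar>s - t\<bar>"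
    unfolding eq .
  qed
 qed
 note main = this
 show "(X has_real_derivative - nu2 (X t) (Y t) / kk (X t) (Y t)) (at t)"
  unfolding has_field_derivative_def has_derivative_at_alt
 proof (intro conjI allI impI bounded_linear_mult_right)
  fix e :: real assume "e > 0"
  from main[OF this] show "\<exists>d>0. \<forall>y. norm (y - t) < d -->
    norm (X y - X t - - nu2 (X t) (Y t) / kk (X t) (Y t) * (y - t)) \<le> e * norm (y - t)"
   by auto
 qed
 show "(Y has_real_derivative nu1 (X t) (Y t) / kk (X t) (Y t)) (at t)"
  unfolding has_field_derivative_def has_derivative_at_alt
 proof (intro conjI allI impI bounded_linear_mult_right)
  fix e :: real assume "e > 0"
  from main[OF this] show "\<exists>d>0. \<forall>y. norm (y - t) < d -->
    norm (Y y - Y t - nu1 (X t) (Y t) / kk (X t) (Y t) * (y - t)) \<le> e * norm (y - t)"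
   by auto
 qed
qed

lemma strand_nu_deriv:
 assumes st: "strand I X Y" and t: "t \<in> I"
 defines "a \<equiv> %t. nu1 (X t) (Y t)" and "b \<equiv> %t. nu2 (X t) (Y t)"
  and "k \<equiv> %t. kk (X t) (Y t)" and "l \<equiv> %t. lam (X t) (Y t)"
 shows "(a has_real_derivative - l t * b t / k t) (at t)"
  and "(b has_real_derivative l t * a t / k t) (at t)"
proof -
 note p = strandD[OF st t]
 obtain D where D: "(\<nu> has_derivative D) (at (emb (X t) (Y t)) within S)"
  by (rule unit_normal_derivative[OF \<nu> p(6)])
 have De: "D (- b t *\<^sub>R e1, a t *\<^sub>R f1) = l t *\<^sub>R (- b t *\<^sub>R e1, a t *\<^sub>R f1)"
  using \<nu>_derivative(2)[OF p(6)[unfolded emb_def] emb_nz(1)[OF p(4)] emb_nz(2)[OF p(5)] D[unfolded emb_def]]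
   emb_norm(1)[OF p(4)] emb_norm(2)[OF p(5)] emb_sgn(1)[OF p(4)] emb_sgn(2)[OF p(5)]
  by (simp add: a_def b_def l_def)
 define gm where "gm s = emb (X (t + s)) (Y (t + s))" for s
 have dX: "((%s. X (t + s)) has_vector_derivative - b t / k t) (at 0)"
  and dY: "((%s. Y (t + s)) has_vector_derivative a t / k t) (at 0)"
  using strand_deriv[OF st t] DERIV_shift[of X _ 0 t] DERIV_shift[of Y _ 0 t]
  by (simp_all add: a_def b_def k_def has_real_derivative_iff_has_vector_derivative[symmetric] add.commute)
 have "(gm has_vector_derivative ((- b t / k t) *\<^sub>R e1, (a t / k t) *\<^sub>R f1)) (at 0)"
  unfolding gm_def emb_def
  by (intro has_vector_derivative_Pair bounded_linear.has_vector_derivative[OF bounded_linear_scaleR_left dX]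
    bounded_linear.has_vector_derivative[OF bounded_linear_scaleR_left dY])
 hence dgm: "(gm has_vector_derivative (1 / k t) *\<^sub>R (- b t *\<^sub>R e1, a t *\<^sub>R f1)) (at 0)" by simp
 have "\<forall>\<^sub>F s in at 0. gm s \<in> S"
 proof -
  obtain d where d: "d > 0" "ball t d \<subseteq> I" using st t openE by (metis strand_def)
  have "t + s \<in> I" if "dist s 0 < d" for s using d(2) that by (auto simp: subset_iff dist_real_def)
  thus ?thesis unfolding eventually_at gm_def using d(1) strandD(6)[OF st] by blast
 qed
 from has_vector_derivative_along_curve[OF D p(6) _ this dgm]
 have d\<nu>: "((%s. \<nu> (gm s)) has_vector_derivative D ((1 / k t) *\<^sub>R (- b t *\<^sub>R e1, a t *\<^sub>R f1))) (at 0)"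
  by (simp add: gm_def)
 interpret D: bounded_linear D using D by (rule has_derivative_bounded_linear)
 have d\<nu>: "((%s. \<nu> (gm s)) has_vector_derivative (1 / k t) *\<^sub>R (l t *\<^sub>R (- b t *\<^sub>R e1, a t *\<^sub>R f1))) (at 0)"
  using d\<nu> unfolding D.scaleR De .
 from bounded_linear.has_vector_derivative[OF bounded_linear_inner_left this, of "(e1, 0)"]
  bounded_linear.has_vector_derivative[OF bounded_linear_inner_left this, of "(0, f1)"]
 have "((%s. a (t + s)) has_vector_derivative - l t * b t / k t) (at 0)"
  "((%s. b (t + s)) has_vector_derivative l t * a t / k t) (at 0)"
  by (simp_all add: a_def b_def nu1_def nu2_def gm_def emb_def inner_prod_def unit_inner)
 thus "(a has_real_derivative - l t * b t / k t) (at t)" "(b has_real_derivative l t * a t / k t) (at t)"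
  using DERIV_shift[of a _ 0 t] DERIV_shift[of b _ 0 t]
  by (simp_all add: has_real_derivative_iff_has_vector_derivative[symmetric] add.commute)
qed

lemma strand_profile_ode:
 assumes st: "strand I X Y"
 shows "profile_ode I X Y (%t. nu1 (X t) (Y t)) (%t. nu2 (X t) (Y t)) (%t. kk (X t) (Y t)) (%t. lam (X t) (Y t)) m n"
proof
 show "open I" "connected I" using st by (auto simp: strand_def)
 show "m \<ge> 2" "n \<ge> 2" using mn dims by auto
qed (use strandD[OF st] strand_deriv[OF st] strand_nu_deriv[OF st] prof_unit in \<open>auto simp: kk_def lam_def\<close>)

end

lemma polar_quadrant:
 fixes x y :: real
 assumes "x > 0" "y > 0"
 shows "sqrt (x\<^sup>2 + y\<^sup>2) * cos (arctan (y / x)) = x" "sqrt (x\<^sup>2 + y\<^sup>2) * sin (arctan (y / x)) = y"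
  "0 < arctan (y / x)" "arctan (y / x) < pi / 2"
proof -
 have 1: "1 + (y / x)\<^sup>2 = (x\<^sup>2 + y\<^sup>2) / x\<^sup>2" using assms by (simp add: field_simps)
 have "sqrt (1 + (y / x)\<^sup>2) = sqrt (x\<^sup>2 + y\<^sup>2) / x"
  unfolding 1 using assms by (simp add: real_sqrt_divide)
 moreover have "sqrt (x\<^sup>2 + y\<^sup>2) > 0" using assms by (simp add: add_pos_pos)
 ultimately show "sqrt (x\<^sup>2 + y\<^sup>2) * cos (arctan (y / x)) = x" "sqrt (x\<^sup>2 + y\<^sup>2) * sin (arctan (y / x)) = y"
  using assms by (simp_all add: cos_arctan sin_arctan)
 show "0 < arctan (y / x)" "arctan (y / x) < pi / 2" using assms arctan_ubound by simp_all
qed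

section \<open>Intrinsic distance along arcs of the profile\<close>

text \<open>The intrinsic distance dominates the Euclidean one, so an intrinsic limit is also the
  Euclidean limit. The speed is compared with its component in the direction \<open>v\<close> of the
  chord, whose integral is the length of the chord; if the length is infinite there is nothing to
  show.\<close>

lemma curve_length_ge_dist:
 fixes gm :: "real => 'a::euclidean_space"
 assumes "valid_path gm"
 shows "ennreal (dist (gm 0) (gm 1)) \<le> curve_length gm"
proof (cases "curve_length gm = \<infinity>")
 case False
 obtain E where E: "finite E" "gm C1_differentiable_on {0..1} - E" and cont: "continuous_on {0..1} gm"
  using assms unfolding valid_path_def piecewise_C1_differentiable_on_def by auto
 define D where "D u = vector_derivative gm (at u)" for u
 have der: "(gm has_vector_derivative D u) (at u)" if "u \<in> {0..1} - E" for u
  using E(2) that unfolding C1_differentiable_on_eq D_def by (auto simp: vector_derivative_works)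
 have cD: "continuous_on ({0..1} - E) D" using E(2) unfolding C1_differentiable_on_eq D_def by auto
 define g where "g u = (if u \<in> {0..1} - E then norm (D u) else 0)" for u
 have "{0..1::real} - E \<in> sets borel"
  using E(1) by (intro sets.Diff borel_closed finite_imp_closed closed_atLeastAtMost)
 hence mg: "g \<in> borel_measurable borel"
  unfolding g_def[abs_def]
  by (rule borel_measurable_continuous_on_if) (use cD in \<open>auto intro!: continuous_intros\<close>)
 \<comment> \<open>At the break points the value of \<open>vector_derivative\<close> carries no
   information; they form a null set.\<close>
 have "AE u in lborel. u \<notin> E"
  using E(1) by (intro AE_not_in finite_imp_null_set_lborel)
 hence ae: "AE u in lborel. ennreal (norm (vector_derivative gm (at u))) * indicator {0..1} u = ennreal (g u)"
  by eventually_elim (auto simp: g_def D_def indicator_def)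
 have len: "curve_length gm = (\<integral>\<^sup>+u. ennreal (g u) \<partial>lborel)"
  unfolding curve_length_def by (rule nn_integral_cong_AE[OF ae])
 have g0: "g u \<ge> 0" for u by (simp add: g_def)
 have int: "integrable lborel g"
  by (rule integrableI_nonneg) (use mg False len g0 in \<open>auto simp: less_top[symmetric]\<close>)
 have Ig: "(g has_integral (integral\<^sup>L lborel g)) UNIV" by (rule has_integral_integral_lborel[OF int])
 define v where "v = sgn (gm 1 - gm 0)"
 have v1: "norm v \<le> 1" by (simp add: v_def norm_sgn)
 have "((%u. D u \<bullet> v) has_integral (gm 1 \<bullet> v - gm 0 \<bullet> v)) {0..1}"
 proof (rule fundamental_theorem_of_calculus_interior_strong[OF E(1)])
  show "((%u. gm u \<bullet> v) has_vector_derivative D u \<bullet> v) (at u)" if "u \<in> {0<..<1} - E" for u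
   by (rule bounded_linear.has_vector_derivative[OF bounded_linear_inner_left der]) (use that in auto)
 qed (auto intro!: continuous_intros cont)
 hence "((%u. if u \<in> E then 0 else D u \<bullet> v) has_integral (gm 1 \<bullet> v - gm 0 \<bullet> v)) {0..1}"
  by (rule has_integral_spike_finite[OF E(1), rotated]) auto
 hence restr: "((%u. if u \<in> {0..1} then if u \<in> E then 0 else D u \<bullet> v else 0) has_integral (gm 1 \<bullet> v - gm 0 \<bullet> v)) UNIV"
  unfolding has_integral_restrict_UNIV .
 have "gm 1 \<bullet> v - gm 0 \<bullet> v \<le> integral\<^sup>L lborel g"
 proof (rule has_integral_le[OF restr Ig])
  fix u :: real
  have "D u \<bullet> v \<le> norm (D u)"
   using norm_cauchy_schwarz[of "D u" v] mult_left_mono[OF v1, of "norm (D u)"] by simp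
  thus "(if u \<in> {0..1} then if u \<in> E then 0 else D u \<bullet> v else 0) \<le> g u" by (simp add: g_def)
 qed
 moreover have "gm 1 \<bullet> v - gm 0 \<bullet> v = dist (gm 0) (gm 1)"
 proof -
  have "gm 1 \<bullet> v - gm 0 \<bullet> v = (gm 1 - gm 0) \<bullet> v" by (simp add: inner_diff_left)
  also have "\<dots> = norm (gm 1 - gm 0)"
   by (cases "gm 1 = gm 0") (simp_all add: v_def sgn_div_norm dot_square_norm power2_eq_square)
  finally show ?thesis by (simp add: dist_norm norm_minus_commute)
 qed
 moreover have "curve_length gm = ennreal (integral\<^sup>L lborel g)"
  unfolding len by (rule nn_integral_eq_integral[OF int]) (simp add: g0)
 ultimately show ?thesis by (simp add: ennreal_leI)
qed simp

lemma geodesic_dist_ge_dist: "ennreal (dist x y) \<le> geodesic_dist S x y"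
 unfolding geodesic_dist_def
proof (rule INF_greatest)
 fix gm assume "gm \<in> {gm. valid_path gm & path_image gm \<subseteq> S & pathstart gm = x & pathfinish gm = y}"
 thus "ennreal (dist x y) \<le> curve_length gm"
  using curve_length_ge_dist[of gm] by (auto simp: pathstart_def pathfinish_def)
qed

lemma monotone_bounded_limit:
 fixes X :: "real => real"
 assumes cd: "c < d" and bound: "\<And>t. t \<in> {c<..<d} ==> \<bar>X t\<bar> \<le> B"
  and mono: "(\<forall>s\<in>{c<..<d}. \<forall>t\<in>{c<..<d}. s \<le> t --> X s \<le> X t) \<or> (\<forall>s\<in>{c<..<d}. \<forall>t\<in>{c<..<d}. s \<le> t --> X t \<le> X s)"
 obtains L L' where "(X \<longlongrightarrow> L) (at_left d)" "(X \<longlongrightarrow> L') (at_right c)"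
proof -
 let ?T = "{c<..<d}"
 have ev: "\<forall>\<^sub>F t in at_left d. t \<in> {s<..<d}" if "s < d" for s
  using that by (auto simp: eventually_at_left[OF that])
 have ev': "\<forall>\<^sub>F t in at_right c. t \<in> {c<..<s}" if "c < s" for s
  using that by (auto simp: eventually_at_right[OF that])
 have up: "(Z \<longlongrightarrow> Sup (Z ` ?T)) (at_left d) & (Z \<longlongrightarrow> Inf (Z ` ?T)) (at_right c)"
  if Z: "\<forall>s\<in>?T. \<forall>t\<in>?T. s \<le> t --> Z s \<le> Z t" "\<And>t. t \<in> ?T ==> \<bar>Z t\<bar> \<le> B" for Z :: "real => real"
 proof
  have ne: "Z ` ?T ~= {}" using dense[OF cd] by auto
  have bdd: "bdd_above (Z ` ?T)" "bdd_below (Z ` ?T)"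
   by (rule bdd_aboveI2[of _ _ B], use Z(2) in fastforce, rule bdd_belowI2[of _ "- B"], use Z(2) in fastforce)
  show "(Z \<longlongrightarrow> Sup (Z ` ?T)) (at_left d)"
  proof (rule order_tendstoI)
   fix a assume "a < Sup (Z ` ?T)"
   then obtain s where s: "s \<in> ?T" "a < Z s" using less_cSup_iff[OF ne bdd(1)] by auto
   show "\<forall>\<^sub>F t in at_left d. a < Z t"
   proof (rule eventually_mono[OF ev[of s]])
    show "s < d" using s by simp
    fix t assume "t \<in> {s<..<d}"
    hence "Z s \<le> Z t" using Z(1) s(1) by auto
    thus "a < Z t" using s by simp
   qed
  next
   fix a assume a: "Sup (Z ` ?T) < a"
   show "\<forall>\<^sub>F t in at_left d. Z t < a"
   proof (rule eventually_mono[OF ev[OF cd]])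
    fix t assume "t \<in> ?T"
    hence "Z t \<le> Sup (Z ` ?T)" by (rule cSUP_upper[OF _ bdd(1)])
    thus "Z t < a" using a by simp
   qed
  qed
  show "(Z \<longlongrightarrow> Inf (Z ` ?T)) (at_right c)"
  proof (rule order_tendstoI)
   fix a assume "Inf (Z ` ?T) < a"
   then obtain s where s: "s \<in> ?T" "Z s < a" using cInf_less_iff[OF ne bdd(2)] by auto
   show "\<forall>\<^sub>F t in at_right c. Z t < a"
   proof (rule eventually_mono[OF ev'[of s]])
    show "c < s" using s by simp
    fix t assume "t \<in> {c<..<s}"
    hence "Z t \<le> Z s" using Z(1) s(1) by auto
    thus "Z t < a" using s by simp
   qed
  next
   fix a assume a: "a < Inf (Z ` ?T)"
   show "\<forall>\<^sub>F t in at_right c. a < Z t"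
   proof (rule eventually_mono[OF ev'[OF cd]])
    fix t assume "t \<in> ?T"
    hence "Inf (Z ` ?T) \<le> Z t" by (rule cINF_lower[OF bdd(2)])
    thus "a < Z t" using a by simp
   qed
  qed
 qed
 from mono show ?thesis
 proof
  assume "\<forall>s\<in>?T. \<forall>t\<in>?T. s \<le> t --> X s \<le> X t"
  from up[OF this bound] that show ?thesis by blast
 next
  assume "\<forall>s\<in>?T. \<forall>t\<in>?T. s \<le> t --> X t \<le> X s"
  hence "\<forall>s\<in>?T. \<forall>t\<in>?T. s \<le> t --> - X s \<le> - X t" by auto
  from up[OF this] bound have "((%t. - X t) \<longlongrightarrow> Sup ((%t. - X t) ` ?T)) (at_left d)"
   "((%t. - X t) \<longlongrightarrow> Inf ((%t. - X t) ` ?T)) (at_right c)" by auto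
  from tendsto_minus[OF this(1)] tendsto_minus[OF this(2)] that show ?thesis by simp
 qed
qed

lemma constant_sign_mult:
 fixes p q :: "'a => real"
 assumes "(\<forall>u\<in>A. p u \<ge> 0) \<or> (\<forall>u\<in>A. p u \<le> 0)" "(\<forall>u\<in>A. q u \<ge> 0) \<or> (\<forall>u\<in>A. q u \<le> 0)"
 shows "(\<forall>u\<in>A. p u * q u \<ge> 0) \<or> (\<forall>u\<in>A. p u * q u \<le> 0)"
 using assms
 by (elim disjE) (simp_all add: mult_nonneg_nonneg mult_nonneg_nonpos mult_nonpos_nonneg mult_nonpos_nonpos)

context profile_surface
begin

text \<open>If neither component of the normal changes sign, then \<open>X\<close> and
  \<open>Y\<close> are monotone, and the length of the arc is at most the sum of their total
  variations, which are just the differences of end values. In this way no bound on the speed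
  \<open>1 / k\<close> enters, although it may blow up towards the end of a strand.\<close>

lemma geodesic_dist_strand:
 assumes st: "strand I X Y" and T: "connected T" "T \<subseteq> I" and s: "s \<in> T" and t: "t \<in> T"
  and sg: "(\<forall>r\<in>T. nu1 (X r) (Y r) \<ge> 0) \<or> (\<forall>r\<in>T. nu1 (X r) (Y r) \<le> 0)"
   "(\<forall>r\<in>T. nu2 (X r) (Y r) \<ge> 0) \<or> (\<forall>r\<in>T. nu2 (X r) (Y r) \<le> 0)"
 shows "geodesic_dist S (emb (X s) (Y s)) (emb (X t) (Y t)) \<le> ennreal (\<bar>X t - X s\<bar> + \<bar>Y t - Y s\<bar>)"
proof -
 note unit_vectors = unit
 interpret profile_ode I X Y "%t. nu1 (X t) (Y t)" "%t. nu2 (X t) (Y t)" "%t. kk (X t) (Y t)" "%t. lam (X t) (Y t)" m n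
  by (rule strand_profile_ode[OF st])
 define rho where "rho u = s + u * (t - s)" for u
 have rhoT: "rho u \<in> T" if "u \<in> {0..1}" for u
 proof -
  have "rho u = (1 - u) *\<^sub>R s + u *\<^sub>R t" by (simp add: rho_def algebra_simps)
  moreover have "convex T" using T(1) is_interval_connected_1 is_interval_convex by blast
  ultimately show ?thesis using convexD_alt[of T s t u] s t that by auto
 qed
 define gm where "gm u = emb (X (rho u)) (Y (rho u))" for u
 define x' where "x' u = (t - s) * (- nu2 (X (rho u)) (Y (rho u)) / kk (X (rho u)) (Y (rho u)))" for u
 define y' where "y' u = (t - s) * (nu1 (X (rho u)) (Y (rho u)) / kk (X (rho u)) (Y (rho u)))" for u
 have drho: "(rho has_real_derivative (t - s)) (at u)" for u
  unfolding rho_def by (auto intro!: derivative_eq_intros)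
 have dx: "((%u. X (rho u)) has_real_derivative x' u) (at u)"
  and dy: "((%u. Y (rho u)) has_real_derivative y' u) (at u)" if "u \<in> {0..1}" for u
 proof -
  have "rho u \<in> I" using rhoT[OF that] T by auto
  from DERIV_chain2[OF dX[OF this] drho] DERIV_chain2[OF dY[OF this] drho]
  show "((%u. X (rho u)) has_real_derivative x' u) (at u)" "((%u. Y (rho u)) has_real_derivative y' u) (at u)"
   by (simp_all add: x'_def y'_def mult.commute)
 qed
 have dgm: "(gm has_vector_derivative (x' u *\<^sub>R e1, y' u *\<^sub>R f1)) (at u)" if "u \<in> {0..1}" for u
  unfolding gm_def emb_def using dx[OF that] dy[OF that]
  by (intro has_vector_derivative_Pair bounded_linear.has_vector_derivative[OF bounded_linear_scaleR_left])
   (simp_all add: has_real_derivative_iff_has_vector_derivative)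
 have crho: "continuous_on {0..1} rho" unfolding rho_def by (intro continuous_intros)
 have sub: "rho ` {0..1} \<subseteq> I" using rhoT T by auto
 have cX: "continuous_on {0..1} (%u. X (rho u))" and cY: "continuous_on {0..1} (%u. Y (rho u))"
  using st crho sub by (auto simp: strand_def intro: continuous_on_compose2)
 have memS: "emb (X (rho u)) (Y (rho u)) \<in> S" "kk (X (rho u)) (Y (rho u)) ~= 0" if "u \<in> {0..1}" for u
  using strandD[OF st, OF subsetD[OF sub imageI[OF that]]] by blast+
 have cx': "continuous_on {0..1} x'" "continuous_on {0..1} y'"
  unfolding x'_def[abs_def] y'_def[abs_def]
  by (intro continuous_intros continuous_nu continuous_kk cX cY memS; simp add: memS)+
 have "gm C1_differentiable_on {0..1}"
  unfolding C1_differentiable_on_def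
  by (intro exI[of _ "%u. (x' u *\<^sub>R e1, y' u *\<^sub>R f1)"] conjI ballI dgm continuous_intros cx')
 hence vp: "valid_path gm" unfolding valid_path_def by (rule C1_differentiable_imp_piecewise)
 have len: "curve_length gm \<le> ennreal (\<bar>X t - X s\<bar> + \<bar>Y t - Y s\<bar>)"
 proof -
  have abs_int: "((%u. \<bar>f' u\<bar>) has_integral \<bar>f 1 - f 0\<bar>) {0..1}"
   if f: "\<And>u. u \<in> {0..1} ==> (f has_real_derivative f' u) (at u)"
    "(\<forall>u\<in>{0..1}. f' u \<ge> 0) \<or> (\<forall>u\<in>{0..1}. f' u \<le> 0)" for f f' :: "real => real"
  proof -
   have I: "(f' has_integral (f 1 - f 0)) {0..1}"
    by (rule fundamental_theorem_of_calculus)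
     (use f(1) in \<open>auto simp: has_real_derivative_iff_has_vector_derivative intro: has_vector_derivative_at_within\<close>)
   from f(2) show ?thesis
   proof
    assume p: "\<forall>u\<in>{0..1}. f' u \<ge> 0"
    hence "0 \<le> f 1 - f 0" using has_integral_nonneg[OF I] by auto
    thus ?thesis using has_integral_cong[of "{0..1}" "%u. \<bar>f' u\<bar>" f'] p I by simp
   next
    assume p: "\<forall>u\<in>{0..1}. f' u \<le> 0"
    have J: "((%u. - f' u) has_integral - (f 1 - f 0)) {0..1}" by (rule has_integral_neg[OF I])
    hence "0 \<le> - (f 1 - f 0)" by (rule has_integral_nonneg) (use p in auto)
    thus ?thesis using has_integral_cong[of "{0..1}" "%u. \<bar>f' u\<bar>" "%u. - f' u"] p J by simp
   qed
  qed
  have ksg: "(\<forall>u\<in>{0..1}. kk (X (rho u)) (Y (rho u)) > 0) \<or> (\<forall>u\<in>{0..1}. kk (X (rho u)) (Y (rho u)) < 0)"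
   using k_sign sub by auto
  have ksg: "(\<forall>u\<in>{0..1}. inverse (kk (X (rho u)) (Y (rho u))) \<ge> 0) \<or> (\<forall>u\<in>{0..1}. inverse (kk (X (rho u)) (Y (rho u))) \<le> 0)"
   using ksg by (auto simp: less_imp_le)
  have tsg: "(\<forall>u\<in>{0..1::real}. t - s \<ge> 0) \<or> (\<forall>u\<in>{0..1::real}. t - s \<le> 0)" by auto
  have n1: "(\<forall>u\<in>{0..1}. nu1 (X (rho u)) (Y (rho u)) \<ge> 0) \<or> (\<forall>u\<in>{0..1}. nu1 (X (rho u)) (Y (rho u)) \<le> 0)"
   using sg(1) rhoT by blast
  have n2: "(\<forall>u\<in>{0..1}. - nu2 (X (rho u)) (Y (rho u)) \<ge> 0) \<or> (\<forall>u\<in>{0..1}. - nu2 (X (rho u)) (Y (rho u)) \<le> 0)"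
   using sg(2) rhoT by (simp del: atLeastAtMost_iff) blast
  have xs: "(\<forall>u\<in>{0..1}. x' u \<ge> 0) \<or> (\<forall>u\<in>{0..1}. x' u \<le> 0)"
   using constant_sign_mult[OF tsg constant_sign_mult[OF n2 ksg]] by (simp add: x'_def divide_inverse)
  have ys: "(\<forall>u\<in>{0..1}. y' u \<ge> 0) \<or> (\<forall>u\<in>{0..1}. y' u \<le> 0)"
   using constant_sign_mult[OF tsg constant_sign_mult[OF n1 ksg]] by (simp add: y'_def divide_inverse)
  have H: "((%u. \<bar>x' u\<bar> + \<bar>y' u\<bar>) has_integral \<bar>X t - X s\<bar> + \<bar>Y t - Y s\<bar>) {0..1}"
   using has_integral_add[OF abs_int[OF dx xs] abs_int[OF dy ys]] by (simp add: rho_def)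
  have "curve_length gm \<le> (\<integral>\<^sup>+u. ennreal (\<bar>x' u\<bar> + \<bar>y' u\<bar>) * indicator {0..1} u \<partial>lborel)"
   unfolding curve_length_def
  proof (rule nn_integral_mono)
   fix u :: real
   show "ennreal (norm (vector_derivative gm (at u))) * indicator {0..1} u
     \<le> ennreal (\<bar>x' u\<bar> + \<bar>y' u\<bar>) * indicator {0..1} u"
   proof (cases "u \<in> {0..1}")
    case True
    have "norm (vector_derivative gm (at u)) \<le> \<bar>x' u\<bar> + \<bar>y' u\<bar>"
     unfolding vector_derivative_at[OF dgm[OF True]]
     by (rule order_trans[OF norm_Pair_le]) (simp add: unit_vectors)
    thus ?thesis by (intro mult_right_mono ennreal_leI) simp_all
   qed simp
  qed
  also have "\<dots> = ennreal (\<bar>X t - X s\<bar> + \<bar>Y t - Y s\<bar>)"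
   by (rule nn_integral_has_integral_lebesgue'[OF _ H]) simp
  finally show ?thesis .
 qed
 show ?thesis
  unfolding geodesic_dist_def
  by (rule INF_lower2[where f = curve_length and i = gm, OF _ len])
   (use vp memS in \<open>auto simp: path_image_def pathstart_def pathfinish_def gm_def rho_def\<close>)
qed

end

section \<open>Local existence, uniqueness, continuation and end points of strands\<close>

context profile_surface
begin

text \<open>An implicit function argument in the coordinates \<open>t\<close> and polar angle. The
  angular derivative of the defining function does not vanish where \<open>kk\<close> does not, so
  the function is strictly monotone in the angle near the given point; the intermediate value
  theorem gives a zero at every level, and monotonicity makes it unique. The last clause records
  this uniqueness: nearby points of the profile lie on the strand.\<close>

lemma local_strand:
 assumes p: "(X0, Y0) \<in> prof" and k: "kk X0 Y0 ~= 0"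
 defines "t0 \<equiv> (X0\<^sup>2 + Y0\<^sup>2) / 2"
 obtains eps r X Y where "eps > 0" "r > 0" "strand {t0 - eps<..<t0 + eps} X Y" "X t0 = X0" "Y t0 = Y0"
  "\<And>x y. (x, y) \<in> prof ==> \<bar>x - X0\<bar> < r ==> \<bar>y - Y0\<bar> < r ==> \<bar>(x\<^sup>2 + y\<^sup>2) / 2 - t0\<bar> < eps ==>
   x = X ((x\<^sup>2 + y\<^sup>2) / 2) & y = Y ((x\<^sup>2 + y\<^sup>2) / 2)"
proof -
 have pos: "X0 > 0" "Y0 > 0" and pS: "emb X0 Y0 \<in> S" using profD[OF p] by auto
 obtain W f D where W: "open W" "emb X0 Y0 \<in> W" "\<And>q. q \<in> W ==> (f has_derivative D q) (at q)"
  "\<And>v. continuous_on W (%q. D q v)" "\<And>q. q \<in> W ==> \<exists>v. D q v ~= 0"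
  "\<And>q. q \<in> W ==> q \<in> S \<longleftrightarrow> f q = (0::real)"
  using hyp pS by (rule smooth_hypersurface_local) blast
 \<comment> \<open>The rotation field \<open>(- y, x)\<close> is tangent to \<open>S\<close> exactly
   where it is orthogonal to the normal, and its inner product with the normal is
   \<open>- kk\<close>.\<close>
 have kD: "D (emb x y) (- y *\<^sub>R e1, x *\<^sub>R f1) = 0 \<longleftrightarrow> kk x y = 0" if xy: "(x, y) \<in> prof" "emb x y \<in> W" for x y
 proof -
  have qS: "emb x y \<in> S" using profD[OF xy(1)] by simp
  obtain g where g: "\<And>v. D (emb x y) v = g \<bullet> v"
   using derivative_as_inner[OF has_derivative_linear[OF W(3)[OF xy(2)]]] by blast
  have "g ~= 0" using W(5)[OF xy(2)] g by auto
  from level_set_tangent[OF W(1) xy(2) W(3) g this W(6) qS]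
  have "D (emb x y) (- y *\<^sub>R e1, x *\<^sub>R f1) = 0 \<longleftrightarrow> (- y *\<^sub>R e1, x *\<^sub>R f1) \<in> tangent_space S (emb x y)"
   by (simp add: g inner_commute)
  also have "\<dots> \<longleftrightarrow> (- y *\<^sub>R e1, x *\<^sub>R f1) \<bullet> \<nu> (emb x y) = 0"
   using tangentI[OF qS] tangentD[OF qS] by blast
  also have "(- y *\<^sub>R e1, x *\<^sub>R f1) \<bullet> \<nu> (emb x y) = - kk x y"
   unfolding prof_\<nu>[OF xy(1)] by (simp add: inner_prod_def unit_inner kk_def)
  finally show ?thesis by simp
 qed
 define Gx where "Gx z = sqrt (2 * fst z) * cos (snd z)" for z :: "real \<times> real"
 define Gy where "Gy z = sqrt (2 * fst z) * sin (snd z)" for z :: "real \<times> real"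
 define G where "G z = emb (Gx z) (Gy z)" for z
 define H where "H z = D (G z) (- Gy z *\<^sub>R e1, Gx z *\<^sub>R f1)" for z
 define F where "F z = f (G z)" for z
 have cG: "continuous_on A Gx" "continuous_on A Gy" "continuous_on A G" for A
  unfolding G_def[abs_def] Gx_def[abs_def] Gy_def[abs_def] emb_def by (intro continuous_intros)+
 define V where "V = ({0<..} \<times> {0<..<pi / 2}) \<inter> G -` W"
 have oV: "open V"
  unfolding V_def by (rule continuous_open_preimage[OF cG(3) _ W(1)]) (intro open_Times open_greaterThan open_greaterThanLessThan)
 have V: "fst z > 0" "snd z > 0" "snd z < pi / 2" "G z \<in> W" if "z \<in> V" for z
  using that by (auto simp: V_def)
 have Gpos: "Gx z > 0" "Gy z > 0" "(Gx z)\<^sup>2 + (Gy z)\<^sup>2 = 2 * fst z" if z: "z \<in> V" for z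
 proof -
  show "Gx z > 0" "Gy z > 0" using V[OF z] by (auto simp: Gx_def Gy_def intro!: mult_pos_pos cos_gt_zero sin_gt_zero)
  have "(Gx z)\<^sup>2 + (Gy z)\<^sup>2 = (sqrt (2 * fst z))\<^sup>2 * ((sin (snd z))\<^sup>2 + (cos (snd z))\<^sup>2)"
   by (simp only: Gx_def Gy_def power_mult_distrib distrib_left add.commute)
  thus "(Gx z)\<^sup>2 + (Gy z)\<^sup>2 = 2 * fst z" using V[OF z] by simp
 qed
 define tht0 where "tht0 = arctan (Y0 / X0)"
 have polar: "Gx ((x\<^sup>2 + y\<^sup>2) / 2, arctan (y / x)) = x" "Gy ((x\<^sup>2 + y\<^sup>2) / 2, arctan (y / x)) = y"
  if "x > 0" "y > 0" for x y :: real
 proof -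
  have "2 * (a / 2) = a" for a :: real by simp
  thus "Gx ((x\<^sup>2 + y\<^sup>2) / 2, arctan (y / x)) = x" "Gy ((x\<^sup>2 + y\<^sup>2) / 2, arctan (y / x)) = y"
   by (simp_all only: Gx_def Gy_def fst_conv snd_conv polar_quadrant[OF that])
 qed
 have t0: "t0 > 0" using pos by (simp add: t0_def add_pos_pos)
 have G0: "Gx (t0, tht0) = X0" "Gy (t0, tht0) = Y0" using polar[OF pos] by (simp_all add: t0_def tht0_def)
 have z0: "(t0, tht0) \<in> V"
  using t0 polar_quadrant(3,4)[OF pos] W(2) G0 by (simp add: V_def G_def tht0_def)
 have "H (t0, tht0) ~= 0" using kD[OF p W(2)] k by (simp add: H_def G_def G0)
 \<comment> \<open>The sign that makes the defining function increasing in the angle.\<close>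
 define sgm where "sgm = sgn (H (t0, tht0))"
 have sgm: "sgm * H (t0, tht0) > 0" "sgm ~= 0"
  using \<open>H (t0, tht0) ~= 0\<close> by (simp_all add: sgm_def sgn_real_def)
 have cH: "continuous_on V (%z. sgm * H z)"
 proof -
  have "continuous_on V (%z. D (G z) (- Gy z *\<^sub>R e1, Gx z *\<^sub>R f1))"
  proof (rule continuous_on_apply_linear[where L = "%z. D (G z)" and v = "%z. (- Gy z *\<^sub>R e1, Gx z *\<^sub>R f1)"])
   show "linear (D (G z))" if "z \<in> V" for z by (rule has_derivative_linear[OF W(3)[OF V(4)[OF that]]])
   show "continuous_on V (%z. D (G z) v)" for v
    by (rule continuous_on_compose2[OF W(4) cG(3)]) (auto simp: V_def)
   show "continuous_on V (%z. (- Gy z *\<^sub>R e1, Gx z *\<^sub>R f1))" by (intro continuous_intros cG)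
  qed
  thus ?thesis unfolding H_def by (intro continuous_intros)
 qed
 have "open (V \<inter> (%z. sgm * H z) -` {0<..})" by (rule continuous_open_preimage[OF cH oV]) simp
 moreover have "(t0, tht0) \<in> V \<inter> (%z. sgm * H z) -` {0<..}" using z0 sgm by simp
 ultimately obtain A B where AB: "open A" "open B" "t0 \<in> A" "tht0 \<in> B" "A \<times> B \<subseteq> V \<inter> (%z. sgm * H z) -` {0<..}"
  by (rule open_prod_elim) blast
 obtain ra rb where "ra > 0" "ball t0 ra \<subseteq> A" "rb > 0" "cball tht0 rb \<subseteq> B"
  using AB openE open_contains_cball by metis
 define rho where "rho = min ra rb"
 have rho: "rho > 0" and box: "\<And>t tht. \<bar>t - t0\<bar> < rho ==> \<bar>tht - tht0\<bar> \<le> rho ==> (t, tht) \<in> V & sgm * H (t, tht) > 0"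
 proof -
  show "rho > 0" using \<open>ra > 0\<close> \<open>rb > 0\<close> by (simp add: rho_def)
  fix t tht assume "\<bar>t - t0\<bar> < rho" "\<bar>tht - tht0\<bar> \<le> rho"
  hence "t \<in> A" "tht \<in> B" using \<open>ball t0 ra \<subseteq> A\<close> \<open>cball tht0 rb \<subseteq> B\<close>
   by (auto simp: rho_def subset_iff dist_real_def abs_minus_commute)
  with AB(5) show "(t, tht) \<in> V & sgm * H (t, tht) > 0" by auto
 qed
 have dF: "((%tht. sgm * F (t, tht)) has_real_derivative sgm * H (t, tht)) (at tht)" if z: "(t, tht) \<in> V" for t tht
 proof -
  have dx: "((%tht. Gx (t, tht)) has_vector_derivative - Gy (t, tht)) (at tht)"
   and dy: "((%tht. Gy (t, tht)) has_vector_derivative Gx (t, tht)) (at tht)"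
   by (auto simp: Gx_def Gy_def has_real_derivative_iff_has_vector_derivative[symmetric] intro!: derivative_eq_intros)
  have "((%tht. G (t, tht)) has_vector_derivative (- Gy (t, tht) *\<^sub>R e1, Gx (t, tht) *\<^sub>R f1)) (at tht)"
   unfolding G_def emb_def
   by (intro has_vector_derivative_Pair bounded_linear.has_vector_derivative[OF bounded_linear_scaleR_left dx]
     bounded_linear.has_vector_derivative[OF bounded_linear_scaleR_left dy])
  from vector_derivative_diff_chain_within[OF this has_derivative_at_withinI[OF W(3)[OF V(4)[OF z]]]]
  have "((%tht. F (t, tht)) has_vector_derivative H (t, tht)) (at tht)" by (simp add: o_def F_def H_def)
  hence "((%tht. F (t, tht)) has_real_derivative H (t, tht)) (at tht)"
   by (simp add: has_real_derivative_iff_has_vector_derivative)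
  thus ?thesis by (rule DERIV_cmult)
 qed
 have mono: "sgm * F (t, a) < sgm * F (t, b)"
  if "\<bar>t - t0\<bar> < rho" "\<bar>a - tht0\<bar> \<le> rho" "\<bar>b - tht0\<bar> \<le> rho" "a < b" for t a b
 proof (rule DERIV_pos_imp_increasing[OF that(4)])
  fix x assume "a \<le> x" "x \<le> b"
  hence "\<bar>x - tht0\<bar> \<le> rho" using that by auto
  from box[OF that(1) this] dF show "\<exists>y. DERIV (%tht. sgm * F (t, tht)) x :> y & y > 0" by blast
 qed
 have uniq: "a = b" if "\<bar>t - t0\<bar> < rho" "\<bar>a - tht0\<bar> \<le> rho" "\<bar>b - tht0\<bar> \<le> rho" "F (t, a) = 0" "F (t, b) = 0" for t a b
  using mono[of t a b] mono[of t b a] that by (cases a b rule: linorder_cases) auto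
 have cF: "isCont (%t. sgm * F (t, tht)) t" if "(t, tht) \<in> V" for t tht
 proof -
  have "isCont f (G (t, tht))" using W(3)[OF V(4)[OF that]] has_derivative_continuous by blast
  moreover have "isCont (%t. G (t, tht)) t" unfolding G_def emb_def Gx_def Gy_def by (intro continuous_intros)
  ultimately have "isCont (%t. f (G (t, tht))) t" by (rule isCont_o2[rotated])
  thus ?thesis unfolding F_def by (intro continuous_intros)
 qed
 \<comment> \<open>Existence of zeros with prescribed closeness to a known zero. At the centre this
   gives the interval of definition, at the other points continuity of the solution.\<close>
 have near: "\<exists>d>0. \<forall>t. \<bar>t - t1\<bar> < d --> (\<exists>tht. \<bar>tht - tht1\<bar> < r & \<bar>tht - tht0\<bar> < rho & F (t, tht) = 0) & \<bar>t - t0\<bar> < rho"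
  if t1: "\<bar>t1 - t0\<bar> < rho" "\<bar>tht1 - tht0\<bar> < rho" "F (t1, tht1) = 0" and r: "r > 0" for t1 tht1 r
 proof -
  define r' where "r' = min r (rho - \<bar>tht1 - tht0\<bar>) / 2"
  have r': "r' > 0" "r' < r" "\<bar>tht1 - tht0\<bar> + r' < rho" using r t1 by (auto simp: r'_def min_def field_simps)
  define a where "a = tht1 - r'"
  define b where "b = tht1 + r'"
  have ab: "\<bar>a - tht0\<bar> \<le> rho" "\<bar>b - tht0\<bar> \<le> rho" "\<bar>tht1 - tht0\<bar> \<le> rho" "a < tht1" "tht1 < b"
   using r' by (auto simp: a_def b_def)
  have "sgm * F (t1, a) < 0" "sgm * F (t1, b) > 0"
   using mono[OF t1(1) ab(1,3,4)] mono[OF t1(1) ab(3,2,5)] t1(3) by auto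
  moreover have "isCont (%t. sgm * F (t, a)) t1" "isCont (%t. sgm * F (t, b)) t1"
   using cF box[OF t1(1)] ab by blast+
  ultimately have "\<forall>\<^sub>F t in at t1. sgm * F (t, a) < 0" "\<forall>\<^sub>F t in at t1. sgm * F (t, b) > 0"
   unfolding isCont_def by (auto intro: order_tendstoD)
  then obtain d1 d2 where d: "d1 > 0" "\<And>t. t ~= t1 ==> dist t t1 < d1 ==> sgm * F (t, a) < 0"
   "d2 > 0" "\<And>t. t ~= t1 ==> dist t t1 < d2 ==> sgm * F (t, b) > 0"
   unfolding eventually_at by auto
  define d where "d = min (min d1 d2) (rho - \<bar>t1 - t0\<bar>)"
  show ?thesis
  proof (intro exI[of _ d] conjI[OF _ allI[OF impI]])
   show "d > 0" using d(1,3) t1(1) by (simp add: d_def)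
   fix t assume t: "\<bar>t - t1\<bar> < d"
   have t': "\<bar>t - t0\<bar> < rho" using t unfolding d_def by linarith
   have s: "sgm * F (t, a) < 0" "sgm * F (t, b) > 0"
    using d(2)[of t] d(4)[of t] t \<open>sgm * F (t1, a) < 0\<close> \<open>sgm * F (t1, b) > 0\<close>
    by (cases "t = t1"; simp add: d_def dist_real_def)+
   have "\<exists>x\<ge>a. x \<le> b & sgm * F (t, x) = 0"
   proof (rule IVT')
    show "sgm * F (t, a) \<le> 0" "0 \<le> sgm * F (t, b)" "a \<le> b" using s ab by auto
    have "isCont (%tht. sgm * F (t, tht)) x" if "x \<in> {a..b}" for x
     using dF[of t x] box[OF t', of x] that ab by (intro DERIV_isCont[of _ "sgm * H (t, x)"]) auto
    thus "continuous_on {a..b} (%tht. sgm * F (t, tht))" by (auto intro: continuous_at_imp_continuous_on)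
   qed
   then obtain x where x: "a \<le> x" "x \<le> b" "F (t, x) = 0" using sgm(2) by auto
   have "\<bar>x - tht1\<bar> \<le> r'" using x by (auto simp: a_def b_def)
   hence "\<bar>x - tht1\<bar> < r" "\<bar>x - tht0\<bar> < rho" using r' by auto
   with x t' show "(\<exists>tht. \<bar>tht - tht1\<bar> < r & \<bar>tht - tht0\<bar> < rho & F (t, tht) = 0) & \<bar>t - t0\<bar> < rho" by blast
  qed
 qed
 have F0: "F (t0, tht0) = 0" using W(6)[OF W(2)] pS by (simp add: F_def G_def G0)
 obtain eps where eps: "eps > 0" "\<And>t. \<bar>t - t0\<bar> < eps ==> (\<exists>tht. \<bar>tht - tht0\<bar> < rho & F (t, tht) = 0) & \<bar>t - t0\<bar> < rho"
 proof -
  have "\<bar>t0 - t0\<bar> < rho" "\<bar>tht0 - tht0\<bar> < rho" using rho by simp_all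
  from near[OF this F0 zero_less_one] that show ?thesis by blast
 qed
 define \<Theta> where "\<Theta> t = (SOME tht. \<bar>tht - tht0\<bar> < rho & F (t, tht) = 0)" for t
 have \<Theta>: "\<bar>\<Theta> t - tht0\<bar> < rho" "F (t, \<Theta> t) = 0" "\<bar>t - t0\<bar> < rho" if "\<bar>t - t0\<bar> < eps" for t
  using someI_ex[OF conjunct1[OF eps(2)[OF that]]] eps(2)[OF that] unfolding \<Theta>_def by auto
 define I where "I = {t0 - eps<..<t0 + eps}"
 have I: "t \<in> I \<longleftrightarrow> \<bar>t - t0\<bar> < eps" for t by (auto simp: I_def)
 have c\<Theta>: "continuous_on I \<Theta>"
  unfolding continuous_on_iff
 proof (intro ballI allI impI)
  fix t1 e :: real assume t1: "t1 \<in> I" and e: "e > 0"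
  note T = \<Theta>[OF t1[unfolded I]]
  from near[OF T(3,1,2) e] obtain d where d: "d > 0"
   "\<And>t. \<bar>t - t1\<bar> < d ==> \<exists>tht. \<bar>tht - \<Theta> t1\<bar> < e & \<bar>tht - tht0\<bar> < rho & F (t, tht) = 0" by blast
  show "\<exists>d>0. \<forall>x'\<in>I. dist x' t1 < d --> dist (\<Theta> x') (\<Theta> t1) < e"
  proof (intro exI[of _ d] conjI ballI impI d(1))
   fix t assume t: "t \<in> I" "dist t t1 < d"
   then obtain tht where tht: "\<bar>tht - \<Theta> t1\<bar> < e" "\<bar>tht - tht0\<bar> < rho" "F (t, tht) = 0"
    using d(2)[of t] by (auto simp: dist_real_def)
   have "tht = \<Theta> t" by (rule uniq[of t]) (use \<Theta>[OF t(1)[unfolded I]] tht in auto)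
   thus "dist (\<Theta> t) (\<Theta> t1) < e" using tht by (simp add: dist_real_def)
  qed
 qed
 define X where "X t = Gx (t, \<Theta> t)" for t
 define Y where "Y t = Gy (t, \<Theta> t)" for t
 have cz: "continuous_on I (%t. (t, \<Theta> t))" by (intro continuous_intros c\<Theta>)
 have st: "strand I X Y"
  unfolding strand_def
 proof (intro conjI ballI)
  show "open I" "connected I" by (simp_all add: I_def)
  show "continuous_on I X" "continuous_on I Y"
   unfolding X_def[abs_def] Y_def[abs_def]
   by (rule continuous_on_compose2[OF cG(1)[of UNIV] cz] continuous_on_compose2[OF cG(2)[of UNIV] cz]; simp)+
  fix t assume "t \<in> I"
  note T = \<Theta>[OF this[unfolded I]]
  have zV: "(t, \<Theta> t) \<in> V" "sgm * H (t, \<Theta> t) > 0" using box[OF T(3)] T(1) by auto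
  have "emb (X t) (Y t) \<in> S" using W(6)[OF V(4)[OF zV(1)]] T(2) by (simp add: F_def G_def X_def Y_def)
  thus pr: "(X t, Y t) \<in> prof" using Gpos[OF zV(1)] by (simp add: prof_def X_def Y_def)
  show "(X t)\<^sup>2 + (Y t)\<^sup>2 = 2 * t" using Gpos[OF zV(1)] by (simp add: X_def Y_def)
  have "H (t, \<Theta> t) ~= 0" using zV(2) by auto
  thus "kk (X t) (Y t) ~= 0" using kD[OF pr] V(4)[OF zV(1)] by (simp add: H_def G_def X_def Y_def)
 qed
 have "\<Theta> t0 = tht0" by (rule uniq[of t0]) (use \<Theta>[of t0] eps rho F0 in auto)
 hence XY0: "X t0 = X0" "Y t0 = Y0" by (simp_all add: X_def Y_def G0)
 have "isCont (%z. arctan (snd z / fst z)) (X0, Y0)" using pos by (intro continuous_intros) auto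
 then obtain d where d: "d > 0" "\<And>z. dist z (X0, Y0) < d ==> dist (arctan (snd z / fst z)) tht0 < rho"
  unfolding continuous_at_eps_delta using rho by (auto simp: tht0_def)
 show ?thesis
 proof (rule that[OF eps(1) _ st[unfolded I_def] XY0])
  show "d / 2 > 0" using d by simp
  fix x y assume xy: "(x, y) \<in> prof" "\<bar>x - X0\<bar> < d / 2" "\<bar>y - Y0\<bar> < d / 2" "\<bar>(x\<^sup>2 + y\<^sup>2) / 2 - t0\<bar> < eps"
  let ?t = "(x\<^sup>2 + y\<^sup>2) / 2"
  have xyp: "x > 0" "y > 0" "emb x y \<in> S" using profD[OF xy(1)] by auto
  have "dist (x, y) (X0, Y0) \<le> \<bar>x - X0\<bar> + \<bar>y - Y0\<bar>"
   unfolding dist_Pair_Pair dist_real_def by (rule sqrt_sum_squares_le_sum) simp_all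
  hence "dist (x, y) (X0, Y0) < d" using xy by simp
  from d(2)[OF this] have th: "\<bar>arctan (y / x) - tht0\<bar> < rho" by (simp add: dist_real_def)
  have zV: "(?t, arctan (y / x)) \<in> V" using box[OF \<Theta>(3)[OF xy(4)]] th by auto
  have "F (?t, arctan (y / x)) = 0"
   using W(6)[OF V(4)[OF zV]] xyp polar[OF xyp(1,2)] by (simp add: F_def G_def)
  from uniq[OF \<Theta>(3)[OF xy(4)] _ _ this \<Theta>(2)[OF xy(4)]]
  have eq: "arctan (y / x) = \<Theta> ?t" using th \<Theta>(1)[OF xy(4)] by simp
  show "x = X ?t & y = Y ?t" unfolding X_def Y_def eq[symmetric] by (simp only: polar[OF xyp(1,2)])
 qed
qed

end

context profile_surface
begin

text \<open>The set of parameters where two strands agree is closed by continuity, and it is open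
  because near a common point both must coincide with the local strand there. The common domain is
  an interval, hence connected.\<close>

lemma strand_unique:
 assumes st: "strand I X Y" "strand J X' Y'" and s: "s \<in> I" "s \<in> J" "X s = X' s" "Y s = Y' s"
  and t: "t \<in> I" "t \<in> J"
 shows "X t = X' t & Y t = Y' t"
proof -
 define K where "K = I \<inter> J"
 have oK: "open K" and cK: "connected K"
  using st by (auto simp: K_def strand_def is_interval_connected_1[symmetric] intro: is_interval_Int)
 define U where "U = {t\<in>K. X t = X' t & Y t = Y' t}"
 define V where "V = {t\<in>K. \<not> (X t = X' t & Y t = Y' t)}"
 have cont: "continuous_on K X" "continuous_on K Y" "continuous_on K X'" "continuous_on K Y'"
  using st by (auto simp: K_def strand_def intro: continuous_on_subset)
 have "open U"
  unfolding open_dist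
 proof
  fix t1 assume t1: "t1 \<in> U"
  hence K1: "t1 \<in> K" and eq: "X' t1 = X t1" "Y' t1 = Y t1" by (auto simp: U_def)
  hence tI: "t1 \<in> I" "t1 \<in> J" by (auto simp: K_def)
  note p = strandD[OF st(1) tI(1)]
  have t1': "((X t1)\<^sup>2 + (Y t1)\<^sup>2) / 2 = t1" using p(2) by simp
  obtain eps r Xl Yl where l: "eps > 0" "r > 0"
   "strand {((X t1)\<^sup>2 + (Y t1)\<^sup>2) / 2 - eps<..<((X t1)\<^sup>2 + (Y t1)\<^sup>2) / 2 + eps} Xl Yl"
   "Xl (((X t1)\<^sup>2 + (Y t1)\<^sup>2) / 2) = X t1" "Yl (((X t1)\<^sup>2 + (Y t1)\<^sup>2) / 2) = Y t1"
   and loc: "\<And>x y. (x, y) \<in> prof ==> \<bar>x - X t1\<bar> < r ==> \<bar>y - Y t1\<bar> < r ==> \<bar>(x\<^sup>2 + y\<^sup>2) / 2 - ((X t1)\<^sup>2 + (Y t1)\<^sup>2) / 2\<bar> < eps ==>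
   x = Xl ((x\<^sup>2 + y\<^sup>2) / 2) & y = Yl ((x\<^sup>2 + y\<^sup>2) / 2)"
   using p(1,3) by (rule local_strand) blast
  have "isCont X t1" "isCont Y t1" "isCont X' t1" "isCont Y' t1"
   using cont oK K1 by (auto simp: continuous_on_eq_continuous_at)
  hence "\<forall>\<^sub>F t in at t1. dist (X t) (X t1) < r" "\<forall>\<^sub>F t in at t1. dist (Y t) (Y t1) < r"
   "\<forall>\<^sub>F t in at t1. dist (X' t) (X t1) < r" "\<forall>\<^sub>F t in at t1. dist (Y' t) (Y t1) < r"
   unfolding isCont_def eq using l(2) by (auto intro: tendstoD)
  hence "\<forall>\<^sub>F t in at t1. dist (X t) (X t1) < r & dist (Y t) (Y t1) < r & dist (X' t) (X t1) < r & dist (Y' t) (Y t1) < r"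
   by eventually_elim simp
  then obtain d where d: "d > 0" "\<And>t. t ~= t1 ==> dist t t1 < d ==>
    dist (X t) (X t1) < r & dist (Y t) (Y t1) < r & dist (X' t) (X t1) < r & dist (Y' t) (Y t1) < r"
   unfolding eventually_at by auto
  obtain d' where d': "d' > 0" "ball t1 d' \<subseteq> K" using oK K1 openE by blast
  show "\<exists>e>0. \<forall>y. dist y t1 < e --> y \<in> U"
  proof (intro exI[of _ "min (min d d') eps"] conjI allI impI)
   show "min (min d d') eps > 0" using d d' l by simp
   fix t assume t: "dist t t1 < min (min d d') eps"
   hence tK: "t \<in> K" using d' by (auto simp: dist_commute subset_iff)
   hence tIJ: "t \<in> I" "t \<in> J" by (auto simp: K_def)
   have near: "\<bar>t - t1\<bar> < eps" using t by (simp add: dist_real_def)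
   have close: "\<bar>X t - X t1\<bar> < r & \<bar>Y t - Y t1\<bar> < r & \<bar>X' t - X t1\<bar> < r & \<bar>Y' t - Y t1\<bar> < r"
    using d(2)[of t] t l(2) eq by (cases "t = t1") (auto simp: dist_real_def)
   have lev: "((X t)\<^sup>2 + (Y t)\<^sup>2) / 2 = t" "((X' t)\<^sup>2 + (Y' t)\<^sup>2) / 2 = t"
    using strandD(2)[OF st(1) tIJ(1)] strandD(2)[OF st(2) tIJ(2)] by simp_all
   have "X t = Xl t & Y t = Yl t"
    using loc[OF strandD(1)[OF st(1) tIJ(1)]] close near unfolding lev t1' by blast
   moreover have "X' t = Xl t & Y' t = Yl t"
    using loc[OF strandD(1)[OF st(2) tIJ(2)]] close near unfolding lev t1' by blast
   ultimately show "t \<in> U" using tK by (simp add: U_def)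
  qed
 qed
 moreover have "open V"
 proof -
  have "open (K \<inter> (%t. \<bar>X t - X' t\<bar> + \<bar>Y t - Y' t\<bar>) -` {0<..})"
   by (rule continuous_open_preimage[OF _ oK]) (auto intro!: continuous_intros cont)
  also have "K \<inter> (%t. \<bar>X t - X' t\<bar> + \<bar>Y t - Y' t\<bar>) -` {0<..} = V"
   by (auto simp: V_def)
  finally show ?thesis .
 qed
 ultimately have "U \<inter> K = {} \<or> V \<inter> K = {}"
  by (rule connectedD[OF cK]) (auto simp: U_def V_def)
 moreover have "s \<in> U" "s \<in> K" using s by (auto simp: U_def K_def)
 ultimately have "V \<inter> K = {}" by auto
 thus ?thesis using t by (auto simp: V_def K_def)
qed

text \<open>The union of all strands through a fixed point; by uniqueness they agree on overlaps.
  Maximality has to hold against strands that meet the union anywhere, not just at the initial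
  point.\<close>

lemma maximal_strand:
 assumes st0: "strand I0 X0 Y0" and s: "s \<in> I0"
 obtains U X Y where "strand U X Y" "I0 \<subseteq> U" "\<And>t. t \<in> I0 ==> X t = X0 t & Y t = Y0 t"
  "\<And>J X' Y' r. strand J X' Y' ==> r \<in> J ==> r \<in> U ==> X' r = X r ==> Y' r = Y r ==> J \<subseteq> U"
proof -
 \<comment> \<open>The triple \<open>p\<close> holds a parameter and the profile point that the
   strand must pass through at this parameter.\<close>
 define good where "good p J X Y \<longleftrightarrow> strand J X Y & fst p \<in> J & (X (fst p), Y (fst p)) = snd p"
  for p :: "real \<times> real \<times> real" and J X Y
 have union: "\<exists>U X Y. strand U X Y & (\<forall>J X' Y'. good p J X' Y' --> J \<subseteq> U & (\<forall>t\<in>J. X t = X' t & Y t = Y' t))"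
  if g0: "good p J0 A0 B0" for p J0 A0 B0
 proof -
  define U where "U = \<Union>{J. \<exists>X Y. good p J X Y}"
  have "\<forall>t\<in>U. \<exists>J X Y. good p J X Y & t \<in> J" by (auto simp: U_def)
  then obtain J X Y where JXY: "\<And>t. t \<in> U ==> good p (J t) (X t) (Y t) & t \<in> J t" by metis
  define XX where "XX t = X t t" for t
  define YY where "YY t = Y t t" for t
  have agree: "XX t = X' t & YY t = Y' t" if "good p J' X' Y'" "t \<in> J'" for J' X' Y' t
  proof -
   have tU: "t \<in> U" using that by (auto simp: U_def)
   show ?thesis unfolding XX_def YY_def
    by (rule strand_unique[where s = "fst p" and X = "X t" and Y = "Y t" and I = "J t" and X' = X' and Y' = Y' and J = J'])
     (use JXY[OF tU] that in \<open>auto simp: good_def prod_eq_iff\<close>)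
  qed
  have sub: "J' \<subseteq> U" if "good p J' X' Y'" for J' X' Y' using that by (auto simp: U_def)
  have "strand U XX YY"
   unfolding strand_def
  proof (intro conjI ballI)
   show oU: "open U" unfolding U_def good_def strand_def by (intro open_Union) auto
   show "connected U" unfolding U_def
    by (rule connected_Union) (auto simp: good_def strand_def)
   have "isCont XX t & isCont YY t" if t: "t \<in> U" for t
   proof -
    from JXY[OF t] have g: "good p (J t) (X t) (Y t)" "t \<in> J t" by auto
    hence o: "open (J t)" "isCont (X t) t" "isCont (Y t) t"
     by (auto simp: good_def strand_def continuous_on_eq_continuous_at)
    have "\<forall>\<^sub>F r in nhds t. XX r = X t r" "\<forall>\<^sub>F r in nhds t. YY r = Y t r"
     using eventually_nhds_in_open[OF o(1) g(2)] agree[OF g(1)] by (auto elim: eventually_mono)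
    from isCont_cong[OF this(1)] isCont_cong[OF this(2)] o show ?thesis by simp
   qed
   thus "continuous_on U XX" "continuous_on U YY" by (auto intro: continuous_at_imp_continuous_on)
   fix t assume t: "t \<in> U"
   from JXY[OF t] have g: "good p (J t) (X t) (Y t)" "t \<in> J t" by auto
   show "(XX t, YY t) \<in> prof" "(XX t)\<^sup>2 + (YY t)\<^sup>2 = 2 * t" "kk (XX t) (YY t) ~= 0"
    using strandD[of "J t" "X t" "Y t" t] g agree[OF g] by (auto simp: good_def)
  qed
  thus ?thesis using agree sub by blast
 qed
 define p where "p = (s, X0 s, Y0 s)"
 have g0: "good p I0 X0 Y0" using st0 s by (simp add: good_def p_def)
 obtain U X Y where U: "strand U X Y"
  "\<And>J X' Y'. good p J X' Y' ==> J \<subseteq> U & (\<forall>t\<in>J. X t = X' t & Y t = Y' t)"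
  using union[OF g0] by blast
 have sU: "s \<in> U" "X s = X0 s" "Y s = Y0 s" using U(2)[OF g0] s by auto
 show ?thesis
 proof (rule that[OF U(1)])
  show "I0 \<subseteq> U" using U(2)[OF g0] by simp
  show "X t = X0 t & Y t = Y0 t" if "t \<in> I0" for t using U(2)[OF g0] that by simp
  fix J X' Y' r assume J: "strand J X' Y'" "r \<in> J" "r \<in> U" "X' r = X r" "Y' r = Y r"
  \<comment> \<open>The union \<open>U'\<close> of all strands through the new meeting point
    contains \<open>U\<close>, so it passes through the initial point as well and is contained in
    \<open>U\<close> in turn.\<close>
  define q where "q = (r, X r, Y r)"
  have g1: "good q J X' Y'" "good q U X Y" using J U(1) by (simp_all add: good_def q_def)
  obtain U' A B where U': "strand U' A B"
   "\<And>J X' Y'. good q J X' Y' ==> J \<subseteq> U' & (\<forall>t\<in>J. A t = X' t & B t = Y' t)"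
   using union[OF g1(1)] by blast
  have "s \<in> U'" "A s = X0 s" "B s = Y0 s" using U'(2)[OF g1(2)] sU by auto
  hence "good p U' A B" using U'(1) by (simp add: good_def p_def)
  hence "U' \<subseteq> U" using U(2) by blast
  thus "J \<subseteq> U" using U'(2)[OF g1(1)] by blast
 qed
qed

text \<open>Near an end of the interval the components of the normal have constant sign by
  monotonicity of the two fluxes. Hence \<open>X\<close> and \<open>Y\<close> are monotone, and
  bounded by the level, so they converge, and points approaching the end form a Cauchy sequence for
  the intrinsic distance. Completeness yields a limit in \<open>S\<close>, and it must be the
  Euclidean limit.\<close>

lemma strand_limit:
 assumes complete: "complete_hypersurface S" and st: "strand I X Y"
  and cd: "c < d" "{c<..<d} \<subseteq> I"
 shows "\<exists>x y. (X \<longlongrightarrow> x) (at_left d) & (Y \<longlongrightarrow> y) (at_left d) & emb x y \<in> S"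
  and "\<exists>x y. (X \<longlongrightarrow> x) (at_right c) & (Y \<longlongrightarrow> y) (at_right c) & emb x y \<in> S"
proof -
 note unit_vectors = unit
 note dims_ge = mn
 interpret ode: profile_ode I X Y "%t. nu1 (X t) (Y t)" "%t. nu2 (X t) (Y t)" "%t. kk (X t) (Y t)" "%t. lam (X t) (Y t)" m n
  by (rule strand_profile_ode[OF st])
 have fX: "(\<forall>s\<in>I. \<forall>t\<in>I. s < t --> ode.w s * nu2 (X s) (Y s) < ode.w t * nu2 (X t) (Y t)) \<or>
   (\<forall>s\<in>I. \<forall>t\<in>I. s < t --> ode.w t * nu2 (X t) (Y t) < ode.w s * nu2 (X s) (Y s))"
  by (rule ode.flux_mono[OF ode.d_flux_X]) (use ode.pos ode.mn in auto)
 have fY: "(\<forall>s\<in>I. \<forall>t\<in>I. s < t --> ode.w s * nu1 (X s) (Y s) < ode.w t * nu1 (X t) (Y t)) \<or>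
   (\<forall>s\<in>I. \<forall>t\<in>I. s < t --> ode.w t * nu1 (X t) (Y t) < ode.w s * nu1 (X s) (Y s))"
  by (rule ode.flux_mono[OF ode.d_flux_Y]) (use ode.pos ode.mn in auto)
 have sgn_w: "ode.w t * z \<ge> 0 \<longleftrightarrow> z \<ge> 0" "ode.w t * z \<le> 0 \<longleftrightarrow> z \<le> 0" if "t \<in> I" for t z
  using ode.w_pos[OF that] by (auto simp: zero_le_mult_iff mult_le_0_iff)
 have restrict: "(\<forall>r\<in>A. z r \<ge> 0) \<or> (\<forall>r\<in>A. z r \<le> 0)"
  if "(\<forall>t\<in>B. ode.w t * z t \<ge> 0) \<or> (\<forall>t\<in>B. ode.w t * z t \<le> 0)" and sub: "A \<subseteq> B" "A \<subseteq> I" for A B z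
  using that(1)
 proof
  assume "\<forall>t\<in>B. ode.w t * z t \<ge> 0"
  hence "z r \<ge> 0" if "r \<in> A" for r using that sub sgn_w(1)[of r "z r"] by blast
  thus ?thesis by blast
 next
  assume "\<forall>t\<in>B. ode.w t * z t \<le> 0"
  hence "z r \<le> 0" if "r \<in> A" for r using that sub sgn_w(2)[of r "z r"] by blast
  thus ?thesis by blast
 qed
 have key: "\<exists>x y. (X \<longlongrightarrow> x) F & (Y \<longlongrightarrow> y) F & emb x y \<in> S"
  if ab: "a < b" "{a<..<b} \<subseteq> I" and F: "F = at_left b \<or> F = at_right a"
   and sg: "(\<forall>r\<in>{a<..<b}. nu1 (X r) (Y r) \<ge> 0) \<or> (\<forall>r\<in>{a<..<b}. nu1 (X r) (Y r) \<le> 0)"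
   "(\<forall>r\<in>{a<..<b}. nu2 (X r) (Y r) \<ge> 0) \<or> (\<forall>r\<in>{a<..<b}. nu2 (X r) (Y r) \<le> 0)" for a b F
 proof -
  let ?T = "{a<..<b}"
  have ksg: "(\<forall>r\<in>?T. inverse (kk (X r) (Y r)) \<ge> 0) \<or> (\<forall>r\<in>?T. inverse (kk (X r) (Y r)) \<le> 0)"
   using ode.k_sign ab(2) by (auto simp: less_imp_le subset_iff)
  have mono: "(\<forall>s\<in>?T. \<forall>t\<in>?T. s \<le> t --> f s \<le> f t) \<or> (\<forall>s\<in>?T. \<forall>t\<in>?T. s \<le> t --> f t \<le> f s)"
   if "\<And>t. t \<in> ?T ==> (f has_real_derivative f' t) (at t)"
    "(\<forall>r\<in>?T. f' r \<ge> 0) \<or> (\<forall>r\<in>?T. f' r \<le> 0)" for f f' :: "real => real"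
   using that(2)
  proof
   assume p: "\<forall>r\<in>?T. f' r \<ge> 0"
   have "f s \<le> f t" if "s \<in> ?T" "t \<in> ?T" "s \<le> t" for s t
   proof (rule DERIV_nonneg_imp_nondecreasing[OF that(3)])
    fix x assume "s \<le> x" "x \<le> t"
    hence "x \<in> ?T" using that by auto
    thus "\<exists>y. DERIV f x :> y & 0 \<le> y" using \<open>\<And>t. t \<in> ?T ==> (f has_real_derivative f' t) (at t)\<close> p by blast
   qed
   thus ?thesis by blast
  next
   assume p: "\<forall>r\<in>?T. f' r \<le> 0"
   have "f t \<le> f s" if "s \<in> ?T" "t \<in> ?T" "s \<le> t" for s t
   proof (rule DERIV_nonpos_imp_nonincreasing[OF that(3)])
    fix x assume "s \<le> x" "x \<le> t"
    hence "x \<in> ?T" using that by auto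
    thus "\<exists>y. DERIV f x :> y & y \<le> 0" using \<open>\<And>t. t \<in> ?T ==> (f has_real_derivative f' t) (at t)\<close> p by blast
   qed
   thus ?thesis by blast
  qed
  have n2: "(\<forall>r\<in>?T. - nu2 (X r) (Y r) \<ge> 0) \<or> (\<forall>r\<in>?T. - nu2 (X r) (Y r) \<le> 0)" using sg(2) by auto
  have mX: "(\<forall>s\<in>?T. \<forall>t\<in>?T. s \<le> t --> X s \<le> X t) \<or> (\<forall>s\<in>?T. \<forall>t\<in>?T. s \<le> t --> X t \<le> X s)"
   by (rule mono[OF ode.dX]) (use ab(2) constant_sign_mult[OF n2 ksg] in \<open>auto simp: divide_inverse\<close>)
  have mY: "(\<forall>s\<in>?T. \<forall>t\<in>?T. s \<le> t --> Y s \<le> Y t) \<or> (\<forall>s\<in>?T. \<forall>t\<in>?T. s \<le> t --> Y t \<le> Y s)"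
   by (rule mono[OF ode.dY]) (use ab(2) constant_sign_mult[OF sg(1) ksg] in \<open>auto simp: divide_inverse\<close>)
  have bd: "\<bar>X t\<bar> \<le> sqrt (2 * b)" "\<bar>Y t\<bar> \<le> sqrt (2 * b)" if "t \<in> ?T" for t
  proof -
   have "(X t)\<^sup>2 + (Y t)\<^sup>2 \<le> 2 * b" using ode.level[of t] that ab(2) by (auto simp: subset_iff)
   hence "(X t)\<^sup>2 \<le> 2 * b" "(Y t)\<^sup>2 \<le> 2 * b"
    using zero_le_power2[of "X t"] zero_le_power2[of "Y t"] by linarith+
   thus "\<bar>X t\<bar> \<le> sqrt (2 * b)" "\<bar>Y t\<bar> \<le> sqrt (2 * b)" by (auto intro!: real_le_rsqrt)
  qed
  obtain x where x: "(X \<longlongrightarrow> x) F" using monotone_bounded_limit[OF ab(1) bd(1) mX] F by metis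
  obtain y where y: "(Y \<longlongrightarrow> y) F" using monotone_bounded_limit[OF ab(1) bd(2) mY] F by metis
  have evT: "\<forall>\<^sub>F t in F. t \<in> ?T"
   using F ab(1) eventually_at_left_field eventually_at_right_field by (auto simp: eventually_at_left[OF ab(1)] eventually_at_right[OF ab(1)])
  obtain sgm :: "nat => real" where sgm: "filterlim sgm F sequentially" "\<And>i. sgm i \<in> ?T"
  proof -
   \<comment> \<open>The shift by 2 keeps already \<open>e 0\<close> strictly below
     \<open>b - a\<close>, so the whole sequence stays inside the open interval.\<close>
   define e where "e i = (b - a) / (real i + 2)" for i :: nat
   have e: "0 < e i" "e i < b - a" for i
   proof -
    show "0 < e i" using ab(1) by (simp add: e_def)
    have "(b - a) * 1 < (b - a) * (real i + 2)" using ab(1) by (intro mult_strict_left_mono) auto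
    thus "e i < b - a" by (simp add: e_def divide_less_eq)
   qed
   have e0: "e \<longlonglongrightarrow> 0"
   proof -
    have "(%i. (b - a) * inverse (real (Suc (Suc i)))) \<longlonglongrightarrow> 0"
     using LIMSEQ_Suc[OF LIMSEQ_inverse_real_of_nat] by (rule tendsto_mult_right_zero)
    thus ?thesis by (simp add: e_def[abs_def] divide_inverse add.commute)
   qed
   show ?thesis
   proof (cases "F = at_left b")
    case True
    have "filterlim (%i. b - e i) (at_left b) sequentially"
     unfolding filterlim_at using tendsto_diff[OF tendsto_const e0, of b] e by (auto intro!: always_eventually simp: less_le)
    thus ?thesis using that[of "%i. b - e i"] True e by (auto simp: algebra_simps)
   next
    case False
    hence "F = at_right a" using F by simp
    moreover have "filterlim (%i. a + e i) (at_right a) sequentially"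
     unfolding filterlim_at using tendsto_add[OF tendsto_const e0, of a] e by (auto intro!: always_eventually simp: less_le)
    ultimately show ?thesis using that[of "%i. a + e i"] e by (auto simp: algebra_simps)
   qed
  qed
  have Xsgm: "(%i. X (sgm i)) \<longlonglongrightarrow> x" and Ysgm: "(%i. Y (sgm i)) \<longlonglongrightarrow> y"
   using filterlim_compose[OF x sgm(1)] filterlim_compose[OF y sgm(1)] by simp_all
  define Z where "Z i = emb (X (sgm i)) (Y (sgm i))" for i
  have ZS: "Z i \<in> S" for i unfolding Z_def by (rule strandD(6)[OF st subsetD[OF ab(2) sgm(2)]])
  have "\<exists>l\<in>S. (%i. geodesic_dist S (Z i) l) \<longlonglongrightarrow> 0"
  proof (rule complete[unfolded complete_hypersurface_def, rule_format], intro conjI allI impI)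
   show "range Z \<subseteq> S" using ZS by auto
   fix e :: real assume e: "e > 0"
   have "Cauchy (%i. X (sgm i))" "Cauchy (%i. Y (sgm i))" using Xsgm Ysgm by (auto intro: LIMSEQ_imp_Cauchy)
   then obtain M1 M2 where M: "\<And>i j. i \<ge> M1 ==> j \<ge> M1 ==> dist (X (sgm i)) (X (sgm j)) < e / 2"
    "\<And>i j. i \<ge> M2 ==> j \<ge> M2 ==> dist (Y (sgm i)) (Y (sgm j)) < e / 2"
    using e half_gt_zero unfolding Cauchy_def by meson
   show "\<exists>M. \<forall>i\<ge>M. \<forall>j\<ge>M. geodesic_dist S (Z i) (Z j) < ennreal e"
   proof (intro exI[of _ "max M1 M2"] allI impI)
    fix i j assume "i \<ge> max M1 M2" "j \<ge> max M1 M2"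
    hence "\<bar>X (sgm j) - X (sgm i)\<bar> + \<bar>Y (sgm j) - Y (sgm i)\<bar> < e"
     using M(1)[of j i] M(2)[of j i] by (simp add: dist_real_def)
    moreover have "geodesic_dist S (Z i) (Z j) \<le> ennreal (\<bar>X (sgm j) - X (sgm i)\<bar> + \<bar>Y (sgm j) - Y (sgm i)\<bar>)"
     unfolding Z_def by (rule geodesic_dist_strand[OF st _ ab(2) sgm(2) sgm(2) sg]) simp
    ultimately show "geodesic_dist S (Z i) (Z j) < ennreal e"
     by (metis (no_types, lifting) e ennreal_lessI le_less_trans)
   qed
  qed
  then obtain l where l: "l \<in> S" "(%i. geodesic_dist S (Z i) l) \<longlonglongrightarrow> 0" by blast
  have "(%i. ennreal (dist (Z i) l)) \<longlonglongrightarrow> 0"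
   by (rule tendsto_sandwich[OF always_eventually always_eventually tendsto_const l(2)])
    (auto intro: geodesic_dist_ge_dist)
  hence "(%i. dist (Z i) l) \<longlonglongrightarrow> 0" 
   using tendsto_ennreal_iff[of "%i. dist (Z i) l" sequentially 0] by simp
  hence Zl: "Z \<longlonglongrightarrow> l" by (rule tendsto_dist_iff[THEN iffD2])
  have "Z \<longlonglongrightarrow> emb x y" unfolding Z_def emb_def by (intro tendsto_intros Xsgm Ysgm)
  with Zl have "l = emb x y" by (rule LIMSEQ_unique)
  thus ?thesis using l(1) x y by blast
 qed
 show "\<exists>x y. (X \<longlongrightarrow> x) (at_left d) & (Y \<longlongrightarrow> y) (at_left d) & emb x y \<in> S"
 proof -
  obtain c1 where c1: "c \<le> c1" "c1 < d" "(\<forall>t\<in>{c1<..<d}. ode.w t * nu2 (X t) (Y t) \<ge> 0) \<or> (\<forall>t\<in>{c1<..<d}. ode.w t * nu2 (X t) (Y t) \<le> 0)"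
   using ode.eventual_sign(1)[OF fX cd(2,1)] by blast
  obtain c2 where c2: "c \<le> c2" "c2 < d" "(\<forall>t\<in>{c2<..<d}. ode.w t * nu1 (X t) (Y t) \<ge> 0) \<or> (\<forall>t\<in>{c2<..<d}. ode.w t * nu1 (X t) (Y t) \<le> 0)"
   using ode.eventual_sign(1)[OF fY cd(2,1)] by blast
  define a where "a = max c1 c2"
  have a: "a < d" "{a<..<d} \<subseteq> I" using c1 c2 cd by (auto simp: a_def)
  have "(\<forall>r\<in>{a<..<d}. nu2 (X r) (Y r) \<ge> 0) \<or> (\<forall>r\<in>{a<..<d}. nu2 (X r) (Y r) \<le> 0)"
   by (rule restrict[OF c1(3) _ a(2)]) (auto simp: a_def)
  moreover have "(\<forall>r\<in>{a<..<d}. nu1 (X r) (Y r) \<ge> 0) \<or> (\<forall>r\<in>{a<..<d}. nu1 (X r) (Y r) \<le> 0)"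
   by (rule restrict[OF c2(3) _ a(2)]) (auto simp: a_def)
  ultimately show ?thesis using key[OF a] by blast
 qed
 show "\<exists>x y. (X \<longlongrightarrow> x) (at_right c) & (Y \<longlongrightarrow> y) (at_right c) & emb x y \<in> S"
 proof -
  obtain d1 where d1: "d1 \<le> d" "c < d1" "(\<forall>t\<in>{c<..<d1}. ode.w t * nu2 (X t) (Y t) \<ge> 0) \<or> (\<forall>t\<in>{c<..<d1}. ode.w t * nu2 (X t) (Y t) \<le> 0)"
   using ode.eventual_sign(2)[OF fX cd(2,1)] by blast
  obtain d2 where d2: "d2 \<le> d" "c < d2" "(\<forall>t\<in>{c<..<d2}. ode.w t * nu1 (X t) (Y t) \<ge> 0) \<or> (\<forall>t\<in>{c<..<d2}. ode.w t * nu1 (X t) (Y t) \<le> 0)"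
   using ode.eventual_sign(2)[OF fY cd(2,1)] by blast
  define b where "b = min d1 d2"
  have b: "c < b" "{c<..<b} \<subseteq> I" using d1 d2 cd by (auto simp: b_def)
  have "(\<forall>r\<in>{c<..<b}. nu2 (X r) (Y r) \<ge> 0) \<or> (\<forall>r\<in>{c<..<b}. nu2 (X r) (Y r) \<le> 0)"
   by (rule restrict[OF d1(3) _ b(2)]) (auto simp: b_def)
  moreover have "(\<forall>r\<in>{c<..<b}. nu1 (X r) (Y r) \<ge> 0) \<or> (\<forall>r\<in>{c<..<b}. nu1 (X r) (Y r) \<le> 0)"
   by (rule restrict[OF d2(3) _ b(2)]) (auto simp: b_def)
  ultimately show ?thesis using key[OF b] by blast
 qed
qed

end

section \<open>The profile in the logarithmic variable r = log |z|\<close>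

lemma slope_force_tan:
 assumes "x > 0" "y > 0"
 shows "slope_force m n (arctan (y / x)) = (n - 1) * (x / y) - (m - 1) * (y / x)"
proof -
 note p = polar_quadrant[OF assms]
 define r where "r = sqrt (x\<^sup>2 + y\<^sup>2)"
 have r: "r > 0" using assms by (simp add: r_def add_pos_pos)
 have "cos (arctan (y / x)) = x / r" "sin (arctan (y / x)) = y / r"
  using p(1,2) r by (simp_all add: r_def[symmetric] field_simps)
 thus ?thesis using r assms by (simp add: slope_force_def)
qed

context profile_ode
begin

text \<open>The polar angle of the profile at radius \<open>exp r\<close>, that is at
  \<open>t = exp (2 * r) / 2\<close>; \<open>slope\<close> is its derivative in
  \<open>r\<close>.\<close>

definition ang :: "real => real" where "ang r = arctan (Y (exp (2 * r) / 2) / X (exp (2 * r) / 2))"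
definition slope :: "real => real" where "slope r = h (exp (2 * r) / 2) / k (exp (2 * r) / 2)"

lemma ang_range: "exp (2 * r) / 2 \<in> I ==> 0 < ang r & ang r < pi / 2"
 using polar_quadrant(3,4) pos unfolding ang_def by blast

lemma d_level: "((%r. exp (2 * r) / 2) has_real_derivative 2 * (exp (2 * r) / 2)) (at r)" for r :: real
 by (auto intro!: derivative_eq_intros)

lemma d_ang:
 assumes "exp (2 * r) / 2 \<in> I"
 shows "(ang has_real_derivative slope r) (at r)"
proof -
 define t where "t = exp (2 * r) / 2"
 have t: "t \<in> I" using assms by (simp add: t_def)
 note p = pos[OF t]
 have "((%t. Y t / X t) has_real_derivative ((a t / k t) * X t - Y t * (- b t / k t)) / (X t * X t)) (at t)"
  by (intro DERIV_divide dX dY t) (use p in simp)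
 from DERIV_chain2[OF DERIV_arctan this]
 have "((%t. arctan (Y t / X t)) has_real_derivative
   inverse (1 + (Y t / X t)\<^sup>2) * (((a t / k t) * X t - Y t * (- b t / k t)) / (X t * X t))) (at t)" .
 moreover have "inverse (1 + (Y t / X t)\<^sup>2) * (((a t / k t) * X t - Y t * (- b t / k t)) / (X t * X t))
   = h t / k t / (2 * t)"
 proof -
  have "1 + (Y t / X t)\<^sup>2 = ((X t)\<^sup>2 + (Y t)\<^sup>2) / (X t * X t)"
   using p by (simp add: add_divide_distrib power_divide power2_eq_square)
  also have "\<dots> = 2 * t / (X t * X t)" by (simp only: level[OF t])
  finally have e: "1 + (Y t / X t)\<^sup>2 = 2 * t / (X t * X t)" .
  have f: "(a t / k t) * X t - Y t * (- b t / k t) = h t / k t"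
   by (simp add: h_def add_divide_distrib mult.commute)
  show ?thesis unfolding e f using p t_pos[OF t] by simp
 qed
 ultimately have "((%t. arctan (Y t / X t)) has_real_derivative h t / k t / (2 * t)) (at t)" by simp
 from DERIV_chain2[OF this[unfolded t_def] d_level[of r]]
 show ?thesis using t_pos[OF t] unfolding ang_def[abs_def] slope_def t_def[symmetric] by simp
qed

lemma slope_sq: "exp (2 * r) / 2 \<in> I ==> 1 + (slope r)\<^sup>2 = exp (2 * r) / (k (exp (2 * r) / 2))\<^sup>2"
 using hk[of "exp (2 * r) / 2"] k0[of "exp (2 * r) / 2"] by (simp add: slope_def power_divide field_simps)

text \<open>Multiplied by \<open>2 * t / k\<close> the eigenvalues become scale invariant and can be
  expressed by the direction \<open>Y / X\<close> and the slope \<open>h / k\<close> alone. The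
  third identity follows from the first two by minimality.\<close>

lemma curvature_slope:
 assumes t: "t \<in> I"
 shows "2 * t * (a t / X t) / k t = Y t / X t + h t / k t" "2 * t * (b t / Y t) / k t = h t / k t - X t / Y t"
  "2 * t * l t / k t = (n - 1) * (X t / Y t) - (m - 1) * (Y t / X t) - (m + n - 2) * (h t / k t)"
proof -
 note p = pos[OF t]
 have 1: "2 * t * (a t / X t) / k t = (2 * t * a t) / X t / k t" by simp
 show A: "2 * t * (a t / X t) / k t = Y t / X t + h t / k t"
  unfolding 1 ab(1)[OF t] using p k0[OF t] by (simp add: add_divide_distrib)
 have 2: "2 * t * (b t / Y t) / k t = (2 * t * b t) / Y t / k t" by simp
 show B: "2 * t * (b t / Y t) / k t = h t / k t - X t / Y t"
  unfolding 2 ab(2)[OF t] using p k0[OF t] by (simp add: diff_divide_distrib)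
 have "2 * t * l t / k t = - (m - 1) * (2 * t * (a t / X t) / k t) - (n - 1) * (2 * t * (b t / Y t) / k t)"
 proof -
  have "2 * t * (- (m - 1) * A - (n - 1) * B) / K = - (m - 1) * (2 * t * A / K) - (n - 1) * (2 * t * B / K)" for A B K
   by (cases "K = 0") (auto simp: field_simps)
  thus ?thesis unfolding l[OF t] .
 qed
 also have "\<dots> = (n - 1) * (X t / Y t) - (m - 1) * (Y t / X t) - (m + n - 2) * (h t / k t)"
 proof -
  have "- (m - 1) * (y + H) - (n - 1) * (H - x) = (n - 1) * x - (m - 1) * y - (m + n - 2) * H" for x y H
   by (simp add: algebra_simps)
  thus ?thesis unfolding A B .
 qed
 finally show "2 * t * l t / k t = (n - 1) * (X t / Y t) - (m - 1) * (Y t / X t) - (m + n - 2) * (h t / k t)" .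
qed

text \<open>The minimal surface equation for the profile. It is autonomous because scaling of the
  surface is translation in \<open>r\<close>; the friction is \<open>N = m + n - 1\<close>, and the
  factor \<open>1 + slope^2 = 2 * t / k^2\<close> converts the parameter \<open>t\<close> into
  \<open>r\<close>.\<close>

lemma d_slope:
 assumes "exp (2 * r) / 2 \<in> I"
 shows "(slope has_real_derivative (1 + (slope r)\<^sup>2) * (slope_force m n (ang r) - (m + n - 1) * slope r)) (at r)"
proof -
 define t where "t = exp (2 * r) / 2"
 have t: "t \<in> I" using assms by (simp add: t_def)
 note p = pos[OF t]
 note kt = k0[OF t]
 have "((%t. h t / k t) has_real_derivative (l t * k t - h t * ((1 - l t * h t) / k t)) / (k t * k t)) (at t)"
  by (intro DERIV_divide dh dk t kt)
 moreover have "(l t * k t - h t * ((1 - l t * h t) / k t)) / (k t * k t)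
   = (2 * t * l t / k t - h t / k t) / (k t)\<^sup>2"
  unfolding hk[OF t, symmetric] using kt by (simp add: field_simps power2_eq_square)
 moreover have "2 * t * l t / k t - h t / k t = slope_force m n (arctan (Y t / X t)) - (m + n - 1) * (h t / k t)"
 proof -
  have "F - (m + n - 2) * H - H = F - (m + n - 1) * H" for F H by (simp add: algebra_simps)
  thus ?thesis
   unfolding curvature_slope(3)[OF t] slope_force_tan[OF p[THEN conjunct1] p[THEN conjunct2]] .
 qed
 ultimately have "((%t. h t / k t) has_real_derivative
   (slope_force m n (arctan (Y t / X t)) - (m + n - 1) * (h t / k t)) / (k t)\<^sup>2) (at t)" by simp
 from DERIV_chain2[OF this[unfolded t_def] d_level[of r]]
 have "(slope has_real_derivative (slope_force m n (ang r) - (m + n - 1) * slope r) / (k t)\<^sup>2 * (2 * t)) (at r)"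
  unfolding ang_def slope_def[abs_def] t_def[symmetric] .
 moreover have "1 + (slope r)\<^sup>2 = 2 * t / (k t)\<^sup>2" using slope_sq[OF assms] by (simp add: t_def)
 ultimately show ?thesis by (simp add: mult.commute)
qed

end

locale profile_end = profile_ode +
 fixes s\<^sub>0 tha :: real
 assumes unbounded: "{s\<^sub>0..} \<subseteq> I" and s0: "s\<^sub>0 > 0"
  and tha: "0 < tha" "tha < pi / 2" "(n - 1) * (cos tha)\<^sup>2 = (m - 1) * (sin tha)\<^sup>2"
begin

lemma mn1: "m > 1" "n > 1" using mn by auto

definition r\<^sub>0 :: real where "r\<^sub>0 = ln (2 * s\<^sub>0) / 2"

lemma level_in_I: "r \<ge> r\<^sub>0 ==> exp (2 * r) / 2 \<in> I"
proof -
 assume "r \<ge> r\<^sub>0"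
 hence "ln (2 * s\<^sub>0) \<le> 2 * r" by (simp add: r\<^sub>0_def)
 hence "exp (ln (2 * s\<^sub>0)) \<le> exp (2 * r)" by simp
 hence "s\<^sub>0 \<le> exp (2 * r) / 2" using s0 by simp
 thus ?thesis using unbounded by auto
qed

lemma ang_decay:
 obtains K c where "c > 0"
  "\<forall>\<^sub>F r in at_top. \<bar>ang r - tha\<bar> \<le> K * exp (- c * r)" "\<forall>\<^sub>F r in at_top. \<bar>slope r\<bar> \<le> K * exp (- c * r)"
proof -
 have d: "r > r\<^sub>0 ==> (ang has_real_derivative slope r) (at r)"
  "r > r\<^sub>0 ==> (slope has_real_derivative (1 + (slope r)\<^sup>2) * (slope_force m n (ang r) - (m + n - 1) * slope r)) (at r)"
  "r > r\<^sub>0 ==> 0 < ang r & ang r < pi / 2" for r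
  using d_ang d_slope ang_range level_in_I by auto
 show ?thesis using slope_exponential_decay[OF mn1 tha d] that by blast
qed

lemma exp_decay_tendsto_0:
 fixes f :: "real => real"
 assumes "c > 0" "\<forall>\<^sub>F r in at_top. \<bar>f r\<bar> \<le> K * exp (- c * r)"
 shows "(f \<longlongrightarrow> 0) at_top"
proof -
 have "((%r. K * exp (- c * r)) \<longlongrightarrow> 0) at_top"
  by (intro tendsto_mult_right_zero filterlim_compose[OF exp_at_bot])
   (use assms(1) in \<open>simp add: filterlim_uminus_at_bot filterlim_tendsto_pos_mult_at_top[OF tendsto_const _ filterlim_ident]\<close>)
 thus ?thesis by (rule Lim_null_comparison[rotated]) (use assms(2) in simp)
qed

lemma ang_tendsto: "(ang \<longlongrightarrow> tha) at_top" and slope_tendsto: "(slope \<longlongrightarrow> 0) at_top"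
proof -
 obtain K c where "c > 0" "\<forall>\<^sub>F r in at_top. \<bar>ang r - tha\<bar> \<le> K * exp (- c * r)"
  "\<forall>\<^sub>F r in at_top. \<bar>slope r\<bar> \<le> K * exp (- c * r)" by (rule ang_decay)
 thus "(slope \<longlongrightarrow> 0) at_top" "(ang \<longlongrightarrow> tha) at_top"
  using exp_decay_tendsto_0[of c "%r. ang r - tha"] exp_decay_tendsto_0[of c slope]
  by (auto simp: LIM_zero_iff)
qed

text \<open>The offset from the cone tends to zero: \<open>e\<^sup>r (ang r - tha)\<close> solves a damped linear equation
 with damping \<open>N - 2\<close> and stiffness \<open>N - 1\<close>, where \<open>N = m + n - 1\<close>.\<close>

lemma offset_tendsto_0: "((%r. exp r * (ang r - tha)) \<longlongrightarrow> 0) at_top"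
proof -
 define N where "N = m + n - 1"
 have N: "N \<ge> 3" using mn by (simp add: N_def)
 \<comment> \<open>The deviation of the difference quotient of the force from its limit
   \<open>- 2 * (N - 1)\<close>. The value 0 at \<open>tha\<close> makes \<open>q\<close> continuous
   there and keeps \<open>qf\<close> valid when the profile crosses the cone.\<close>
 define q where "q tht = (if tht = tha then 0 else - slope_force m n tht / (tht - tha) - 2 * (N - 1))" for tht
 have f0: "slope_force m n tha = 0" by (rule slope_force_zero[OF mn1 tha])
 have qf: "slope_force m n tht = - (2 * (N - 1) + q tht) * (tht - tha)" for tht
  using f0 by (cases "tht = tha") (simp_all add: q_def field_simps)
 have "(slope_force m n has_real_derivative - (2 * (m + n - 2))) (at tha)"
  using slope_force_deriv[OF mn1 tha tha(1,2)] slope_force_deriv_zero[OF mn1 tha] by simp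
 hence "((%tht. (slope_force m n tht - slope_force m n tha) / (tht - tha)) \<longlongrightarrow> - (2 * (m + n - 2))) (at tha)"
  by (simp add: has_field_derivative_iff)
 hence "((%tht. - ((slope_force m n tht - slope_force m n tha) / (tht - tha)) - 2 * (N - 1)) \<longlongrightarrow> - (- (2 * (m + n - 2))) - 2 * (N - 1)) (at tha)"
  by (intro tendsto_intros)
 moreover have "- (- (2 * (m + n - 2))) - 2 * (N - 1) = 0" by (simp add: N_def)
 ultimately have "((%tht. - (slope_force m n tht / (tht - tha)) - 2 * (N - 1)) \<longlongrightarrow> 0) (at tha)"
  by (simp add: f0)
 hence "(q \<longlongrightarrow> 0) (at tha)"
  by (rule Lim_transform_eventually) (auto simp: eventually_at_filter q_def)
 hence "isCont q tha" by (simp add: isCont_def q_def)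
 from isCont_tendsto_compose[OF this ang_tendsto]
 have q0: "((%r. q (ang r)) \<longlongrightarrow> 0) at_top" by (simp add: q_def)
 define v where "v r = exp r * (ang r - tha)" for r
 define w where "w r = exp r * (slope r + (ang r - tha))" for r
 define e1 where "e1 r = N * (slope r)\<^sup>2" for r
 define e2 where "e2 r = (1 + (slope r)\<^sup>2) * (N - 2 + q (ang r)) - (N - 2)" for r
 have "(v \<longlongrightarrow> 0) at_top"
 proof (rule damped_oscillator_tendsto_0[of "N - 2" "N - 1" e1 e2 v w])
  have "(e1 \<longlongrightarrow> N * 0\<^sup>2) at_top" unfolding e1_def by (intro tendsto_intros slope_tendsto)
  thus "(e1 \<longlongrightarrow> 0) at_top" by simp
  have "(e2 \<longlongrightarrow> (1 + 0\<^sup>2) * (N - 2 + 0) - (N - 2)) at_top"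
   unfolding e2_def by (intro tendsto_intros slope_tendsto q0)
  thus "(e2 \<longlongrightarrow> 0) at_top" by simp
  show "\<forall>\<^sub>F r in at_top. (v has_real_derivative w r) (at r)"
   using eventually_ge_at_top[of r\<^sub>0]
  proof eventually_elim
   case (elim r)
   show ?case unfolding v_def w_def
    by (rule derivative_eq_intros d_ang[OF level_in_I[OF elim]] refl)+ (simp add: algebra_simps)
  qed
  show "\<forall>\<^sub>F r in at_top. (w has_real_derivative - (N - 2 + e1 r) * w r - (N - 1 + e2 r) * v r) (at r)"
   using eventually_ge_at_top[of r\<^sub>0]
  proof eventually_elim
   case (elim r)
   note i = level_in_I[OF elim]
   have "(w has_real_derivative exp r * ((1 + (slope r)\<^sup>2) * (slope_force m n (ang r) - N * slope r) + slope r)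
     + exp r * (slope r + (ang r - tha))) (at r)"
    unfolding w_def N_def
    by (rule derivative_eq_intros d_ang[OF i] d_slope[OF i] refl)+ (simp add: algebra_simps)
   moreover have "exp r * ((1 + (slope r)\<^sup>2) * (slope_force m n (ang r) - N * slope r) + slope r)
     + exp r * (slope r + (ang r - tha)) = - (N - 2 + e1 r) * w r - (N - 1 + e2 r) * v r"
    unfolding qf v_def w_def e1_def e2_def by (simp add: algebra_simps power2_eq_square)
   ultimately show ?case by simp
  qed
 qed (use N in auto)
 thus ?thesis by (simp add: v_def[abs_def])
qed

end

section \<open>The end of the profile as a graph over the cone\<close>

locale asymptotic_surface = profile_surface S \<nu> e1 f1 m n
 for S :: "((real^'m) \<times> (real^'n)) set" and \<nu> e1 f1 and m n :: real +
 assumes complete: "complete_hypersurface S" and asym: "asymptotic_to_lawson_cone S"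
  and dist1: "infdist 0 S = 1"
begin

lemma norm_ge_1: "z \<in> S ==> 1 \<le> norm z"
 using infdist_le[of z S 0] dist1 by simp

lemma S_nonempty: "S ~= {}" using dist1 by (auto simp: infdist_def)

definition tha :: real where "tha = arctan (sqrt ((n - 1) / (m - 1)))"

lemma mn2: "m \<ge> 2" "n \<ge> 2" using mn dims by auto

lemma cone_angle: "0 < tha" "tha < pi / 2" "(n - 1) * (cos tha)\<^sup>2 = (m - 1) * (sin tha)\<^sup>2"
proof -
 show 1: "0 < tha" "tha < pi / 2" using mn2 arctan_ubound by (auto simp: tha_def)
 have "cos tha > 0" using 1 by (simp add: cos_gt_zero)
 moreover have "tan tha = sqrt ((n - 1) / (m - 1))" by (simp add: tha_def tan_arctan)
 ultimately have "sin tha = sqrt ((n - 1) / (m - 1)) * cos tha" by (simp add: tan_def field_simps)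
 hence "(sin tha)\<^sup>2 = (n - 1) / (m - 1) * (cos tha)\<^sup>2" using mn2 by (simp add: power_mult_distrib)
 thus "(n - 1) * (cos tha)\<^sup>2 = (m - 1) * (sin tha)\<^sup>2" using mn2 by simp
qed

lemma cone_sin_cos: "cos tha > 0" "sin tha > 0" "(cos tha)\<^sup>2 + (sin tha)\<^sup>2 = 1"
 using cone_angle by (auto simp: cos_gt_zero sin_gt_zero)

lemma link_norms:
 assumes "tht \<in> (lawson_link :: ((real^'m) \<times> (real^'n)) set)"
 shows "norm (fst tht) = cos tha" "norm (snd tht) = sin tha"
proof -
 define p q where "p = (norm (fst tht))\<^sup>2" and "q = (norm (snd tht))\<^sup>2"
 have "norm tht = 1" using assms by (simp add: lawson_link_def)
 hence 1: "p + q = 1" by (simp add: p_def q_def norm_prod_def split: prod.splits)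
 have 2: "(n - 1) * p = (m - 1) * q"
  using assms by (simp add: lawson_link_def lawson_cone_def lawson_form_def p_def q_def dims case_prod_beta)
 have e: "u = c" if "u + v = 1" "(n - 1) * u = (m - 1) * v" "c + s = 1" "(n - 1) * c = (m - 1) * s" for u v c s :: real
 proof -
  have "(n - 1) * u = (m - 1) * (1 - u)" "(n - 1) * c = (m - 1) * (1 - c)"
   using that by (metis add_diff_cancel_left')+
  hence "(m + n - 2) * (u - c) = 0" by (simp add: algebra_simps)
  thus ?thesis using mn2 by simp
 qed
 have "p = (cos tha)\<^sup>2" by (rule e[OF 1 2 cone_sin_cos(3) cone_angle(3)])
 moreover from this 1 cone_sin_cos(3) have "q = (sin tha)\<^sup>2" by linarith
 ultimately show "norm (fst tht) = cos tha" "norm (snd tht) = sin tha"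
  using cone_sin_cos by (auto simp: p_def q_def intro!: power2_eq_imp_eq)
qed

text \<open>The orbit directions and the radial direction are tangent to the cone and leave a single
  normal line. Which of its two unit vectors \<open>\<nu>C\<close> picks stays open as
  \<open>sgm\<close>.\<close>

lemma cone_normal:
 fixes \<nu>C :: "(real^'m) \<times> (real^'n) => (real^'m) \<times> (real^'n)"
 assumes nC: "unit_normal (lawson_cone - {0}) \<nu>C" and tht: "tht \<in> lawson_link"
 obtains sgm where "\<bar>sgm\<bar> = 1"
  "\<nu>C tht = ((sgm * sin tha) *\<^sub>R sgn (fst tht), (- sgm * cos tha) *\<^sub>R sgn (snd tht))"
proof -
 obtain x y where xy: "tht = (x, y)" by fastforce
 have nx: "norm x = cos tha" "norm y = sin tha" using link_norms[OF tht] by (simp_all add: xy)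
 have nz: "x ~= 0" "y ~= 0" using nx cone_sin_cos by auto
 have ss: "sgn x \<bullet> sgn x = 1" "sgn y \<bullet> sgn y = 1" using nz by (simp_all add: sgn_inner_self)
 have C: "tht \<in> lawson_cone - {0}" using tht nz by (auto simp: lawson_link_def xy)
 have nrm: "norm (\<nu>C tht) = 1" and perp: "\<And>v. v \<in> tangent_space (lawson_cone - {0}) tht ==> v \<bullet> \<nu>C tht = 0"
  using nC C unfolding unit_normal_def orthogonal_comp_def orthogonal_def by auto
 have cone: "(x', y') \<in> lawson_cone - {0}" if "norm x' = norm x" "norm y' = norm y" for x' :: "real^'m" and y' :: "real^'n"
  using C that nz by (auto simp: xy lawson_cone_def lawson_form_def zero_prod_def)
 have 1: "xi \<bullet> fst (\<nu>C tht) = 0" if xi: "xi \<bullet> x = 0" for xi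
 proof -
  obtain gm where gm: "gm 0 = x" "\<And>t. norm (gm t) = norm x" "(gm has_vector_derivative xi) (at (0::real))"
   using nz(1) xi by (rule curve_on_sphere) blast
  have "(xi, 0) \<in> tangent_space (lawson_cone - {0}) tht"
   unfolding tangent_space_def
   by (rule CollectI, rule exI[of _ "%t. (gm t, y)"])
    (use gm cone in \<open>auto simp: xy intro!: has_vector_derivative_Pair has_vector_derivative_const\<close>)
  from perp[OF this] show ?thesis by (simp add: inner_prod_def)
 qed
 have 2: "xi \<bullet> snd (\<nu>C tht) = 0" if xi: "xi \<bullet> y = 0" for xi
 proof -
  obtain gm where gm: "gm 0 = y" "\<And>t. norm (gm t) = norm y" "(gm has_vector_derivative xi) (at (0::real))"
   using nz(2) xi by (rule curve_on_sphere) blast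
  have "(0, xi) \<in> tangent_space (lawson_cone - {0}) tht"
   unfolding tangent_space_def
   by (rule CollectI, rule exI[of _ "%t. (x, gm t)"])
    (use gm cone in \<open>auto simp: xy intro!: has_vector_derivative_Pair has_vector_derivative_const\<close>)
  from perp[OF this] show ?thesis by (simp add: inner_prod_def)
 qed
 have 3: "tht \<bullet> \<nu>C tht = 0"
 proof (rule perp)
  have "(1 + t) *\<^sub>R tht \<in> lawson_cone - {0}" if "dist t 0 < 1" for t :: real
  proof -
   have "1 + t ~= 0" using that by (auto simp: dist_real_def)
   moreover have "lawson_form ((1 + t) *\<^sub>R tht) = (1 + t)\<^sup>2 * lawson_form tht"
   proof -
    have e: "(norm ((1 + t) *\<^sub>R v))\<^sup>2 = (1 + t)\<^sup>2 * (norm v)\<^sup>2" for v :: "'c::real_normed_vector"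
     by (simp only: norm_scaleR power_mult_distrib power2_abs)
    show ?thesis unfolding xy lawson_form_def scaleR_Pair prod.case e
     by (simp add: right_diff_distrib mult.left_commute)
   qed
   ultimately show ?thesis using C by (simp add: lawson_cone_def)
  qed
  hence "\<forall>\<^sub>F t in at 0. (1 + t) *\<^sub>R tht \<in> lawson_cone - {0}"
   unfolding eventually_at by (intro exI[of _ 1]) auto
  moreover have "((%t. (1 + t) *\<^sub>R tht) has_vector_derivative tht) (at 0)"
   by (auto intro!: derivative_eq_intros)
  ultimately show "tht \<in> tangent_space (lawson_cone - {0}) tht"
   unfolding tangent_space_def by (intro CollectI exI[of _ "%t. (1 + t) *\<^sub>R tht"]) auto
 qed
 define p q where "p = fst (\<nu>C tht) \<bullet> sgn x" and "q = snd (\<nu>C tht) \<bullet> sgn y"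
 have P: "fst (\<nu>C tht) = p *\<^sub>R sgn x"
 proof -
  define d where "d = fst (\<nu>C tht) - p *\<^sub>R sgn x"
  have "d \<bullet> sgn x = 0" by (simp add: d_def p_def inner_diff_left ss)
  hence dx: "d \<bullet> x = 0" using nz by (simp add: sgn_div_norm)
  have "d \<bullet> d = d \<bullet> fst (\<nu>C tht) - p * (d \<bullet> sgn x)" by (simp add: d_def inner_diff_right)
  also have "\<dots> = 0" using 1[OF dx] \<open>d \<bullet> sgn x = 0\<close> by simp
  finally show ?thesis by (simp add: d_def)
 qed
 have Q: "snd (\<nu>C tht) = q *\<^sub>R sgn y"
 proof -
  define d where "d = snd (\<nu>C tht) - q *\<^sub>R sgn y"
  have "d \<bullet> sgn y = 0" by (simp add: d_def q_def inner_diff_left ss)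
  hence dx: "d \<bullet> y = 0" using nz by (simp add: sgn_div_norm)
  have "d \<bullet> d = d \<bullet> snd (\<nu>C tht) - q * (d \<bullet> sgn y)" by (simp add: d_def inner_diff_right)
  also have "\<dots> = 0" using 2[OF dx] \<open>d \<bullet> sgn y = 0\<close> by simp
  finally show ?thesis by (simp add: d_def)
 qed
 have "\<nu>C tht \<bullet> \<nu>C tht = 1" using nrm by (simp add: dot_square_norm)
 hence u: "p\<^sup>2 + q\<^sup>2 = 1" by (simp add: inner_prod_def P Q ss power2_eq_square)
 have "x \<bullet> sgn x = norm x" "y \<bullet> sgn y = norm y" using nz by (simp_all add: sgn_div_norm dot_square_norm power2_eq_square)
 hence o: "cos tha * p + sin tha * q = 0" using 3 nx by (simp add: xy[symmetric] inner_prod_def P Q) (simp add: xy mult.commute)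
 define sgm where "sgm = p * sin tha - q * cos tha"
 have alg: "(p * s - q * c) * s = p * (c\<^sup>2 + s\<^sup>2) - c * (c * p + s * q)"
  "- (p * s - q * c) * c = q * (c\<^sup>2 + s\<^sup>2) - s * (c * p + s * q)"
  "(p * s - q * c)\<^sup>2 = (p\<^sup>2 + q\<^sup>2) * (c\<^sup>2 + s\<^sup>2) - (c * p + s * q)\<^sup>2" for c s
  by (simp_all add: power2_eq_square algebra_simps)
 have "sgm * sin tha = p * ((cos tha)\<^sup>2 + (sin tha)\<^sup>2) - cos tha * (cos tha * p + sin tha * q)"
  "- sgm * cos tha = q * ((cos tha)\<^sup>2 + (sin tha)\<^sup>2) - sin tha * (cos tha * p + sin tha * q)"
  "sgm\<^sup>2 = (p\<^sup>2 + q\<^sup>2) * ((cos tha)\<^sup>2 + (sin tha)\<^sup>2) - (cos tha * p + sin tha * q)\<^sup>2"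
  unfolding sgm_def by (fact alg)+
 hence "sgm * sin tha = p" "- sgm * cos tha = q" "sgm\<^sup>2 = 1" unfolding o cone_sin_cos(3) u by simp_all
 moreover from this have "\<bar>sgm\<bar> = 1" by (simp add: abs_square_eq_1)
 ultimately show ?thesis using P Q by (intro that[of sgm]) (auto simp: xy prod_eq_iff)
qed

text \<open>Coordinates along and across the profile ray \<open>(cos tha, sin tha)\<close> of the cone; the sign cases
 of \<open>graph_radius\<close> exclude that the point lies over another ray of the orbit.\<close>

lemma strand_end:
 assumes st: "strand I X Y" and I: "{s..} \<subseteq> I"
 defines "A \<equiv> %t. X t * cos tha + Y t * sin tha" and "B \<equiv> %t. X t * sin tha - Y t * cos tha"
 shows "filterlim A at_top at_top" "(B \<longlongrightarrow> 0) at_top"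
proof -
 have sI: "s \<in> I" using I by auto
 have s0: "s > 0" using strandD[OF st sI] by (smt (verit) zero_less_power2)
 note end_ax = profile_end_axioms.intro[OF I s0 cone_angle]
 interpret ode: profile_end I X Y "%t. nu1 (X t) (Y t)" "%t. nu2 (X t) (Y t)" "%t. kk (X t) (Y t)" "%t. lam (X t) (Y t)" m n s tha
  by (intro profile_end.intro strand_profile_ode[OF st] end_ax)
 have lim: "filterlim (%t::real. ln (2 * t) / 2) at_top at_top"
  using filterlim_tendsto_pos_mult_at_top[OF tendsto_const _ filterlim_compose[OF ln_at_top
   filterlim_tendsto_pos_mult_at_top[OF tendsto_const _ filterlim_ident]], of "1/2" 2] by simp
 have ev: "\<forall>\<^sub>F t in at_top. t \<in> I" using eventually_ge_at_top[of s] by eventually_elim (use I in auto)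
 have eln: "exp (2 * (ln (2 * t) / 2)) / 2 = t" "exp (ln (2 * t) / 2) = sqrt (2 * t)" if "t \<in> I" for t
 proof -
  have t: "t > 0" by (rule ode.t_pos[OF that])
  thus "exp (2 * (ln (2 * t) / 2)) / 2 = t" by simp
  have "ln (2 * t) / 2 = ln (sqrt (2 * t))" using t ln_sqrt[of "2 * t"] by simp
  thus "exp (ln (2 * t) / 2) = sqrt (2 * t)" using t by simp
 qed
 have bnd: "\<bar>B t\<bar> \<le> \<bar>exp (ln (2 * t) / 2) * (ode.ang (ln (2 * t) / 2) - tha)\<bar>" if t: "t \<in> I" for t
 proof -
  define al where "al = ode.ang (ln (2 * t) / 2)"
  have al: "al = arctan (Y t / X t)" by (simp only: al_def ode.ang_def eln[OF t])
  have "B t = - sqrt (2 * t) * sin (al - tha)"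
  proof -
   have "X t = sqrt (2 * t) * cos al" "Y t = sqrt (2 * t) * sin al"
    using polar_quadrant(1,2)[of "X t" "Y t"] ode.pos[OF t] unfolding ode.level[OF t] al by simp_all
   moreover have "rho * cos al * s - rho * sin al * c = - rho * (sin al * c - cos al * s)" for rho s c :: real
    by (simp add: algebra_simps)
   ultimately show ?thesis unfolding B_def sin_diff by simp
  qed
  hence "\<bar>B t\<bar> = sqrt (2 * t) * \<bar>sin (al - tha)\<bar>" using ode.t_pos[OF t] by (simp add: abs_mult)
  also have "\<dots> \<le> sqrt (2 * t) * \<bar>al - tha\<bar>" by (intro mult_left_mono abs_sin_x_le_abs_x) (use ode.t_pos[OF t] in simp)
  finally show ?thesis using ode.t_pos[OF t] by (simp add: eln(2)[OF t] al_def abs_mult)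
 qed
 have "((%t. exp (ln (2 * t) / 2) * (ode.ang (ln (2 * t) / 2) - tha)) \<longlongrightarrow> 0) at_top"
  by (rule filterlim_compose[OF ode.offset_tendsto_0 lim])
 from tendsto_rabs_zero[OF this] show B0: "(B \<longlongrightarrow> 0) at_top"
  by (rule Lim_null_comparison[rotated]) (use ev bnd in \<open>auto elim: eventually_mono\<close>)
 have AB: "(A t)\<^sup>2 + (B t)\<^sup>2 = 2 * t" "A t > 0" if t: "t \<in> I" for t
 proof -
  have "(x * c + y * s)\<^sup>2 + (x * s - y * c)\<^sup>2 = (x\<^sup>2 + y\<^sup>2) * (c\<^sup>2 + s\<^sup>2)" for x y c s :: real
   by (simp add: power2_eq_square algebra_simps)
  from this[of "X t" "cos tha" "Y t" "sin tha"] show "(A t)\<^sup>2 + (B t)\<^sup>2 = 2 * t"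
   unfolding A_def B_def ode.level[OF t] cone_sin_cos(3) by simp
  show "A t > 0" unfolding A_def using ode.pos[OF t] cone_sin_cos by (intro add_pos_pos mult_pos_pos) auto
 qed
 have ev1: "\<forall>\<^sub>F t in at_top. \<bar>B t\<bar> < 1" using order_tendstoD(2)[OF tendsto_rabs_zero[OF B0], of 1] by simp
 have "\<forall>\<^sub>F t in at_top. sqrt (2 * t - 1) \<le> A t"
  using ev ev1
 proof eventually_elim
  case (elim t)
  have "(B t)\<^sup>2 \<le> 1" using elim(2) by (simp add: abs_square_le_1)
  hence "2 * t - 1 \<le> (A t)\<^sup>2" using AB(1)[OF elim(1)] by simp
  from real_sqrt_le_mono[OF this] show ?case using AB(2)[OF elim(1)] by simp
 qed
 moreover have "filterlim (%t::real. sqrt (2 * t - 1)) at_top at_top"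
  using filterlim_compose[OF sqrt_at_top filterlim_tendsto_add_at_top[OF tendsto_const[of "- 1"]
   filterlim_tendsto_pos_mult_at_top[OF tendsto_const _ filterlim_ident]], of 2] by simp
 ultimately show "filterlim A at_top at_top" using filterlim_at_top_mono by blast
qed

lemma graph_radius:
 fixes c s r om X Y eps dlt R R' :: real
 assumes cs: "c > 0" "s > 0" "c\<^sup>2 + s\<^sup>2 = 1" and XY: "X > 0" "Y > 0"
  and X: "X = eps * (r * c + om * s)" and Y: "Y = dlt * (r * s - om * c)" and sg: "eps = 1 \<or> eps = -1" "dlt = 1 \<or> dlt = -1"
  and r: "r > R" "R > 0" and w: "r > R' ==> \<bar>om\<bar> < 1"
  and B: "\<bar>X * s - Y * c\<bar> < min 1 R"
  and A: "X * c + Y * s > 1 / (c * s)" "s ~= c ==> X * c + Y * s > (\<bar>R'\<bar> + 1) / \<bar>s\<^sup>2 - c\<^sup>2\<bar>"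
 shows "eps = 1" "dlt = 1"
proof -
 define a where "a = X * c + Y * s"
 define b where "b = X * s - Y * c"
 have b: "\<bar>b\<bar> < 1" "\<bar>b\<bar> < R" using B by (auto simp: b_def)
 have a0: "a > 0" unfolding a_def using cs XY by (simp add: add_pos_pos)
 have sc: "2 * (s * c) \<le> 1" "s * c > 0" using cs sum_squares_bound[of s c] by (simp_all add: mult.assoc)
 have acs: "a * (s * c) > 1" using A(1) cs unfolding a_def[symmetric] by (simp add: field_simps)
 have d1: "\<bar>s\<^sup>2 - c\<^sup>2\<bar> \<le> 1" using cs zero_le_power2[of s] zero_le_power2[of c] by linarith
 have bsc: "\<bar>2 * (s * c) * b\<bar> \<le> \<bar>b\<bar>" "\<bar>(s\<^sup>2 - c\<^sup>2) * b\<bar> \<le> \<bar>b\<bar>"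
  using mult_right_mono[OF sc(1), of "\<bar>b\<bar>"] mult_right_mono[OF d1, of "\<bar>b\<bar>"] cs by (simp_all add: abs_mult)
 have ids: "c * (c * u + s * v) + s * (s * u - c * v) = (c\<^sup>2 + s\<^sup>2) * u" for u v :: real
  by (simp add: power2_eq_square algebra_simps)
 \<comment> \<open>Opposite signs would put the point over a reflected ray. Then
   \<open>\<bar>om\<bar> \<ge> 1\<close>, which forces \<open>r \<le> R'\<close>. On the other hand
   \<open>r\<close> is, up to a term of size at most \<open>\<bar>b\<bar>\<close>, the large number
   \<open>a\<close> times \<open>s^2 - c^2\<close> or its negative, so it is either below
   \<open>R\<close> or above \<open>R'\<close>.\<close>
 have opp: False if "r = kap * (a * (s\<^sup>2 - c\<^sup>2) - 2 * (s * c) * b)" "\<bar>om\<bar> = \<bar>2 * (a * (s * c)) + (s\<^sup>2 - c\<^sup>2) * b\<bar>"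
  "kap = 1 \<or> kap = - 1" for kap :: real
 proof -
  have om: "\<bar>om\<bar> \<ge> 1" using acs bsc b(1) unfolding that(2) by linarith
  have "r \<le> R'" using w om by force
  show False
  proof (cases "kap * (s\<^sup>2 - c\<^sup>2) \<le> 0")
   case True
   hence "a * (kap * (s\<^sup>2 - c\<^sup>2)) \<le> 0" using a0 by (simp add: mult_nonneg_nonpos)
   moreover have "r = a * (kap * (s\<^sup>2 - c\<^sup>2)) - kap * (2 * (s * c) * b)" unfolding that(1) by (simp add: algebra_simps)
   moreover have "- (kap * (2 * (s * c) * b)) \<le> \<bar>2 * (s * c) * b\<bar>" using that(3) by auto
   ultimately show False using bsc(1) b(2) r by linarith
  next
   case False
   hence d: "kap * (s\<^sup>2 - c\<^sup>2) = \<bar>s\<^sup>2 - c\<^sup>2\<bar>" "s\<^sup>2 ~= c\<^sup>2" using that(3) by auto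
   hence "s ~= c" by auto
   from A(2)[OF this] d have "a * \<bar>s\<^sup>2 - c\<^sup>2\<bar> > \<bar>R'\<bar> + 1" unfolding a_def[symmetric] by (simp add: field_simps)
   moreover have "r = a * \<bar>s\<^sup>2 - c\<^sup>2\<bar> - kap * (2 * (s * c) * b)"
    unfolding that(1) d(1)[symmetric] by (simp add: algebra_simps)
   moreover have "kap * (2 * (s * c) * b) \<le> \<bar>2 * (s * c) * b\<bar>" using that(3) by auto
   ultimately show False using bsc(1) b \<open>r \<le> R'\<close> by linarith
  qed
 qed
 have rw: "r = c * (r * c + om * s) + s * (r * s - om * c)" "om = s * (r * c + om * s) - c * (r * s - om * c)"
 proof -
  have "c * (r * c + om * s) + s * (r * s - om * c) = r * (c\<^sup>2 + s\<^sup>2)"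
   "s * (r * c + om * s) - c * (r * s - om * c) = om * (c\<^sup>2 + s\<^sup>2)"
   by (simp_all add: power2_eq_square algebra_simps)
  thus "r = c * (r * c + om * s) + s * (r * s - om * c)" "om = s * (r * c + om * s) - c * (r * s - om * c)"
   using cs(3) by simp_all
 qed
 have ee: "eps * X = r * c + om * s" "dlt * Y = r * s - om * c" using X Y sg by auto
 have rab: "r = c * (eps * X) + s * (dlt * Y)" "om = s * (eps * X) - c * (dlt * Y)" using rw unfolding ee by simp_all
 have XYab: "X = a * c + b * s" "Y = a * s - b * c"
 proof -
  have "a * c + b * s = X * (c\<^sup>2 + s\<^sup>2)" "a * s - b * c = Y * (c\<^sup>2 + s\<^sup>2)"
   by (simp_all add: a_def b_def power2_eq_square algebra_simps)
  thus "X = a * c + b * s" "Y = a * s - b * c" using cs(3) by simp_all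
 qed
 have n1: "\<not> (eps = -1 & dlt = -1)"
 proof
  assume "eps = -1 & dlt = -1"
  hence "r = - a" using rab by (simp add: a_def mult.commute)
  thus False using a0 r by simp
 qed
 have n2: "\<not> (eps = -1 & dlt = 1)"
 proof
  assume e: "eps = -1 & dlt = 1"
  have "r = 1 * (a * (s\<^sup>2 - c\<^sup>2) - 2 * (s * c) * b)" and om: "om = - (2 * (a * (s * c)) + (s\<^sup>2 - c\<^sup>2) * b)"
   unfolding rab using e by (simp_all add: XYab power2_eq_square algebra_simps)
  from opp[OF this(1)] show False unfolding om abs_minus_cancel by blast
 qed
 have n3: "\<not> (eps = 1 & dlt = -1)"
 proof
  assume e: "eps = 1 & dlt = -1"
  have "r = (-1) * (a * (s\<^sup>2 - c\<^sup>2) - 2 * (s * c) * b)" and om: "om = 2 * (a * (s * c)) + (s\<^sup>2 - c\<^sup>2) * b"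
   unfolding rab using e by (simp_all add: XYab power2_eq_square algebra_simps)
  from opp[OF this(1)] show False unfolding om by blast
 qed
 show "eps = 1" "dlt = 1" using n1 n2 n3 sg by auto
qed

text \<open>The map \<open>G\<close> does not depend on the strand. Outside a compact set every
  point of \<open>S\<close> is a graph value over some point of the link; for a strand this point
  has to be \<open>thts\<close>, and the radius is the coordinate along the ray. Hence points of two
  strands with the same coordinate coincide.\<close>

lemma strand_end_graph:
 obtains G :: "real => (real^'m) \<times> (real^'n)" where
  "\<And>I X Y s. strand I X Y ==> {s..} \<subseteq> I ==>
   \<forall>\<^sub>F t in at_top. emb (X t) (Y t) = G (X t * cos tha + Y t * sin tha)"
proof -
 obtain \<nu>C R w where nC: "unit_normal (lawson_cone - {0 :: (real^'m) \<times> (real^'n)}) \<nu>C" and R: "R > 0"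
  and wlim: "((%r. C2_norm lawson_link (w r)) \<longlongrightarrow> 0) at_top"
  and cpt: "compact (S - {r *\<^sub>R tht + w r tht *\<^sub>R \<nu>C tht | r tht. tht \<in> lawson_link & r > R})"
  using asym unfolding asymptotic_to_lawson_cone_def Let_def by blast
 obtain M where M: "\<And>z. z \<in> S - {r *\<^sub>R tht + w r tht *\<^sub>R \<nu>C tht | r tht. tht \<in> lawson_link & r > R} ==> norm z \<le> M"
  using compact_imp_bounded[OF cpt] unfolding bounded_iff by blast
 have "\<forall>\<^sub>F r in at_top. C2_norm lawson_link (w r) < 1" using order_tendstoD(2)[OF wlim, of 1] by simp
 then obtain R' where R': "\<And>r. r \<ge> R' ==> C2_norm lawson_link (w r) < 1" unfolding eventually_at_top_linorder by blast
 have w1: "\<bar>w r tht\<bar> < 1" if "r > R'" "tht \<in> lawson_link" for r tht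
 proof -
  have "ennreal \<bar>w r tht\<bar> \<le> (SUP p\<in>lawson_link. ennreal \<bar>w r p\<bar>)" by (rule SUP_upper[OF that(2)])
  also have "\<dots> \<le> C2_norm lawson_link (w r)" unfolding C2_norm_def by (simp add: add.assoc)
  also have "\<dots> < 1" using R'[of r] that by simp
  finally show ?thesis by (simp add: ennreal_less_one_iff)
 qed
 define thts where "thts = emb (cos tha) (sin tha)"
 define G where "G rho = rho *\<^sub>R thts + w rho thts *\<^sub>R \<nu>C thts" for rho
 define c s where "c = cos tha" and "s = sin tha"
 have cs: "c > 0" "s > 0" "c\<^sup>2 + s\<^sup>2 = 1" using cone_sin_cos by (simp_all add: c_def s_def)
 show ?thesis
 proof (rule that[of G])
  fix I X Y s0 assume st: "strand I X Y" and I: "{s0..} \<subseteq> I"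
  note lims = strand_end[OF st I, folded c_def s_def]
  have ev1: "\<forall>\<^sub>F t in at_top. \<bar>X t * s - Y t * c\<bar> < min 1 R"
   using order_tendstoD(2)[OF tendsto_rabs_zero[OF lims(2)], of "min 1 R"] R by simp
  have ev2: "\<forall>\<^sub>F t in at_top. X t * c + Y t * s > max (1 / (c * s)) ((\<bar>R'\<bar> + 1) / \<bar>s\<^sup>2 - c\<^sup>2\<bar>)"
   using lims(1) unfolding filterlim_at_top_dense by blast
  have "\<forall>\<^sub>F t in at_top. emb (X t) (Y t) = G (X t * c + Y t * s)"
   using ev1 ev2 eventually_ge_at_top[of s0] eventually_gt_at_top[of "M\<^sup>2 / 2"]
  proof eventually_elim
   case (elim t)
   have tI: "t \<in> I" using elim(3) I by auto
   note p = strandD[OF st tI]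
   have t0: "t \<ge> 0" using p(2) by (smt (verit) zero_le_power2)
   have "(norm (emb (X t) (Y t)))\<^sup>2 = 2 * t"
    using p(2) t0 unfolding emb_def by (simp add: norm_prod_def unit p(4,5))
   hence "norm (emb (X t) (Y t)) > M" using elim(4) by (smt (verit) field_sum_of_halves power_mono norm_ge_zero)
   with M[of "emb (X t) (Y t)"] p(6) obtain r tht where r: "emb (X t) (Y t) = r *\<^sub>R tht + w r tht *\<^sub>R \<nu>C tht"
    "tht \<in> lawson_link" "r > R" by force
   obtain sgm where sgm: "\<bar>sgm\<bar> = 1"
    "\<nu>C tht = ((sgm * s) *\<^sub>R sgn (fst tht), (- sgm * c) *\<^sub>R sgn (snd tht))"
    using nC r(2) unfolding c_def s_def by (rule cone_normal) blast
   define x y where "x = sgn (fst tht)" and "y = sgn (snd tht)"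
   have th: "tht = (c *\<^sub>R x, s *\<^sub>R y)"
    using norm_scaleR_sgn[of "fst tht"] norm_scaleR_sgn[of "snd tht"] link_norms[OF r(2)]
    by (simp add: x_def y_def c_def s_def prod_eq_iff)
   have nxy: "norm x = 1" "norm y = 1"
    using link_norms[OF r(2)] cs by (auto simp: x_def y_def norm_sgn c_def s_def)
   define om where "om = w r tht * sgm"
   have eX: "X t *\<^sub>R e1 = (r * c + om * s) *\<^sub>R x" and eY: "Y t *\<^sub>R f1 = (r * s - om * c) *\<^sub>R y"
   proof -
    have "emb (X t) (Y t) = r *\<^sub>R (c *\<^sub>R x, s *\<^sub>R y) + w r tht *\<^sub>R ((sgm * s) *\<^sub>R x, (- sgm * c) *\<^sub>R y)"
     using r(1) unfolding sgm(2) x_def[symmetric] y_def[symmetric] by (simp only: th[symmetric])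
    thus "X t *\<^sub>R e1 = (r * c + om * s) *\<^sub>R x" "Y t *\<^sub>R f1 = (r * s - om * c) *\<^sub>R y"
     by (simp_all add: emb_def om_def algebra_simps)
   qed
   have aX: "\<bar>r * c + om * s\<bar> = X t" "\<bar>r * s - om * c\<bar> = Y t"
    using arg_cong[OF eX, of norm] arg_cong[OF eY, of norm] p(4,5) by (simp_all add: nxy unit)
   define eps dlt where "eps = sgn (r * c + om * s)" and "dlt = sgn (r * s - om * c)"
   have sg: "eps = 1 \<or> eps = -1" "dlt = 1 \<or> dlt = -1" using aX p(4,5) by (auto simp: eps_def dlt_def sgn_if)
   have XY: "X t = eps * (r * c + om * s)" "Y t = dlt * (r * s - om * c)"
    using aX by (simp_all add: eps_def dlt_def abs_sgn mult.commute)
   have wom: "\<bar>om\<bar> < 1" if "r > R'" using w1[OF that r(2)] sgm(1) by (simp add: om_def abs_mult)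
   have e2: "X t * c + Y t * s > 1 / (c * s)" "X t * c + Y t * s > (\<bar>R'\<bar> + 1) / \<bar>s\<^sup>2 - c\<^sup>2\<bar>" using elim(2) by simp_all
   have "eps = 1 & dlt = 1"
    using graph_radius[OF cs p(4,5) XY sg r(3) R wom elim(1) e2(1)] e2(2) by blast
   hence XY: "X t = r * c + om * s" "Y t = r * s - om * c" using XY by simp_all
   have "x = e1" "y = f1" using eX eY p(4,5) unfolding XY[symmetric] by auto
   hence th: "tht = thts" using th by (simp add: thts_def emb_def c_def s_def)
   have "X t * c + Y t * s = r * (c\<^sup>2 + s\<^sup>2)" unfolding XY by (simp add: power2_eq_square algebra_simps)
   hence "X t * c + Y t * s = r" using cs by simp
   thus ?case using r(1) unfolding G_def th by simp
  qed
  thus "\<forall>\<^sub>F t in at_top. emb (X t) (Y t) = G (X t * cos tha + Y t * sin tha)" by (simp add: c_def s_def)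
 qed
qed

lemma emb_eqD: "emb x y = emb x' y' ==> x = x' & y = y'"
 using unit by (auto simp: emb_def)

text \<open>The coordinates along the ray are continuous and tend to infinity on both strands, so
  some common value is attained on each of them. The graph then gives the same point, and since the
  parameter is \<open>|z|^2 / 2\<close>, also the same parameter.\<close>

lemma strands_meet:
 assumes st: "strand I X Y" "strand J X' Y'" and I: "{s..} \<subseteq> I" "{s'..} \<subseteq> J"
 obtains t where "t \<in> I" "t \<in> J" "X t = X' t" "Y t = Y' t"
proof -
 obtain G where G: "\<And>I X Y s. strand I X Y ==> {s..} \<subseteq> I ==>
   \<forall>\<^sub>F t in at_top. emb (X t) (Y t) = G (X t * cos tha + Y t * sin tha)"
  by (rule strand_end_graph) blast
 define A where "A t = X t * cos tha + Y t * sin tha" for t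
 define A' where "A' t = X' t * cos tha + Y' t * sin tha" for t
 have lim: "filterlim A at_top at_top" "filterlim A' at_top at_top"
  using strand_end(1)[OF st(1) I(1)] strand_end(1)[OF st(2) I(2)] by (simp_all add: A_def[abs_def] A'_def[abs_def])
 from eventually_conj[OF G[OF st(1) I(1)] G[OF st(2) I(2)]] obtain T0 where
  T0: "\<And>t. t \<ge> T0 ==> emb (X t) (Y t) = G (A t) & emb (X' t) (Y' t) = G (A' t)"
  unfolding A_def A'_def eventually_at_top_linorder by blast
 define T where "T = max T0 (max s s')"
 have sub: "{T..} \<subseteq> I" "{T..} \<subseteq> J" using I by (auto simp: T_def)
 have cont: "continuous_on {T..} A" "continuous_on {T..} A'"
 proof -
  have "continuous_on {T..} X" "continuous_on {T..} Y" "continuous_on {T..} X'" "continuous_on {T..} Y'"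
   using st sub unfolding strand_def by (meson continuous_on_subset)+
  thus "continuous_on {T..} A" "continuous_on {T..} A'"
   unfolding A_def[abs_def] A'_def[abs_def] by (simp_all add: continuous_on_add continuous_on_mult_right)
 qed
 define rho where "rho = max (A T) (A' T)"
 have hit: "\<exists>t\<ge>T. F t = rho" if F: "filterlim F at_top at_top" "continuous_on {T..} F" "F T \<le> rho" for F :: "real => real"
 proof -
  have "\<forall>\<^sub>F t in at_top. rho \<le> F t & T \<le> t"
   using F(1) eventually_ge_at_top[of T] unfolding filterlim_at_top by (simp add: eventually_conj)
  then obtain u where u: "rho \<le> F u" "T \<le> u" using eventually_happens by fastforce
  have "continuous_on {T..u} F" using F(2) by (rule continuous_on_subset) auto
  from IVT'[OF F(3) u this] show ?thesis by auto
 qed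
 obtain t where t: "t \<ge> T" "A t = rho" using hit[OF lim(1) cont(1)] by (auto simp: rho_def)
 obtain t' where t': "t' \<ge> T" "A' t' = rho" using hit[OF lim(2) cont(2)] by (auto simp: rho_def)
 have "emb (X t) (Y t) = emb (X' t') (Y' t')" using T0[of t] T0[of t'] t t' by (simp add: T_def)
 hence e: "X t = X' t'" "Y t = Y' t'" using emb_eqD by blast+
 have tI: "t \<in> I" "t' \<in> J" using t t' sub by auto
 have "2 * t = 2 * t'" using strandD(2)[OF st(1) tI(1)] strandD(2)[OF st(2) tI(2)] unfolding e by simp
 thus ?thesis using that e tI by simp
qed

end

section \<open>Global structure: the profile is a single strand that ends on an axis\<close>

context asymptotic_surface
begin

definition maximal :: "real set => (real => real) => (real => real) => bool" where
 "maximal U X Y \<longleftrightarrow> strand U X Y &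
  (\<forall>J X' Y' r. strand J X' Y' --> r \<in> J --> r \<in> U --> X' r = X r --> Y' r = Y r --> J \<subseteq> U)"

lemma maximal_through:
 assumes p: "(x, y) \<in> prof" and k: "kk x y ~= 0"
 obtains U X Y where "maximal U X Y" "(x\<^sup>2 + y\<^sup>2) / 2 \<in> U" "X ((x\<^sup>2 + y\<^sup>2) / 2) = x" "Y ((x\<^sup>2 + y\<^sup>2) / 2) = y"
proof -
 define t0 where "t0 = (x\<^sup>2 + y\<^sup>2) / 2"
 obtain eps X Y where eps: "eps > 0" "strand {t0 - eps<..<t0 + eps} X Y" "X t0 = x" "Y t0 = y"
  unfolding t0_def using p k by (rule local_strand) blast
 hence t0: "t0 \<in> {t0 - eps<..<t0 + eps}" by simp
 obtain U X1 Y1 where "strand U X1 Y1" "{t0 - eps<..<t0 + eps} \<subseteq> U"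
  "\<And>t. t \<in> {t0 - eps<..<t0 + eps} ==> X1 t = X t & Y1 t = Y t"
  "\<And>J X' Y' r. strand J X' Y' ==> r \<in> J ==> r \<in> U ==> X' r = X1 r ==> Y' r = Y1 r ==> J \<subseteq> U"
  using maximal_strand[OF eps(2) t0] by blast
 with t0 eps show ?thesis by (intro that[of U X1 Y1, folded t0_def]) (auto simp: maximal_def)
qed

lemma level_limit:
 assumes st: "strand U X Y" and F: "F ~= bot" "F \<le> nhds b" "\<forall>\<^sub>F t in F. t \<in> U"
  and lim: "(X \<longlongrightarrow> x) F" "(Y \<longlongrightarrow> y) F"
 shows "x\<^sup>2 + y\<^sup>2 = 2 * b" "x \<ge> 0" "y \<ge> 0"
proof -
 have "((%t. t) \<longlongrightarrow> b) F" using F(2) by (simp add: filterlim_def)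
 hence 1: "((%t. 2 * t) \<longlongrightarrow> 2 * b) F" by (intro tendsto_intros)
 have 2: "((%t. (X t)\<^sup>2 + (Y t)\<^sup>2) \<longlongrightarrow> x\<^sup>2 + y\<^sup>2) F" by (intro tendsto_intros lim)
 have "\<forall>\<^sub>F t in F. (X t)\<^sup>2 + (Y t)\<^sup>2 = 2 * t" using F(3) by eventually_elim (rule strandD(2)[OF st])
 from tendsto_unique[OF F(1) _ 1] 2 tendsto_cong[OF this] show "x\<^sup>2 + y\<^sup>2 = 2 * b" by blast
 have "\<forall>\<^sub>F t in F. 0 \<le> X t" "\<forall>\<^sub>F t in F. 0 \<le> Y t"
  using F(3) strandD(4,5)[OF st] by (auto elim!: eventually_mono intro: less_imp_le)
 thus "x \<ge> 0" "y \<ge> 0" using tendsto_lowerbound lim F(1) by blast+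
qed

text \<open>The local strand through a regular limit point contains the nearby points of the maximal
  strand, so it belongs to it, and its interval reaches past \<open>b\<close>. The filter covers
  both ends of the interval.\<close>

lemma maximal_extends:
 assumes max: "maximal U X Y" and F: "F ~= bot" "F \<le> nhds b" "\<forall>\<^sub>F t in F. t \<in> U"
  and lim: "(X \<longlongrightarrow> x) F" "(Y \<longlongrightarrow> y) F" and p: "(x, y) \<in> prof" "kk x y ~= 0"
 shows "b \<in> U"
proof -
 have st: "strand U X Y" using max by (simp add: maximal_def)
 have b: "(x\<^sup>2 + y\<^sup>2) / 2 = b" using level_limit(1)[OF st F lim] by simp
 obtain eps r X' Y' where eps: "eps > 0" "r > 0" "strand {b - eps<..<b + eps} X' Y'"
  and agree: "\<And>x' y'. (x', y') \<in> prof ==> \<bar>x' - x\<bar> < r ==> \<bar>y' - y\<bar> < r ==> \<bar>(x'\<^sup>2 + y'\<^sup>2) / 2 - b\<bar> < eps ==>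
   x' = X' ((x'\<^sup>2 + y'\<^sup>2) / 2) & y' = Y' ((x'\<^sup>2 + y'\<^sup>2) / 2)"
  unfolding b[symmetric] using p by (rule local_strand) blast
 have "((%t. t) \<longlongrightarrow> b) F" using F(2) by (simp add: filterlim_def)
 hence ev: "\<forall>\<^sub>F t in F. dist t b < eps" "\<forall>\<^sub>F t in F. dist (X t) x < r" "\<forall>\<^sub>F t in F. dist (Y t) y < r"
  using tendstoD lim eps(1,2) by blast+
 have "\<forall>\<^sub>F t in F. t \<in> U & dist t b < eps & dist (X t) x < r & dist (Y t) y < r"
  using F(3) ev by eventually_elim blast
 then obtain t where t: "t \<in> U" "\<bar>t - b\<bar> < eps" "\<bar>X t - x\<bar> < r" "\<bar>Y t - y\<bar> < r"
  using eventually_happens'[OF F(1)] by (auto simp: dist_real_def)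
 have e: "((X t)\<^sup>2 + (Y t)\<^sup>2) / 2 = t" using strandD(2)[OF st t(1)] by simp
 have "X t = X' t & Y t = Y' t"
  using agree[OF strandD(1)[OF st t(1)] t(3,4)] t(2) unfolding e by blast
 moreover have "t \<in> {b - eps<..<b + eps}" using t(2) by (auto simp: abs_less_iff)
 ultimately have "{b - eps<..<b + eps} \<subseteq> U" using max eps(3) t(1) unfolding maximal_def by metis
 thus ?thesis using eps(1) by auto
qed

lemma tendsto_nu:
 assumes "(X \<longlongrightarrow> x) F" "(Y \<longlongrightarrow> y) F" "emb x y \<in> S" "\<forall>\<^sub>F t in F. emb (X t) (Y t) \<in> S"
 shows "((%t. nu1 (X t) (Y t)) \<longlongrightarrow> nu1 x y) F" "((%t. nu2 (X t) (Y t)) \<longlongrightarrow> nu2 x y) F"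
  "((%t. kk (X t) (Y t)) \<longlongrightarrow> kk x y) F"
proof -
 have "((%t. emb (X t) (Y t)) \<longlongrightarrow> emb x y) F" unfolding emb_def by (intro tendsto_intros assms)
 hence *: "((%t. \<nu> (emb (X t) (Y t))) \<longlongrightarrow> \<nu> (emb x y)) F"
  by (rule continuous_on_tendsto_compose[OF unit_normal_continuous[OF \<nu>] _ assms(3,4)])
 show n: "((%t. nu1 (X t) (Y t)) \<longlongrightarrow> nu1 x y) F" "((%t. nu2 (X t) (Y t)) \<longlongrightarrow> nu2 x y) F"
  using * unfolding nu1_def nu2_def emb_def by (auto intro!: tendsto_intros)
 show "((%t. kk (X t) (Y t)) \<longlongrightarrow> kk x y) F" unfolding kk_def by (intro tendsto_intros assms n)
qed

text \<open>Towards infinity the flux \<open>w k\<close> cannot decrease, so a strand can end neither on an axis nor at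
 a critical point of the distance from the origin.\<close>

lemma maximal_unbounded:
 assumes max: "maximal U X Y" and s: "s \<in> U"
 shows "{s..} \<subseteq> U"
proof (rule ccontr)
 assume "\<not> ?thesis"
 then obtain u where u: "u \<ge> s" "u \<notin> U" by auto
 have st: "strand U X Y" using max by (simp add: maximal_def)
 interpret ode: profile_ode U X Y "%t. nu1 (X t) (Y t)" "%t. nu2 (X t) (Y t)" "%t. kk (X t) (Y t)" "%t. lam (X t) (Y t)" m n
  by (rule strand_profile_ode[OF st])
 define b where "b = Inf ({s..} - U)"
 have cl: "closed ({s..} - U)" using ode.I(1) by (intro closed_Diff) auto
 have bd: "bdd_below ({s..} - U)" by (rule bdd_belowI[of _ s]) auto
 have b: "b \<in> {s..} - U" unfolding b_def by (rule closed_contains_Inf[OF _ bd cl]) (use u in auto)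
 have sb: "s < b" using b s by (cases "s = b") auto
 have sub: "{s<..<b} \<subseteq> U"
 proof (rule subsetI, rule ccontr)
  fix t assume t: "t \<in> {s<..<b}" "t \<notin> U"
  hence "b \<le> t" unfolding b_def by (intro cInf_lower[OF _ bd]) auto
  thus False using t by simp
 qed
 obtain x y where lim: "(X \<longlongrightarrow> x) (at_left b)" "(Y \<longlongrightarrow> y) (at_left b)" and xyS: "emb x y \<in> S"
  using strand_limit(1)[OF complete st sb sub] by blast
 have ev: "\<forall>\<^sub>F t in at_left b. t \<in> {s<..<b}" using sb by (auto simp: eventually_at_left[OF sb])
 have evU: "\<forall>\<^sub>F t in at_left b. t \<in> U" using ev by (rule eventually_mono) (use sub in auto)
 have F: "at_left b ~= bot" "at_left b \<le> nhds b" by (simp_all add: at_within_le_nhds)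
 note lev = level_limit[OF st F evU lim]
 have S: "\<forall>\<^sub>F t in at_left b. emb (X t) (Y t) \<in> S" using evU strandD(6)[OF st] by (auto elim: eventually_mono)
 note nu = tendsto_nu[OF lim xyS S]
 have evXY: "\<forall>\<^sub>F t in at_left b. X t \<ge> 0" "\<forall>\<^sub>F t in at_left b. Y t \<ge> 0"
  using evU ode.pos by (auto elim!: eventually_mono intro: less_imp_le)
 have w: "(ode.w \<longlongrightarrow> x powr (m - 1) * y powr (n - 1)) (at_left b)"
  unfolding ode.w_def[abs_def]
  by (intro tendsto_mult tendsto_powr' lim tendsto_const) (use evXY ode.mn in auto)
 define c where "c = (ode.w s * kk (X s) (Y s))\<^sup>2"
 have c: "c > 0" using ode.w_pos[OF s] ode.k0[OF s] by (simp add: c_def)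
 have "\<forall>\<^sub>F t in at_left b. c \<le> (ode.w t * kk (X t) (Y t))\<^sup>2"
  using ev
 proof eventually_elim
  case (elim t)
  have "t \<in> U" using elim sub by auto
  from ode.flux_square_mono[OF s this] elim show ?case unfolding c_def by simp
 qed
 moreover have "((%t. (ode.w t * kk (X t) (Y t))\<^sup>2) \<longlongrightarrow> (x powr (m - 1) * y powr (n - 1) * kk x y)\<^sup>2) (at_left b)"
  by (intro tendsto_intros w nu)
 ultimately have "c \<le> (x powr (m - 1) * y powr (n - 1) * kk x y)\<^sup>2" using F(1) tendsto_lowerbound by blast
 with c have "x powr (m - 1) * y powr (n - 1) * kk x y ~= 0" by auto
 hence nz: "x ~= 0" "y ~= 0" "kk x y ~= 0" by auto
 hence "(x, y) \<in> prof" using lev xyS by (simp add: prof_def)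
 from maximal_extends[OF max F evU lim this nz(3)] b show False by simp
qed

lemma curve_in_profile:
 assumes S: "emb x y \<in> S" and xy: "x \<ge> 0" "y \<ge> 0" and v: "(u *\<^sub>R e1, v *\<^sub>R f1) \<bullet> \<nu> (emb x y) = 0"
 obtains gm :: "real => (real^'m) \<times> (real^'n)" where "gm 0 = emb x y" "\<forall>\<^sub>F t in at 0. gm t \<in> S"
  "(gm has_vector_derivative (u *\<^sub>R e1, v *\<^sub>R f1)) (at 0)"
 using tangentI[OF S v] unfolding tangent_space_def by blast

text \<open>At a zero of \<open>k\<close> its derivative along the profile is \<open>1 - lam h = m + n - 1 > 0\<close>, so \<open>k\<close> would
 take both signs, and two strands of opposite signs cannot meet at infinity.\<close>

lemma no_critical:
 assumes p: "(x, y) \<in> prof"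
 shows "kk x y ~= 0"
proof
 assume k0: "kk x y = 0"
 note P = profD[OF p]
 define a b \<Lambda> where "a = nu1 x y" and "b = nu2 x y" and "\<Lambda> = lam x y"
 have Sp: "emb x y \<in> S" and pos: "x > 0" "y > 0" using P by auto
 have "(- b *\<^sub>R e1, a *\<^sub>R f1) \<bullet> \<nu> (emb x y) = 0"
  unfolding prof_\<nu>[OF p] by (simp add: inner_prod_def unit_inner a_def b_def)
 then obtain gm where gm: "gm 0 = emb x y" "\<forall>\<^sub>F t in at 0. gm t \<in> S"
  "(gm has_vector_derivative (- b *\<^sub>R e1, a *\<^sub>R f1)) (at 0)"
  using curve_in_profile[OF Sp] pos less_imp_le by metis
 \<comment> \<open>The curve need not stay in the plane of \<open>e1\<close> and \<open>f1\<close>;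
   passing to the norms of its two components brings it back to the profile without changing its
   velocity.\<close>
 define X where "X t = norm (fst (gm t))" for t
 define Y where "Y t = norm (snd (gm t))" for t
 have XY0: "X 0 = x" "Y 0 = y" using pos by (simp_all add: X_def Y_def gm(1) emb_def unit)
 have d1: "((%t. fst (gm t)) has_vector_derivative - b *\<^sub>R e1) (at 0)"
  "((%t. snd (gm t)) has_vector_derivative a *\<^sub>R f1) (at 0)"
  using bounded_linear.has_vector_derivative[OF bounded_linear_fst gm(3)]
   bounded_linear.has_vector_derivative[OF bounded_linear_snd gm(3)] by simp_all
 have dX: "(X has_real_derivative - b) (at 0)" "(Y has_real_derivative a) (at 0)"
 proof -
  have n: "fst (gm 0) ~= 0" "snd (gm 0) ~= 0" using pos unit by (auto simp: gm(1) emb_def)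
  have "(X has_derivative (%t. sgn (fst (gm 0)) \<bullet> (t *\<^sub>R (- b *\<^sub>R e1)))) (at 0)"
   unfolding X_def[abs_def]
   by (rule has_derivative_compose[OF d1(1)[unfolded has_vector_derivative_def] has_derivative_norm[OF n(1)], unfolded inner_commute[of _ "sgn _"]])
  moreover have "(Y has_derivative (%t. sgn (snd (gm 0)) \<bullet> (t *\<^sub>R (a *\<^sub>R f1)))) (at 0)"
   unfolding Y_def[abs_def]
   by (rule has_derivative_compose[OF d1(2)[unfolded has_vector_derivative_def] has_derivative_norm[OF n(2)], unfolded inner_commute[of _ "sgn _"]])
  moreover have "sgn (fst (gm 0)) = e1" "sgn (snd (gm 0)) = f1"
   using emb_sgn pos by (simp_all add: gm(1) emb_def)
  ultimately show "(X has_real_derivative - b) (at 0)" "(Y has_real_derivative a) (at 0)"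
  proof -
   have "(%t. - (t * b)) = (*) (- b)" "(%t. t * a) = (*) a" by (simp_all add: fun_eq_iff mult.commute)
   moreover note sX = calculation
   assume "(X has_derivative (%t. sgn (fst (gm 0)) \<bullet> (t *\<^sub>R (- b *\<^sub>R e1)))) (at 0)"
    "(Y has_derivative (%t. sgn (snd (gm 0)) \<bullet> (t *\<^sub>R (a *\<^sub>R f1)))) (at 0)"
    "sgn (fst (gm 0)) = e1" "sgn (snd (gm 0)) = f1"
   hence "(X has_derivative (%t. - (t * b))) (at 0)" "(Y has_derivative (%t. t * a)) (at 0)"
    by (simp_all add: unit_inner)
   thus "(X has_real_derivative - b) (at 0)" "(Y has_real_derivative a) (at 0)"
    unfolding has_field_derivative_def sX .
  qed
 qed
 have ev_prof: "\<forall>\<^sub>F t in at 0. (X t, Y t) \<in> prof"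
 proof -
  have "\<forall>\<^sub>F t in at 0. X t > 0" "\<forall>\<^sub>F t in at 0. Y t > 0"
   using order_tendstoD(1)[OF DERIV_isCont[OF dX(1), unfolded isCont_def], of 0]
    order_tendstoD(1)[OF DERIV_isCont[OF dX(2), unfolded isCont_def], of 0] pos by (simp_all add: XY0)
  with gm(2) show ?thesis
  proof eventually_elim
   case (elim t)
   have "(fst (gm t), snd (gm t)) \<in> S" using elim by simp
   hence "emb (X t) (Y t) \<in> S" unfolding emb_def
    by (rule mem_S_norms[rotated 2]) (simp_all add: X_def Y_def unit)
   thus ?case using elim by (simp add: prof_def)
  qed
 qed
 obtain D where D: "(\<nu> has_derivative D) (at (emb x y) within S)" by (rule unit_normal_derivative[OF \<nu> Sp])
 interpret D: bounded_linear D using D by (rule has_derivative_bounded_linear)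
 have De: "D (- b *\<^sub>R e1, a *\<^sub>R f1) = \<Lambda> *\<^sub>R (- b *\<^sub>R e1, a *\<^sub>R f1)"
  using \<nu>_derivative(2)[OF Sp[unfolded emb_def] emb_nz(1)[OF pos(1)] emb_nz(2)[OF pos(2)] D[unfolded emb_def]]
   emb_norm(1)[OF pos(1)] emb_norm(2)[OF pos(2)] emb_sgn(1)[OF pos(1)] emb_sgn(2)[OF pos(2)]
  by (simp add: a_def b_def \<Lambda>_def)
 define eta where "eta t = emb (X t) (Y t)" for t
 have eta: "(eta has_vector_derivative (- b *\<^sub>R e1, a *\<^sub>R f1)) (at 0)"
  unfolding eta_def emb_def using dX[unfolded has_real_derivative_iff_has_vector_derivative]
  by (intro has_vector_derivative_Pair bounded_linear.has_vector_derivative[OF bounded_linear_scaleR_left])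
 have "\<forall>\<^sub>F t in at 0. eta t \<in> S" using ev_prof by eventually_elim (simp add: eta_def profD)
 from has_vector_derivative_along_curve[OF D Sp _ this eta]
 have d\<nu>: "((%t. \<nu> (eta t)) has_vector_derivative \<Lambda> *\<^sub>R (- b *\<^sub>R e1, a *\<^sub>R f1)) (at 0)"
  unfolding De by (simp add: eta_def XY0)
 from bounded_linear.has_vector_derivative[OF bounded_linear_inner_left d\<nu>, of "(e1, 0)"]
  bounded_linear.has_vector_derivative[OF bounded_linear_inner_left d\<nu>, of "(0, f1)"]
 have dn: "((%t. nu1 (X t) (Y t)) has_real_derivative - \<Lambda> * b) (at 0)"
  "((%t. nu2 (X t) (Y t)) has_real_derivative \<Lambda> * a) (at 0)"
  by (simp_all add: nu1_def nu2_def eta_def emb_def inner_prod_def unit_inner has_real_derivative_iff_has_vector_derivative)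
 define kap where "kap t = kk (X t) (Y t)" for t
 have "(kap has_real_derivative - (- b * b + \<Lambda> * a * x) + (a * a + - \<Lambda> * b * y)) (at 0)"
  unfolding kap_def kk_def
  using DERIV_add[OF DERIV_minus[OF DERIV_mult[OF dX(1) dn(2)]] DERIV_mult[OF dX(2) dn(1)]]
  by (simp add: XY0 a_def b_def)
 moreover have "- (- b * b + \<Lambda> * a * x) + (a * a + - \<Lambda> * b * y) = m + n - 1"
 proof -
  have ab: "a\<^sup>2 + b\<^sup>2 = 1" using prof_unit[OF p] by (simp add: a_def b_def)
  have xb: "x * b = y * a" using k0 by (simp add: kk_def a_def b_def)
  have "a / x * (a * x + b * y) = a\<^sup>2 + b * (y * a) / x" "b / y * (a * x + b * y) = b\<^sup>2 + a * (x * b) / y"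
   using pos by (simp_all add: field_simps power2_eq_square)
  hence "a / x * (a * x + b * y) = 1" "b / y * (a * x + b * y) = 1"
   using pos ab unfolding xb[symmetric] by (simp_all add: power2_eq_square) (simp add: xb)
  moreover have "\<Lambda> * (a * x + b * y) = - (m - 1) * (a / x * (a * x + b * y)) - (n - 1) * (b / y * (a * x + b * y))"
  proof -
   have "(- p * A - q * B) * C = - p * (A * C) - q * (B * C)" for p q A B C :: real
    by (simp add: algebra_simps)
   thus ?thesis unfolding \<Lambda>_def lam_def a_def b_def .
  qed
  ultimately have "\<Lambda> * (a * x + b * y) = - (m - 1) - (n - 1)" by simp
  moreover have "- (- b * b + \<Lambda> * a * x) + (a * a + - \<Lambda> * b * y) = (a\<^sup>2 + b\<^sup>2) - \<Lambda> * (a * x + b * y)"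
   by (simp add: power2_eq_square algebra_simps)
  ultimately show ?thesis using ab by simp
 qed
 ultimately have "(kap has_real_derivative m + n - 1) (at 0)" by simp
 moreover have "m + n - 1 > 0" using mn2 by simp
 ultimately obtain d where d: "d > 0" "\<And>h. 0 < h ==> h < d ==> kap 0 < kap h" "\<And>h. 0 < h ==> h < d ==> kap (- h) < kap 0"
 proof -
  assume kap: "(kap has_real_derivative m + n - 1) (at 0)" "m + n - 1 > 0" and
   t: "\<And>d. 0 < d ==> (\<And>h. 0 < h ==> h < d ==> kap 0 < kap h) ==> (\<And>h. 0 < h ==> h < d ==> kap (- h) < kap 0) ==> thesis"
  obtain d1 where "d1 > 0" "\<And>h. 0 < h ==> h < d1 ==> kap 0 < kap (0 + h)" using DERIV_pos_inc_right[OF kap] by blast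
  moreover obtain d2 where "d2 > 0" "\<And>h. 0 < h ==> h < d2 ==> kap (0 - h) < kap 0" using DERIV_pos_inc_left[OF kap] by blast
  ultimately show thesis by (intro t[of "min d1 d2"]) auto
 qed
 obtain d' where d': "d' > 0" "\<And>t. t ~= 0 ==> dist t 0 < d' ==> (X t, Y t) \<in> prof"
  using ev_prof unfolding eventually_at by blast
 define h where "h = min d d' / 2"
 have h: "h > 0" "h < d" "h < d'" using d d' by (auto simp: h_def)
 have kap0: "kap 0 = 0" by (simp add: kap_def XY0 k0)
 have k: "kk (X h) (Y h) > 0" "kk (X (- h)) (Y (- h)) < 0" using d h kap0 by (auto simp: kap_def)
 have pr: "(X h, Y h) \<in> prof" "(X (- h), Y (- h)) \<in> prof" using d' h by (auto simp: dist_real_def)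
 obtain U1 X1 Y1 s1 where 1: "maximal U1 X1 Y1" "s1 \<in> U1" "kk (X1 s1) (Y1 s1) > 0"
  using maximal_through[OF pr(1)] k(1) by (metis less_irrefl)
 obtain U2 X2 Y2 s2 where 2: "maximal U2 X2 Y2" "s2 \<in> U2" "kk (X2 s2) (Y2 s2) < 0"
  using maximal_through[OF pr(2)] k(2) by (metis less_irrefl)
 have st: "strand U1 X1 Y1" "strand U2 X2 Y2" using 1 2 by (simp_all add: maximal_def)
 obtain t where t: "t \<in> U1" "t \<in> U2" "X1 t = X2 t" "Y1 t = Y2 t"
  using strands_meet[OF st maximal_unbounded[OF 1(1,2)] maximal_unbounded[OF 2(1,2)]] by blast
 have "kk (X1 t) (Y1 t) > 0"
  using profile_ode.k_sign[OF strand_profile_ode[OF st(1)]] 1(2,3) t(1) by force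
 moreover have "kk (X2 t) (Y2 t) < 0"
  using profile_ode.k_sign[OF strand_profile_ode[OF st(2)]] 2(2,3) t(2) by force
 ultimately show False using t by simp
qed

text \<open>At an axis point the normal points along the axis, so \<open>S\<close> contains a curve
  that leaves the axis orthogonally and lies off both axes for small nonzero times. Axis points are
  therefore limits of profile points.\<close>

lemma axis_accumulation:
 assumes z: "(x, y) \<in> S" and ax: "x = 0 \<or> y = 0" and e: "e > 0"
 shows "\<exists>(X, Y)\<in>prof. \<bar>X - norm x\<bar> < e & \<bar>Y - norm y\<bar> < e"
proof -
 define X0 Y0 where "X0 = norm x" and "Y0 = norm y"
 have nn: "X0 \<ge> 0" "Y0 \<ge> 0" by (simp_all add: X0_def Y0_def)
 have enz: "e1 ~= 0" "f1 ~= 0" using unit by (metis norm_zero zero_neq_one)+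
 have S0: "emb X0 Y0 \<in> S" unfolding emb_def
  by (rule mem_S_norms[OF _ _ z]) (simp_all add: X0_def Y0_def unit)
 have nz: "\<not> (x = 0 & y = 0)" using norm_ge_1[OF z] by (auto simp: zero_prod_def[symmetric])
 have cases: "X0 > 0 & Y0 = 0 \<or> X0 = 0 & Y0 > 0" using nz ax by (auto simp: X0_def Y0_def)
 \<comment> \<open>The velocity lies in the factor in which the axis point vanishes.\<close>
 define u v where "u = (if Y0 = 0 then 0 else 1::real)" and "v = (if Y0 = 0 then 1 else 0::real)"
 have "(u *\<^sub>R e1, v *\<^sub>R f1) \<bullet> \<nu> (emb X0 Y0) = 0"
  using cases
 proof
  assume c: "X0 > 0 & Y0 = 0"
  have E: "emb X0 Y0 = (X0 *\<^sub>R e1, 0)" using c by (simp add: emb_def)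
  have "snd (\<nu> (X0 *\<^sub>R e1, 0)) = 0"
   using arg_cong[OF axis_normal_fst(1)[of "X0 *\<^sub>R e1"], of snd] S0[unfolded E] c enz by simp
  thus ?thesis using c unfolding E by (simp add: u_def v_def inner_prod_def)
 next
  assume c: "X0 = 0 & Y0 > 0"
  have E: "emb X0 Y0 = (0, Y0 *\<^sub>R f1)" using c by (simp add: emb_def)
  have "fst (\<nu> (0, Y0 *\<^sub>R f1)) = 0"
   using arg_cong[OF axis_normal_snd(1)[of "Y0 *\<^sub>R f1"], of fst] S0[unfolded E] c enz by simp
  thus ?thesis using c unfolding E by (simp add: u_def v_def inner_prod_def)
 qed
 then obtain gm where gm: "gm 0 = emb X0 Y0" "\<forall>\<^sub>F t in at 0. gm t \<in> S"
  "(gm has_vector_derivative (u *\<^sub>R e1, v *\<^sub>R f1)) (at 0)"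
  by (rule curve_in_profile[OF S0 nn])
 have cgm: "(gm \<longlongrightarrow> emb X0 Y0) (at 0)"
  using has_vector_derivative_continuous[OF gm(3)] by (simp add: continuous_within gm(1))
 have "((%t. norm (fst (gm t))) \<longlongrightarrow> norm (fst (emb X0 Y0))) (at 0)"
  "((%t. norm (snd (gm t))) \<longlongrightarrow> norm (snd (emb X0 Y0))) (at 0)" by (intro tendsto_intros cgm)+
 hence lims: "((%t. norm (fst (gm t))) \<longlongrightarrow> X0) (at 0)" "((%t. norm (snd (gm t))) \<longlongrightarrow> Y0) (at 0)"
  using cases by (auto simp: emb_def unit)
 have quot: "((%t. (gm t - gm 0) /\<^sub>R t) \<longlongrightarrow> (u *\<^sub>R e1, v *\<^sub>R f1)) (at 0)"
 proof -
  have 1: "((%t. norm (gm t - gm 0 - t *\<^sub>R (u *\<^sub>R e1, v *\<^sub>R f1)) / norm t) \<longlongrightarrow> 0) (at 0)"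
   using gm(3) unfolding has_vector_derivative_def has_derivative_iff_norm by simp
  have "((%t. norm ((gm t - gm 0) /\<^sub>R t - (u *\<^sub>R e1, v *\<^sub>R f1))) \<longlongrightarrow> 0) (at 0)"
  proof (rule Lim_transform_eventually[OF 1])
   show "\<forall>\<^sub>F t in at 0. norm (gm t - gm 0 - t *\<^sub>R (u *\<^sub>R e1, v *\<^sub>R f1)) / norm t
     = norm ((gm t - gm 0) /\<^sub>R t - (u *\<^sub>R e1, v *\<^sub>R f1))"
    unfolding eventually_at_filter
   proof (intro always_eventually allI impI)
    fix t :: real assume "t ~= 0"
    hence "gm t - gm 0 - t *\<^sub>R (u *\<^sub>R e1, v *\<^sub>R f1) = t *\<^sub>R ((gm t - gm 0) /\<^sub>R t - (u *\<^sub>R e1, v *\<^sub>R f1))"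
     by (simp add: scaleR_diff_right del: scaleR_Pair)
    from arg_cong[OF this, of norm] \<open>t ~= 0\<close>
    show "norm (gm t - gm 0 - t *\<^sub>R (u *\<^sub>R e1, v *\<^sub>R f1)) / norm t
     = norm ((gm t - gm 0) /\<^sub>R t - (u *\<^sub>R e1, v *\<^sub>R f1))" by (simp only: norm_scaleR) simp
   qed
  qed
  thus ?thesis by (simp add: tendsto_norm_zero_iff LIM_zero_iff)
 qed
 have pos: "\<forall>\<^sub>F t in at 0. norm (fst (gm t)) > 0 & norm (snd (gm t)) > 0"
  using cases
 proof
  assume c: "X0 > 0 & Y0 = 0"
  have "((%t. norm (snd ((gm t - gm 0) /\<^sub>R t))) \<longlongrightarrow> norm (snd (u *\<^sub>R e1, v *\<^sub>R f1))) (at 0)"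
   by (intro tendsto_intros quot)
  hence "\<forall>\<^sub>F t in at 0. norm (snd ((gm t - gm 0) /\<^sub>R t)) > 0"
   by (rule order_tendstoD(1)) (use c unit in \<open>simp add: v_def\<close>)
  moreover have "\<forall>\<^sub>F t in at 0. norm (fst (gm t)) > 0" using order_tendstoD(1)[OF lims(1)] c by blast
  ultimately show ?thesis by eventually_elim (use c in \<open>auto simp: gm(1) emb_def\<close>)
 next
  assume c: "X0 = 0 & Y0 > 0"
  have "((%t. norm (fst ((gm t - gm 0) /\<^sub>R t))) \<longlongrightarrow> norm (fst (u *\<^sub>R e1, v *\<^sub>R f1))) (at 0)"
   by (intro tendsto_intros quot)
  hence "\<forall>\<^sub>F t in at 0. norm (fst ((gm t - gm 0) /\<^sub>R t)) > 0"
   by (rule order_tendstoD(1)) (use c unit in \<open>simp add: u_def\<close>)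
  moreover have "\<forall>\<^sub>F t in at 0. norm (snd (gm t)) > 0" using order_tendstoD(1)[OF lims(2)] c by blast
  ultimately show ?thesis by eventually_elim (use c in \<open>auto simp: gm(1) emb_def\<close>)
 qed
 have "\<forall>\<^sub>F t in at 0. gm t \<in> S & norm (fst (gm t)) > 0 & norm (snd (gm t)) > 0 &
   dist (norm (fst (gm t))) X0 < e & dist (norm (snd (gm t))) Y0 < e"
  using gm(2) pos tendstoD[OF lims(1) e] tendstoD[OF lims(2) e] by eventually_elim blast
 then obtain t where t: "gm t \<in> S" "norm (fst (gm t)) > 0" "norm (snd (gm t)) > 0"
   "dist (norm (fst (gm t))) X0 < e" "dist (norm (snd (gm t))) Y0 < e"
  using eventually_happens'[OF at_neq_bot] by blast
 have "(norm (fst (gm t)), norm (snd (gm t))) \<in> prof"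
  using t(2,3) mem_S_iff_prof[of "fst (gm t)" "snd (gm t)"] t(1) by simp
 thus ?thesis using t(4,5) by (intro bexI[of _ "(norm (fst (gm t)), norm (snd (gm t)))"]) (auto simp: dist_real_def X0_def Y0_def)
qed

text \<open>Without critical points every profile point lies on a maximal strand; all of these reach
  infinity, meet there and hence coincide. The lower end \<open>t0\<close> is finite since
  \<open>|z| \<ge> 1\<close> on \<open>S\<close>, and the limit point there lies on an axis, as the
  strand would otherwise extend. Axis points of \<open>S\<close> are limits of the strand, and only
  its end is available for them.\<close>

theorem profile_structure:
 obtains t0 X Y x0 y0 where "t0 \<ge> 1 / 2" "strand {t0<..} X Y"
  "(X \<longlongrightarrow> x0) (at_right t0)" "(Y \<longlongrightarrow> y0) (at_right t0)" "x0\<^sup>2 + y0\<^sup>2 = 2 * t0" "emb x0 y0 \<in> S"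
  "x0 = 0 & y0 > 0 \<or> x0 > 0 & y0 = 0"
  "\<And>x y. (x, y) \<in> S ==> (norm x = x0 & norm y = y0) \<or> (\<exists>t>t0. norm x = X t & norm y = Y t)"
proof -
 have "prof ~= {}"
 proof -
  obtain x y where z: "(x, y) \<in> S" using S_nonempty by fastforce
  show ?thesis
  proof (cases "x = 0 \<or> y = 0")
   case True
   from axis_accumulation[OF z True, of 1] show ?thesis by auto
  next
   case False
   thus ?thesis using mem_S_iff_prof[of x y] z by auto
  qed
 qed
 then obtain p1 p2 where p: "(p1, p2) \<in> prof" by fastforce
 obtain U X Y s where max: "maximal U X Y" and s: "s \<in> U"
  using maximal_through[OF p no_critical[OF p]] by metis
 have st: "strand U X Y" using max by (simp add: maximal_def)
 have lev: "2 * t = (norm (emb (X t) (Y t)))\<^sup>2" if "t \<in> U" for t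
 proof -
  have "t \<ge> 0" using strandD(2)[OF st that] by (smt (verit) zero_le_power2)
  thus ?thesis using strandD(2,4,5)[OF st that] by (simp add: emb_def norm_prod_def unit)
 qed
 have half: "1 / 2 \<le> t" if "t \<in> U" for t
 proof -
  have "1 \<le> (norm (emb (X t) (Y t)))\<^sup>2"
   using norm_ge_1[OF strandD(6)[OF st that]] by (simp add: one_le_power)
  thus ?thesis using lev[OF that] by simp
 qed
 define t0 where "t0 = Inf U"
 have bdd: "bdd_below U" using half by (intro bdd_belowI[of _ "1 / 2"]) auto
 have oU: "open U" using st by (simp add: strand_def)
 have U: "U = {t0<..}"
 proof (intro equalityI subsetI)
  fix t assume t: "t \<in> U"
  then obtain d where d: "d > 0" "ball t d \<subseteq> U" using oU openE by blast
  hence "t - d / 2 \<in> U" by (auto simp: dist_real_def subset_iff)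
  from cInf_lower[OF this bdd] d show "t \<in> {t0<..}" by (simp add: t0_def)
 next
  fix t assume "t \<in> {t0<..}"
  then obtain r where "r \<in> U" "r < t" using cInf_less_iff[of U t] s bdd by (auto simp: t0_def)
  with maximal_unbounded[OF max this(1)] show "t \<in> U" by auto
 qed
 have t0: "t0 \<ge> 1 / 2" unfolding t0_def by (rule cInf_greatest) (use s half in auto)
 have sub: "{t0<..<t0 + 1} \<subseteq> U" by (auto simp: U)
 obtain x0 y0 where lim: "(X \<longlongrightarrow> x0) (at_right t0)" "(Y \<longlongrightarrow> y0) (at_right t0)" and S0: "emb x0 y0 \<in> S"
  using strand_limit(2)[OF complete st _ sub] by auto
 have F: "at_right t0 ~= bot" "at_right t0 \<le> nhds t0" by (simp_all add: at_within_le_nhds)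
 have ev: "\<forall>\<^sub>F t in at_right t0. t \<in> U" by (auto simp: U eventually_at_filter)
 note lv = level_limit[OF st F ev lim]
 have ax: "x0 = 0 \<or> y0 = 0"
 proof (rule ccontr)
  assume "\<not> ?thesis"
  hence pr: "(x0, y0) \<in> prof" using lv S0 by (auto simp: prof_def)
  from maximal_extends[OF max F ev lim pr no_critical[OF pr]] show False by (simp add: U)
 qed
 have ax': "x0 = 0 & y0 > 0 \<or> x0 > 0 & y0 = 0" using ax lv t0 by (cases "x0 = 0"; cases "y0 = 0") auto
 have on_strand: "\<exists>t>t0. x = X t & y = Y t" if pr: "(x, y) \<in> prof" for x y
 proof -
  obtain V X' Y' r where V: "maximal V X' Y'" "r \<in> V" "X' r = x" "Y' r = y"
   using maximal_through[OF pr no_critical[OF pr]] by metis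
  have st': "strand V X' Y'" using V(1) by (simp add: maximal_def)
  obtain t where t: "t \<in> U" "t \<in> V" "X t = X' t" "Y t = Y' t"
   using strands_meet[OF st st' maximal_unbounded[OF max s] maximal_unbounded[OF V(1,2)]] by blast
  have "V \<subseteq> U" using max st' t unfolding maximal_def by metis
  hence r: "r \<in> U" using V(2) by blast
  have "X r = X' r & Y r = Y' r" by (rule strand_unique[OF st st' t r V(2)])
  thus ?thesis using r V(3,4) by (auto simp: U)
 qed
 show ?thesis
 proof (rule that[OF t0 st[unfolded U] lim lv(1) S0 ax'])
  fix x y assume z: "(x, y) \<in> S"
  show "(norm x = x0 & norm y = y0) \<or> (\<exists>t>t0. norm x = X t & norm y = Y t)"
  proof (cases "x = 0 \<or> y = 0")
   case False
   thus ?thesis using on_strand[of "norm x" "norm y"] mem_S_iff_prof[of x y] z by auto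
  next
   case True
   have "\<forall>i::nat. \<exists>t>t0. \<bar>X t - norm x\<bar> < 1 / Suc i & \<bar>Y t - norm y\<bar> < 1 / Suc i"
   proof
    fix i :: nat
    have "0 < 1 / real (Suc i)" by simp
    from axis_accumulation[OF z True this] obtain p q where pq: "(p, q) \<in> prof"
     "\<bar>p - norm x\<bar> < 1 / Suc i" "\<bar>q - norm y\<bar> < 1 / Suc i" by blast
    then obtain t where "t > t0" "p = X t" "q = Y t" using on_strand by blast
    with pq show "\<exists>t>t0. \<bar>X t - norm x\<bar> < 1 / Suc i & \<bar>Y t - norm y\<bar> < 1 / Suc i" by blast
   qed
   then obtain T where T: "\<And>i. T i > t0" "\<And>i. \<bar>X (T i) - norm x\<bar> < 1 / Suc i" "\<And>i. \<bar>Y (T i) - norm y\<bar> < 1 / Suc i"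
    by metis
   have null: "(%i. 1 / real (Suc i)) \<longlonglongrightarrow> 0" by (rule LIMSEQ_Suc[OF lim_1_over_n])
   have "(%i. X (T i) - norm x) \<longlonglongrightarrow> 0" "(%i. Y (T i) - norm y) \<longlonglongrightarrow> 0"
    by (rule Lim_null_comparison[OF _ null], use T(2,3) less_imp_le in \<open>auto intro!: always_eventually\<close>)+
   hence lT: "(%i. X (T i)) \<longlonglongrightarrow> norm x" "(%i. Y (T i)) \<longlonglongrightarrow> norm y" by (simp_all add: LIM_zero_iff)
   define tau where "tau = ((norm x)\<^sup>2 + (norm y)\<^sup>2) / 2"
   have "(%i. ((X (T i))\<^sup>2 + (Y (T i))\<^sup>2) / 2) \<longlonglongrightarrow> tau" unfolding tau_def by (intro tendsto_intros lT) simp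
   moreover have "((X (T i))\<^sup>2 + (Y (T i))\<^sup>2) / 2 = T i" for i using strandD(2)[OF st, of "T i"] T(1)[of i] by (simp add: U)
   ultimately have Ttau: "T \<longlonglongrightarrow> tau" by simp
   hence "tau \<ge> t0" using T(1) by (intro LIMSEQ_le_const[OF Ttau]) (auto intro: less_imp_le)
   \<comment> \<open>At an inner level both coordinates of the strand are positive, whereas one of
     \<open>norm x\<close> and \<open>norm y\<close> is 0.\<close>
   have "\<not> tau > t0"
   proof
    assume "tau > t0"
    hence tau: "tau \<in> U" by (simp add: U)
    hence "isCont X tau" "isCont Y tau" using st oU by (auto simp: strand_def continuous_on_eq_continuous_at)
    hence "(%i. X (T i)) \<longlonglongrightarrow> X tau" "(%i. Y (T i)) \<longlonglongrightarrow> Y tau" using Ttau isCont_tendsto_compose by blast+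
    hence "X tau = norm x" "Y tau = norm y" using lT LIMSEQ_unique by blast+
    thus False using True strandD(4,5)[OF st tau] by auto
   qed
   with \<open>tau \<ge> t0\<close> have "tau = t0" by simp
   hence "filterlim T (at_right t0) sequentially"
    using Ttau T(1) by (auto simp: filterlim_at intro!: always_eventually)
   from filterlim_compose[OF lim(1) this] filterlim_compose[OF lim(2) this] lT
   have "norm x = x0" "norm y = y0" using LIMSEQ_unique by blast+
   thus ?thesis by simp
  qed
 qed
qed

end

section \<open>Regularity of the curvatures where the profile meets an axis\<close>

context profile_ode
begin

text \<open>Exchanging the two factors reverses the orientation of the profile plane and therefore
  the sign of \<open>k\<close>. It reduces the axis \<open>X = 0\<close> to the axis
  \<open>Y = 0\<close>.\<close>

lemma flip: "profile_ode I Y X b a (%t. - k t) l n m"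
proof
 show "open I" "connected I" "n \<ge> 2" "m \<ge> 2" using I mn by auto
 fix t assume t: "t \<in> I"
 show "0 < Y t & 0 < X t" "(Y t)\<^sup>2 + (X t)\<^sup>2 = 2 * t" "(b t)\<^sup>2 + (a t)\<^sup>2 = 1" "- k t = - Y t * a t + X t * b t"
  "- k t ~= 0"
  using pos[OF t] level[OF t] unit[OF t] k[OF t] k0[OF t] by (simp_all add: add.commute)
 have "- p * u - q * v = - q * v - p * u" for p u q v :: real by simp
 thus "l t = - (n - 1) * (b t / Y t) - (m - 1) * (a t / X t)" unfolding l[OF t] .
 show "(Y has_real_derivative - a t / - k t) (at t)" "(X has_real_derivative b t / - k t) (at t)"
  "(b has_real_derivative - l t * a t / - k t) (at t)" "(a has_real_derivative l t * b t / - k t) (at t)"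
  using dX[OF t] dY[OF t] da[OF t] db[OF t] by simp_all
qed

lemma nzXY: "t \<in> I ==> X t ~= 0" "t \<in> I ==> Y t ~= 0" using pos by force+

text \<open>Derivatives of the rotational eigenvalues, arranged as multiples of their differences to
  \<open>l\<close>. In \<open>b1\<close> the factor \<open>1 / (k * Y)\<close> grows like
  \<open>1 / Y^2\<close> at the axis \<open>Y = 0\<close>, so the difference has to vanish there to
  second order.\<close>

definition a1 :: "real => real" where "a1 t = - (b t / (k t * X t)) * (l t - a t / X t)"
definition b1 :: "real => real" where "b1 t = a t / (k t * Y t) * (l t - b t / Y t)"

lemma d_rotational:
 assumes t: "t \<in> I"
 shows "((%t. a t / X t) has_real_derivative a1 t) (at t)" "((%t. b t / Y t) has_real_derivative b1 t) (at t)"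
  "(l has_real_derivative - (m - 1) * a1 t - (n - 1) * b1 t) (at t)"
proof -
 note p = pos[OF t] k0[OF t]
 have "((%t. a t / X t) has_real_derivative (- l t * b t / k t * X t - a t * (- b t / k t)) / (X t * X t)) (at t)"
  "((%t. b t / Y t) has_real_derivative (l t * a t / k t * Y t - b t * (a t / k t)) / (Y t * Y t)) (at t)"
  by (intro DERIV_divide dX dY da db t; use p in simp)+
 moreover have "(- l t * b t / k t * X t - a t * (- b t / k t)) / (X t * X t) = a1 t"
  "(l t * a t / k t * Y t - b t * (a t / k t)) / (Y t * Y t) = b1 t"
  using p by (simp_all add: a1_def b1_def field_simps)
 ultimately show 1: "((%t. a t / X t) has_real_derivative a1 t) (at t)" "((%t. b t / Y t) has_real_derivative b1 t) (at t)"
  by simp_all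
 show "(l has_real_derivative - (m - 1) * a1 t - (n - 1) * b1 t) (at t)"
  by (rule transform_on_I[OF t DERIV_diff[OF DERIV_cmult[OF 1(1)] DERIV_cmult[OF 1(2)]]]) (use l in simp)
qed

lemma d_powr: "t \<in> I ==> ((%t. Y t powr p) has_real_derivative p * Y t powr (p - 1) * (a t / k t)) (at t)"
 by (rule DERIV_chain2[OF has_real_derivative_powr dY]) (use pos in auto)

text \<open>Regularity of the profile where it meets the axis \<open>Y = 0\<close>: both limits come from
 l'Hospital's rule, applied to \<open>Y\<^sup>n (b/Y)\<close> and to \<open>Y\<^sup>n (l - b/Y)\<close>, whose derivatives involve
 only quantities of known limit.\<close>

lemma cap_limits_Y:
 assumes F: "F = at_right t0" "\<forall>\<^sub>F t in F. t \<in> I"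
  and lim: "(X \<longlongrightarrow> X0) F" "(Y \<longlongrightarrow> 0) F" "(a \<longlongrightarrow> a0) F" "(b \<longlongrightarrow> 0) F" and X0: "X0 > 0" and a0: "a0\<^sup>2 = 1"
 shows "\<exists>p q l0 p1 q1 rho. ((%t. a t / X t) \<longlongrightarrow> p) F & ((%t. b t / Y t) \<longlongrightarrow> q) F & (l \<longlongrightarrow> l0) F &
  (a1 \<longlongrightarrow> p1) F & (b1 \<longlongrightarrow> q1) F & (k \<longlongrightarrow> 0) F & ((%t. 1 - l t * h t) \<longlongrightarrow> rho) F & rho \<ge> 0"
proof -
 have a0': "a0 ~= 0" using a0 by auto
 \<comment> \<open>For a surface that is smooth across the axis \<open>b / Y\<close> and
   \<open>l\<close> must have a common limit, and minimality then reads
   \<open>(m - 1) * (a0 / X0) + n * mu0 = 0\<close>.\<close>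
 define mu0 where "mu0 = - (m - 1) * (a0 / X0) / n"
 have aX: "((%t. a t / X t) \<longlongrightarrow> a0 / X0) F" by (intro tendsto_divide lim) (use X0 in simp)
 have evY: "\<forall>\<^sub>F t in F. Y t \<ge> 0" using F(2) pos by (auto elim!: eventually_mono intro: less_imp_le)
 have pw: "((%t. Y t powr e) \<longlongrightarrow> 0) F" if "e > 0" for e
  using tendsto_powr'[OF lim(2) tendsto_const[of e]] evY that by simp
 have eva: "\<forall>\<^sub>F t in F. a t ~= 0"
  using tendsto_imp_eventually_ne[OF lim(3) a0'] .
 have nz: "\<forall>\<^sub>F t in at_right t0. e * Y t powr (e - 1) * (a t / k t) ~= 0" if "e > 0" for e
  unfolding F(1)[symmetric] using F(2) eva by eventually_elim (use nzXY k0 that in auto)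
 have Ynz: "\<forall>\<^sub>F t in at_right t0. Y t powr e ~= 0" for e
  unfolding F(1)[symmetric] using F(2) by eventually_elim (use nzXY in auto)
 have d_pw: "\<forall>\<^sub>F t in at_right t0. ((%t. Y t powr e) has_real_derivative e * Y t powr (e - 1) * (a t / k t)) (at t)" for e
  unfolding F(1)[symmetric] using F(2) by eventually_elim (rule d_powr)
 have mu: "((%t. b t / Y t) \<longlongrightarrow> mu0) F"
 proof -
  have "((%t. (Y t powr (n - 1) * b t) / Y t powr n) \<longlongrightarrow> mu0) (at_right t0)"
  proof (rule lhopital_right[where g' = "%t. n * Y t powr (n - 1) * (a t / k t)"
     and f' = "%t. Y t powr (n - 1) * (a t / k t) * (- (m - 1) * (a t / X t))"])
   show "((%t. Y t powr (n - 1) * b t) \<longlongrightarrow> 0) (at_right t0)"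
    using tendsto_mult[OF pw[of "n - 1"] lim(4)] mn by (simp add: F(1))
   show "((%t. Y t powr n) \<longlongrightarrow> 0) (at_right t0)" using pw[of n] mn by (simp add: F(1))
   show "\<forall>\<^sub>F t in at_right t0. ((%t. Y t powr (n - 1) * b t) has_real_derivative
     Y t powr (n - 1) * (a t / k t) * (- (m - 1) * (a t / X t))) (at t)"
    unfolding F(1)[symmetric] using F(2)
   proof eventually_elim
    case (elim t)
    have e: "Y t powr (n - 1 - 1) = Y t powr (n - 1) / Y t" using pos[OF elim] by (simp add: powr_diff power2_eq_square)
    have "((%t. Y t powr (n - 1) * b t) has_real_derivative
      (n - 1) * (Y t powr (n - 1) / Y t) * (a t / k t) * b t + l t * a t / k t * Y t powr (n - 1)) (at t)"
     using DERIV_mult[OF d_powr[OF elim, of "n - 1"] db[OF elim]] unfolding e .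
    moreover have "(n - 1) * (Y t powr (n - 1) / Y t) * (a t / k t) * b t + l t * a t / k t * Y t powr (n - 1)
      = Y t powr (n - 1) * (a t / k t) * ((n - 1) * (b t / Y t) + l t)" by (simp add: divide_inverse algebra_simps)
    moreover have "(n - 1) * (b t / Y t) + l t = - (m - 1) * (a t / X t)" using l[OF elim] by simp
    ultimately show ?case by (simp only:)
   qed
   have "((%t. - (m - 1) * (a t / X t) / n) \<longlongrightarrow> mu0) F"
    unfolding mu0_def by (intro tendsto_intros aX) (use mn in simp)
   moreover have "\<forall>\<^sub>F t in F. - (m - 1) * (a t / X t) / n
     = Y t powr (n - 1) * (a t / k t) * (- (m - 1) * (a t / X t)) / (n * Y t powr (n - 1) * (a t / k t))"
    using F(2) eva by eventually_elim (use nzXY k0 mn in \<open>auto simp: field_simps\<close>)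
   ultimately show "((%t. Y t powr (n - 1) * (a t / k t) * (- (m - 1) * (a t / X t)) / (n * Y t powr (n - 1) * (a t / k t)))
     \<longlongrightarrow> mu0) (at_right t0)" unfolding F(1) by (rule Lim_transform_eventually)
  qed (use Ynz nz[of n] mn d_pw in auto)
  moreover have "\<forall>\<^sub>F t in F. (Y t powr (n - 1) * b t) / Y t powr n = b t / Y t"
   using F(2)
  proof eventually_elim
   case (elim t)
   have "Y t > 0" using pos[OF elim] by simp
   thus ?case by (simp add: powr_diff)
  qed
  ultimately show ?thesis unfolding F(1) by (rule Lim_transform_eventually)
 qed
 have lmu: "(l \<longlongrightarrow> mu0) F"
 proof -
  have "((%t. - (m - 1) * (a t / X t) - (n - 1) * (b t / Y t)) \<longlongrightarrow> - (m - 1) * (a0 / X0) - (n - 1) * mu0) F"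
   by (intro tendsto_intros aX mu)
  moreover have "- (m - 1) * (a0 / X0) = n * mu0" using mn by (simp add: mu0_def)
  moreover have "n * mu0 - (n - 1) * mu0 = mu0" by (simp add: algebra_simps)
  ultimately have "((%t. - (m - 1) * (a t / X t) - (n - 1) * (b t / Y t)) \<longlongrightarrow> mu0) F" by simp
  thus ?thesis by (rule Lim_transform_eventually) (use F(2) l in \<open>auto elim!: eventually_mono\<close>)
 qed
 \<comment> \<open>The value that l'Hospital's rule yields for the limit of
   \<open>(l - b / Y) / Y^2\<close>. The derivative \<open>b1\<close> is this quotient times
   \<open>a / (k / Y)\<close>.\<close>
 define sgm where "sgm = (m - 1) * mu0 * (mu0 - a0 / X0) / (X0 * (n + 2) * a0)"
 have d2: "((%t. (l t - b t / Y t) / (Y t)\<^sup>2) \<longlongrightarrow> sgm) F"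
 proof -
  have "((%t. (Y t powr n * (l t - b t / Y t)) / Y t powr (n + 2)) \<longlongrightarrow> sgm) (at_right t0)"
  proof (rule lhopital_right[where g' = "%t. (n + 2) * Y t powr (n + 2 - 1) * (a t / k t)"
     and f' = "%t. Y t powr n * ((m - 1) * (b t / k t) * (l t - a t / X t) / X t)"])
   have "((%t. Y t powr n * (l t - b t / Y t)) \<longlongrightarrow> 0 * (mu0 - mu0)) F"
    by (intro tendsto_intros pw mu lmu) (use mn in simp)
   thus "((%t. Y t powr n * (l t - b t / Y t)) \<longlongrightarrow> 0) (at_right t0)" by (simp add: F(1))
   show "((%t. Y t powr (n + 2)) \<longlongrightarrow> 0) (at_right t0)" using pw[of "n + 2"] mn by (simp add: F(1))
   show "\<forall>\<^sub>F t in at_right t0. ((%t. Y t powr n * (l t - b t / Y t)) has_real_derivative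
     Y t powr n * ((m - 1) * (b t / k t) * (l t - a t / X t) / X t)) (at t)"
    unfolding F(1)[symmetric] using F(2)
   proof eventually_elim
    case (elim t)
    note p = pos[OF elim] k0[OF elim]
    have e: "Y t powr (n - 1) = Y t powr n / Y t" using p by (simp add: powr_diff)
    have "((%t. Y t powr n * (l t - b t / Y t)) has_real_derivative
      n * (Y t powr n / Y t) * (a t / k t) * (l t - b t / Y t) + ((- (m - 1) * a1 t - (n - 1) * b1 t) - b1 t) * Y t powr n) (at t)"
     using DERIV_mult[OF d_powr[OF elim, of n] DERIV_diff[OF d_rotational(3)[OF elim] d_rotational(2)[OF elim]]] unfolding e .
    moreover have "n * (W / Y t) * (a t / k t) * (l t - b t / Y t) + ((- (m - 1) * a1 t - (n - 1) * b1 t) - b1 t) * W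
      = W * (n * b1 t - (m - 1) * a1 t - n * b1 t)" for W
    proof -
     have "n * (W / Y t) * (a t / k t) * (l t - b t / Y t) = W * (n * b1 t)"
      by (simp add: b1_def mult_ac)
     thus ?thesis by (simp only:) (simp add: algebra_simps)
    qed
    moreover have "n * b1 t - (m - 1) * a1 t - n * b1 t = (m - 1) * (b t / k t) * (l t - a t / X t) / X t"
     by (simp add: a1_def)
    ultimately show ?case by (simp only:)
   qed
   have "((%t. (m - 1) * (b t / Y t) * (l t - a t / X t) / (X t * (n + 2) * a t)) \<longlongrightarrow> sgm) F"
    unfolding sgm_def by (intro tendsto_intros aX mu lmu lim) (use mn X0 a0' in auto)
   moreover have "\<forall>\<^sub>F t in F. (m - 1) * (b t / Y t) * (l t - a t / X t) / (X t * (n + 2) * a t)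
     = Y t powr n * ((m - 1) * (b t / k t) * (l t - a t / X t) / X t) / ((n + 2) * Y t powr (n + 2 - 1) * (a t / k t))"
    using F(2) eva
   proof eventually_elim
    case (elim t)
    note p = pos[OF elim(1)] k0[OF elim(1)]
    have e: "Y t powr (n + 2 - 1) = Y t powr n * Y t" using p powr_add[of "Y t" n 1] by (simp add: add.commute)
    have "(m - 1) * (\<beta> / y) * D / (x * c * A) = W * ((m - 1) * (\<beta> / kap) * D / x) / (c * (W * y) * (A / kap))"
     if "W ~= 0" "kap ~= 0" "A ~= 0" "y ~= 0" "x ~= 0" "c ~= 0" for W \<beta> y D x c A kap :: real
     using that by (simp add: field_simps)
    from this[of "Y t powr n" "k t" "a t" "Y t" "X t" "n + 2"] p elim(2) mn show ?case unfolding e by simp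
   qed
   ultimately show "((%t. Y t powr n * ((m - 1) * (b t / k t) * (l t - a t / X t) / X t) / ((n + 2) * Y t powr (n + 2 - 1) * (a t / k t)))
     \<longlongrightarrow> sgm) (at_right t0)" unfolding F(1) by (rule Lim_transform_eventually)
  qed (use Ynz nz[of "n + 2"] mn d_pw[of "n + 2"] in auto)
  moreover have "\<forall>\<^sub>F t in F. (Y t powr n * (l t - b t / Y t)) / Y t powr (n + 2) = (l t - b t / Y t) / (Y t)\<^sup>2"
   using F(2)
  proof eventually_elim
   case (elim t)
   have "Y t > 0" using pos[OF elim] by simp
   thus ?case by (simp add: powr_add powr_numeral)
  qed
  ultimately show ?thesis unfolding F(1) by (rule Lim_transform_eventually)
 qed
 \<comment> \<open>The expression is \<open>k / Y\<close>. Its limit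
   \<open>a0 * ((m + n - 1) / n)\<close> is not zero, so \<open>k\<close> vanishes exactly to first
   order in \<open>Y\<close>.\<close>
 have kY: "((%t. - X t * (b t / Y t) + a t) \<longlongrightarrow> - X0 * mu0 + a0) F" by (intro tendsto_intros lim mu)
 have "- X0 * mu0 + a0 = a0 * ((m + n - 1) / n)" using X0 mn by (simp add: mu0_def field_simps)
 hence kY0: "- X0 * mu0 + a0 ~= 0" using a0' mn by simp
 have kY': "- X t * (b t / Y t) + a t = k t / Y t" if "t \<in> I" for t
  using pos[OF that] k[OF that] by (simp add: field_simps)
 have "((%t. - ((b t / Y t) / (- X t * (b t / Y t) + a t) / X t) * (l t - a t / X t)) \<longlongrightarrow>
   - (mu0 / (- X0 * mu0 + a0) / X0) * (mu0 - a0 / X0)) F"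
  by (intro tendsto_intros lim mu lmu aX kY) (use X0 kY0 in auto)
 moreover have "\<forall>\<^sub>F t in F. - ((b t / Y t) / (- X t * (b t / Y t) + a t) / X t) * (l t - a t / X t) = a1 t"
  using F(2) by eventually_elim (simp only: kY' a1_def, use nzXY k0 in \<open>auto simp: field_simps\<close>)
 ultimately have A1: "(a1 \<longlongrightarrow> - (mu0 / (- X0 * mu0 + a0) / X0) * (mu0 - a0 / X0)) F" by (rule Lim_transform_eventually)
 have "((%t. a t / (- X t * (b t / Y t) + a t) * ((l t - b t / Y t) / (Y t)\<^sup>2)) \<longlongrightarrow> a0 / (- X0 * mu0 + a0) * sgm) F"
  by (intro tendsto_intros lim mu d2 kY) (use kY0 in auto)
 moreover have "\<forall>\<^sub>F t in F. a t / (- X t * (b t / Y t) + a t) * ((l t - b t / Y t) / (Y t)\<^sup>2) = b1 t"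
  using F(2)
 proof eventually_elim
  case (elim t)
  have "A / (kap / y) * (D / y\<^sup>2) = A / (kap * y) * D" if "y ~= 0" "kap ~= 0" for A kap y D :: real
   using that by (simp add: field_simps power2_eq_square)
  from this[of "Y t" "k t"] pos[OF elim] k0[OF elim] show ?case unfolding kY'[OF elim] b1_def by simp
 qed
 ultimately have B1: "(b1 \<longlongrightarrow> a0 / (- X0 * mu0 + a0) * sgm) F" by (rule Lim_transform_eventually)
 have "((%t. - X t * b t + Y t * a t) \<longlongrightarrow> - X0 * 0 + 0 * a0) F" by (intro tendsto_intros lim)
 hence k0': "((%t. - X t * b t + Y t * a t) \<longlongrightarrow> 0) F" by simp
 have klim: "(k \<longlongrightarrow> 0) F"
  by (rule Lim_transform_eventually[OF k0']) (use F(2) k in \<open>auto elim!: eventually_mono\<close>)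
 have r1: "((%t. 1 - l t * h t) \<longlongrightarrow> 1 - mu0 * (X0 * a0 + 0 * 0)) F"
  unfolding h_def by (intro tendsto_intros lim lmu)
 have r2: "1 - mu0 * (X0 * a0 + 0 * 0) = 1 + (m - 1) / n * a0\<^sup>2" using X0 mn by (simp add: mu0_def power2_eq_square field_simps)
 have r3: "1 + (m - 1) / n * a0\<^sup>2 \<ge> 0" using mn by simp
 have "((%t. 1 - l t * h t) \<longlongrightarrow> 1 + (m - 1) / n * a0\<^sup>2) F & 1 + (m - 1) / n * a0\<^sup>2 \<ge> 0"
  using r1 r3 unfolding r2 by blast
 with aX mu lmu A1 B1 klim show ?thesis by blast
qed

lemma cap_limits:
 assumes F: "F = at_right t0" "\<forall>\<^sub>F t in F. t \<in> I"
  and lim: "(X \<longlongrightarrow> X0) F" "(Y \<longlongrightarrow> Y0) F" "(a \<longlongrightarrow> a0) F" "(b \<longlongrightarrow> b0) F" and unit0: "a0\<^sup>2 + b0\<^sup>2 = 1"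
  and ax: "X0 > 0 & Y0 = 0 & b0 = 0 \<or> X0 = 0 & Y0 > 0 & a0 = 0"
 shows "\<exists>p q l0 p1 q1 rho. ((%t. a t / X t) \<longlongrightarrow> p) F & ((%t. b t / Y t) \<longlongrightarrow> q) F & (l \<longlongrightarrow> l0) F &
  (a1 \<longlongrightarrow> p1) F & (b1 \<longlongrightarrow> q1) F & (k \<longlongrightarrow> 0) F & ((%t. 1 - l t * h t) \<longlongrightarrow> rho) F & rho \<ge> 0"
 using ax
proof
 assume "X0 > 0 & Y0 = 0 & b0 = 0"
 with cap_limits_Y[OF F, of X0 a0] lim unit0 show ?thesis by simp
next
 assume z: "X0 = 0 & Y0 > 0 & a0 = 0"
 interpret flip: profile_ode I Y X b a "%t. - k t" l n m by (rule flip)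
 have e: "flip.a1 = b1" "flip.b1 = a1" "flip.h = h"
  by (auto simp: fun_eq_iff flip.a1_def flip.b1_def a1_def b1_def flip.h_def h_def)
 obtain p q l0 p1 q1 rho where "((%t. b t / Y t) \<longlongrightarrow> p) F" "((%t. a t / X t) \<longlongrightarrow> q) F" "(l \<longlongrightarrow> l0) F"
  "(b1 \<longlongrightarrow> p1) F" "(a1 \<longlongrightarrow> q1) F" "((%t. - k t) \<longlongrightarrow> 0) F" "((%t. 1 - l t * h t) \<longlongrightarrow> rho) F" "rho \<ge> 0"
  using flip.cap_limits_Y[OF F, of Y0 b0] lim unit0 z unfolding e by auto
 moreover from this have "(k \<longlongrightarrow> 0) F" using tendsto_minus_cancel_left[of k 0 F] by simp
 ultimately show ?thesis by blast
qed

end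

section \<open>The radial equation as a perturbed oscillator near infinity\<close>

definition exp_decay :: "real => (real => real) => bool" where
 "exp_decay c f \<longleftrightarrow> (\<exists>K. \<forall>\<^sub>F r in at_top. \<bar>f r\<bar> \<le> K * exp (- c * r))"

lemma exp_decay_add: "exp_decay c f ==> exp_decay c g ==> exp_decay c (%r. f r + g r)"
proof -
 assume "exp_decay c f" "exp_decay c g"
 then obtain K L where "\<forall>\<^sub>F r in at_top. \<bar>f r\<bar> \<le> K * exp (- c * r)" "\<forall>\<^sub>F r in at_top. \<bar>g r\<bar> \<le> L * exp (- c * r)"
  by (auto simp: exp_decay_def)
 hence "\<forall>\<^sub>F r in at_top. \<bar>f r + g r\<bar> \<le> (K + L) * exp (- c * r)"
  by eventually_elim (simp add: distrib_right)
 thus ?thesis by (auto simp: exp_decay_def)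
qed

lemma exp_decay_bounded_mult:
 assumes "exp_decay c f" "\<forall>\<^sub>F r in at_top. \<bar>g r\<bar> \<le> B"
 shows "exp_decay c (%r. g r * f r)"
proof -
 obtain K where K: "\<forall>\<^sub>F r in at_top. \<bar>f r\<bar> \<le> K * exp (- c * r)" using assms(1) by (auto simp: exp_decay_def)
 have "\<forall>\<^sub>F r in at_top. \<bar>g r * f r\<bar> \<le> (\<bar>B\<bar> * K) * exp (- c * r)"
  using K assms(2)
 proof eventually_elim
  case (elim r)
  have "\<bar>g r\<bar> * \<bar>f r\<bar> \<le> \<bar>B\<bar> * (K * exp (- c * r))" by (rule mult_mono) (use elim in auto)
  thus ?case by (simp add: abs_mult mult.assoc)
 qed
 thus ?thesis by (auto simp: exp_decay_def)
qed

lemma exp_decay_cmult: "exp_decay c f ==> exp_decay c (%r. k * f r)"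
 by (rule exp_decay_bounded_mult[where B = "\<bar>k\<bar>"]) auto

lemma eventually_bounded: "(f \<longlongrightarrow> (L::real)) F ==> \<forall>\<^sub>F x in F. \<bar>f x\<bar> \<le> \<bar>L\<bar> + 1"
 using order_tendstoD(2)[OF tendsto_rabs, of f L F "\<bar>L\<bar> + 1"] by (auto elim: eventually_mono)

lemma exp_decay_square:
 assumes "exp_decay c (%r. f r - L)" "(f \<longlongrightarrow> L) at_top"
 shows "exp_decay c (%r. (f r)\<^sup>2 - L\<^sup>2)"
proof -
 have "((%r. f r + L) \<longlongrightarrow> L + L) at_top" by (intro tendsto_intros assms)
 from exp_decay_bounded_mult[OF assms(1) eventually_bounded[OF this]]
 have "exp_decay c (%r. (f r + L) * (f r - L))" .
 thus ?thesis by (simp add: power2_eq_square algebra_simps)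
qed

lemma exp_decay_differentiable:
 assumes "exp_decay c (%r. f r - x0)" "(f \<longlongrightarrow> x0) at_top" "(g has_real_derivative d) (at x0)"
 shows "exp_decay c (%r. g (f r) - g x0)"
proof -
 define q where "q x = (if x = x0 then d else (g x - g x0) / (x - x0))" for x
 have "((%x. (g x - g x0) / (x - x0)) \<longlongrightarrow> d) (at x0)" using assms(3) by (simp add: has_field_derivative_iff)
 hence "(q \<longlongrightarrow> d) (at x0)"
  by (rule Lim_transform_eventually[where f = "%x. (g x - g x0) / (x - x0)"])
   (auto simp: eventually_at_filter q_def)
 hence "isCont q x0" by (simp add: isCont_def q_def)
 from exp_decay_bounded_mult[OF assms(1) eventually_bounded[OF isCont_tendsto_compose[OF this assms(2)]]]
 have "exp_decay c (%r. q (f r) * (f r - x0))" .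
 moreover have "(%r. q (f r) * (f r - x0)) = (%r. g (f r) - g x0)" by (auto simp: q_def)
 ultimately show ?thesis by simp
qed

context profile_end
begin

definition level :: "real => real" where "level r = exp (2 * r) / 2"
text \<open>The three eigenvalues of \<open>d\<nu>\<close> multiplied by \<open>2 * t / k\<close>,
  as functions of the angle and the slope. Along the end they tend to \<open>tan tha\<close>,
  \<open>- cot tha\<close> and 0, the values on the cone.\<close>

definition x1 :: "real => real" where "x1 r = tan (ang r) + slope r"
definition x2 :: "real => real" where "x2 r = slope r - cot (ang r)"
definition x3 :: "real => real" where "x3 r = slope_force m n (ang r) - (m + n - 2) * slope r"

lemma slope_force_tan_cot: "slope_force m n tht = (n - 1) * cot tht - (m - 1) * tan tht"
 by (simp add: slope_force_def cot_def tan_def)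

lemma scaled_curvatures:
 assumes "r \<ge> r\<^sub>0"
 defines "t \<equiv> level r"
 shows "2 * t * (a t / X t) / k t = x1 r" "2 * t * (b t / Y t) / k t = x2 r" "2 * t * l t / k t = x3 r"
  "2 * t / (k t)\<^sup>2 = 1 + (slope r)\<^sup>2" "\<bar>k t / (2 * t)\<bar> \<le> exp (- r)" "t \<in> I" "2 * t = exp (2 * r)"
proof -
 have t: "t \<in> I" using level_in_I[OF assms(1)] by (simp add: t_def level_def)
 note p = pos[OF t]
 have tn: "tan (ang r) = Y t / X t" by (simp add: ang_def t_def level_def tan_arctan)
 hence ct: "cot (ang r) = X t / Y t" by (simp add: cot_altdef)
 have sl: "slope r = h t / k t" by (simp add: slope_def t_def level_def)
 show "2 * t * (a t / X t) / k t = x1 r" "2 * t * (b t / Y t) / k t = x2 r" "2 * t * l t / k t = x3 r"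
  unfolding curvature_slope[OF t] x1_def x2_def x3_def slope_force_tan_cot tn ct sl by simp_all
 show e: "2 * t = exp (2 * r)" by (simp add: t_def level_def)
 show "2 * t / (k t)\<^sup>2 = 1 + (slope r)\<^sup>2" using slope_sq[of r] t unfolding e by (simp add: t_def level_def)
 show "t \<in> I" by (rule t)
 have "(k t)\<^sup>2 \<le> 2 * t" using hk[OF t] by (smt (verit) zero_le_power2)
 hence "(k t)\<^sup>2 \<le> (exp r)\<^sup>2" unfolding e by (simp add: power2_eq_square mult_exp_exp)
 hence "\<bar>k t\<bar> \<le> exp r" by (simp add: abs_le_square_iff[symmetric])
 hence "\<bar>k t\<bar> / exp (2 * r) \<le> exp r / exp (2 * r)" by (intro divide_right_mono) auto
 thus "\<bar>k t / (2 * t)\<bar> \<le> exp (- r)" unfolding e by (simp add: abs_divide exp_diff[symmetric])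
qed

definition al :: "real => real" where "al t = (m - 1) * (a t / X t)\<^sup>2 + (n - 1) * (b t / Y t)\<^sup>2 + (l t)\<^sup>2"
definition gm :: "real => real" where "gm t = - ((m - 1) * (a t / X t) ^ 3 + (n - 1) * (b t / Y t) ^ 3 + (l t) ^ 3)"
text \<open>The potential and, as \<open>f\<close> below, the right side of the radial equation
  after multiplication by \<open>(2 * t)^2 / k^2\<close>, the factor that turns
  \<open>k^2 * u''\<close> into \<open>(2 * t)^2 * u''\<close>. The right side is cubic in the
  curvatures, so one factor \<open>k / (2 * t)\<close> remains, and it is at most
  \<open>exp (- r)\<close> in modulus.\<close>

definition Q :: "real => real" where "Q r = (m - 1) * (x1 r)\<^sup>2 + (n - 1) * (x2 r)\<^sup>2 + (x3 r)\<^sup>2"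
definition f :: "real => real" where
 "f r = - (k (level r) / (2 * level r)) * ((m - 1) * (x1 r) ^ 3 + (n - 1) * (x2 r) ^ 3 + (x3 r) ^ 3)"

lemma scaled_coefficients:
 assumes r: "r \<ge> r\<^sub>0"
 defines "t \<equiv> level r"
 shows "(2 * t)\<^sup>2 / (k t)\<^sup>2 * al t = Q r" "(2 * t)\<^sup>2 / (k t)\<^sup>2 * gm t = f r"
proof -
 note s = scaled_curvatures[OF r, folded t_def]
 have k: "k t ~= 0" "t ~= 0" using k0[OF s(6)] t_pos[OF s(6)] by auto
 have alg: "T\<^sup>2 / K\<^sup>2 * (p * A\<^sup>2 + q * B\<^sup>2 + C\<^sup>2) = p * (T * A / K)\<^sup>2 + q * (T * B / K)\<^sup>2 + (T * C / K)\<^sup>2"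
  "T\<^sup>2 / K\<^sup>2 * - (p * A ^ 3 + q * B ^ 3 + C ^ 3) = - (K / T) * (p * (T * A / K) ^ 3 + q * (T * B / K) ^ 3 + (T * C / K) ^ 3)"
  if "K ~= 0" "T ~= 0" for T K p q A B C :: real
  using that by (simp_all add: field_simps power2_eq_square power3_eq_cube)
 show "(2 * t)\<^sup>2 / (k t)\<^sup>2 * al t = Q r" "(2 * t)\<^sup>2 / (k t)\<^sup>2 * gm t = f r"
  unfolding al_def gm_def Q_def f_def t_def[symmetric] s(1-3)[symmetric]
  using alg[of "k t" "2 * t"] k by simp_all
qed

lemma tan_cot_derivs:
 "\<exists>d. (tan has_real_derivative d) (at tha)" "\<exists>d. (cot has_real_derivative d) (at tha)"
 "(m - 1) * (tan tha)\<^sup>2 + (n - 1) * (cot tha)\<^sup>2 = m + n - 2"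
proof -
 have sc: "cos tha > 0" "sin tha > 0" using tha by (auto simp: cos_gt_zero sin_gt_zero)
 show "\<exists>d. (tan has_real_derivative d) (at tha)" "\<exists>d. (cot has_real_derivative d) (at tha)"
  using DERIV_tan[of tha] DERIV_cot[of tha] sc by (metis less_irrefl)+
 have "(m - 1) * (tan tha)\<^sup>2 = n - 1" "(n - 1) * (cot tha)\<^sup>2 = m - 1"
  using tha(3) sc by (simp_all add: tan_def cot_def field_simps)
 thus "(m - 1) * (tan tha)\<^sup>2 + (n - 1) * (cot tha)\<^sup>2 = m + n - 2" by simp
qed

text \<open>The scaled eigenvalues are differentiable functions of the angle plus multiples of the
  slope, so their deviation from the limits inherits the exponential rate. The limit of
  \<open>Q\<close> is \<open>(m - 1) * tan^2 + (n - 1) * cot^2\<close> at the cone angle. For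
  \<open>f\<close> convergence of the cubic expression is enough, as its prefactor supplies
  \<open>exp (- r)\<close>.\<close>

lemma coefficient_decay:
 obtains c where "c > 0" "exp_decay c (%r. (slope r)\<^sup>2)" "exp_decay c (%r. Q r - (m + n - 2))"
  "\<exists>B. \<forall>\<^sub>F r in at_top. \<bar>exp r * f r\<bar> \<le> B"
proof -
 obtain K c where c: "c > 0" "\<forall>\<^sub>F r in at_top. \<bar>ang r - tha\<bar> \<le> K * exp (- c * r)"
  "\<forall>\<^sub>F r in at_top. \<bar>slope r\<bar> \<le> K * exp (- c * r)" by (rule ang_decay)
 hence E: "exp_decay c (%r. ang r - tha)" "exp_decay c slope" by (auto simp: exp_decay_def)
 obtain d d' where d: "(tan has_real_derivative d) (at tha)" "(cot has_real_derivative d') (at tha)"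
  using tan_cot_derivs by blast
 have ct: "((%r. tan (ang r)) \<longlongrightarrow> tan tha) at_top" "((%r. cot (ang r)) \<longlongrightarrow> cot tha) at_top"
  using isCont_tendsto_compose[OF DERIV_isCont[OF d(1)] ang_tendsto]
   isCont_tendsto_compose[OF DERIV_isCont[OF d(2)] ang_tendsto] by simp_all
 note tc = exp_decay_differentiable[OF E(1) ang_tendsto d(1)] exp_decay_differentiable[OF E(1) ang_tendsto d(2)]
 have sf: "(slope_force m n has_real_derivative (n - 1) * d' - (m - 1) * d) (at tha)"
  unfolding slope_force_tan_cot[abs_def] by (intro DERIV_diff DERIV_cmult d)
 have sf0: "slope_force m n tha = 0" by (rule slope_force_zero[OF mn1 tha])
 have l1: "(x1 \<longlongrightarrow> tan tha + 0) at_top" unfolding x1_def[abs_def] by (intro tendsto_intros ct slope_tendsto)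
 have l2: "(x2 \<longlongrightarrow> 0 - cot tha) at_top" unfolding x2_def[abs_def] by (intro tendsto_intros ct slope_tendsto)
 have l3: "(x3 \<longlongrightarrow> slope_force m n tha - (m + n - 2) * 0) at_top" unfolding x3_def[abs_def]
  by (intro tendsto_intros isCont_tendsto_compose[OF DERIV_isCont[OF sf] ang_tendsto] slope_tendsto)
 have e1: "exp_decay c (%r. x1 r - tan tha)"
  using exp_decay_add[OF tc(1) E(2)] by (simp add: x1_def algebra_simps)
 have e2: "exp_decay c (%r. x2 r - - cot tha)"
  using exp_decay_add[OF exp_decay_cmult[OF tc(2), of "-1"] E(2)] by (simp add: x2_def algebra_simps)
 have x3: "(%r. slope_force m n (ang r) - slope_force m n tha + - (m + n - 2) * slope r) = (%r. x3 r - 0)"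
  by (simp add: x3_def sf0 fun_eq_iff algebra_simps)
 have e3: "exp_decay c (%r. x3 r - 0)"
  using exp_decay_add[OF exp_decay_differentiable[OF E(1) ang_tendsto sf] exp_decay_cmult[OF E(2), of "- (m + n - 2)"]]
  unfolding x3 .
 have "exp_decay c (%r. (m - 1) * ((x1 r)\<^sup>2 - (tan tha)\<^sup>2) + (n - 1) * ((x2 r)\<^sup>2 - (- cot tha)\<^sup>2) + ((x3 r)\<^sup>2 - 0\<^sup>2))"
  by (intro exp_decay_add exp_decay_cmult exp_decay_square e1 e2 e3) (use l1 l2 l3 sf0 in simp_all)
 moreover have "(m - 1) * ((x1 r)\<^sup>2 - (tan tha)\<^sup>2) + (n - 1) * ((x2 r)\<^sup>2 - (- cot tha)\<^sup>2) + ((x3 r)\<^sup>2 - 0\<^sup>2)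
   = Q r - (m + n - 2)" for r
  unfolding tan_cot_derivs(3)[symmetric] by (simp add: Q_def algebra_simps)
 ultimately have eQ: "exp_decay c (%r. Q r - (m + n - 2))" by simp
 have es: "exp_decay c (%r. (slope r)\<^sup>2)"
  using exp_decay_square[of c slope 0] E(2) slope_tendsto by simp
 define C where "C r = (m - 1) * (x1 r) ^ 3 + (n - 1) * (x2 r) ^ 3 + (x3 r) ^ 3" for r
 obtain L where "(C \<longlongrightarrow> L) at_top"
 proof
  show "(C \<longlongrightarrow> (m - 1) * (tan tha + 0) ^ 3 + (n - 1) * (0 - cot tha) ^ 3 + (slope_force m n tha - (m + n - 2) * 0) ^ 3) at_top"
   unfolding C_def[abs_def] by (intro tendsto_intros l1 l2 l3)
 qed
 from eventually_bounded[OF this] eventually_ge_at_top[of r\<^sub>0]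
 have "\<forall>\<^sub>F r in at_top. \<bar>exp r * f r\<bar> \<le> \<bar>L\<bar> + 1"
 proof eventually_elim
  case (elim r)
  have "\<bar>exp r * f r\<bar> = exp r * \<bar>k (level r) / (2 * level r)\<bar> * \<bar>C r\<bar>" by (simp add: f_def C_def abs_mult)
  also have "\<dots> \<le> exp r * exp (- r) * (\<bar>L\<bar> + 1)"
   by (intro mult_mono mult_left_mono scaled_curvatures(5) elim) auto
  finally show ?case by (simp add: mult_exp_exp)
 qed
 with c(1) es eQ show ?thesis using that by blast
qed

text \<open>With \<open>|z| = e\<^sup>r\<close> and \<open>u(z\<sup>2/2) = e\<^sup>-\<^sup>sgm\<^sup>r v(r)\<close> the radial Jacobi equation becomes a perturbed oscillator.\<close>

lemma oscillator_form:
 fixes u u1 u2 :: "real => real" and sgm :: real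
 assumes der: "\<And>t. (u has_real_derivative u1 t) (at t)" "\<And>t. (u1 has_real_derivative u2 t) (at t)"
  and eq: "\<And>t. t \<in> I ==> (k t)\<^sup>2 * u2 t + N * u1 t + al t * u t = gm t" and r: "r \<ge> r\<^sub>0"
 defines "V \<equiv> %r. exp (sgm * r) * u (level r)"
  and "W \<equiv> %r. exp (sgm * r) * (2 * level r * u1 (level r) + sgm * u (level r))"
  and "e1 \<equiv> %r. N * (slope r)\<^sup>2" and "e2 \<equiv> %r. Q r - (m + n - 2) - sgm * (N * (slope r)\<^sup>2)"
 shows "(V has_real_derivative W r) (at r)"
  "(W has_real_derivative exp (sgm * r) * f r - (N - 2 - 2 * sgm + e1 r) * W r
   - (m + n - 2 + sgm\<^sup>2 - sgm * (N - 2) + e2 r) * V r) (at r)"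
proof -
 have dl: "(level has_real_derivative 2 * level r) (at r)" unfolding level_def[abs_def] by (rule d_level)
 have du: "((%r. u (level r)) has_real_derivative u1 (level r) * (2 * level r)) (at r)"
  "((%r. u1 (level r)) has_real_derivative u2 (level r) * (2 * level r)) (at r)"
  using DERIV_chain2[OF der(1) dl] DERIV_chain2[OF der(2) dl] .
 have de: "((%r. exp (sgm * r)) has_real_derivative sgm * exp (sgm * r)) (at r)"
  by (auto intro!: derivative_eq_intros)
 show "(V has_real_derivative W r) (at r)"
  unfolding V_def W_def using DERIV_mult[OF de du(1)] by (simp add: algebra_simps)
 define E T U U1 U2 where "E = exp (sgm * r)" and "T = 2 * level r" and "U = u (level r)" and "U1 = u1 (level r)"
  and "U2 = u2 (level r)"
 have dW: "(W has_real_derivative sgm * E * (T * U1 + sgm * U) + ((2 * T * U1 + U2 * T * T) + sgm * (U1 * T)) * E) (at r)"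
  unfolding W_def
  using DERIV_mult[OF de DERIV_add[OF DERIV_mult[OF DERIV_cmult[OF dl, of 2] du(2)] DERIV_cmult[OF du(1), of sgm]]]
  by (simp add: E_def T_def U_def U1_def U2_def algebra_simps)
 have eqU: "U2 * T * T = f r - N * (1 + (slope r)\<^sup>2) * (T * U1) - Q r * U"
 proof -
  note s = scaled_curvatures[OF r] and c = scaled_coefficients[OF r]
  define q where "q = (k (level r))\<^sup>2"
  have q: "q ~= 0" using k0[OF s(6)] by (simp add: q_def)
  have "q * U2 + N * U1 + al (level r) * U = gm (level r)"
   using eq[OF s(6)] by (simp add: q_def U_def U1_def U2_def)
  hence "T\<^sup>2 / q * (q * U2 + N * U1 + al (level r) * U) = T\<^sup>2 / q * gm (level r)" by simp
  moreover have "T\<^sup>2 / q * (q * U2 + N * U1 + A * U) = U2 * T * T + N * (T / q) * (T * U1) + (T\<^sup>2 / q * A) * U" for A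
   using q by (simp add: field_simps power2_eq_square)
  ultimately have "U2 * T * T + N * (T / q) * (T * U1) + (T\<^sup>2 / q * al (level r)) * U = T\<^sup>2 / q * gm (level r)" by metis
  moreover have "T / q = 1 + (slope r)\<^sup>2" "T\<^sup>2 / q * al (level r) = Q r" "T\<^sup>2 / q * gm (level r) = f r"
   using s(4) c by (simp_all only: q_def T_def)
  ultimately have "U2 * T * T + N * (1 + (slope r)\<^sup>2) * (T * U1) + Q r * U = f r"
   by (simp only:)
  thus ?thesis by simp
 qed
 have alg: "sgm * E * (T * U1 + sgm * U) + ((2 * T * U1 + (F - N * (1 + p) * (T * U1) - Q' * U)) + sgm * (U1 * T)) * E
   = E * F - (N - 2 - 2 * sgm + N * p) * (E * (T * U1 + sgm * U))
    - (M + sgm\<^sup>2 - sgm * (N - 2) + (Q' - M - sgm * (N * p))) * (E * U)" for F p Q' M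
  by (simp add: power2_eq_square algebra_simps)
 show "(W has_real_derivative exp (sgm * r) * f r - (N - 2 - 2 * sgm + e1 r) * W r
   - (m + n - 2 + sgm\<^sup>2 - sgm * (N - 2) + e2 r) * V r) (at r)"
  using dW unfolding eqU alg[where M = "m + n - 2"]
  by (simp only: W_def V_def e1_def e2_def E_def T_def U_def U1_def)
qed

end

context profile_end
begin

lemma radial_growth:
 fixes u u1 u2 :: "real => real"
 defines "N \<equiv> m + n - 1"
 assumes der: "\<And>t. (u has_real_derivative u1 t) (at t)" "\<And>t. (u1 has_real_derivative u2 t) (at t)"
  and eq: "\<And>t. t \<in> I ==> (k t)\<^sup>2 * u2 t + N * u1 t + al t * u t = gm t"
 shows "N > 4 ==> \<exists>A. \<forall>\<^sub>F r in at_top. \<bar>exp (1 * r) * u (level r)\<bar> \<le> A"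
  and "N = 4 ==> \<exists>A. \<forall>\<^sub>F r in at_top. \<bar>exp (1 * r) * u (level r)\<bar> \<le> A * (1 + r)"
  and "N = 3 ==> \<exists>A. \<forall>\<^sub>F r in at_top. \<bar>exp (1 / 2 * r) * u (level r)\<bar> \<le> A * (1 + r)"
proof -
 obtain c where c: "c > 0" "exp_decay c (%r. (slope r)\<^sup>2)" "exp_decay c (%r. Q r - (m + n - 2))"
  "\<exists>B. \<forall>\<^sub>F r in at_top. \<bar>exp r * f r\<bar> \<le> B" by (rule coefficient_decay)
 obtain B where B: "\<forall>\<^sub>F r in at_top. \<bar>exp r * f r\<bar> \<le> B" using c(4) by blast
 define V where "V sgm r = exp (sgm * r) * u (level r)" for sgm r
 define W where "W sgm r = exp (sgm * r) * (2 * level r * u1 (level r) + sgm * u (level r))" for sgm r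
 define e1 where "e1 r = N * (slope r)\<^sup>2" for r
 define e2 where "e2 sgm r = Q r - (m + n - 2) - sgm * (N * (slope r)\<^sup>2)" for sgm r
 have E1: "exp_decay c e1" unfolding e1_def[abs_def] by (rule exp_decay_cmult[OF c(2)])
 have E2: "exp_decay c (e2 sgm)" for sgm
 proof -
  have "exp_decay c (%r. (Q r - (m + n - 2)) + (- (sgm * N)) * (slope r)\<^sup>2)"
   by (intro exp_decay_add exp_decay_cmult c)
  thus ?thesis unfolding e2_def[abs_def] by (simp add: mult.assoc)
 qed
 have dV: "\<forall>\<^sub>F r in at_top. (V sgm has_real_derivative W sgm r) (at r)"
  and dW: "\<forall>\<^sub>F r in at_top. (W sgm has_real_derivative exp (sgm * r) * f r - (N - 2 - 2 * sgm + e1 r) * W sgm r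
   - (N - 1 + sgm\<^sup>2 - sgm * (N - 2) + e2 sgm r) * V sgm r) (at r)" for sgm
 proof -
  have N1: "m + n - 2 = N - 1" by (simp add: N_def)
  show "\<forall>\<^sub>F r in at_top. (V sgm has_real_derivative W sgm r) (at r)"
   "\<forall>\<^sub>F r in at_top. (W sgm has_real_derivative exp (sgm * r) * f r - (N - 2 - 2 * sgm + e1 r) * W sgm r
   - (N - 1 + sgm\<^sup>2 - sgm * (N - 2) + e2 sgm r) * V sgm r) (at r)"
   unfolding V_def[abs_def] W_def[abs_def] e1_def e2_def N1[symmetric]
   by (rule eventually_mono[OF eventually_ge_at_top[of r\<^sub>0]], rule oscillator_form[OF der eq], assumption+)+
 qed
 \<comment> \<open>\<open>f\<close> is at most of order \<open>exp (- r)\<close>, so every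
   \<open>sgm \<le> 1\<close> leaves the forcing bounded. For \<open>sgm = 1 / 2\<close> it even
   decays, but boundedness already gives the linear growth that becomes the logarithm.\<close>
 have bounded: "\<forall>\<^sub>F r in at_top. \<bar>exp (sgm * r) * f r\<bar> \<le> B" if "sgm \<le> 1" for sgm
  using B eventually_ge_at_top[of 0]
 proof eventually_elim
  case (elim r)
  have "exp (sgm * r) \<le> exp r" using that elim(2) mult_right_mono[of sgm 1 r] by simp
  hence "exp (sgm * r) * \<bar>f r\<bar> \<le> exp r * \<bar>f r\<bar>" by (intro mult_right_mono) auto
  thus ?case using elim(1) by (simp add: abs_mult)
 qed
 obtain K1 where K1: "\<forall>\<^sub>F r in at_top. \<bar>e1 r\<bar> \<le> K1 * exp (- c * r)" using E1 by (auto simp: exp_decay_def)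
 obtain K2 where K2: "\<And>sgm. \<forall>\<^sub>F r in at_top. \<bar>e2 sgm r\<bar> \<le> K2 sgm * exp (- c * r)"
  using E2 unfolding exp_decay_def by metis
 show "\<exists>A. \<forall>\<^sub>F r in at_top. \<bar>exp (1 * r) * u (level r)\<bar> \<le> A" if N: "N > 4"
 proof -
  have "N - 2 - 2 * 1 > 0" "N - 1 + 1\<^sup>2 - 1 * (N - 2) > 0" using N by simp_all
  from damped_oscillator_bounded[OF this exp_decay_tendsto_0[OF c(1) K1] exp_decay_tendsto_0[OF c(1) K2] dV dW bounded]
  show ?thesis unfolding V_def by blast
 qed
 \<comment> \<open>The first condition chooses \<open>sgm\<close> so that the damping cancels
   exactly; what remains in front of \<open>W\<close> is the exponentially small
   \<open>e1\<close>.\<close>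
 have grow: "\<exists>A. \<forall>\<^sub>F r in at_top. \<bar>exp (sgm * r) * u (level r)\<bar> \<le> A * (1 + r)"
  if "N - 2 - 2 * sgm = 0" "N - 1 + sgm\<^sup>2 - sgm * (N - 2) > 0" "sgm \<le> 1" for sgm
 proof -
  define M where "M = max K1 (K2 sgm)"
  have m1: "\<forall>\<^sub>F r in at_top. \<bar>e1 r\<bar> \<le> M * exp (- c * r)"
   using K1 by eventually_elim (erule order_trans, simp add: M_def mult_right_mono)
  have m2: "\<forall>\<^sub>F r in at_top. \<bar>e2 sgm r\<bar> \<le> M * exp (- c * r)"
   using K2[of sgm] by eventually_elim (erule order_trans, simp add: M_def mult_right_mono)
  have dW': "\<forall>\<^sub>F r in at_top. (W sgm has_real_derivative exp (sgm * r) * f r - e1 r * W sgm r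
   - (N - 1 + sgm\<^sup>2 - sgm * (N - 2) + e2 sgm r) * V sgm r) (at r)"
   using dW[of sgm] unfolding that(1) by simp
  from oscillator_linear_growth[OF that(2) c(1) m1 m2 dV dW' bounded[OF that(3)]]
  show ?thesis unfolding V_def by blast
 qed
 show "\<exists>A. \<forall>\<^sub>F r in at_top. \<bar>exp (1 * r) * u (level r)\<bar> \<le> A * (1 + r)" if "N = 4"
  by (rule grow) (simp_all add: that)
 show "\<exists>A. \<forall>\<^sub>F r in at_top. \<bar>exp (1 / 2 * r) * u (level r)\<bar> \<le> A * (1 + r)" if "N = 3"
  by (rule grow) (simp_all add: that power2_eq_square)
qed

lemma level_ln: "t > 0 ==> level (ln (2 * t) / 2) = t" by (simp add: level_def)

text \<open>Provides near infinity the uniform bound on the coefficients that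
  \<open>singular_ode\<close> asks for. Undoing the scaling by \<open>(2 * t)^2 / k^2\<close> can
  only decrease them, since this factor is at least 1.\<close>

lemma coefficients_bounded:
 obtains T B where "T \<in> I" "\<And>t. t \<ge> T ==> \<bar>al t\<bar> \<le> B & \<bar>gm t\<bar> \<le> B"
proof -
 obtain c where c: "c > 0" "exp_decay c (%r. (slope r)\<^sup>2)" "exp_decay c (%r. Q r - (m + n - 2))"
  "\<exists>B. \<forall>\<^sub>F r in at_top. \<bar>exp r * f r\<bar> \<le> B" by (rule coefficient_decay)
 obtain B where B: "\<forall>\<^sub>F r in at_top. \<bar>exp r * f r\<bar> \<le> B" using c(4) by blast
 obtain K where K: "\<forall>\<^sub>F r in at_top. \<bar>Q r - (m + n - 2)\<bar> \<le> K * exp (- c * r)"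
  using c(3) by (auto simp: exp_decay_def)
 have "((%r. Q r - (m + n - 2)) \<longlongrightarrow> 0) at_top" by (rule exp_decay_tendsto_0[OF c(1) K])
 hence "(Q \<longlongrightarrow> m + n - 2) at_top" by (simp add: LIM_zero_iff)
 note QB = eventually_bounded[OF this]
 define C where "C = max (\<bar>m + n - 2\<bar> + 1) B"
 have "\<forall>\<^sub>F r in at_top. \<bar>al (level r)\<bar> \<le> C & \<bar>gm (level r)\<bar> \<le> C"
  using QB B eventually_ge_at_top[of "max r\<^sub>0 0"]
 proof eventually_elim
  case (elim r)
  hence r: "r \<ge> r\<^sub>0" "r \<ge> 0" by auto
  note s = scaled_curvatures[OF r(1)] and co = scaled_coefficients[OF r(1)]
  define M where "M = (2 * level r)\<^sup>2 / (k (level r))\<^sup>2"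
  \<comment> \<open>The chain is \<open>k^2 \<le> 2 * t \<le> (2 * t)^2\<close>; the last part uses
    \<open>r \<ge> 0\<close>, that is \<open>2 * t \<ge> 1\<close>.\<close>
  have "(k (level r))\<^sup>2 \<le> 2 * level r" using hk[OF s(6)] by (smt (verit) zero_le_power2)
  also have "\<dots> \<le> 2 * level r * (2 * level r)" using r(2) unfolding s(7) by simp
  finally have "(k (level r))\<^sup>2 \<le> (2 * level r)\<^sup>2" by (simp add: power2_eq_square mult_ac)
  moreover have "(k (level r))\<^sup>2 > 0" using k0[OF s(6)] by simp
  ultimately have "M \<ge> 1" by (simp add: M_def le_divide_eq)
  hence M: "\<bar>z\<bar> \<le> \<bar>M * z\<bar>" for z using mult_right_mono[of 1 M "\<bar>z\<bar>"] by (simp add: abs_mult)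
  have MQ: "M * al (level r) = Q r" "M * gm (level r) = f r" using co by (simp_all only: M_def)
  have "\<bar>al (level r)\<bar> \<le> \<bar>Q r\<bar>" "\<bar>gm (level r)\<bar> \<le> \<bar>f r\<bar>"
   using M[of "al (level r)"] M[of "gm (level r)"] unfolding MQ .
  moreover have "\<bar>f r\<bar> \<le> \<bar>exp r * f r\<bar>" using r(2) mult_right_mono[of 1 "exp r" "\<bar>f r\<bar>"] by (simp add: abs_mult)
  ultimately show ?case using elim(1,2) unfolding C_def by linarith
 qed
 then obtain R where R: "\<And>r. r \<ge> R ==> \<bar>al (level r)\<bar> \<le> C & \<bar>gm (level r)\<bar> \<le> C"
  unfolding eventually_at_top_linorder by blast
 show ?thesis
 proof (rule that[of "level (max R r\<^sub>0)" C])
  show "level (max R r\<^sub>0) \<in> I" using level_in_I[of "max R r\<^sub>0"] by (simp add: level_def)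
  fix t assume t: "t \<ge> level (max R r\<^sub>0)"
  have l0: "level (max R r\<^sub>0) > 0" by (simp add: level_def)
  have "ln (2 * level (max R r\<^sub>0)) \<le> ln (2 * t)" using t l0 by simp
  moreover have "ln (2 * level (max R r\<^sub>0)) = 2 * max R r\<^sub>0" by (simp add: level_def)
  ultimately have "ln (2 * t) / 2 \<ge> R" by simp
  from R[OF this] show "\<bar>al t\<bar> \<le> C & \<bar>gm t\<bar> \<le> C" using level_ln[of t] t l0 by simp
 qed
qed

definition al1 :: "real => real" where
 "al1 t = (m - 1) * (2 * (a t / X t) * a1 t) + (n - 1) * (2 * (b t / Y t) * b1 t)
  + 2 * l t * (- (m - 1) * a1 t - (n - 1) * b1 t)"

definition gm1 :: "real => real" where
 "gm1 t = - ((m - 1) * (3 * (a t / X t)\<^sup>2 * a1 t) + (n - 1) * (3 * (b t / Y t)\<^sup>2 * b1 t)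
  + 3 * (l t)\<^sup>2 * (- (m - 1) * a1 t - (n - 1) * b1 t))"

lemma d_coefficients:
 assumes t: "t \<in> I"
 shows "(al has_real_derivative al1 t) (at t)" "(gm has_real_derivative gm1 t) (at t)"
  "((%t. (k t)\<^sup>2) has_real_derivative 2 * (1 - l t * h t)) (at t)"
proof -
 have p2: "((%t. (p t)\<^sup>2) has_real_derivative 2 * p t * d) (at t)" and
  p3: "((%t. p t ^ 3) has_real_derivative 3 * (p t)\<^sup>2 * d) (at t)"
  if "(p has_real_derivative d) (at t)" for p d
  using DERIV_power[OF that, of 2] DERIV_power[OF that, of 3] by (simp_all add: mult_ac)
 note dr = d_rotational[OF t]
 show "(al has_real_derivative al1 t) (at t)"
  unfolding al_def[abs_def] al1_def by (intro DERIV_add DERIV_cmult p2 dr)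
 show "(gm has_real_derivative gm1 t) (at t)"
  unfolding gm_def[abs_def] gm1_def by (intro DERIV_minus DERIV_add DERIV_cmult p3 dr)
 show "((%t. (k t)\<^sup>2) has_real_derivative 2 * (1 - l t * h t)) (at t)"
  using p2[OF dk[OF t]] k0[OF t] by simp
qed

lemma cap_coefficients:
 assumes "F = at_right t0" "\<forall>\<^sub>F t in F. t \<in> I"
  and "(X \<longlongrightarrow> X0) F" "(Y \<longlongrightarrow> Y0) F" "(a \<longlongrightarrow> a0) F" "(b \<longlongrightarrow> b0) F" and "a0\<^sup>2 + b0\<^sup>2 = 1"
  and "X0 > 0 & Y0 = 0 & b0 = 0 \<or> X0 = 0 & Y0 > 0 & a0 = 0"
 obtains A1 G1 q1 where "(al1 \<longlongrightarrow> A1) F" "(gm1 \<longlongrightarrow> G1) F" "(k \<longlongrightarrow> 0) F"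
  "((%t. 2 * (1 - l t * h t)) \<longlongrightarrow> q1) F" "q1 \<ge> 0"
proof -
 obtain p q l0 p1 q1 rho where L: "((%t. a t / X t) \<longlongrightarrow> p) F" "((%t. b t / Y t) \<longlongrightarrow> q) F" "(l \<longlongrightarrow> l0) F"
  "(a1 \<longlongrightarrow> p1) F" "(b1 \<longlongrightarrow> q1) F" "(k \<longlongrightarrow> 0) F" "((%t. 1 - l t * h t) \<longlongrightarrow> rho) F" "rho \<ge> 0"
  using cap_limits[OF assms] by blast
 have LA: "(al1 \<longlongrightarrow> (m - 1) * (2 * p * p1) + (n - 1) * (2 * q * q1) + 2 * l0 * (- (m - 1) * p1 - (n - 1) * q1)) F"
  unfolding al1_def[abs_def] by (intro tendsto_intros L)
 have LG: "(gm1 \<longlongrightarrow> - ((m - 1) * (3 * p\<^sup>2 * p1) + (n - 1) * (3 * q\<^sup>2 * q1) + 3 * l0\<^sup>2 * (- (m - 1) * p1 - (n - 1) * q1))) F"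
  unfolding gm1_def[abs_def] by (intro tendsto_intros L)
 have LR: "((%t. 2 * (1 - l t * h t)) \<longlongrightarrow> 2 * rho) F" by (intro tendsto_intros L)
 show ?thesis by (rule that[OF LA LG L(6) LR]) (use L(8) in simp)
qed

text \<open>The bound near infinity is joined with compactness of the remaining range of
  \<open>r\<close>, where \<open>L \<ge> 1\<close> absorbs the constant. Starting at
  \<open>r = 0\<close> covers the surface because it stays at distance at least 1 from the
  origin.\<close>

lemma growth_everywhere:
 fixes u L :: "real => real"
 assumes u: "continuous_on UNIV u" and L: "\<And>r. r \<ge> 0 ==> L r \<ge> 1" and sgm: "sgm \<ge> 0"
  and ev: "\<forall>\<^sub>F r in at_top. \<bar>exp (sgm * r) * u (level r)\<bar> \<le> A * L r"
 obtains C where "C \<ge> 0" "\<And>r. r \<ge> 0 ==> \<bar>exp (sgm * r) * u (level r)\<bar> \<le> C * L r"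
proof -
 obtain R where R: "\<And>r. r \<ge> R ==> \<bar>exp (sgm * r) * u (level r)\<bar> \<le> A * L r"
  using ev unfolding eventually_at_top_linorder by blast
 have "continuous_on {0..R} (%r. exp (sgm * r) * u (level r))"
  unfolding level_def by (intro continuous_intros continuous_on_compose2[OF u]) auto
 hence "bounded ((%r. exp (sgm * r) * u (level r)) ` {0..R})"
  by (intro compact_imp_bounded compact_continuous_image compact_Icc)
 then obtain M where "\<forall>x\<in>(%r. exp (sgm * r) * u (level r)) ` {0..R}. norm x \<le> M"
  unfolding bounded_iff by blast
 hence M: "\<bar>exp (sgm * r) * u (level r)\<bar> \<le> M" if "r \<in> {0..R}" for r using that by auto
 define C where "C = \<bar>A\<bar> + \<bar>M\<bar>"
 show ?thesis
 proof (rule that[of C])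
  show "C \<ge> 0" by (simp add: C_def)
  fix r :: real assume r: "r \<ge> 0"
  have AL: "A * L r \<le> C * L r" "M \<le> C * L r"
   using L[OF r] mult_right_mono[of A C "L r"] mult_mono[of M C 1 "L r"] by (simp_all add: C_def)
  show "\<bar>exp (sgm * r) * u (level r)\<bar> \<le> C * L r"
  proof (cases "r \<le> R")
   case True
   thus ?thesis using M[of r] r AL(2) by simp
  next
   case False
   thus ?thesis using R[of r] AL(1) by simp
  qed
 qed
qed

end

section \<open>The radial solution on the surface\<close>

lemma continuous_extend_endpoint:
 fixes f :: "real => real"
 assumes "continuous_on {t0<..} f" "(f \<longlongrightarrow> c) (at_right t0)"
 shows "continuous_on {t0..} (%t. if t \<le> t0 then c else f t)"
 unfolding continuous_on_eq_continuous_within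
proof
 fix t assume "t \<in> {t0..}"
 show "continuous (at t within {t0..}) (%t. if t \<le> t0 then c else f t)"
 proof (cases "t = t0")
  case True
  have "((%t. if t \<le> t0 then c else f t) \<longlongrightarrow> c) (at_right t0)"
   by (rule Lim_transform_eventually[OF assms(2)]) (auto simp: eventually_at_filter)
  thus ?thesis using True by (simp add: continuous_within at_within_Ici_at_right)
 next
  case False
  with \<open>t \<in> {t0..}\<close> have t: "t \<in> {t0<..}" by auto
  have c: "isCont f t" using assms(1) t by (simp add: continuous_on_eq_continuous_at)
  have ev: "\<forall>\<^sub>F s in nhds t. f s = (if s \<le> t0 then c else f s)"
   using eventually_nhds_in_open[OF open_greaterThan t] by (auto elim: eventually_mono)
  have "isCont (%t. if t \<le> t0 then c else f t) t" by (rule iffD1[OF isCont_cong[OF ev] c])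
  thus ?thesis by (rule continuous_at_imp_continuous_at_within)
 qed
qed

lemma continuous_agree_endpoint:
 fixes f g :: "real => real"
 assumes "continuous_on {t0..} f" "continuous_on {t0..} g" "\<And>t. t > t0 ==> f t = g t"
 shows "f t0 = g t0"
proof -
 have "(f \<longlongrightarrow> f t0) (at_right t0)" "(g \<longlongrightarrow> g t0) (at_right t0)"
  unfolding at_within_Ici_at_right[symmetric] using assms(1,2) unfolding continuous_on_def by auto
 moreover have "\<forall>\<^sub>F t in at_right t0. f t = g t" using assms(3) by (auto simp: eventually_at_filter)
 ultimately show ?thesis using tendsto_unique[OF trivial_limit_at_right_real] tendsto_cong by blast
qed

context asymptotic_surface
begin

text \<open>The flux \<open>w * k\<close>, made positive by a sign, plays the role of the
  integrating factor \<open>P\<close>, and \<open>q = k^2\<close>; \<open>d_flux\<close> then is the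
  required relation \<open>P' = N * P / q\<close>. On the end orbit the position vector is parallel
  to the normal, the second order term of the radial Jacobi operator drops out, and the equation
  there is the end condition of the singular problem.\<close>

theorem radial_jacobi_solution:
 obtains u u1 u2 :: "real => real" where "continuous_on UNIV u2"
  "\<And>t. (u has_real_derivative u1 t) (at t)" "\<And>t. (u1 has_real_derivative u2 t) (at t)"
  "\<And>z. z \<in> S ==> jacobi_operator S \<nu> (%z. u (z \<bullet> z / 2)) z = trace_A_cubed S \<nu> z"
  "m + n - 1 > 4 ==> \<exists>C\<ge>0. \<forall>r\<ge>0. \<bar>exp (1 * r) * u (exp (2 * r) / 2)\<bar> \<le> C * 1"
  "m + n - 1 = 4 ==> \<exists>C\<ge>0. \<forall>r\<ge>0. \<bar>exp (1 * r) * u (exp (2 * r) / 2)\<bar> \<le> C * (1 + r)"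
  "m + n - 1 = 3 ==> \<exists>C\<ge>0. \<forall>r\<ge>0. \<bar>exp (1 / 2 * r) * u (exp (2 * r) / 2)\<bar> \<le> C * (1 + r)"
proof -
 obtain t0 X Y x0 y0 where t0: "t0 \<ge> 1 / 2" and st: "strand {t0<..} X Y"
  and lim: "(X \<longlongrightarrow> x0) (at_right t0)" "(Y \<longlongrightarrow> y0) (at_right t0)" and lev0: "x0\<^sup>2 + y0\<^sup>2 = 2 * t0" and S0: "emb x0 y0 \<in> S"
  and ax: "x0 = 0 & y0 > 0 \<or> x0 > 0 & y0 = 0"
  and all: "\<And>x y. (x, y) \<in> S ==> (norm x = x0 & norm y = y0) \<or> (\<exists>t>t0. norm x = X t & norm y = Y t)"
  by (rule profile_structure) blast
 define I where "I = {t0<..}"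
 have unb: "{t0 + 1..} \<subseteq> I" "t0 + 1 > 0" using t0 by (auto simp: I_def)
 note end_ax = profile_end_axioms.intro[OF unb cone_angle]
 have stI: "strand I X Y" using st by (simp add: I_def)
 interpret ode: profile_end I X Y "%t. nu1 (X t) (Y t)" "%t. nu2 (X t) (Y t)" "%t. kk (X t) (Y t)" "%t. lam (X t) (Y t)" m n "t0 + 1" tha
  by (intro profile_end.intro strand_profile_ode[OF stI] end_ax)
 define N where "N = m + n - 1"
 define k where "k t = kk (X t) (Y t)" for t
 define Xb where "Xb t = (if t \<le> t0 then x0 else X t)" for t
 define Yb where "Yb t = (if t \<le> t0 then y0 else Y t)" for t
 have cXY: "continuous_on {t0..} Xb" "continuous_on {t0..} Yb"
  using st unfolding Xb_def[abs_def] Yb_def[abs_def] strand_def by (intro continuous_extend_endpoint lim; simp)+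
 have evI: "\<forall>\<^sub>F t in at_right t0. t \<in> I" by (simp add: eventually_at_filter I_def)
 have mem: "(Xb t *\<^sub>R e, Yb t *\<^sub>R f) \<in> S" if "norm e = 1" "norm f = 1" "t \<ge> t0" for e f t
 proof -
  have "emb (Xb t) (Yb t) \<in> S" using S0 strandD(6)[OF st, of t] that(3) by (simp add: Xb_def Yb_def)
  thus ?thesis unfolding emb_def by (rule mem_S_norms[rotated 2]) (simp_all add: that unit)
 qed
 \<comment> \<open>The coefficients are read off from \<open>S\<close> and not from the profile
   formulas: continuity at \<open>t0\<close> is then inherited from the curvature functions of
   \<open>S\<close>, whereas one of the quotients in the formulas is 0 / 0 there.\<close>
 define al where "al t = norm_A_squared S \<nu> (emb (Xb t) (Yb t))" for t
 define g where "g t = trace_A_cubed S \<nu> (emb (Xb t) (Yb t))" for t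
 have curv_off: "norm_A_squared S \<nu> (x, y) = ode.al t" "trace_A_cubed S \<nu> (x, y) = ode.gm t"
  if "(x, y) \<in> S" "norm x = X t" "norm y = Y t" "t \<in> I" for x y t
 proof -
  have nz: "x ~= 0" "y ~= 0" using ode.pos[OF that(4)] that(2,3) by auto
  show "norm_A_squared S \<nu> (x, y) = ode.al t" "trace_A_cubed S \<nu> (x, y) = ode.gm t"
   using curvatures[OF that(1) nz] unfolding ode.al_def ode.gm_def that(2,3) by simp_all
 qed
 have curv_cont: "continuous_on {t0..} (%t. norm_A_squared S \<nu> (Xb t *\<^sub>R e, Yb t *\<^sub>R f))"
  "continuous_on {t0..} (%t. trace_A_cubed S \<nu> (Xb t *\<^sub>R e, Yb t *\<^sub>R f))"
  if "norm e = 1" "norm f = 1" for e f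
 proof -
  have c: "continuous_on {t0..} (%t. (Xb t *\<^sub>R e, Yb t *\<^sub>R f))" by (intro continuous_intros cXY)
  have sub: "(%t. (Xb t *\<^sub>R e, Yb t *\<^sub>R f)) ` {t0..} \<subseteq> S" using mem[OF that] by auto
  show "continuous_on {t0..} (%t. norm_A_squared S \<nu> (Xb t *\<^sub>R e, Yb t *\<^sub>R f))"
   "continuous_on {t0..} (%t. trace_A_cubed S \<nu> (Xb t *\<^sub>R e, Yb t *\<^sub>R f))"
   by (rule continuous_on_compose2[OF _ c sub], rule curvature_continuous[OF hyp \<nu>])+
 qed
 have curv_on: "norm_A_squared S \<nu> (Xb t *\<^sub>R e, Yb t *\<^sub>R f) = ode.al t" "trace_A_cubed S \<nu> (Xb t *\<^sub>R e, Yb t *\<^sub>R f) = ode.gm t"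
  if "norm e = 1" "norm f = 1" "t > t0" for e f t
 proof -
  have "(Xb t *\<^sub>R e, Yb t *\<^sub>R f) \<in> S" "t \<in> I" using mem that by (auto simp: I_def)
  moreover from this have "norm (Xb t *\<^sub>R e) = X t" "norm (Yb t *\<^sub>R f) = Y t"
   using ode.pos[of t] that by (auto simp: Xb_def Yb_def)
  ultimately show "norm_A_squared S \<nu> (Xb t *\<^sub>R e, Yb t *\<^sub>R f) = ode.al t" "trace_A_cubed S \<nu> (Xb t *\<^sub>R e, Yb t *\<^sub>R f) = ode.gm t"
   using curv_off by blast+
 qed
 have cont: "continuous_on {t0..} al" "continuous_on {t0..} g"
  unfolding al_def[abs_def] g_def[abs_def] emb_def by (rule curv_cont[OF unit])+
 have on: "al t = ode.al t" "g t = ode.gm t" if "t > t0" for t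
  unfolding al_def g_def emb_def by (rule curv_on[OF unit that])+
 \<comment> \<open>For \<open>t > t0\<close> the curvature along either ray is given by the same
   profile formula. Continuity up to \<open>t0\<close> shows that it is constant on the end
   orbit.\<close>
 have curv_end: "norm_A_squared S \<nu> (x0 *\<^sub>R e, y0 *\<^sub>R f) = al t0" "trace_A_cubed S \<nu> (x0 *\<^sub>R e, y0 *\<^sub>R f) = g t0"
  if ef: "norm e = 1" "norm f = 1" for e f
  using continuous_agree_endpoint[OF curv_cont(1)[OF ef] cont(1)] continuous_agree_endpoint[OF curv_cont(2)[OF ef] cont(2)]
   curv_on[OF ef] on by (simp_all add: Xb_def Yb_def)
 have S_ev: "\<forall>\<^sub>F t in at_right t0. emb (X t) (Y t) \<in> S" using evI strandD(6)[OF stI] by (auto elim: eventually_mono)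
 note nu_lim = tendsto_nu[OF lim S0 S_ev]
 have enz: "e1 ~= 0" "f1 ~= 0" using unit by (metis norm_zero zero_neq_one)+
 have nu_ax: "x0 > 0 & y0 = 0 & nu2 x0 y0 = 0 \<or> x0 = 0 & y0 > 0 & nu1 x0 y0 = 0"
  using ax
 proof
  assume c: "x0 = 0 & y0 > 0"
  have E: "emb x0 y0 = (0, y0 *\<^sub>R f1)" using c by (simp add: emb_def)
  have "fst (\<nu> (0, y0 *\<^sub>R f1)) = 0"
   using arg_cong[OF axis_normal_snd(1)[OF S0[unfolded E]], of fst] enz c by simp
  thus ?thesis using c by (simp add: nu1_def)
 next
  assume c: "x0 > 0 & y0 = 0"
  have E: "emb x0 y0 = (x0 *\<^sub>R e1, 0)" using c by (simp add: emb_def)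
  have "snd (\<nu> (x0 *\<^sub>R e1, 0)) = 0"
   using arg_cong[OF axis_normal_fst(1)[OF S0[unfolded E]], of snd] enz c by simp
  thus ?thesis using c by (simp add: nu2_def)
 qed
 have n1: "((%t. (nu1 (X t) (Y t))\<^sup>2 + (nu2 (X t) (Y t))\<^sup>2) \<longlongrightarrow> (nu1 x0 y0)\<^sup>2 + (nu2 x0 y0)\<^sup>2) (at_right t0)"
  by (intro tendsto_intros nu_lim)
 have n2: "\<forall>\<^sub>F t in at_right t0. (nu1 (X t) (Y t))\<^sup>2 + (nu2 (X t) (Y t))\<^sup>2 = 1"
  using evI by eventually_elim (rule ode.unit)
 have nu_unit: "(nu1 x0 y0)\<^sup>2 + (nu2 x0 y0)\<^sup>2 = 1"
  using tendsto_unique[OF trivial_limit_at_right_real Lim_transform_eventually[OF n1 n2] tendsto_const] .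
 obtain A1 G1 q1 where cap: "(ode.al1 \<longlongrightarrow> A1) (at_right t0)" "(ode.gm1 \<longlongrightarrow> G1) (at_right t0)" "(k \<longlongrightarrow> 0) (at_right t0)"
  "((%t. 2 * (1 - lam (X t) (Y t) * ode.h t)) \<longlongrightarrow> q1) (at_right t0)" "q1 \<ge> 0"
  unfolding k_def[abs_def] by (rule ode.cap_coefficients[OF refl evI lim nu_lim(1,2) nu_unit nu_ax])
 \<comment> \<open>The sign of \<open>k\<close> depends on the orientation of \<open>\<nu>\<close>;
   the integrating factor has to be positive.\<close>
 obtain sgm where sgm: "\<And>t. t \<in> I ==> sgm * k t > 0"
  using ode.k_sign that[of 1] that[of "-1"] by (auto simp: k_def)
 define P where "P t = (if t \<le> t0 then 0 else sgm * (ode.w t * k t))" for t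
 define q where "q t = (k t)\<^sup>2" for t
 obtain T B where TB: "T \<in> I" "\<And>t. t \<ge> T ==> \<bar>ode.al t\<bar> \<le> B & \<bar>ode.gm t\<bar> \<le> B"
  using ode.coefficients_bounded by blast
 have bdd: "\<exists>M. \<forall>t\<in>{t0..T}. \<bar>h t\<bar> \<le> M" if "continuous_on {t0..} h" for h :: "real => real"
 proof -
  have "continuous_on {t0..T} h" using that by (rule continuous_on_subset) auto
  hence "bounded (h ` {t0..T})" by (intro compact_imp_bounded compact_continuous_image compact_Icc)
  thus ?thesis unfolding bounded_iff by auto
 qed
 obtain M1 M2 where M: "\<forall>t\<in>{t0..T}. \<bar>al t\<bar> \<le> M1" "\<forall>t\<in>{t0..T}. \<bar>g t\<bar> \<le> M2" using bdd cont by blast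
 define A where "A = 1 + \<bar>B\<bar> + \<bar>M1\<bar> + \<bar>M2\<bar>"
 have bound: "\<bar>al t\<bar> \<le> A & \<bar>g t\<bar> \<le> A" if "t \<ge> t0" for t
 proof (cases "t \<le> T")
  case True
  hence "\<bar>al t\<bar> \<le> M1" "\<bar>g t\<bar> \<le> M2" using M that by auto
  thus ?thesis unfolding A_def by (intro conjI; linarith)
 next
  case False
  hence "t \<ge> T" "t > t0" using TB(1) by (auto simp: I_def)
  hence "\<bar>al t\<bar> \<le> B" "\<bar>g t\<bar> \<le> B" using TB(2)[of t] on[of t] by auto
  thus ?thesis unfolding A_def by (intro conjI; linarith)
 qed
 have wk: "((%t. sgm * (ode.w t * k t)) has_real_derivative sgm * (N * (ode.w t * k t) / (k t)\<^sup>2)) (at t)" if "t \<in> I" for t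
  unfolding N_def k_def by (rule DERIV_cmult[OF ode.d_flux[OF that]])
 interpret sing: singular_ode t0 N A P q al g
 proof
  show "N > 0" using mn2 by (simp add: N_def)
  show "A > 0" by (simp add: A_def)
  have "(ode.w \<longlongrightarrow> x0 powr (m - 1) * y0 powr (n - 1)) (at_right t0)"
   unfolding ode.w_def[abs_def]
  proof (intro tendsto_mult tendsto_powr' lim tendsto_const)
   show "x0 ~= 0 \<or> 0 < m - 1 & (\<forall>\<^sub>F t in at_right t0. 0 \<le> X t)" "y0 ~= 0 \<or> 0 < n - 1 & (\<forall>\<^sub>F t in at_right t0. 0 \<le> Y t)"
    using evI ode.pos mn2 by (auto elim!: eventually_mono intro: less_imp_le)
  qed
  hence "((%t. sgm * (ode.w t * k t)) \<longlongrightarrow> sgm * (x0 powr (m - 1) * y0 powr (n - 1) * 0)) (at_right t0)"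
   by (intro tendsto_intros cap)
  hence l0: "((%t. sgm * (ode.w t * k t)) \<longlongrightarrow> 0) (at_right t0)" by simp
  have "continuous_on {t0<..} (%t. sgm * (ode.w t * k t))"
   using DERIV_isCont[OF wk] by (intro continuous_at_imp_continuous_on) (auto simp: I_def)
  from continuous_extend_endpoint[OF this l0] show "continuous_on {t0..} P" unfolding P_def[abs_def] .
  show "P t0 = 0" by (simp add: P_def)
  fix t assume "t > t0"
  hence t: "t \<in> I" by (simp add: I_def)
  show "q t > 0" using ode.k0[OF t] by (simp add: q_def k_def)
  have "P t = ode.w t * (sgm * k t)" using \<open>t > t0\<close> by (simp add: P_def)
  hence "P t > 0" using ode.w_pos[OF t] sgm[OF t] by simp
  moreover have "(P has_real_derivative sgm * (N * (ode.w t * k t) / (k t)\<^sup>2)) (at t)"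
   by (rule ode.transform_on_I[OF t wk[OF t]]) (simp add: P_def I_def)
  moreover have "sgm * (N * (ode.w t * k t) / (k t)\<^sup>2) = N * P t / q t" using \<open>t > t0\<close> by (simp add: P_def q_def)
  ultimately show "P t > 0 & (P has_real_derivative N * P t / q t) (at t)" by simp
 qed (use cont bound in auto)
 have k2: "((%t. (k t)\<^sup>2) \<longlongrightarrow> 0) (at_right t0)" using tendsto_power[OF cap(3), of 2] by simp
 obtain u u1 u2 where u: "continuous_on UNIV u2"
  "\<And>t. (u has_real_derivative u1 t) (at t)" "\<And>t. (u1 has_real_derivative u2 t) (at t)"
  and ode_eq: "\<And>t. t > t0 ==> q t * u2 t + N * u1 t + al t * u t = g t"
  and end_eq: "N * u1 t0 + al t0 * u t0 = g t0"
 proof (rule sing.C2_solution)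
  fix t assume "t > t0"
  hence t: "t \<in> I" by (simp add: I_def)
  show "(al has_real_derivative ode.al1 t) (at t)"
   by (rule ode.transform_on_I[OF t ode.d_coefficients(1)[OF t]]) (simp add: on I_def)
  show "(g has_real_derivative ode.gm1 t) (at t)"
   by (rule ode.transform_on_I[OF t ode.d_coefficients(2)[OF t]]) (simp add: on I_def)
  show "(q has_real_derivative 2 * (1 - lam (X t) (Y t) * ode.h t)) (at t)"
   unfolding q_def[abs_def] k_def by (rule ode.d_coefficients(3)[OF t])
 next
  show "(q \<longlongrightarrow> 0) (at_right t0)" unfolding q_def[abs_def] by (rule k2)
 qed (use cap in auto)
 have eqI: "(kk (X t) (Y t))\<^sup>2 * u2 t + (m + n - 1) * u1 t + ode.al t * u t = ode.gm t" if "t \<in> I" for t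
  using ode_eq[of t] on[of t] that by (simp add: I_def q_def k_def N_def)
 have cu: "continuous_on UNIV u" using DERIV_isCont[OF u(2)] by (intro continuous_at_imp_continuous_on) auto
 note gr = ode.radial_growth[OF u(2,3) eqI]
 have grow: "\<exists>C\<ge>0. \<forall>r\<ge>0. \<bar>exp (sgm * r) * u (exp (2 * r) / 2)\<bar> \<le> C * L r"
  if ev: "\<exists>A. \<forall>\<^sub>F r in at_top. \<bar>exp (sgm * r) * u (ode.level r)\<bar> \<le> A * L r" and L: "\<And>r. r \<ge> 0 ==> L r \<ge> 1" "sgm \<ge> 0" for sgm L
 proof -
  obtain A where A: "\<forall>\<^sub>F r in at_top. \<bar>exp (sgm * r) * u (ode.level r)\<bar> \<le> A * L r" using ev by blast
  from ode.growth_everywhere[OF cu L A] obtain C where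
   "C \<ge> 0" "\<And>r. r \<ge> 0 ==> \<bar>exp (sgm * r) * u (ode.level r)\<bar> \<le> C * L r" by blast
  thus ?thesis unfolding ode.level_def by blast
 qed
 show ?thesis
 proof (rule that[OF u])
  show "\<exists>C\<ge>0. \<forall>r\<ge>0. \<bar>exp (1 * r) * u (exp (2 * r) / 2)\<bar> \<le> C * 1" if "m + n - 1 > 4"
   using grow[of 1 "%_. 1"] gr(1)[OF _ that] by simp
  show "\<exists>C\<ge>0. \<forall>r\<ge>0. \<bar>exp (1 * r) * u (exp (2 * r) / 2)\<bar> \<le> C * (1 + r)" if "m + n - 1 = 4"
   using grow[of 1 "%r. 1 + r"] gr(2)[OF _ that] by simp
  show "\<exists>C\<ge>0. \<forall>r\<ge>0. \<bar>exp (1 / 2 * r) * u (exp (2 * r) / 2)\<bar> \<le> C * (1 + r)" if "m + n - 1 = 3"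
   using grow[of "1 / 2" "%r. 1 + r"] gr(3)[OF _ that] by simp
  fix z assume z: "z \<in> S"
  obtain x y where xy: "z = (x, y)" by fastforce
  have D: "real DIM((real^'m) \<times> (real^'n)) - 1 = N" by (simp add: N_def dims)
  have J: "jacobi_operator S \<nu> (%z. u (z \<bullet> z / 2)) z =
    (z \<bullet> z - (z \<bullet> \<nu> z)\<^sup>2) * u2 (z \<bullet> z / 2) + N * u1 (z \<bullet> z / 2) + norm_A_squared S \<nu> z * u (z \<bullet> z / 2)"
   using jacobi_operator_radial[OF min \<nu> z u(2,3)] unfolding D .
  have zz: "z \<bullet> z = (norm x)\<^sup>2 + (norm y)\<^sup>2" by (simp add: xy inner_prod_def dot_square_norm)
  from all[OF z[unfolded xy]] show "jacobi_operator S \<nu> (%z. u (z \<bullet> z / 2)) z = trace_A_cubed S \<nu> z"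
  proof
   assume nxy: "norm x = x0 & norm y = y0"
   \<comment> \<open>Since \<open>sgn 0 = 0\<close> is not a unit vector, the vanishing factor is
     represented by the fixed unit vector.\<close>
   define e where "e = (if x = 0 then e1 else sgn x)"
   define f where "f = (if y = 0 then f1 else sgn y)"
   have ef: "norm e = 1" "norm f = 1" by (simp_all add: e_def f_def unit norm_sgn)
   have zef: "z = (x0 *\<^sub>R e, y0 *\<^sub>R f)" using nxy by (auto simp: xy e_def f_def norm_scaleR_sgn)
   have t: "z \<bullet> z / 2 = t0" using zz nxy lev0 by simp
   \<comment> \<open>On an axis the normal is \<open>sgn x\<close> or \<open>sgn y\<close> up to a
     sign, so the coefficient of the second derivative is 0 and the end condition is all that is
     left to use.\<close>
   have "(z \<bullet> \<nu> z)\<^sup>2 = z \<bullet> z"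
   proof (cases "y = 0")
    case True
    hence x: "x ~= 0" using ax nxy by auto
    have S': "(x, 0) \<in> S" using z by (simp add: xy True)
    define s where "s = sgn x \<bullet> fst (\<nu> (x, 0))"
    have n: "\<nu> (x, 0) = s *\<^sub>R (sgn x, 0)" "\<bar>s\<bar> = 1" using axis_normal_fst[OF S' x] by (simp_all add: s_def)
    have "x \<bullet> sgn x = norm x" using x by (simp add: sgn_div_norm dot_square_norm power2_eq_square)
    hence "z \<bullet> \<nu> z = s * norm x" by (simp add: xy True n(1) inner_prod_def)
    moreover have "s\<^sup>2 = 1" using n(2) by (simp add: abs_square_eq_1)
    ultimately show ?thesis using zz True by (simp add: power_mult_distrib)
   next
    case False
    hence x: "x = 0" using ax nxy by auto
    have S': "(0, y) \<in> S" using z by (simp add: xy x)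
    define s where "s = sgn y \<bullet> snd (\<nu> (0, y))"
    have n: "\<nu> (0, y) = s *\<^sub>R (0, sgn y)" "\<bar>s\<bar> = 1" using axis_normal_snd[OF S' False] by (simp_all add: s_def)
    have "y \<bullet> sgn y = norm y" using False by (simp add: sgn_div_norm dot_square_norm power2_eq_square)
    hence "z \<bullet> \<nu> z = s * norm y" by (simp add: xy x n(1) inner_prod_def)
    moreover have "s\<^sup>2 = 1" using n(2) by (simp add: abs_square_eq_1)
    ultimately show ?thesis using zz x by (simp add: power_mult_distrib)
   qed
   thus ?thesis unfolding J t using end_eq curv_end[OF ef] by (simp add: zef[symmetric])
  next
   assume "\<exists>t>t0. norm x = X t & norm y = Y t"
   then obtain t where t: "t > t0" "norm x = X t" "norm y = Y t" by blast
   hence tI: "t \<in> I" by (simp add: I_def)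
   have nz: "x ~= 0" "y ~= 0" using ode.pos[OF tI] t by auto
   have t2: "z \<bullet> z = 2 * t" using zz ode.level[OF tI] t by simp
   have "x \<bullet> sgn x = norm x" "y \<bullet> sgn y = norm y"
    using nz by (simp_all add: sgn_div_norm dot_square_norm power2_eq_square)
   hence "z \<bullet> \<nu> z = ode.h t"
    unfolding xy \<nu>_orbit[OF z[unfolded xy] nz] by (simp add: inner_prod_def ode.h_def t mult.commute)
   hence "z \<bullet> z - (z \<bullet> \<nu> z)\<^sup>2 = q t" using ode.hk[OF tI] t2 by (simp add: q_def k_def)
   thus ?thesis unfolding J using ode_eq[OF t(1)] on[OF t(1)] curv_off[OF z[unfolded xy] t(2,3) tI] t2
    by (simp add: xy)
  qed
 qed
qed

end

section \<open>Regularity of the solution and comparison with the weighted norm\<close>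

text \<open>Because \<open>u\<close> is of class \<open>C^2\<close> on the whole line, a single
  ambient function on the whole space serves as the local extension at every point.\<close>

lemma Ck_on_radial:
 fixes u u1 u2 :: "real => real"
 assumes "continuous_on UNIV u2" "\<And>t. (u has_real_derivative u1 t) (at t)" "\<And>t. (u1 has_real_derivative u2 t) (at t)"
 shows "Ck_on 2 S (%z::'a::euclidean_space. u (z \<bullet> z / 2))"
proof -
 have d: "((%z::'a. c (z \<bullet> z / 2)) has_derivative (%v. c1 (x \<bullet> x / 2) * (x \<bullet> v))) (at x)"
  if "\<And>t. (c has_real_derivative c1 t) (at t)" for c c1 :: "real => real" and x
 proof -
  have "((%z::'a. z \<bullet> z / 2) has_derivative (%v. x \<bullet> v)) (at x)"
   by (auto intro!: derivative_eq_intros simp: inner_commute)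
  from has_derivative_compose[OF this that[unfolded has_field_derivative_def]] show ?thesis .
 qed
 have cont: "continuous_on UNIV (%z::'a. c (z \<bullet> z / 2))" if "continuous_on UNIV c" for c :: "real => real"
  by (rule continuous_on_compose2[OF that]) (auto intro!: continuous_intros)
 have c: "continuous_on UNIV u" "continuous_on UNIV u1"
  using assms(2,3) DERIV_isCont by (blast intro: continuous_at_imp_continuous_on)+
 let ?F = "%z::'a. u (z \<bullet> z / 2)"
 note d1 = d[OF assms(2)]
 have f1: "frechet_derivative ?F (at x) v = u1 (x \<bullet> x / 2) * (x \<bullet> v)" for x v
  by (subst frechet_derivative_at[OF d1, symmetric]) (rule refl)
 have d2: "((%x::'a. u1 (x \<bullet> x / 2) * (x \<bullet> v)) has_derivative
   (%w. u1 (x \<bullet> x / 2) * (w \<bullet> v) + u2 (x \<bullet> x / 2) * (x \<bullet> w) * (x \<bullet> v))) (at x)" for x v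
  by (rule has_derivative_mult[OF d[OF assms(3)] bounded_linear_imp_has_derivative[OF bounded_linear_inner_left]])
 have f2: "frechet_derivative (%x::'a. u1 (x \<bullet> x / 2) * (x \<bullet> v)) (at x) w
   = u1 (x \<bullet> x / 2) * (w \<bullet> v) + u2 (x \<bullet> x / 2) * (x \<bullet> w) * (x \<bullet> v)" for x v w
  by (subst frechet_derivative_at[OF d2, symmetric]) (rule refl)
 have C0: "Ck_on_open 0 ?F UNIV" by (simp add: cont c)
 have C1: "Ck_on_open (Suc 0) ?F UNIV"
  unfolding Ck_on_open.simps f1 using d1 by (auto simp: differentiable_def intro!: continuous_intros cont c)
 have C2: "Ck_on_open (Suc (Suc 0)) ?F UNIV"
  unfolding Ck_on_open.simps f1 f2
  by (intro conjI allI ballI continuous_intros cont c assms(1); use d1 d2 in \<open>auto simp: differentiable_def\<close>)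
 have "Ck_on_open j ?F UNIV" if "enat j \<le> 2" for j
 proof -
  have "j \<le> 2" using that by (metis enat_ord_simps(1) numeral_eq_enat)
  then consider "j = 0" | "j = Suc 0" | "j = Suc (Suc 0)" by linarith
  thus ?thesis using C0 C1 C2 by cases simp_all
 qed
 thus ?thesis unfolding Ck_on_def by (intro ballI exI[of _ UNIV] exI[of _ ?F]) auto
qed

lemma geodesic_ball_center: "z \<in> S ==> z \<in> geodesic_ball S z 1"
proof -
 assume z: "z \<in> S"
 have "geodesic_dist S z z \<le> curve_length (%_::real. z)"
  unfolding geodesic_dist_def
 proof (rule INF_lower)
  have "valid_path (%_::real. z)"
   unfolding valid_path_def by (intro C1_differentiable_imp_piecewise) simp
  thus "(%_. z) \<in> {gm. valid_path gm & path_image gm \<subseteq> S & pathstart gm = z & pathfinish gm = z}"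
   using z by (auto simp: path_image_def pathstart_def pathfinish_def)
 qed
 also have "curve_length (%_::real. z) = 0" by (simp add: curve_length_def)
 finally show ?thesis using z by (simp add: geodesic_ball_def)
qed

text \<open>Each point is the centre of its own geodesic ball, so the sup part of the norm sees its
  value.\<close>

lemma weighted_holder_norm_zero:
 assumes "weighted_holder_norm S \<beta> a g = 0" "z \<in> S"
 shows "g z = 0"
proof -
 have "ennreal ((norm z + 1) powr (- a)) * ennreal \<bar>g z\<bar>
   \<le> ennreal ((norm z + 1) powr (- a)) * holder_norm S \<beta> (geodesic_ball S z 1) g"
 proof (rule mult_left_mono)
  have "ennreal \<bar>g z\<bar> \<le> (SUP p\<in>geodesic_ball S z 1. ennreal \<bar>g p\<bar>)"
   by (rule SUP_upper[OF geodesic_ball_center[OF assms(2)]])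
  thus "ennreal \<bar>g z\<bar> \<le> holder_norm S \<beta> (geodesic_ball S z 1) g"
   unfolding holder_norm_def by (rule order_trans) simp
 qed simp
 also have "\<dots> \<le> weighted_holder_norm S \<beta> a g" unfolding weighted_holder_norm_def by (rule SUP_upper[OF assms(2)])
 finally have "ennreal ((norm z + 1) powr (- a)) * ennreal \<bar>g z\<bar> = 0" using assms(1) by simp
 moreover have "(norm z + 1) powr (- a) > 0" 
 proof -
  have "norm z + 1 > 0" using norm_ge_zero[of z] by linarith
  thus ?thesis by simp
 qed
 ultimately show ?thesis by (simp add: ennreal_eq_0_iff)
qed

lemma log_weight:
 fixes rho :: real
 assumes "rho \<ge> 1"
 shows "1 + ln rho \<le> 2 * ln (rho + 2)" "ln (rho + 2) > 0"
proof -
 have "exp 1 \<le> rho + 2" using exp_le assms by linarith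
 hence "1 \<le> ln (rho + 2)" using assms by (simp add: ln_ge_iff)
 moreover have "ln rho \<le> ln (rho + 2)" using assms by simp
 ultimately show "1 + ln rho \<le> 2 * ln (rho + 2)" "ln (rho + 2) > 0" by linarith+
qed

text \<open>An infinite norm makes any bound true already with \<open>c = 1\<close>. For a finite
  one the summand 1 in \<open>C / w + 1\<close> keeps the constant positive when \<open>C\<close> is
  0.\<close>

lemma scale_by_weight:
 fixes W :: ennreal
 assumes "W ~= 0" "C \<ge> 0"
 obtains c where "c > 0" "\<And>x. x \<le> C ==> ennreal x \<le> ennreal c * W"
proof (cases "W = top")
 case True
 show ?thesis by (rule that[of 1]) (simp_all add: True ennreal_mult_top)
next
 case False
 then obtain w where w: "W = ennreal w" "w \<ge> 0" by (cases W) auto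
 have w0: "w > 0" using assms(1) w by (cases "w = 0") auto
 show ?thesis
 proof (rule that[of "C / w + 1"])
  show "C / w + 1 > 0" using w0 assms(2) by (simp add: add_nonneg_pos)
  fix x assume "x \<le> C"
  moreover have "(C / w + 1) * w = C + w" using w0 by (simp add: distrib_right)
  ultimately have "x \<le> (C / w + 1) * w" using w0 by linarith
  hence "ennreal x \<le> ennreal ((C / w + 1) * w)" by (rule ennreal_leI)
  also have "\<dots> = ennreal (C / w + 1) * W" unfolding w(1) using w0 assms(2) by (intro ennreal_mult) auto
  finally show "ennreal x \<le> ennreal (C / w + 1) * W" .
 qed
qed

theorem theorem5p1:
  fixes S :: "((real^'m) \<times> (real^'n)) set"
    and \<nu> :: "(real^'m) \<times> (real^'n) \<Rightarrow> (real^'m) \<times> (real^'n)"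
    and N :: nat and \<beta> :: real
  assumes m: "CARD('m) \<ge> 2" and n: "CARD('n) \<ge> 2"
    and N: "N + 1 = CARD('m) + CARD('n)"
    and S: "N + 1 \<ge> 8 \<and> (is_Sigma_pm 1 S \<or> is_Sigma_pm (- 1) S) \<or> N + 1 \<le> 7 \<and> is_Sigma S"
    and \<nu>: "unit_normal S \<nu>"
    and known: "N + 1 \<ge> 8 \<Longrightarrow> OmOn_invariant S \<and> (\<forall>y\<in>S. y \<bullet> \<nu> y \<noteq> 0)"
    and \<beta>: "0 < \<beta>" "\<beta> < 1"
  shows "\<exists>\<phi> c. Ck_on 2 S \<phi> \<and> (\<forall>y\<in>S. jacobi_operator S \<nu> \<phi> y = trace_A_cubed S \<nu> y) \<and>
    (c::real) > 0 \<and>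
    (\<forall>y\<in>S.
      (N \<ge> 5 \<longrightarrow> ennreal (\<bar>\<phi> y\<bar> * (norm y + 1))
         \<le> ennreal c * weighted_holder_norm S \<beta> (- 3) (trace_A_cubed S \<nu>)) \<and>
      (N = 4 \<longrightarrow> ennreal (\<bar>\<phi> y\<bar> * ((norm y + 1) / ln (norm y + 2)))
         \<le> ennreal c * weighted_holder_norm S \<beta> (- 3) (trace_A_cubed S \<nu>)) \<and>
      (N = 3 \<longrightarrow> ennreal (\<bar>\<phi> y\<bar> * ((norm y + 1) powr (1/2) / ln (norm y + 2)))
         \<le> ennreal c * weighted_holder_norm S \<beta> (- 3) (trace_A_cubed S \<nu>)))"
proof -
 have props: "minimal_hypersurface S" "complete_hypersurface S" "OmOn_invariant S" "asymptotic_to_lawson_cone S" "infdist 0 S = 1"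
  using S known by (auto simp: is_Sigma_pm_def is_Sigma_def)
 obtain e1 :: "real^'m" where e1: "norm e1 = 1" using vector_choose_size[of 1] by auto
 obtain f1 :: "real^'n" where f1: "norm f1 = 1" using vector_choose_size[of 1] by auto
 interpret surf: asymptotic_surface S \<nu> e1 f1 "real CARD('m)" "real CARD('n)"
  by unfold_locales (use m n \<nu> props e1 f1 in auto)
 define W where "W = weighted_holder_norm S \<beta> (- 3) (trace_A_cubed S \<nu>)"
 have rN: "real CARD('m) + real CARD('n) - 1 = real N" using N by linarith
 show ?thesis
 \<comment> \<open>The constant may depend on \<open>S\<close>. If the norm vanishes, so does the
   right side, and 0 is a solution; otherwise any finite bound on the weighted solution can be
   rescaled to a multiple of the norm.\<close>
 proof (cases "W = 0")
  case True
  have "jacobi_operator S \<nu> (%_. 0) y = trace_A_cubed S \<nu> y" if "y \<in> S" for y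
   using jacobi_operator_radial[OF props(1) \<nu> that, of "%_. 0" "%_. 0" "%_. 0"]
    weighted_holder_norm_zero[OF True[unfolded W_def] that] by simp
  moreover have "Ck_on 2 S (%_. 0::real)"
   using Ck_on_radial[of "%_. 0" "%_. 0" "%_. 0" S] by simp
  ultimately show ?thesis by (intro exI[of _ "%_. 0"] exI[of _ 1]) auto
 next
  case False
  obtain u u1 u2 where u: "continuous_on UNIV u2" "\<And>t. (u has_real_derivative u1 t) (at t)"
   "\<And>t. (u1 has_real_derivative u2 t) (at t)"
   and J: "\<And>z. z \<in> S ==> jacobi_operator S \<nu> (%z. u (z \<bullet> z / 2)) z = trace_A_cubed S \<nu> z"
   and growth: "real N > 4 ==> \<exists>C\<ge>0. \<forall>r\<ge>0. \<bar>exp (1 * r) * u (exp (2 * r) / 2)\<bar> \<le> C * 1"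
    "real N = 4 ==> \<exists>C\<ge>0. \<forall>r\<ge>0. \<bar>exp (1 * r) * u (exp (2 * r) / 2)\<bar> \<le> C * (1 + r)"
    "real N = 3 ==> \<exists>C\<ge>0. \<forall>r\<ge>0. \<bar>exp (1 / 2 * r) * u (exp (2 * r) / 2)\<bar> \<le> C * (1 + r)"
   unfolding rN[symmetric] by (rule surf.radial_jacobi_solution) blast
  define \<phi> where "\<phi> z = u (z \<bullet> z / 2)" for z :: "(real^'m) \<times> (real^'n)"
  have y: "norm y \<ge> 1" "ln (norm y) \<ge> 0" "u (exp (2 * ln (norm y)) / 2) = \<phi> y" "exp (ln (norm y)) = norm y" if "y \<in> S" for y
  proof -
   show y1: "norm y \<ge> 1" by (rule surf.norm_ge_1[OF that])
   thus "ln (norm y) \<ge> 0" by simp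
   show e: "exp (ln (norm y)) = norm y" using y1 by (intro exp_ln) linarith
   have "exp (2 * ln (norm y)) = exp (ln (norm y)) * exp (ln (norm y))" unfolding mult_exp_exp by simp
   hence "exp (2 * ln (norm y)) = y \<bullet> y" unfolding e by (simp add: dot_square_norm power2_eq_square)
   thus "u (exp (2 * ln (norm y)) / 2) = \<phi> y" by (simp add: \<phi>_def)
  qed
  have "\<exists>C\<ge>0. \<forall>y\<in>S. (N \<ge> 5 --> \<bar>\<phi> y\<bar> * (norm y + 1) \<le> C) &
   (N = 4 --> \<bar>\<phi> y\<bar> * ((norm y + 1) / ln (norm y + 2)) \<le> C) &
   (N = 3 --> \<bar>\<phi> y\<bar> * ((norm y + 1) powr (1/2) / ln (norm y + 2)) \<le> C)"
  proof -
   have "N \<ge> 3" using m n N by linarith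
   then consider "N \<ge> 5" | "N = 4" | "N = 3" by linarith
   thus ?thesis
   proof cases
    case 1
    then obtain C where C: "C \<ge> 0" "\<And>r. r \<ge> 0 ==> \<bar>exp (1 * r) * u (exp (2 * r) / 2)\<bar> \<le> C * 1"
     using growth(1) by auto
    have "\<bar>\<phi> z\<bar> * (norm z + 1) \<le> 2 * C" if z: "z \<in> S" for z
    proof -
     have "norm z * \<bar>\<phi> z\<bar> \<le> C" using C(2)[OF y(2)[OF z]] unfolding y(3)[OF z] mult_1 y(4)[OF z] by (simp add: abs_mult)
     \<comment> \<open>The weight \<open>norm z + 1\<close> is at most \<open>2 * norm z\<close>,
       since the surface has distance 1 from the origin.\<close>
     moreover have "\<bar>\<phi> z\<bar> * (norm z + 1) \<le> \<bar>\<phi> z\<bar> * (2 * norm z)" by (intro mult_left_mono) (use y(1)[OF z] in auto)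
     moreover have "\<bar>\<phi> z\<bar> * (2 * norm z) = 2 * (norm z * \<bar>\<phi> z\<bar>)" by simp
     ultimately show ?thesis by linarith
    qed
    thus ?thesis using 1 C(1) by (intro exI[of _ "2 * C"]) auto
   next
    case 2
    then obtain C where C: "C \<ge> 0" "\<And>r. r \<ge> 0 ==> \<bar>exp (1 * r) * u (exp (2 * r) / 2)\<bar> \<le> C * (1 + r)"
     using growth(2) by auto
    have "\<bar>\<phi> z\<bar> * ((norm z + 1) / ln (norm z + 2)) \<le> 4 * C" if z: "z \<in> S" for z
    proof -
     note lw = log_weight[OF y(1)[OF z]]
     have "norm z * \<bar>\<phi> z\<bar> \<le> C * (1 + ln (norm z))"
      using C(2)[OF y(2)[OF z]] unfolding y(3)[OF z] mult_1 y(4)[OF z] by (simp add: abs_mult)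
     also have "\<dots> \<le> C * (2 * ln (norm z + 2))" by (rule mult_left_mono[OF lw(1) C(1)])
     finally have "norm z * \<bar>\<phi> z\<bar> \<le> C * (2 * ln (norm z + 2))" .
     moreover have "\<bar>\<phi> z\<bar> * (norm z + 1) \<le> \<bar>\<phi> z\<bar> * (2 * norm z)" by (intro mult_left_mono) (use y(1)[OF z] in auto)
     moreover have "\<bar>\<phi> z\<bar> * (2 * norm z) = 2 * (norm z * \<bar>\<phi> z\<bar>)" by simp
     ultimately have "\<bar>\<phi> z\<bar> * (norm z + 1) \<le> 4 * C * ln (norm z + 2)" by linarith
     thus ?thesis using lw(2) by (simp add: divide_le_eq)
    qed
    thus ?thesis using 2 C(1) by (intro exI[of _ "4 * C"]) auto
   next
    case 3
    then obtain C where C: "C \<ge> 0" "\<And>r. r \<ge> 0 ==> \<bar>exp (1 / 2 * r) * u (exp (2 * r) / 2)\<bar> \<le> C * (1 + r)"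
     using growth(3) by auto
    have "\<bar>\<phi> z\<bar> * ((norm z + 1) powr (1/2) / ln (norm z + 2)) \<le> 4 * C" if z: "z \<in> S" for z
    proof -
     note lw = log_weight[OF y(1)[OF z]] and z1 = y(1)[OF z]
     have "exp (1 / 2 * ln (norm z)) = sqrt (norm z)"
     proof -
      have "norm z > 0" using z1 by linarith
      thus ?thesis by (simp add: powr_half_sqrt[symmetric] powr_def)
     qed
     hence "sqrt (norm z) * \<bar>\<phi> z\<bar> \<le> C * (1 + ln (norm z))"
      using C(2)[OF y(2)[OF z]] unfolding y(3)[OF z] by (simp add: abs_mult)
     also have "\<dots> \<le> C * (2 * ln (norm z + 2))" by (rule mult_left_mono[OF lw(1) C(1)])
     finally have 1: "sqrt (norm z) * \<bar>\<phi> z\<bar> \<le> C * (2 * ln (norm z + 2))" .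
     \<comment> \<open>The bound \<open>2 * norm z\<close> would do; the factor 4 has a rational
       root.\<close>
     have "sqrt (norm z + 1) \<le> sqrt (4 * norm z)" using z1 by simp
     also have "\<dots> = 2 * sqrt (norm z)" by (simp add: real_sqrt_mult)
     finally have "\<bar>\<phi> z\<bar> * sqrt (norm z + 1) \<le> \<bar>\<phi> z\<bar> * (2 * sqrt (norm z))" by (intro mult_left_mono) auto
     moreover have "\<bar>\<phi> z\<bar> * (2 * sqrt (norm z)) = 2 * (sqrt (norm z) * \<bar>\<phi> z\<bar>)" by simp
     ultimately have "\<bar>\<phi> z\<bar> * sqrt (norm z + 1) \<le> 4 * C * ln (norm z + 2)" using 1 by linarith
     moreover have "(norm z + 1) powr (1/2) = sqrt (norm z + 1)" by (simp add: powr_half_sqrt)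
     ultimately show ?thesis using lw(2) by (simp add: divide_le_eq)
    qed
    thus ?thesis using 3 C(1) by (intro exI[of _ "4 * C"]) auto
   qed
  qed
  then obtain C where C: "C \<ge> 0" "\<And>y. y \<in> S ==> (N \<ge> 5 --> \<bar>\<phi> y\<bar> * (norm y + 1) \<le> C) &
   (N = 4 --> \<bar>\<phi> y\<bar> * ((norm y + 1) / ln (norm y + 2)) \<le> C) &
   (N = 3 --> \<bar>\<phi> y\<bar> * ((norm y + 1) powr (1/2) / ln (norm y + 2)) \<le> C)" by blast
  obtain c where c: "c > 0" "\<And>x. x \<le> C ==> ennreal x \<le> ennreal c * W"
   using scale_by_weight[OF False C(1)] by blast
  have "Ck_on 2 S \<phi>" unfolding \<phi>_def[abs_def] by (rule Ck_on_radial[OF u])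
  moreover have "\<forall>y\<in>S. jacobi_operator S \<nu> \<phi> y = trace_A_cubed S \<nu> y" using J unfolding \<phi>_def[abs_def] by blast
  ultimately show ?thesis using c C(2) unfolding W_def by blast
 qed
qed

end
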